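(* Let $z>0$ and $(a,b,c)\in V_z^{gen}$. Let $-(1+a)^2\le\mu_1<\mu_2\le-(1-a)^2$ and let $0\le\theta_2<\theta_1\le\pi$ be such that $\mu_j=\mu(e^{i\theta_j})$ for $j=1,2$. Then $$\langle E((\mu_1,\mu_2))f,g\rangle=\frac1{2\pi K}\int_{\theta_2}^{\theta_1}(\mathcal Ff)(e^{i\theta})\,\overline{(\mathcal Fg)(e^{i\theta})}\,\frac{d\theta}{|c(e^{i\theta})|^2}$$ for all $f,g\in\mathcal D_{fin}$.
   Context: Fix $0<q<1$ and $z>0$. Notation: $(x;q)_\infty=\prod_{i\ge 0}(1-xq^i)$, $(x;q)_n=\prod_{i=0}^{n-1}(1-xq^i)$, $(x_1,\dots,x_r;q)_n=\prod_j(x_j;q)_n$ (also for $n=\infty$), $\theta(x)=(x,q/x;q)_\infty$, $\theta(x_1,\dots,x_r)=\prod_j\theta(x_j)$, and ${}_3\phi_2\left(\begin{array}{c}\alpha_1,\alpha_2,\alpha_3\\ \beta_1,\beta_2\end{array};q,y\right)=\sum_{n\ge0}\frac{(\alpha_1,\alpha_2,\alpha_3;q)_n}{(q,\beta_1,\beta_2;q)_n}y^n$. $V=\{(a,b,c): a,b,c>0,\ ab,ac,bc<1\}$ and $V_z^{gen}=\{(a,b,c)\in V: a^2,b^2,c^2,ab,ac,bc,a/b,a/c,a^2b^2c^2z^2\notin\{q^k\}_{k\in\mathbb Z}\}$. $I=\{-q^k: k=0,1,2,\dots\}\cup\{zq^k: k\in\mathbb Z\}$. For $f:I\to\mathbb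 C$ and $x\in I\setminus\{-1\}$, $(Lf)(x)=A(x)(f(qx)-f(x))+B(x)(f(q^{-1}x)-f(x))$, with $A(x)=a^2\left(1+\frac1{abx}\right)\left(1+\frac1{acx}\right)$ and $B(x)=\left(1+\frac{q}{bcx}\right)\left(1+\frac1x\right)$; $(Lf)(-1)=A(-1)(f(-q)-f(-1))$. $p(x)=\frac{(-abx,-acx;q)_\infty}{(-bcx,-qx;q)_\infty}>0$ on $I$. $\mathcal H$ is the Hilbert space of $f:I\to\mathbb C$ with $\langle f,f\rangle<\infty$, where $$\langle f,g\rangle=\sum_{k\ge0}f(-q^k)\overline{g(-q^k)}\frac{(1-q)q^k}{p(-q^k)}+\sum_{k\in\mathbb Z}f(zq^k)\overline{g(zq^k)}\frac{(1-q)zq^k}{p(zq^k)}$$ (the same formula is used for $\langle f,g\rangle$ whenever the sums converge absolutely). $\mathcal D_{fin}\subset\mathcal H$ is the space of functions $I\to\mathbb C$ with finite support. $(D_qf)(x)=\frac{f(x)-f(qx)}{(1-q)x}$. $\mathcal D$ is the space of $f\in\mathcal H$ with $Lf\in\mathcal H$ such that $\lim_{k\to\infty}f(zq^k)=\lim_{k\to\infty}f(-q^k)$ and $\lim_{k\to\infty}(D_qf)(zq^k)=\lim_{k\to\infty}(D_qf)(-q^k)$ (all limits existing). The operator $(L,\mathcal D)$ on $\mathcal H$ is self-adjoint; $E$ denotes its spectral measure (resolution of the identity, $L=\int_{\mathbb R}t\,dE(t)$). $\mu(\gamma)=-1-a^2+a(\gamma+\gamma^{-1})$ for $\gamma\in\mathbb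 C^*$. $\phi_\gamma:I\to\mathbb C$ is given by $\phi_\gamma(x)={}_3\phi_2\left(\begin{array}{c}a\gamma,a/\gamma,-1/x\\ ab,ac\end{array};q,-bcx\right)$ for $x\in I$ with $bc|x|<1$, and extended to all of $I$ by requiring $(L\phi_\gamma)(x)=\mu(\gamma)\phi_\gamma(x)$ for all $x\in I\setminus\{-1\}$ (this extension exists and is unique). $(\mathcal Ff)(\gamma)=\langle f,\phi_\gamma\rangle$ for $f\in\mathcal D_{fin}$, $\gamma\in\mathbb C^*$. $K=(1-q)z\frac{\theta(-bcz,-qz)}{\theta(-abz,-acz)}$ and $c(\gamma)=\frac{1}{(ab,ac;q)_\infty\theta(-bcz)}\,\frac{(a/\gamma,b/\gamma,c/\gamma;q)_\infty\,\theta(-q/abcz\gamma)}{(1/\gamma^2;q)_\infty}$. *)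

theory Defs
  imports "HOL-Analysis.Analysis"
begin

definition qpoch :: "real \<Rightarrow> 'a::real_normed_field \<Rightarrow> nat \<Rightarrow> 'a" where
  "qpoch q x n = (\<Prod>i<n. 1 - x * of_real q ^ i)"

definition qpoch_inf :: "real \<Rightarrow> 'a::real_normed_field \<Rightarrow> 'a" where
  "qpoch_inf q x = (\<Prod>i. 1 - x * of_real q ^ i)"

definition qtheta :: "real \<Rightarrow> 'a::real_normed_field \<Rightarrow> 'a" where
  "qtheta q x = qpoch_inf q x * qpoch_inf q (of_real q / x)"

definition phi32 ::
  "real \<Rightarrow> complex \<Rightarrow> complex \<Rightarrow> complex \<Rightarrow> complex \<Rightarrow> complex \<Rightarrow> complex \<Rightarrow> complex" where
  "phi32 q \<alpha>1 \<alpha>2 \<alpha>3 \<beta>1 \<beta>2 y =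
     (\<Sum>n. (qpoch q \<alpha>1 n * qpoch q \<alpha>2 n * qpoch q \<alpha>3 n) /
           (qpoch q (of_real q) n * qpoch q \<beta>1 n * qpoch q \<beta>2 n) * y ^ n)"

definition V :: "(real \<times> real \<times> real) set" where
  "V = {(a, b, c). a > 0 \<and> b > 0 \<and> c > 0 \<and> a * b < 1 \<and> a * c < 1 \<and> b * c < 1}"

definition Vgen :: "real \<Rightarrow> real \<Rightarrow> (real \<times> real \<times> real) set" where
  "Vgen q z = {(a, b, c) \<in> V.
     \<forall>u \<in> {a^2, b^2, c^2, a * b, a * c, b * c, a / b, a / c, a^2 * b^2 * c^2 * z^2}.
       u \<notin> range (\<lambda>k::int. q powi k)}"

definition Iset :: "real \<Rightarrow> real \<Rightarrow> real set" where
  "Iset q z = range (\<lambda>k::nat. - (q ^ k)) \<union> range (\<lambda>k::int. z * q powi k)"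

text \<open>A function \<open>I \<rightarrow> \<complex>\<close> is represented by the total function
  that extends it by 0 outside \<open>I\<close>.\<close>

definition funs_on :: "real set \<Rightarrow> (real \<Rightarrow> complex) set" where
  "funs_on S = {f. \<forall>x. x \<notin> S \<longrightarrow> f x = 0}"

definition coeffA :: "real \<Rightarrow> real \<Rightarrow> real \<Rightarrow> real \<Rightarrow> real" where
  "coeffA a b c x = a^2 * (1 + 1 / (a * b * x)) * (1 + 1 / (a * c * x))"

definition coeffB :: "real \<Rightarrow> real \<Rightarrow> real \<Rightarrow> real \<Rightarrow> real" where
  "coeffB q b c x = (1 + q / (b * c * x)) * (1 + 1 / x)"

definition opL ::
  "real \<Rightarrow> real \<Rightarrow> real \<Rightarrow> real \<Rightarrow> real \<Rightarrow> (real \<Rightarrow> complex) \<Rightarrow> real \<Rightarrow> complex" where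
  "opL q z a b c f x =
     (if x \<notin> Iset q z then 0
      else if x = -1 then of_real (coeffA a b c (-1)) * (f (- q) - f (-1))
      else of_real (coeffA a b c x) * (f (q * x) - f x)
         + of_real (coeffB q b c x) * (f (x / q) - f x))"

definition pfun :: "real \<Rightarrow> real \<Rightarrow> real \<Rightarrow> real \<Rightarrow> real \<Rightarrow> real" where
  "pfun q a b c x =
     (qpoch_inf q (- (a * b * x)) * qpoch_inf q (- (a * c * x))) /
     (qpoch_inf q (- (b * c * x)) * qpoch_inf q (- (q * x)))"

definition wneg :: "real \<Rightarrow> real \<Rightarrow> real \<Rightarrow> real \<Rightarrow> nat \<Rightarrow> real" where
  "wneg q a b c k = (1 - q) * q ^ k / pfun q a b c (- (q ^ k))"

definition wpos :: "real \<Rightarrow> real \<Rightarrow> real \<Rightarrow> real \<Rightarrow> real \<Rightarrow> int \<Rightarrow> real" where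
  "wpos q z a b c k = (1 - q) * (z * q powi k) / pfun q a b c (z * q powi k)"

text \<open>Over the complex numbers, summability in the sense of \<open>infsum\<close> is
  absolute summability.\<close>

definition ip ::
  "real \<Rightarrow> real \<Rightarrow> real \<Rightarrow> real \<Rightarrow> real \<Rightarrow> (real \<Rightarrow> complex) \<Rightarrow> (real \<Rightarrow> complex) \<Rightarrow> complex" where
  "ip q z a b c f g =
     (\<Sum>\<^sub>\<infinity>k\<in>(UNIV :: nat set).
        f (- (q ^ k)) * cnj (g (- (q ^ k))) * of_real (wneg q a b c k))
   + (\<Sum>\<^sub>\<infinity>k\<in>(UNIV :: int set).
        f (z * q powi k) * cnj (g (z * q powi k)) * of_real (wpos q z a b c k))"

definition Hspace :: "real \<Rightarrow> real \<Rightarrow> real \<Rightarrow> real \<Rightarrow> real \<Rightarrow> (real \<Rightarrow> complex) set" where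
  "Hspace q z a b c = {f \<in> funs_on (Iset q z).
     (\<lambda>k::nat. (cmod (f (- (q ^ k))))^2 * wneg q a b c k) summable_on UNIV \<and>
     (\<lambda>k::int. (cmod (f (z * q powi k)))^2 * wpos q z a b c k) summable_on UNIV}"

definition Dfin :: "real \<Rightarrow> real \<Rightarrow> (real \<Rightarrow> complex) set" where
  "Dfin q z = {f \<in> funs_on (Iset q z). finite {x. f x \<noteq> 0}}"

definition qderiv :: "real \<Rightarrow> (real \<Rightarrow> complex) \<Rightarrow> real \<Rightarrow> complex" where
  "qderiv q f x = (f x - f (q * x)) / of_real ((1 - q) * x)"

definition Ddom :: "real \<Rightarrow> real \<Rightarrow> real \<Rightarrow> real \<Rightarrow> real \<Rightarrow> (real \<Rightarrow> complex) set" where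
  "Ddom q z a b c = {f \<in> Hspace q z a b c.
     opL q z a b c f \<in> Hspace q z a b c \<and>
     (\<exists>l. (\<lambda>k::nat. f (z * q ^ k)) \<longlonglongrightarrow> l \<and> (\<lambda>k::nat. f (- (q ^ k))) \<longlonglongrightarrow> l) \<and>
     (\<exists>l. (\<lambda>k::nat. qderiv q f (z * q ^ k)) \<longlonglongrightarrow> l \<and>
          (\<lambda>k::nat. qderiv q f (- (q ^ k))) \<longlonglongrightarrow> l)}"

text \<open>The Hilbert space is given as a set \<open>H\<close> of functions closed under the
  pointwise operations, together with its inner product \<open>inn\<close>, which is linear in
  the first argument.\<close>

definition orthogonal_projection_on ::
  "('a \<Rightarrow> complex) set \<Rightarrow> (('a \<Rightarrow> complex) \<Rightarrow> ('a \<Rightarrow> complex) \<Rightarrow> complex)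
    \<Rightarrow> (('a \<Rightarrow> complex) \<Rightarrow> ('a \<Rightarrow> complex)) \<Rightarrow> bool" where
  "orthogonal_projection_on H inn P \<longleftrightarrow>
     (\<forall>f\<in>H. P f \<in> H) \<and>
     (\<forall>f\<in>H. \<forall>g\<in>H. \<forall>\<alpha> \<beta>.
        P (\<lambda>x. \<alpha> * f x + \<beta> * g x) = (\<lambda>x. \<alpha> * P f x + \<beta> * P g x)) \<and>
     (\<forall>f\<in>H. P (P f) = P f) \<and>
     (\<forall>f\<in>H. \<forall>g\<in>H. inn (P f) g = inn f (P g))"

definition resolution_of_identity ::
  "('a \<Rightarrow> complex) set \<Rightarrow> (('a \<Rightarrow> complex) \<Rightarrow> ('a \<Rightarrow> complex) \<Rightarrow> complex)
    \<Rightarrow> (real set \<Rightarrow> ('a \<Rightarrow> complex) \<Rightarrow> ('a \<Rightarrow> complex)) \<Rightarrow> bool" where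
  "resolution_of_identity H inn E \<longleftrightarrow>
     (\<forall>S\<in>sets borel. orthogonal_projection_on H inn (E S)) \<and>
     (\<forall>f\<in>H. E {} f = (\<lambda>x. 0)) \<and>
     (\<forall>f\<in>H. E UNIV f = f) \<and>
     (\<forall>S\<in>sets borel. \<forall>T\<in>sets borel. \<forall>f\<in>H. E (S \<inter> T) f = E S (E T f)) \<and>
     (\<forall>S :: nat \<Rightarrow> real set. range S \<subseteq> sets borel \<longrightarrow> disjoint_family S \<longrightarrow>
        (\<forall>f\<in>H. \<forall>g\<in>H. (\<lambda>n. inn (E (S n) f) g) sums inn (E (\<Union>n. S n) f) g))"

text \<open>For a resolution of the identity \<open>E\<close> and \<open>f \<in> H\<close> the set function below is countably additive,
  so \<open>measure_of\<close> does not collapse to the zero measure.\<close>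

definition spectral_meas ::
  "(('a \<Rightarrow> complex) \<Rightarrow> ('a \<Rightarrow> complex) \<Rightarrow> complex)
    \<Rightarrow> (real set \<Rightarrow> ('a \<Rightarrow> complex) \<Rightarrow> ('a \<Rightarrow> complex)) \<Rightarrow> ('a \<Rightarrow> complex) \<Rightarrow> real measure" where
  "spectral_meas inn E f =
     measure_of UNIV (sets borel) (\<lambda>S. ennreal (Re (inn (E S f) f)))"

text \<open>\<open>T = \<integral> t dE(t)\<close> with domain \<open>D\<close>, i.e. \<open>D\<close> consists of the \<open>f\<close> with
  \<open>\<integral> t\<^sup>2 d\<langle>E f, f\<rangle> < \<infinity>\<close>, and \<open>\<langle>T f, f\<rangle> = \<integral> t d\<langle>E f, f\<rangle>\<close> on \<open>D\<close>. Since \<open>D\<close> is a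
  dense linear subspace, polarization shows that the quadratic form determines \<open>T\<close>.\<close>

definition is_spectral_measure_of ::
  "('a \<Rightarrow> complex) set \<Rightarrow> (('a \<Rightarrow> complex) \<Rightarrow> ('a \<Rightarrow> complex) \<Rightarrow> complex)
    \<Rightarrow> (('a \<Rightarrow> complex) \<Rightarrow> ('a \<Rightarrow> complex)) \<Rightarrow> ('a \<Rightarrow> complex) set
    \<Rightarrow> (real set \<Rightarrow> ('a \<Rightarrow> complex) \<Rightarrow> ('a \<Rightarrow> complex)) \<Rightarrow> bool" where
  "is_spectral_measure_of H inn T D E \<longleftrightarrow>
     resolution_of_identity H inn E \<and>
     D = {f \<in> H. (\<integral>\<^sup>+ t. ennreal (t^2) \<partial>spectral_meas inn E f) < \<infinity>} \<and>
     (\<forall>f\<in>D. inn (T f) f = of_real (\<integral>t. t \<partial>spectral_meas inn E f))"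

definition mu :: "real \<Rightarrow> complex \<Rightarrow> complex" where
  "mu a \<gamma> = - 1 - of_real (a^2) + of_real a * (\<gamma> + inverse \<gamma>)"

definition phi ::
  "real \<Rightarrow> real \<Rightarrow> real \<Rightarrow> real \<Rightarrow> real \<Rightarrow> complex \<Rightarrow> real \<Rightarrow> complex" where
  "phi q z a b c \<gamma> = (THE f. f \<in> funs_on (Iset q z) \<and>
     (\<forall>x \<in> Iset q z. b * c * \<bar>x\<bar> < 1 \<longrightarrow>
        f x = phi32 q (of_real a * \<gamma>) (of_real a / \<gamma>) (of_real (- 1 / x))
                (of_real (a * b)) (of_real (a * c)) (of_real (- (b * c * x)))) \<and>
     (\<forall>x \<in> Iset q z - {-1}. opL q z a b c f x = mu a \<gamma> * f x))"

definition Ftrans ::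
  "real \<Rightarrow> real \<Rightarrow> real \<Rightarrow> real \<Rightarrow> real \<Rightarrow> (real \<Rightarrow> complex) \<Rightarrow> complex \<Rightarrow> complex" where
  "Ftrans q z a b c f \<gamma> = ip q z a b c f (phi q z a b c \<gamma>)"

definition Kconst :: "real \<Rightarrow> real \<Rightarrow> real \<Rightarrow> real \<Rightarrow> real \<Rightarrow> real" where
  "Kconst q z a b c = (1 - q) * z *
     (qtheta q (- (b * c * z)) * qtheta q (- (q * z))) /
     (qtheta q (- (a * b * z)) * qtheta q (- (a * c * z)))"

definition cfun :: "real \<Rightarrow> real \<Rightarrow> real \<Rightarrow> real \<Rightarrow> real \<Rightarrow> complex \<Rightarrow> complex" where
  "cfun q z a b c \<gamma> =
     1 / of_real (qpoch_inf q (a * b) * qpoch_inf q (a * c) * qtheta q (- (b * c * z))) *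
     (qpoch_inf q (of_real a / \<gamma>) * qpoch_inf q (of_real b / \<gamma>) * qpoch_inf q (of_real c / \<gamma>) *
      qtheta q (- (of_real q / (of_real (a * b * c * z) * \<gamma>)))) /
     qpoch_inf q (1 / \<gamma>^2)"

end

theory Submission
  imports Defs "HOL-Complex_Analysis.Complex_Analysis"
begin

text \<open>Stieltjes inversion. For \<open>y = z q^k\<close> the resolvent maps the delta function at \<open>y\<close> to a Green
  function made of \<open>\<phi>\<close> and of the solution \<open>\<Phi>\<close> that decays at infinity; it lies in the domain
  because \<open>\<phi>\<close> is analytic at 0. Its jump across the interval follows from the connection formula
  \<open>\<phi> = c(\<gamma>) \<Phi>(1/\<gamma>) + c(1/\<gamma>) \<Phi>(\<gamma>)\<close> and the Wronskian. Between two negative points no Green function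
  is needed: the recurrence reduces everything to \<open>u = E(S)\<delta>\<close> with the delta function at \<open>-1\<close>. As \<open>u\<close> is in
  the domain, its values and \<open>q\<close>-derivatives at 0 agree from both sides, and from the right they are
  already known. This determines the spectral measure of that delta function, because \<open>\<phi>\<close> and its
  \<open>q\<close>-derivative do not both vanish at 0. By symmetry in \<open>b, c\<close> one may assume \<open>c < 1\<close>.\<close>

section \<open>Shifted factorials\<close>

text \<open>Each nonreal \<xi> is \<open>mu a ga\<close> for a \<open>ga\<close> outside the unit
  circle; at a point of the interval the two boundary values are \<open>ga\<close> and
  \<open>1 / ga\<close> on the circle. The series for \<open>psi\<close> and for the decaying
  solution both have ratio \<open>c / ga\<close>, which is why \<open>c < 1\<close> is assumed. A
  Green function with its pole at a negative point would need \<Phi> continued through 0; with a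
  positive pole \<Phi> occurs on the positive half only. The spectral measure is given through
  quadratic forms, so the complex measures of pairs f, g are built by polarization, and identities
  between them are tested on Borel sets. Inversion returns half of the mass at the end points of an
  interval; exhausting an open interval from inside removes them. Genericity makes
  \<open>1 / c(ga)\<close> continuous on the circle. The constant arises from three factors: the
  jump is a multiple of \<open>1 / (4 K a sin \<theta> |c|^2)\<close>, the substitution for the
  eigenvalue contributes \<open>2 a sin \<theta>\<close>, and the inversion contributes
  \<open>1 / pi\<close>.\<close>

locale qbase =
  fixes q :: real
  assumes q_pos: "0 < q" and q_less_1: "q < 1"
begin

abbreviation qinf :: "'a::real_normed_field \<Rightarrow> 'a" where "qinf \<equiv> qpoch_inf q"

lemma qpoch_0 [simp]: "qpoch q x 0 = 1"
  by (simp add: qpoch_def)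

lemma qpoch_Suc: "qpoch q x (Suc n) = qpoch q x n * (1 - x * of_real q ^ n)"
  by (simp add: qpoch_def)

lemma qpoch_add: "qpoch q x (m + n) = qpoch q x m * qpoch q (x * of_real q ^ m) n"
  by (induction n) (simp_all add: qpoch_Suc power_add algebra_simps)

lemma qpoch_Suc': "qpoch q x (Suc n) = (1 - x) * qpoch q (x * of_real q) n"
  using qpoch_add[of x 1 n] by (simp add: qpoch_Suc)

lemma qpoch_of_real: "qpoch q (of_real x) n = of_real (qpoch q x n)"
  by (simp add: qpoch_def)

lemma q_nonzero [simp]: "q \<noteq> 0" using q_pos by simp

lemma summable_q: "summable (\<lambda>i. norm (x * of_real q ^ i :: 'a::real_normed_field))"
  using q_pos q_less_1 by (simp add: norm_mult norm_power summable_mult summable_geometric)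

lemma convergent_prod_qpoch:
  "convergent_prod (\<lambda>i. 1 - x * of_real q ^ i :: 'a::{real_normed_field, banach})"
proof -
  have "abs_convergent_prod (\<lambda>i. 1 - x * of_real q ^ i)"
    using summable_q[of "x"] by (intro summable_imp_abs_convergent_prod) simp
  then show ?thesis by (rule abs_convergent_prod_imp_convergent_prod)
qed

lemma qpoch_LIMSEQ:
  "qpoch q (x :: 'a::{real_normed_field, banach}) \<longlonglongrightarrow> qinf x"
proof -
  have "(\<lambda>n. \<Prod>i<n. 1 - x * of_real q ^ i) \<longlonglongrightarrow> qinf x"
    using convergent_prod_LIMSEQ[OF convergent_prod_qpoch[of x]]
    unfolding qpoch_inf_def by (subst LIMSEQ_lessThan_iff_atMost)
  then show ?thesis by (simp add: qpoch_def[abs_def])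
qed

lemma qpoch_inf_split:
  "qinf (x :: 'a::{real_normed_field, banach}) = qpoch q x n * qinf (x * of_real q ^ n)"
proof (rule LIMSEQ_unique)
  show "(\<lambda>m. qpoch q x (n + m)) \<longlonglongrightarrow> qinf x"
    using LIMSEQ_ignore_initial_segment[OF qpoch_LIMSEQ, of x n] by (simp add: add.commute)
  show "(\<lambda>m. qpoch q x (n + m)) \<longlonglongrightarrow> qpoch q x n * qinf (x * of_real q ^ n)"
    unfolding qpoch_add by (intro tendsto_intros qpoch_LIMSEQ)
qed

lemma qpoch_inf_step:
  "qinf (x :: 'a::{real_normed_field, banach}) = (1 - x) * qinf (x * of_real q)"
proof -
  have "qinf x = qpoch q x (Suc 0) * qinf (x * of_real q ^ Suc 0)"
    by (rule qpoch_inf_split)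
  also have "qpoch q x (Suc 0) = 1 - x" by (simp only: qpoch_Suc qpoch_0) simp
  finally show ?thesis by (simp only: power_Suc power_0 mult_1_right)
qed

lemma qpoch_inf_of_real:
  "qinf (of_real x :: 'a::{real_normed_field, banach}) = of_real (qinf x)"
proof (rule LIMSEQ_unique[OF qpoch_LIMSEQ])
  show "qpoch q (of_real x :: 'a) \<longlonglongrightarrow> of_real (qinf x)"
    unfolding qpoch_of_real by (intro tendsto_of_real qpoch_LIMSEQ)
qed

lemma qpoch_inf_eq_0_iff:
  "qinf (x :: 'a::{real_normed_field, banach}) = 0 \<longleftrightarrow> (\<exists>i. x * of_real q ^ i = 1)"
proof -
  have "qinf x = 0 \<longleftrightarrow> 0 \<in> range (\<lambda>i. 1 - x * of_real q ^ i)"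
    unfolding qpoch_inf_def
    by (rule has_prod_eq_0_iff[OF convergent_prod_has_prod[OF convergent_prod_qpoch[of x]]])
  also have "\<dots> \<longleftrightarrow> (\<exists>i. x * of_real q ^ i = 1)" by (auto simp: image_iff)
  finally show ?thesis .
qed

lemma qpoch_inf_0 [simp]: "qinf (0 :: 'a::{real_normed_field, banach}) = 1"
  by (simp add: qpoch_inf_def)

lemma qpoch_nonneg_neg: "0 \<le> x \<Longrightarrow> 1 \<le> qpoch q (- x :: real) n"
proof (induction n)
  case (Suc n)
  have "1 * 1 \<le> qpoch q (- x) n * (1 + x * q ^ n)"
    using Suc q_pos by (intro mult_mono) auto
  then show ?case by (simp add: qpoch_Suc)
qed simp

lemma qpoch_neg_le_inf:
  assumes "0 \<le> x" shows "qpoch q (- x :: real) n \<le> qinf (- x)"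
proof (rule incseq_le[OF _ qpoch_LIMSEQ])
  show "incseq (qpoch q (- x))"
  proof (rule incseq_SucI)
    fix n
    have "qpoch q (- x) n * 1 \<le> qpoch q (- x) n * (1 + x * q ^ n)"
      using assms q_pos qpoch_nonneg_neg[of x n] by (intro mult_left_mono) auto
    then show "qpoch q (- x) n \<le> qpoch q (- x) (Suc n)" by (simp add: qpoch_Suc)
  qed
qed

lemma qpoch_inf_neg_ge_1: "0 \<le> x \<Longrightarrow> 1 \<le> qinf (- x :: real)"
  using qpoch_neg_le_inf[of x 0] by simp

lemma norm_qpoch_le: "norm (qpoch q (x::'a::real_normed_field) n) \<le> qpoch q (- norm x) n"
proof (induction n)
  case (Suc n)
  have "norm (1 - x * of_real q ^ n) \<le> 1 + norm x * q ^ n"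
    using norm_triangle_ineq4[of 1 "x * of_real q ^ n"] q_pos
    by (simp add: norm_mult norm_power)
  then have "norm (qpoch q x n) * norm (1 - x * of_real q ^ n) \<le> qpoch q (- norm x) n * (1 + norm x * q ^ n)"
    using Suc qpoch_nonneg_neg[of "norm x" n] by (intro mult_mono) auto
  then show ?case by (simp add: qpoch_Suc norm_mult)
qed simp

lemma qpoch_neg_mono:
  assumes "0 \<le> x" "x \<le> y" shows "qpoch q (- x :: real) n \<le> qpoch q (- y) n"
proof (induction n)
  case (Suc n)
  have "qpoch q (- x) n * (1 + x * q ^ n) \<le> qpoch q (- y) n * (1 + y * q ^ n)"
    using Suc qpoch_nonneg_neg[of x n] qpoch_nonneg_neg[of y n] assms q_pos
    by (intro mult_mono) auto
  then show ?case by (simp add: qpoch_Suc)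
qed simp

lemma norm_qpoch_le_inf:
  assumes "norm (x::'a::real_normed_field) \<le> r" shows "norm (qpoch q x n) \<le> qinf (- r)"
proof -
  have "0 \<le> r" using norm_ge_zero[of x] assms by linarith
  have "norm (qpoch q x n) \<le> qpoch q (- norm x) n" by (rule norm_qpoch_le)
  also have "\<dots> \<le> qpoch q (- r) n" using assms by (intro qpoch_neg_mono) auto
  also have "\<dots> \<le> qinf (- r)" by (intro qpoch_neg_le_inf \<open>0 \<le> r\<close>)
  finally show ?thesis .
qed

lemma norm_qpoch_inf_le:
  assumes "norm (x::'a::{real_normed_field,banach}) \<le> r" shows "norm (qinf x) \<le> qinf (- r)"
  by (rule LIMSEQ_le_const2[OF tendsto_norm[OF qpoch_LIMSEQ]])
     (intro exI[of _ 0] allI impI norm_qpoch_le_inf[OF assms])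

lemma qpoch_pos: "x < 1 \<Longrightarrow> 0 < qpoch q (x::real) n"
proof (induction n)
  case (Suc n)
  have "x * q ^ n < 1"
  proof (cases "x \<le> 0")
    case True then have "x * q ^ n \<le> 0" using q_pos by (simp add: mult_nonpos_nonneg)
    then show ?thesis by linarith
  next
    case False then have "x * q ^ n \<le> x * 1" using q_pos q_less_1 by (intro mult_left_mono power_le_one) auto
    then show ?thesis using Suc by simp
  qed
  then show ?case using Suc by (simp add: qpoch_Suc)
qed simp

lemma qpoch_inf_pos: assumes "x < 1" shows "0 < qinf (x::real)"
proof -
  have "0 \<le> qinf x"
    by (rule LIMSEQ_le_const[OF qpoch_LIMSEQ]) (use qpoch_pos[OF assms] in \<open>auto intro: less_imp_le\<close>)
  moreover have "x * q ^ i \<noteq> 1" for i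
    using qpoch_pos[OF assms, of "Suc i"] by (auto simp: qpoch_Suc)
  then have "qinf x \<noteq> 0" by (simp add: qpoch_inf_eq_0_iff)
  ultimately show ?thesis by linarith
qed

lemma qpoch_inf_le_qpoch:
  assumes "0 \<le> x" "x < 1" shows "qinf (x::real) \<le> qpoch q x n"
proof (rule decseq_ge[OF _ qpoch_LIMSEQ])
  show "decseq (qpoch q x)"
  proof (rule decseq_SucI)
    fix n
    have "qpoch q x n * (1 - x * q ^ n) \<le> qpoch q x n * 1"
      using assms q_pos less_imp_le[OF qpoch_pos[OF assms(2), of n]] by (intro mult_left_mono) simp_all
    then show "qpoch q x (Suc n) \<le> qpoch q x n" by (simp add: qpoch_Suc)
  qed
qed

lemma holomorphic_qpoch_inf: "qinf holomorphic_on (UNIV :: complex set)"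
proof (rule holomorphic_uniform_sequence[where f = "\<lambda>n x. qpoch q x n"])
  show "(\<lambda>x. qpoch q x n) holomorphic_on (UNIV::complex set)" for n
    unfolding qpoch_def
    by (intro holomorphic_on_prod holomorphic_on_diff holomorphic_on_mult holomorphic_on_const holomorphic_on_ident)
  fix x :: complex
  define A where "A = cball x 1"
  have "uniformly_convergent_on A (\<lambda>N x. \<Prod>n<N. 1 - x * of_real q ^ n)"
  proof (rule uniformly_convergent_on_prod')
    show "compact A" by (simp add: A_def)
    show "continuous_on A (\<lambda>x. 1 - x * complex_of_real q ^ n)" for n
      by (intro continuous_intros)
    have "norm y \<le> norm x + 1" if "y \<in> A" for y
      using that norm_triangle_ineq3[of y x] by (auto simp: A_def dist_norm norm_minus_commute)
    then have *: "norm (norm (1 - y * of_real q ^ n - 1)) \<le> (norm x + 1) * q ^ n" if "y \<in> A" for y n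
      using that q_pos by (auto simp: norm_mult norm_power intro!: mult_right_mono)
    show "uniformly_convergent_on A (\<lambda>N y. \<Sum>n<N. norm (1 - y * complex_of_real q ^ n - 1))"
      by (rule Weierstrass_m_test'[where M = "\<lambda>n. (norm x + 1) * q ^ n", OF *])
         (use q_pos q_less_1 in \<open>auto intro: summable_mult summable_geometric\<close>)
  qed
  then obtain l where l: "uniform_limit A (\<lambda>N x. qpoch q x N) l sequentially"
    by (auto simp: uniformly_convergent_on_def qpoch_def)
  have "l y = qinf y" if "y \<in> A" for y
    using tendsto_uniform_limitI[OF l that] qpoch_LIMSEQ[of y] LIMSEQ_unique by blast
  then have "uniform_limit A (\<lambda>N x. qpoch q x N) (qinf) sequentially"
    using l by (simp cong: uniform_limit_cong')
  then show "\<exists>d>0. cball x d \<subseteq> UNIV \<and> uniform_limit (cball x d) (\<lambda>n x. qpoch q x n) (qinf) sequentially"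
    unfolding A_def by (intro exI[of _ 1]) auto
qed simp

lemma holomorphic_qpoch_inf' [holomorphic_intros]:
  "f holomorphic_on A \<Longrightarrow> (\<lambda>x. qinf (f x)) holomorphic_on A"
  using holomorphic_on_compose[of f A "qinf", OF _ holomorphic_on_subset[OF holomorphic_qpoch_inf subset_UNIV]]
  by (simp only: o_def)

lemma continuous_qpoch_inf [continuous_intros]:
  fixes f :: "'b::t2_space \<Rightarrow> complex"
  shows "continuous_on A f \<Longrightarrow> continuous_on A (\<lambda>x. qinf (f x))"
  by (rule continuous_on_compose2[OF holomorphic_on_imp_continuous_on[OF holomorphic_qpoch_inf]]) simp_all

lemma tendsto_qpoch_inf [tendsto_intros]:
  fixes f :: "'b \<Rightarrow> complex"
  assumes "(f \<longlongrightarrow> l) F" shows "((\<lambda>x. qinf (f x)) \<longlongrightarrow> qinf l) F"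
proof -
  have "isCont (qinf) l"
    using holomorphic_on_imp_continuous_on[OF holomorphic_qpoch_inf] by (simp add: continuous_on_eq_continuous_at)
  then show ?thesis using assms isCont_tendsto_compose by blast
qed

lemma tendsto_qpoch_inf_real [tendsto_intros]:
  fixes f :: "'b \<Rightarrow> real"
  assumes "(f \<longlongrightarrow> l) F" shows "((\<lambda>x. qinf (f x)) \<longlongrightarrow> qinf l) F"
proof -
  have "((\<lambda>x. qinf (complex_of_real (f x))) \<longlongrightarrow> qinf (complex_of_real l)) F"
    by (intro tendsto_intros assms)
  then show ?thesis unfolding qpoch_inf_of_real tendsto_of_real_iff .
qed

lemma q_power_LIMSEQ: "(\<lambda>n. q ^ n) \<longlonglongrightarrow> 0"
  using q_pos q_less_1 by (intro LIMSEQ_realpow_zero) auto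

lemma cq_power_LIMSEQ: "(\<lambda>n. complex_of_real q ^ n) \<longlonglongrightarrow> 0"
  using q_pos q_less_1 by (intro LIMSEQ_power_zero) auto

text \<open>Telescoping: if \<open>u n\<close> is the \<open>n\<close>-th term of the series with lower parameter \<open>C\<close> and \<open>v n\<close> the one
  with lower parameter \<open>C q\<close>, then \<open>(1 - C/AB) u n - (1 - C/A)(1 - C/B)/(1 - C) v n\<close> is the
  difference of \<open>- (1 - q^n) u n\<close>.\<close>

definition gauss_term :: "complex \<Rightarrow> complex \<Rightarrow> complex \<Rightarrow> nat \<Rightarrow> complex" where
  "gauss_term A B C n = qpoch q A n * qpoch q B n / (qpoch q (of_real q) n * qpoch q C n) * (C / (A * B)) ^ n"

lemma qpoch_q_nonzero: "qpoch q (complex_of_real q) n \<noteq> 0"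
  using qpoch_pos[OF q_less_1, of n] by (simp add: qpoch_of_real)

lemma qpoch_nonzero: "(\<And>i. i < n \<Longrightarrow> C * of_real q ^ i \<noteq> (1::complex)) \<Longrightarrow> qpoch q C n \<noteq> 0"
  by (fastforce simp: qpoch_def)

end

lemma tannery_seq:
  fixes f :: "nat \<Rightarrow> nat \<Rightarrow> complex"
  assumes lim: "\<And>n. (\<lambda>k. f k n) \<longlonglongrightarrow> g n"
    and bound: "\<And>k n. norm (f k n) \<le> M n" and M: "summable M"
  shows "(\<lambda>k. \<Sum>n. f k n) \<longlonglongrightarrow> (\<Sum>n. g n)"
proof -
  have "\<forall>\<^sub>F (k, n) in at_top \<times>\<^sub>F sequentially. norm (f n k) \<le> M k"
    using bound by (simp add: always_eventually)
  from tannerys_theorem[of "\<lambda>n k. f k n", OF lim this M] show ?thesis by simp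
qed

lemma holomorphic_suminf:
  fixes f :: "nat \<Rightarrow> complex \<Rightarrow> complex"
  assumes "open S" and hol: "\<And>k. f k holomorphic_on S"
    and bound: "\<And>x. x \<in> S \<Longrightarrow> \<exists>d>0. \<exists>M. cball x d \<subseteq> S \<and> summable M \<and> (\<forall>y\<in>cball x d. \<forall>k. norm (f k y) \<le> M k)"
  shows "(\<lambda>x. \<Sum>k. f k x) holomorphic_on S"
proof (rule holomorphic_uniform_sequence[where f = "\<lambda>n x. \<Sum>k<n. f k x"])
  show "open S" by fact
  show "(\<lambda>x. \<Sum>k<n. f k x) holomorphic_on S" for n
    by (intro holomorphic_on_sum hol)
  fix x assume "x \<in> S"
  from bound[OF this] obtain d M where d: "d > 0" "cball x d \<subseteq> S" "summable M"
    "\<And>y k. y \<in> cball x d \<Longrightarrow> norm (f k y) \<le> M k" by blast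
  have "uniform_limit (cball x d) (\<lambda>n x. \<Sum>k<n. f k x) (\<lambda>x. \<Sum>k. f k x) sequentially"
    by (rule Weierstrass_m_test[OF d(4) d(3)])
  then show "\<exists>d>0. cball x d \<subseteq> S \<and> uniform_limit (cball x d) (\<lambda>n x. \<Sum>k<n. f k x) (\<lambda>x. \<Sum>k. f k x) sequentially"
    using d by blast
qed

context qbase begin

text \<open>No factor of the infinite product vanishes, so the reciprocals converge and are
  therefore bounded.\<close>

lemma qpoch_bounded_below:
  assumes "\<And>i. C * of_real q ^ i \<noteq> (1::complex)"
  obtains K where "K > 0" "\<And>n. norm (inverse (qpoch q C n)) \<le> K"
proof -
  have "qinf C \<noteq> 0" using assms by (simp add: qpoch_inf_eq_0_iff)
  then have "(\<lambda>n. inverse (qpoch q C n)) \<longlonglongrightarrow> inverse (qinf C)"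
    by (intro tendsto_inverse qpoch_LIMSEQ)
  then have "Bseq (\<lambda>n. inverse (qpoch q C n))"
    by (intro convergent_imp_Bseq convergentI)
  then show ?thesis using that by (auto elim!: BseqE)
qed

lemma q_power_neq_1: "complex_of_real q * of_real q ^ i \<noteq> 1"
proof -
  have "q ^ Suc i < 1" using q_pos q_less_1 by (intro power_Suc_less_one) auto
  then have "complex_of_real (q ^ Suc i) \<noteq> 1" by (metis less_irrefl of_real_eq_1_iff)
  then show ?thesis by simp
qed

text \<open>Uniformity in the shift \<open>N\<close> is the point: it supplies the majorant when the
  lower parameter tends to 0 in \<open>q_gauss\<close>.\<close>

lemma gauss_term_bound:
  assumes "\<And>i. C * of_real q ^ i \<noteq> (1::complex)"
  obtains K where "K > 0" "\<And>N n. norm (gauss_term A B (C * of_real q ^ N) n) \<le> K * norm (C / (A * B)) ^ n"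
proof -
  obtain K1 where K1: "K1 > 0" "\<And>n. norm (inverse (qpoch q C n)) \<le> K1"
    using qpoch_bounded_below[OF assms] by blast
  obtain K2 where K2: "K2 > 0" "\<And>n. norm (inverse (qpoch q (complex_of_real q) n)) \<le> K2"
    using qpoch_bounded_below[of "of_real q"] q_power_neq_1 by blast
  define a b where "a = qinf (- norm A)" and "b = qinf (- norm B)"
  define c where "c = qinf (- norm C)"
  have abc: "a \<ge> 1" "b \<ge> 1" "c \<ge> 1" by (simp_all add: a_def b_def c_def qpoch_inf_neg_ge_1)
  show ?thesis
  proof
    show "a * b * (K2 * (c * K1)) > 0" using abc K1 K2 by (intro mult_pos_pos) auto
    fix N n
    have nz: "qpoch q C m \<noteq> 0" for m using assms by (intro qpoch_nonzero)
    \<comment> \<open>The shifted denominator is a quotient of unshifted products; one is bounded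
      and the reciprocal of the other is bounded, whatever \<open>N\<close> is.\<close>
    have "qpoch q (C * of_real q ^ N) n = qpoch q C (N + n) * inverse (qpoch q C N)"
      using nz[of N] by (simp add: qpoch_add field_simps)
    then have e: "inverse (qpoch q (C * of_real q ^ N) n) = qpoch q C N * inverse (qpoch q C (N + n))"
      by (simp add: field_simps)
    have "gauss_term A B (C * of_real q ^ N) n = qpoch q A n * qpoch q B n *
       (inverse (qpoch q (of_real q) n) * (qpoch q C N * inverse (qpoch q C (N + n)))) * ((C / (A * B)) ^ n * of_real q ^ (N * n))"
      unfolding gauss_term_def e[symmetric] by (simp add: field_simps power_mult_distrib power_mult power_divide)
    also have "norm \<dots> \<le> a * b * (K2 * (c * K1)) * (norm (C / (A * B)) ^ n * 1)"
      unfolding norm_mult norm_power a_def b_def c_def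
      by (intro mult_mono norm_qpoch_le_inf K1 K2 power_le_one mult_nonneg_nonneg)
         (use q_pos q_less_1 K1 K2 abc in \<open>auto simp: a_def b_def c_def norm_divide norm_mult\<close>)
    finally show "norm (gauss_term A B (C * of_real q ^ N) n) \<le> a * b * (K2 * (c * K1)) * norm (C / (A * B)) ^ n"
      by simp
  qed
qed

lemma gauss_term_summable:
  assumes "\<And>i. C * of_real q ^ i \<noteq> (1::complex)" "norm (C / (A * B)) < 1"
  shows "summable (gauss_term A B C)"
proof -
  obtain K where "K > 0" and K: "\<And>N n. norm (gauss_term A B (C * of_real q ^ N) n) \<le> K * norm (C / (A * B)) ^ n"
    using gauss_term_bound[OF assms(1)] by blast
  show ?thesis
    by (rule summable_comparison_test'[where g = "\<lambda>n. K * norm (C / (A * B)) ^ n" and N = 0])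
       (use K[of 0] assms in \<open>auto intro!: summable_mult summable_geometric simp del: norm_divide\<close>)
qed

lemma gauss_term_telescope:
  assumes nz: "A \<noteq> 0" "B \<noteq> 0" and C: "\<And>i. C * of_real q ^ i \<noteq> (1::complex)"
  shows "(1 - C / (A * B)) * gauss_term A B C n
      - (1 - C / A) * (1 - C / B) / (1 - C) * gauss_term A B (C * of_real q) n
    = - (1 - of_real q ^ Suc n) * gauss_term A B C (Suc n) - (- (1 - of_real q ^ n) * gauss_term A B C n)"
proof -
  define s where "s = complex_of_real q ^ n"
  have C1: "1 - C \<noteq> 0" using C[of 0] by simp
  have Cs: "1 - C * s \<noteq> 0" using C[of n] by (simp add: s_def)
  have qs: "1 - complex_of_real q * s \<noteq> 0" using q_power_neq_1[of n] by (simp add: s_def)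
  have step: "gauss_term A B C (Suc n) =
      gauss_term A B C n * ((1 - A * s) * (1 - B * s) * (C / (A * B)) / ((1 - of_real q * s) * (1 - C * s)))"
    by (simp add: gauss_term_def qpoch_Suc s_def mult_ac)
  have p: "qpoch q (C * of_real q) n = qpoch q C n * (1 - C * s) / (1 - C)"
    using C1 qpoch_Suc[of C n] qpoch_Suc'[of C n] by (simp add: s_def field_simps)
  have "(C * of_real q / (A * B)) ^ n = (C / (A * B)) ^ n * s"
    by (simp add: s_def power_mult_distrib power_divide)
  then have shift: "gauss_term A B (C * of_real q) n = gauss_term A B C n * (s * (1 - C) / (1 - C * s))"
    unfolding gauss_term_def p by (simp add: mult_ac)
  have key: "(1 - C / (A * B)) - (1 - C / A) * (1 - C / B) / (1 - C) * (s * (1 - C) / (1 - C * s))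
     = - (1 - of_real q * s) * ((1 - A * s) * (1 - B * s) * (C / (A * B)) / ((1 - of_real q * s) * (1 - C * s))) + (1 - s)"
    using C1 Cs qs nz by (simp add: divide_simps) (simp add: algebra_simps)
  have factor: "x * g - y * (g * w) = g * (x - y * w)" for x y g w :: complex
    by (simp add: algebra_simps)
  have "(1 - C / (A * B)) * gauss_term A B C n
      - (1 - C / A) * (1 - C / B) / (1 - C) * gauss_term A B (C * of_real q) n
    = gauss_term A B C n * ((1 - C / (A * B)) - (1 - C / A) * (1 - C / B) / (1 - C) * (s * (1 - C) / (1 - C * s)))"
    unfolding shift by (rule factor)
  also have "\<dots> = gauss_term A B C n * (- (1 - of_real q * s) * ((1 - A * s) * (1 - B * s) * (C / (A * B)) / ((1 - of_real q * s) * (1 - C * s))) + (1 - s))"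
    unfolding key ..
  also have "\<dots> = - (1 - of_real q * s) * gauss_term A B C (Suc n) + (1 - s) * gauss_term A B C n"
    unfolding step by (simp add: mult_ac distrib_left)
  finally show ?thesis by (simp add: s_def algebra_simps)
qed

text \<open>The telescoped quantity vanishes at n = 0 through the factor \<open>1 - q^0\<close> and
  at infinity because the series converges.\<close>

lemma q_gauss_step:
  assumes nz: "A \<noteq> 0" "B \<noteq> 0" and C: "\<And>i. C * of_real q ^ i \<noteq> (1::complex)" and z: "norm (C / (A * B)) < 1"
  shows "(1 - C / (A * B)) * suminf (gauss_term A B C)
      = (1 - C / A) * (1 - C / B) / (1 - C) * suminf (gauss_term A B (C * of_real q))"
proof -
  let ?H = "\<lambda>n. - (1 - of_real q ^ n) * gauss_term A B C n"
  have C': "C * of_real q * of_real q ^ i \<noteq> 1" for i using C[of "Suc i"] by (simp add: mult.assoc)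
  have "norm (C * of_real q / (A * B)) = norm (C / (A * B)) * q"
    using q_pos by (simp add: norm_mult norm_divide)
  also have "\<dots> \<le> norm (C / (A * B)) * 1" using q_less_1 by (intro mult_left_mono) auto
  finally have z': "norm (C * of_real q / (A * B)) < 1" using z by simp
  note S = gauss_term_summable[OF C z] and S' = gauss_term_summable[OF C' z']
  have "?H \<longlonglongrightarrow> - (1 - 0) * 0"
    by (intro tendsto_intros cq_power_LIMSEQ summable_LIMSEQ_zero[OF S])
  then have "(\<lambda>n. ?H (Suc n) - ?H n) sums (- (1 - 0) * 0 - ?H 0)" by (rule telescope_sums)
  then have "(\<lambda>n. ?H (Suc n) - ?H n) sums 0" by simp
  then have "(\<lambda>n. (1 - C / (A * B)) * gauss_term A B C n
      - (1 - C / A) * (1 - C / B) / (1 - C) * gauss_term A B (C * of_real q) n) sums 0"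
    unfolding gauss_term_telescope[OF nz C, symmetric] .
  moreover have "(\<lambda>n. (1 - C / (A * B)) * gauss_term A B C n
      - (1 - C / A) * (1 - C / B) / (1 - C) * gauss_term A B (C * of_real q) n) sums
     ((1 - C / (A * B)) * suminf (gauss_term A B C)
      - (1 - C / A) * (1 - C / B) / (1 - C) * suminf (gauss_term A B (C * of_real q)))"
    by (intro sums_diff sums_mult summable_sums S S')
  ultimately show ?thesis using sums_unique2 by fastforce
qed

text \<open>Heine's q-analogue of Gauss's sum. Each step from \<open>C\<close> to \<open>C q\<close>
  splits off one factor of every product; along the way the argument of the series tends to 0, and
  only the term n = 0 survives.\<close>

theorem q_gauss:
  assumes nz: "A \<noteq> 0" "B \<noteq> 0" and C: "\<And>i. C * of_real q ^ i \<noteq> (1::complex)" and z: "norm (C / (A * B)) < 1"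
  shows "suminf (gauss_term A B C) = qinf (C / A) * qinf (C / B) / (qinf C * qinf (C / (A * B)))"
proof -
  define F where "F N = suminf (gauss_term A B (C * of_real q ^ N))" for N
  define D where "D = C / (A * B)"
  have Cnz: "qpoch q C N \<noteq> 0" for N using C by (intro qpoch_nonzero)
  have Dlt: "norm (D * of_real q ^ N) < 1" for N
  proof -
    have "norm (D * of_real q ^ N) \<le> norm D * 1"
      unfolding norm_mult norm_power using q_pos q_less_1 by (intro mult_left_mono power_le_one) auto
    then show ?thesis using z by (simp add: D_def)
  qed
  have Dneq: "D * of_real q ^ N \<noteq> 1" for N using Dlt[of N] by auto
  have Dnz: "qpoch q D N \<noteq> 0" for N using Dneq by (intro qpoch_nonzero)
  have eq: "F 0 = qpoch q (C / A) N * qpoch q (C / B) N / (qpoch q C N * qpoch q D N) * F N" for N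
  proof (induction N)
    case (Suc N)
    have "(1 - D * of_real q ^ N) * F N = (1 - C / A * of_real q ^ N) * (1 - C / B * of_real q ^ N) / (1 - C * of_real q ^ N) * F (Suc N)"
      using q_gauss_step[of A B "C * of_real q ^ N"] nz C[of "N + _"] Dlt[of N]
      by (simp add: F_def D_def power_add mult_ac)
    moreover have "1 - D * of_real q ^ N \<noteq> 0" using Dneq[of N] by simp
    ultimately have "F N = (1 - C / A * of_real q ^ N) * (1 - C / B * of_real q ^ N) / (1 - C * of_real q ^ N) * F (Suc N) / (1 - D * of_real q ^ N)"
      by (metis nonzero_mult_div_cancel_left)
    then show ?case using Suc by (simp add: qpoch_Suc mult_ac)
  qed simp
  obtain K where "K > 0" and K: "\<And>N n. norm (gauss_term A B (C * of_real q ^ N) n) \<le> K * norm (C / (A * B)) ^ n"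
    using gauss_term_bound[OF C] by blast
  have "F \<longlonglongrightarrow> (\<Sum>n. if n = 0 then 1 else 0)"
    unfolding F_def
  proof (rule tannery_seq[OF _ K])
    show "summable (\<lambda>n. K * norm (C / (A * B)) ^ n)" using z by (intro summable_mult summable_geometric) simp
    fix n
    have "(\<lambda>N. qpoch q (C * of_real q ^ N) n) \<longlonglongrightarrow> (\<Prod>i<n. 1 - C * 0 * of_real q ^ i)"
      unfolding qpoch_def by (intro tendsto_intros cq_power_LIMSEQ)
    then have 1: "(\<lambda>N. qpoch q (C * of_real q ^ N) n) \<longlonglongrightarrow> 1" by simp
    have "(\<lambda>N. gauss_term A B (C * of_real q ^ N) n) \<longlonglongrightarrow> qpoch q A n * qpoch q B n / (qpoch q (of_real q) n * 1) * (C * 0 / (A * B)) ^ n"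
      unfolding gauss_term_def
      by (intro tendsto_intros 1 cq_power_LIMSEQ) (use qpoch_q_nonzero nz in auto)
    then show "(\<lambda>N. gauss_term A B (C * of_real q ^ N) n) \<longlonglongrightarrow> (if n = 0 then 1 else 0)"
      by (simp add: power_0_left split: if_splits)
  qed
  then have F: "F \<longlonglongrightarrow> 1" using suminf_finite[of "{0}" "\<lambda>n::nat. if n = 0 then 1 else 0::complex"] by simp
  have "(\<lambda>N. qpoch q (C / A) N * qpoch q (C / B) N / (qpoch q C N * qpoch q D N) * F N) \<longlonglongrightarrow>
     qinf (C / A) * qinf (C / B) / (qinf C * qinf D) * 1"
    using C Dneq by (intro tendsto_intros qpoch_LIMSEQ F) (simp add: qpoch_inf_eq_0_iff)
  then have "(\<lambda>N. F 0) \<longlonglongrightarrow> qinf (C / A) * qinf (C / B) / (qinf C * qinf D) * 1"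
    unfolding eq[symmetric] .
  then have "F 0 = qinf (C / A) * qinf (C / B) / (qinf C * qinf D) * 1"
    by (rule LIMSEQ_unique[OF tendsto_const])
  then show ?thesis by (simp add: F_def D_def)
qed

end

section \<open>The eigenfunction regular at the left end point\<close>

text \<open>In this form the eigenvalue matches the numerator parameters \<open>a ga\<close> and
  \<open>a / ga\<close> of the series, as the certificates below require.\<close>

lemma mu_factor: "ga \<noteq> 0 \<Longrightarrow> mu a ga = - ((1 - of_real a * ga) * (1 - of_real a / ga))"
  by (simp add: mu_def field_simps power2_eq_square)

text \<open>What remains of \<open>psi_term_telescope\<close> at an index k > 0 once the common
  factors are cancelled. The letters stand for \<open>gi = 1 / g\<close>, \<open>u = q\<close>,
  \<open>r = q^(k-1)\<close>, \<open>s = q^k\<close>; with reciprocals as variables the identity is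
  polynomial.\<close>

lemma psi_certificate:
  fixes A B C g gi x r u s :: complex
  assumes "g * gi = 1" "s = u * r"
  shows "(1 + A*C*x) * (1 + B*C*x) * (1 + A*B*x* s) * (1 + A*B*x*r)
      + (u + A*B*x) * (1 + x) * (1 + A*B*C*g*x*r) * (1 + A*B*C*g*x* s)
      - (B*C*x*x * (- ((1 - A*g) * (1 - A*gi))) + (1 + A*B*x) * (1 + A*C*x) + (u + B*C*x) * (1 + x))
          * (1 + A*B*x*r) * (1 + A*B*C*g*x* s)
    = (- (A*B*x*x) * (1 - C*g)) * ((1 - A*g* s) * (1 - B*g* s) * (C*gi) * (1 + A*B*x*r)
        - (1 - s) * (1 - A*B*r) * (1 + A*B*C*g*x* s))"
  using assms by algebra

text \<open>The case k = 0, where \<open>r = 1 / q\<close>. It is the general identity at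
  \<open>s = 1\<close> divided by \<open>1 + A B x r\<close>, a factor that may vanish.\<close>

lemma psi_certificate_0:
  fixes A B C g gi x r u :: complex
  assumes "g * gi = 1" "u * r = 1"
  shows "(1 + A*B*x) * (1 + A*C*x) * (1 + B*C*x)
      + u * (1 + x) * (1 + A*B*C*g*x*r) * (1 + A*B*C*g*x)
      - (B*C*x*x * (- ((1 - A*g) * (1 - A*gi))) + (1 + A*B*x) * (1 + A*C*x) + (u + B*C*x) * (1 + x))
          * (1 + A*B*C*g*x)
    = (- (A*B*x*x) * (1 - C*g)) * ((1 - A*g) * (1 - B*g) * (C*gi))"
  using assms by algebra

locale big_q = qbase +
  fixes a b c z :: real
  assumes a_pos: "0 < a" and b_pos: "0 < b" and c_pos: "0 < c" and z_pos: "0 < z"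
    and ab_less_1: "a * b < 1" and ac_less_1: "a * c < 1" and bc_less_1: "b * c < 1"
    and c_less_1: "c < 1" and gen: "(a, b, c) \<in> Vgen q z"
begin

lemma ratio_less_1 [simp]: "c < r \<Longrightarrow> c / r < 1"
  using c_pos by simp

lemma qpoch_inf_neg_nonneg: "0 \<le> x \<Longrightarrow> 0 \<le> qinf (- x :: real)"
  using qpoch_inf_neg_ge_1[of x] by linarith

text \<open>A transform of the \<open>3\<phi>2\<close> series that is entire in \<open>x\<close> up to the factor in \<open>psi\<close>; it
  gives the extension of \<open>\<phi>\<close> to all of \<open>I\<close>, at the price of \<open>c < |ga|\<close>.\<close>

definition psi_coef :: "complex \<Rightarrow> nat \<Rightarrow> complex" where
  "psi_coef ga k = qpoch q (of_real a * ga) k * qpoch q (of_real b * ga) k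
     / (qpoch q (of_real q) k * qpoch q (of_real a * of_real b) k) * (of_real c / ga) ^ k"

definition psi_term :: "complex \<Rightarrow> complex \<Rightarrow> nat \<Rightarrow> complex" where
  "psi_term ga x k = psi_coef ga k * qpoch q (- (of_real a * of_real b * x)) k
     * qinf (- (of_real a * of_real b * of_real c * ga * x) * of_real q ^ k)"

definition psi_entire :: "complex \<Rightarrow> complex \<Rightarrow> complex" where
  "psi_entire ga x = qinf (of_real c / ga) / qinf (of_real a * of_real c) * (\<Sum>k. psi_term ga x k)"

definition psi :: "complex \<Rightarrow> complex \<Rightarrow> complex" where
  "psi ga x = psi_entire ga x / qinf (- (of_real b * of_real c * x))"

lemma qpoch_ab: "qpoch q (complex_of_real a * of_real b) k = of_real (qpoch q (a * b) k)"
  by (simp only: of_real_mult[symmetric] qpoch_of_real)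

lemma qpoch_ac: "qpoch q (complex_of_real a * of_real c) k = of_real (qpoch q (a * c) k)"
  by (simp only: of_real_mult[symmetric] qpoch_of_real)

lemma qpoch_ab_nonzero: "qpoch q (complex_of_real a * of_real b) k \<noteq> 0"
  using qpoch_pos[OF ab_less_1, of k] by (simp add: qpoch_ab)

lemma qpoch_ac_nonzero: "qpoch q (complex_of_real a * of_real c) k \<noteq> 0"
  using qpoch_pos[OF ac_less_1, of k] by (simp add: qpoch_ac)

lemma qpoch_inf_ab: "qinf (complex_of_real a * of_real b) = of_real (qinf (a * b))"
  by (simp only: of_real_mult[symmetric] qpoch_inf_of_real)

lemma qpoch_inf_ac: "qinf (complex_of_real a * of_real c) = of_real (qinf (a * c))"
  by (simp only: of_real_mult[symmetric] qpoch_inf_of_real)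

lemma qpoch_inf_ab_nonzero: "qinf (complex_of_real a * of_real b) \<noteq> 0"
  using qpoch_inf_pos[OF ab_less_1] by (simp add: qpoch_inf_ab)

lemma qpoch_inf_ac_nonzero: "qinf (complex_of_real a * of_real c) \<noteq> 0"
  using qpoch_inf_pos[OF ac_less_1] by (simp add: qpoch_inf_ac)

lemma qpoch_inf_q_nonzero: "qinf (complex_of_real q) \<noteq> 0"
  using qpoch_inf_pos[OF q_less_1] by (simp add: qpoch_inf_of_real)

lemma psi_coef_Suc:
  "psi_coef ga (Suc k) * ((1 - of_real q ^ Suc k) * (1 - of_real a * of_real b * of_real q ^ k))
   = psi_coef ga k * ((1 - of_real a * ga * of_real q ^ k) * (1 - of_real b * ga * of_real q ^ k) * (of_real c / ga))"
proof -
  have "qpoch q (complex_of_real q) (Suc k) \<noteq> 0" "qpoch q (complex_of_real a * of_real b) (Suc k) \<noteq> 0"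
    by (rule qpoch_q_nonzero qpoch_ab_nonzero)+
  then have "1 - complex_of_real q * of_real q ^ k \<noteq> 0" "1 - complex_of_real a * of_real b * of_real q ^ k \<noteq> 0"
    by (simp_all only: qpoch_Suc mult_eq_0_iff) auto
  then show ?thesis
    by (simp add: psi_coef_def qpoch_Suc divide_simps qpoch_q_nonzero qpoch_ab_nonzero)
qed

definition psi_coef_bound :: "real \<Rightarrow> real" where
  "psi_coef_bound R = qinf (- (a * R)) * qinf (- (b * R)) / (qinf q * qinf (a * b))"

lemma psi_coef_bound:
  assumes "norm ga \<le> R"
  shows "norm (psi_coef ga k) \<le> psi_coef_bound R * (c / norm ga) ^ k"
proof -
  have R: "0 \<le> R" using assms norm_ge_zero[of ga] by linarith
  have d: "0 < qinf q * qinf (a * b)"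
    by (intro mult_pos_pos qpoch_inf_pos q_less_1 ab_less_1)
  have "norm (qpoch q (of_real a * ga) k * qpoch q (of_real b * ga) k) \<le> qinf (- (a * R)) * qinf (- (b * R))"
    unfolding norm_mult using assms a_pos b_pos R
    by (intro mult_mono norm_qpoch_le_inf) (auto simp: norm_mult intro: order.trans[OF zero_le_one qpoch_inf_neg_ge_1])
  moreover have "qinf q * qinf (a * b) \<le> norm (qpoch q (complex_of_real q) k * qpoch q (of_real a * of_real b) k)"
    unfolding qpoch_ab qpoch_of_real norm_mult norm_of_real
    using qpoch_pos[OF q_less_1, of k] qpoch_pos[OF ab_less_1, of k] qpoch_inf_pos[OF q_less_1] qpoch_inf_pos[OF ab_less_1]
      a_pos b_pos q_pos qpoch_inf_le_qpoch[of q k] qpoch_inf_le_qpoch[of "a * b" k] q_less_1 ab_less_1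
    by (intro mult_mono) auto
  ultimately have "norm (qpoch q (of_real a * ga) k * qpoch q (of_real b * ga) k
       / (qpoch q (of_real q) k * qpoch q (of_real a * of_real b) k)) \<le> psi_coef_bound R"
    unfolding norm_divide psi_coef_bound_def using d a_pos b_pos R
    by (intro frac_le mult_nonneg_nonneg qpoch_inf_neg_nonneg) auto
  then have "norm (qpoch q (of_real a * ga) k * qpoch q (of_real b * ga) k
       / (qpoch q (of_real q) k * qpoch q (of_real a * of_real b) k)) * norm ((of_real c / ga) ^ k)
     \<le> psi_coef_bound R * norm ((of_real c / ga) ^ k)" by (intro mult_right_mono) auto
  then show ?thesis unfolding psi_coef_def norm_mult[symmetric] using c_pos by (simp add: norm_power norm_divide)
qed

lemma psi_coef_bound_nonneg: "0 \<le> R \<Longrightarrow> 0 \<le> psi_coef_bound R"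
  unfolding psi_coef_bound_def using a_pos b_pos
  by (intro divide_nonneg_nonneg mult_nonneg_nonneg less_imp_le[OF qpoch_inf_pos[OF q_less_1]]
       less_imp_le[OF qpoch_inf_pos[OF ab_less_1]] qpoch_inf_neg_nonneg) auto

definition psi_term_bound :: "real \<Rightarrow> real \<Rightarrow> real" where
  "psi_term_bound R S = psi_coef_bound R * qinf (- (a * b * S)) * qinf (- (a * b * c * R * S))"

lemma psi_term_bound:
  assumes "norm ga \<le> R" "norm x \<le> S"
  shows "norm (psi_term ga x k) \<le> psi_term_bound R S * (c / norm ga) ^ k"
proof -
  have RS: "0 \<le> R" "0 \<le> S" using assms norm_ge_zero[of ga] norm_ge_zero[of x] by linarith+
  have n1: "norm (- (of_real a * of_real b * x)) \<le> a * b * S"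
    using assms a_pos b_pos by (simp add: norm_mult)
  have "norm (- (of_real a * of_real b * of_real c * ga * x) * of_real q ^ k) \<le> a * b * c * R * S * 1"
    unfolding norm_mult norm_minus_cancel norm_power norm_of_real using assms a_pos b_pos c_pos RS q_pos q_less_1
    by (intro mult_mono power_le_one mult_nonneg_nonneg) auto
  then have n2: "norm (- (of_real a * of_real b * of_real c * ga * x) * of_real q ^ k) \<le> a * b * c * R * S" by simp
  have "norm (psi_term ga x k) \<le> (psi_coef_bound R * (c / norm ga) ^ k) * qinf (- (a * b * S)) * qinf (- (a * b * c * R * S))"
    unfolding psi_term_def norm_mult using RS a_pos b_pos c_pos
    by (intro mult_mono psi_coef_bound assms norm_qpoch_le_inf norm_qpoch_inf_le n1 n2 mult_nonneg_nonneg psi_coef_bound_nonneg)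
       (auto intro!: order.trans[OF zero_le_one qpoch_inf_neg_ge_1])
  then show ?thesis by (simp add: psi_term_bound_def mult_ac)
qed

lemma psi_term_bound_nonneg: "0 \<le> R \<Longrightarrow> 0 \<le> S \<Longrightarrow> 0 \<le> psi_term_bound R S"
  unfolding psi_term_bound_def using a_pos b_pos c_pos
  by (intro mult_nonneg_nonneg psi_coef_bound_nonneg)
     (auto intro!: order.trans[OF zero_le_one qpoch_inf_neg_ge_1])

lemma psi_term_summable: "c < norm ga \<Longrightarrow> summable (psi_term ga x)"
proof (rule summable_comparison_test'[where g = "\<lambda>k. psi_term_bound (norm ga) (norm x) * (c / norm ga) ^ k" and N = 0])
  assume "c < norm ga"
  then show "summable (\<lambda>k. psi_term_bound (norm ga) (norm x) * (c / norm ga) ^ k)"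
    using c_pos ratio_less_1 by (intro summable_mult summable_geometric) auto
qed (use psi_term_bound in auto)

lemma holomorphic_psi_entire:
  assumes "c < norm ga" shows "psi_entire ga holomorphic_on UNIV"
proof -
  have "(\<lambda>x. \<Sum>k. psi_term ga x k) holomorphic_on UNIV"
  proof (rule holomorphic_suminf)
    show "(\<lambda>x. psi_term ga x k) holomorphic_on UNIV" for k
      unfolding psi_term_def qpoch_def
      by (intro holomorphic_on_mult holomorphic_on_const holomorphic_on_prod holomorphic_qpoch_inf'
            holomorphic_on_diff holomorphic_on_minus holomorphic_on_ident)
    fix x :: complex
    have s: "summable (\<lambda>k. psi_term_bound (norm ga) (norm x + 1) * (c / norm ga) ^ k)"
      using assms c_pos ratio_less_1 by (intro summable_mult summable_geometric) auto
    have "norm y \<le> norm x + 1" if "y \<in> cball x 1" for y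
      using that norm_triangle_ineq3[of y x] by (auto simp: dist_norm norm_minus_commute)
    then have "\<forall>y\<in>cball x 1. \<forall>k. norm (psi_term ga y k) \<le> psi_term_bound (norm ga) (norm x + 1) * (c / norm ga) ^ k"
      by (intro ballI allI psi_term_bound) auto
    with s show "\<exists>d>0. \<exists>M. cball x d \<subseteq> UNIV \<and> summable M \<and> (\<forall>y\<in>cball x d. \<forall>k. norm (psi_term ga y k) \<le> M k)"
      by (intro exI[of _ 1] conjI exI[of _ "\<lambda>k. psi_term_bound (norm ga) (norm x + 1) * (c / norm ga) ^ k"]) auto
  qed simp
  then show ?thesis unfolding psi_entire_def by (intro holomorphic_on_mult holomorphic_on_const)
qed

text \<open>The series is dominated by a geometric one of ratio \<open>c / norm ga\<close>,
  uniformly on small discs. Because c < 1 the region contains the unit circle, where the boundary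
  values of the Green function are taken.\<close>

lemma holomorphic_psi_entire_gamma:
  "(\<lambda>ga. psi_entire ga x) holomorphic_on {ga. c < norm ga}"
proof -
  have nz: "ga \<noteq> 0" if "c < norm ga" for ga :: complex using that c_pos by auto
  have "(\<lambda>ga. \<Sum>k. psi_term ga x k) holomorphic_on {ga. c < norm ga}"
  proof (rule holomorphic_suminf)
    show "open {ga::complex. c < norm ga}" by (intro open_Collect_less continuous_intros)
    show "(\<lambda>ga. psi_term ga x k) holomorphic_on {ga. c < norm ga}" for k
      unfolding psi_term_def psi_coef_def qpoch_def
      by (intro holomorphic_on_mult holomorphic_on_const holomorphic_on_prod holomorphic_qpoch_inf'
            holomorphic_on_diff holomorphic_on_minus holomorphic_on_ident holomorphic_on_divide holomorphic_on_power)
         (use nz qpoch_q_nonzero qpoch_ab_nonzero in \<open>auto simp: qpoch_def\<close>)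
    fix x' :: complex assume "x' \<in> {ga. c < norm ga}"
    then have x': "c < norm x'" by simp
    define d where "d = (norm x' - c) / 2"
    have d: "d > 0" "c < norm x' - d" using x' by (simp_all add: d_def field_simps)
    let ?r = "c / (norm x' - d)"
    have r: "0 \<le> ?r" "?r < 1" using d c_pos ratio_less_1 by auto
    have n: "norm y \<le> norm x' + d" "norm x' - d \<le> norm y" if "y \<in> cball x' d" for y
      using that norm_triangle_ineq3[of y x'] by (auto simp: dist_norm norm_minus_commute)
    have "norm (psi_term y x k) \<le> psi_term_bound (norm x' + d) (norm x) * ?r ^ k" if "y \<in> cball x' d" for y k
    proof -
      have "norm (psi_term y x k) \<le> psi_term_bound (norm x' + d) (norm x) * (c / norm y) ^ k"
        by (intro psi_term_bound n that) simp
      also have "\<dots> \<le> psi_term_bound (norm x' + d) (norm x) * ?r ^ k"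
        using d c_pos n[OF that]
        by (intro mult_left_mono power_mono divide_left_mono psi_term_bound_nonneg) (auto intro!: mult_pos_pos)
      finally show ?thesis .
    qed
    moreover have "summable (\<lambda>k. psi_term_bound (norm x' + d) (norm x) * ?r ^ k)"
      using r by (intro summable_mult summable_geometric) (simp only: real_norm_def abs_of_nonneg)
    moreover have "cball x' d \<subseteq> {ga. c < norm ga}" using n d by fastforce
    ultimately show "\<exists>d>0. \<exists>M. cball x' d \<subseteq> {ga. c < norm ga} \<and> summable M \<and> (\<forall>y\<in>cball x' d. \<forall>k. norm (psi_term y x k) \<le> M k)"
      using d(1) by blast
  qed
  then show ?thesis unfolding psi_entire_def
    by (intro holomorphic_on_mult holomorphic_on_const holomorphic_on_divide holomorphic_qpoch_inf' holomorphic_on_ident)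
       (use nz qpoch_inf_ac_nonzero in auto)
qed

lemma continuous_on_psi_gamma: "continuous_on {ga. c < norm ga} (\<lambda>ga. psi ga x)"
proof (cases "qinf (- (of_real b * of_real c * x)) = 0")
  \<comment> \<open>Division by zero gives 0 here, a constant function of \<open>ga\<close>.\<close>
  case True then show ?thesis by (simp add: psi_def)
next
  case False then show ?thesis unfolding psi_def
    by (intro continuous_on_divide holomorphic_on_imp_continuous_on[OF holomorphic_psi_entire_gamma] continuous_on_const) auto
qed

text \<open>The antidifference in k of the recurrence applied to \<open>psi_term\<close>. By
  \<open>psi_coef_Suc\<close> the factor built from index j is \<open>psi_coef ga k\<close> times
  \<open>(1 - q^k) (1 - a b q^(k-1))\<close> with k = j + 1, which explains the value 0 at k =
  0.\<close>

definition psi_cert :: "complex \<Rightarrow> complex \<Rightarrow> nat \<Rightarrow> complex" where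
  "psi_cert ga x k = (case k of 0 \<Rightarrow> 0 | Suc j \<Rightarrow>
     - (of_real a * of_real b * x * x) * (1 - of_real c * ga) * psi_coef ga j *
     ((1 - of_real a * ga * of_real q ^ j) * (1 - of_real b * ga * of_real q ^ j) * (of_real c / ga)) *
     qpoch q (- (of_real a * of_real b * x)) j * qinf (- (of_real a * of_real b * of_real c * ga * x) * of_real q ^ k))"

text \<open>This is \<open>b c x^2 (m + A(x) + B(x))\<close>, the coefficient of f(x) in L f = m f
  after clearing denominators.\<close>

definition eig_coef :: "complex \<Rightarrow> complex \<Rightarrow> complex" where
  "eig_coef m x = of_real b * of_real c * x * x * m
     + (1 + of_real a * of_real b * x) * (1 + of_real a * of_real c * x)
     + (of_real q + of_real b * of_real c * x) * (1 + x)"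

text \<open>The left-hand side is the eigenvalue equation of \<open>psi\<close> multiplied by the
  denominator of \<open>psi\<close>: the step to q x costs \<open>1 + b c x\<close>, and the step to
  x / q turns \<open>q + b c x\<close> into \<open>q\<close>.\<close>

lemma psi_term_telescope:
  assumes g: "ga \<noteq> 0"
  shows "(1 + of_real a * of_real b * x) * (1 + of_real a * of_real c * x) * (1 + of_real b * of_real c * x) * psi_term ga (of_real q * x) k
    + of_real q * (1 + x) * psi_term ga (x / of_real q) k - eig_coef (mu a ga) x * psi_term ga x k
    = psi_cert ga x (Suc k) - psi_cert ga x k"
proof -
  define A B C where "A = complex_of_real a" and "B = complex_of_real b" and "C = complex_of_real c"
  define u where "u = complex_of_real q"
  define gi where "gi = inverse ga"
  have gi: "ga * gi = 1" using g by (simp add: gi_def)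
  have u0: "u \<noteq> 0" by (simp add: u_def)
  have CG: "C / ga = C * gi" "A / ga = A * gi" by (simp_all add: gi_def divide_inverse)
  have mu: "mu a ga = - ((1 - A * ga) * (1 - A * gi))" using mu_factor[OF g, of a] by (simp add: A_def CG[unfolded A_def])
  define s where "s = u ^ k"
  define w where "w = qinf (- (A * B * C * ga * (u * x)) * s)"
  have w1: "qinf (- (A * B * C * ga * x) * s) = (1 + A * B * C * ga * x * s) * w"
    using qpoch_inf_step[of "- (A * B * C * ga * x) * s"] by (simp add: w_def u_def mult_ac)
  have w2: "qinf (- (A * B * C * ga * x) * (u * s)) = w" by (simp add: w_def mult_ac)
  show ?thesis
  proof (cases k)
    case 0
    then have s: "s = 1" by (simp add: s_def)
    have w3: "qinf (- (A * B * C * ga * (x / u))) = (1 + A * B * C * ga * x * inverse u) * ((1 + A * B * C * ga * x * s) * w)"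
    proof -
      have "- (A * B * C * ga * (x / u)) * complex_of_real q = - (A * B * C * ga * x) * s"
        using u0 by (simp add: u_def s)
      with qpoch_inf_step[of "- (A * B * C * ga * (x / u))"] w1
      have "qinf (- (A * B * C * ga * (x / u))) = (1 - - (A * B * C * ga * (x / u))) * ((1 + A * B * C * ga * x * s) * w)"
        by metis
      then show ?thesis by (simp add: divide_inverse mult.assoc)
    qed
    have "u * inverse u = 1" using u0 by simp
    note c0 = psi_certificate_0[OF gi this, of A B x C]
    have [simp]: "psi_coef ga 0 = 1" by (simp add: psi_coef_def)
    show ?thesis
      unfolding psi_term_def psi_cert_def 0 eig_coef_def mu
      unfolding A_def[symmetric] B_def[symmetric] C_def[symmetric] u_def[symmetric]
      using c0 w1 w2 w3 w_def by (simp add: s CG) algebra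
  next
    case (Suc j)
    define r where "r = u ^ j"
    have s: "s = u * r" by (simp add: s_def r_def Suc)
    have w3: "qinf (- (A * B * C * ga * (x / u)) * s) = (1 + A * B * C * ga * x * r) * ((1 + A * B * C * ga * x * s) * w)"
      using qpoch_inf_step[of "- (A * B * C * ga * (x / u)) * s"] w1 u0 by (simp add: u_def[symmetric] s mult_ac)
    define p where "p = qpoch q (- (A * B * x)) j"
    have p1: "qpoch q (- (A * B * x)) k = p * (1 + A * B * x * r)"
      by (simp add: Suc qpoch_Suc p_def r_def u_def)
    have p2: "(1 + A * B * x) * qpoch q (- (A * B * (u * x))) k = p * (1 + A * B * x * r) * (1 + A * B * x * s)"
      using qpoch_Suc'[of "- (A * B * x)" k] qpoch_Suc[of "- (A * B * x)" k] p1 by (simp add: s_def u_def mult_ac)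
    have p3: "u * qpoch q (- (A * B * (x / u))) k = (u + A * B * x) * p"
      using qpoch_Suc'[of "- (A * B * (x / u))" j] u0 by (simp add: Suc p_def u_def[symmetric] field_simps)
    define \<alpha> where "\<alpha> = psi_coef ga k"
    have al: "psi_coef ga j * ((1 - A * ga * r) * (1 - B * ga * r) * (C / ga)) = \<alpha> * ((1 - s) * (1 - A * B * r))"
      using psi_coef_Suc[of ga j] by (simp add: \<alpha>_def Suc s r_def u_def A_def B_def C_def)
    have G1: "psi_cert ga x (Suc k) = - (A*B*x*x) * (1 - C * ga) * \<alpha> * ((1 - A * ga * s) * (1 - B * ga * s) * (C * gi)) * (p * (1 + A * B * x * r)) * w"
      unfolding psi_cert_def using p1 w2 by (simp add: A_def B_def C_def \<alpha>_def s_def u_def CG[unfolded C_def])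
    have G0: "psi_cert ga x k = - (A*B*x*x) * (1 - C * ga) * (\<alpha> * ((1 - s) * (1 - A * B * r))) * p * ((1 + A * B * C * ga * x * s) * w)"
      unfolding psi_cert_def al[symmetric] w1[symmetric]
      by (simp add: Suc A_def B_def C_def p_def r_def u_def s mult.assoc)
    note c1 = psi_certificate[OF gi s, of A C x B]
    have t1: "(1 + A*B*x) * psi_term ga (u * x) k = \<alpha> * (p * (1 + A * B * x * r) * (1 + A * B * x * s)) * w"
      unfolding psi_term_def p2[symmetric] by (simp add: A_def B_def C_def \<alpha>_def w_def s_def u_def mult_ac)
    have t2: "u * psi_term ga (x / u) k = \<alpha> * ((u + A * B * x) * p) * ((1 + A * B * C * ga * x * r) * ((1 + A * B * C * ga * x * s) * w))"
      unfolding psi_term_def p3[symmetric] w3[symmetric] by (simp add: A_def B_def C_def \<alpha>_def s_def u_def mult_ac)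
    have t3: "psi_term ga x k = \<alpha> * (p * (1 + A * B * x * r)) * ((1 + A * B * C * ga * x * s) * w)"
      unfolding psi_term_def p1[symmetric] w1[symmetric] by (simp add: A_def B_def C_def \<alpha>_def s_def u_def)
    have "(1 + A*B*x) * (1 + A*C*x) * (1 + B*C*x) * psi_term ga (u * x) k
       + u * (1 + x) * psi_term ga (x / u) k - eig_coef (mu a ga) x * psi_term ga x k
     = (1 + A*C*x) * (1 + B*C*x) * ((1 + A*B*x) * psi_term ga (u * x) k)
       + (1 + x) * (u * psi_term ga (x / u) k) - eig_coef (mu a ga) x * psi_term ga x k"
      by (simp add: mult_ac)
    also have "\<dots> = \<alpha> * p * w * ((1 + A*C*x) * (1 + B*C*x) * (1 + A*B*x* s) * (1 + A*B*x*r)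
      + (u + A*B*x) * (1 + x) * (1 + A*B*C*ga*x*r) * (1 + A*B*C*ga*x* s)
      - (B*C*x*x * (- ((1 - A*ga) * (1 - A*gi))) + (1 + A*B*x) * (1 + A*C*x) + (u + B*C*x) * (1 + x))
          * (1 + A*B*x*r) * (1 + A*B*C*ga*x* s))"
      unfolding t1 t2 t3 eig_coef_def mu A_def[symmetric] B_def[symmetric] C_def[symmetric] u_def[symmetric]
      by algebra
    also have "\<dots> = psi_cert ga x (Suc k) - psi_cert ga x k"
      unfolding c1 G0 G1 by algebra
    finally show ?thesis by (simp add: A_def B_def C_def u_def)
  qed
qed

lemma psi_coef_LIMSEQ: "c < norm ga \<Longrightarrow> psi_coef ga \<longlonglongrightarrow> 0"
proof -
  assume "c < norm ga"
  then have p: "(\<lambda>k. (of_real c / ga) ^ k) \<longlonglongrightarrow> 0"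
    using c_pos ratio_less_1 by (intro LIMSEQ_power_zero) (auto simp: norm_divide)
  then have "psi_coef ga \<longlonglongrightarrow> qinf (of_real a * ga) * qinf (of_real b * ga)
     / (qinf (of_real q) * qinf (of_real a * of_real b)) * 0"
    unfolding psi_coef_def
    by (intro tendsto_mult tendsto_divide qpoch_LIMSEQ p) (simp_all add: qpoch_inf_q_nonzero qpoch_inf_ab_nonzero)
  then show ?thesis by simp
qed

text \<open>The antidifference starts at 0 and tends to 0, since \<open>psi_coef\<close> does for c
  < norm ga; hence the sum of the telescoping identity is 0.\<close>

lemma psi_entire_eq:
  assumes "c < norm ga"
  shows "(1 + of_real a * of_real b * x) * (1 + of_real a * of_real c * x) * (1 + of_real b * of_real c * x) * psi_entire ga (of_real q * x)
    + of_real q * (1 + x) * psi_entire ga (x / of_real q) = eig_coef (mu a ga) x * psi_entire ga x"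
proof -
  have g: "ga \<noteq> 0" using assms c_pos by auto
  let ?P = "(1 + of_real a * of_real b * x) * (1 + of_real a * of_real c * x) * (1 + of_real b * of_real c * x)"
  let ?K = "qinf (of_real c / ga) / qinf (of_real a * of_real c)"
  have "(\<lambda>j. psi_cert ga x (Suc j)) \<longlonglongrightarrow> - (of_real a * of_real b * x * x) * (1 - of_real c * ga) * 0 *
     ((1 - of_real a * ga * 0) * (1 - of_real b * ga * 0) * (of_real c / ga)) *
     qinf (- (of_real a * of_real b * x)) * qinf (- (of_real a * of_real b * of_real c * ga * x) * 0)"
    unfolding psi_cert_def nat.case
    by (intro tendsto_mult tendsto_diff tendsto_const cq_power_LIMSEQ qpoch_LIMSEQ psi_coef_LIMSEQ assms
         tendsto_qpoch_inf LIMSEQ_Suc[OF cq_power_LIMSEQ])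
  then have "(\<lambda>j. psi_cert ga x (Suc j)) \<longlonglongrightarrow> 0" by simp
  then have "psi_cert ga x \<longlonglongrightarrow> 0" by (rule LIMSEQ_imp_Suc)
  then have "(\<lambda>k. psi_cert ga x (Suc k) - psi_cert ga x k) sums (0 - psi_cert ga x 0)" by (rule telescope_sums)
  then have 1: "(\<lambda>k. psi_cert ga x (Suc k) - psi_cert ga x k) sums 0" by (simp add: psi_cert_def)
  have 2: "(\<lambda>k. psi_cert ga x (Suc k) - psi_cert ga x k) sums (?P * suminf (psi_term ga (of_real q * x))
    + of_real q * (1 + x) * suminf (psi_term ga (x / of_real q)) - eig_coef (mu a ga) x * suminf (psi_term ga x))"
    unfolding psi_term_telescope[OF g, symmetric]
    by (intro sums_diff sums_add sums_mult summable_sums psi_term_summable assms)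
  have "?P * suminf (psi_term ga (of_real q * x))
    + of_real q * (1 + x) * suminf (psi_term ga (x / of_real q)) = eig_coef (mu a ga) x * suminf (psi_term ga x)"
    using sums_unique2[OF 1 2] by simp
  then have "?K * (?P * suminf (psi_term ga (of_real q * x))
    + of_real q * (1 + x) * suminf (psi_term ga (x / of_real q))) = ?K * (eig_coef (mu a ga) x * suminf (psi_term ga x))"
    by simp
  then show ?thesis unfolding psi_entire_def by (simp only: distrib_left mult_ac)
qed

text \<open>If \<open>q + b c x = 0\<close>, the denominator of \<open>psi\<close> vanishes at x /
  q. At x = - 1 this is harmless because the factor \<open>1 + x\<close> removes that term; this is
  the reason for the alternative in the hypothesis.\<close>

lemma psi_eq:
  assumes g: "c < norm ga" and nz: "qinf (- (of_real b * of_real c * x)) \<noteq> 0"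
    and x: "x = - 1 \<or> of_real q + of_real b * of_real c * x \<noteq> 0"
  shows "(1 + of_real a * of_real b * x) * (1 + of_real a * of_real c * x) * (psi ga (of_real q * x) - psi ga x)
    + (of_real q + of_real b * of_real c * x) * (1 + x) * (psi ga (x / of_real q) - psi ga x)
    = of_real b * of_real c * x * x * mu a ga * psi ga x"
proof -
  define D where "D y = qinf (- (of_real b * of_real c * y))" for y :: complex
  define u where "u = complex_of_real q"
  have u0: "u \<noteq> 0" by (simp add: u_def)
  have D1: "D x = (1 + of_real b * of_real c * x) * D (u * x)"
    using qpoch_inf_step[of "- (of_real b * of_real c * x)"] by (simp add: D_def u_def mult_ac)
  have D2: "u * D (x / u) = (u + of_real b * of_real c * x) * D x"
    using qpoch_inf_step[of "- (of_real b * of_real c * (x / u))"] u0 by (simp add: D_def u_def[symmetric] field_simps)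
  have nz0: "D x \<noteq> 0" using nz by (simp add: D_def)
  then have nz1: "D (u * x) \<noteq> 0" "1 + of_real b * of_real c * x \<noteq> 0" using D1 by auto
  have p: "psi_entire ga y = D y * psi ga y" if "D y \<noteq> 0" for y using that by (simp add: psi_def D_def)
  have e1: "(1 + of_real b * of_real c * x) * psi_entire ga (u * x) = D x * psi ga (u * x)"
    using p[OF nz1(1)] D1 by simp
  have e2: "u * (1 + x) * psi_entire ga (x / u) = (1 + x) * (u + of_real b * of_real c * x) * D x * psi ga (x / u)"
  proof (cases "x = - 1")
    case False
    then have "D (x / u) \<noteq> 0" using D2 nz0 x by (auto simp: u_def)
    from p[OF this] D2 show ?thesis by (metis (no_types, lifting) mult.assoc mult.commute)
  qed simp
  have "D x * ((1 + of_real a * of_real b * x) * (1 + of_real a * of_real c * x) * psi ga (u * x)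
      + (1 + x) * (u + of_real b * of_real c * x) * psi ga (x / u)) = D x * (eig_coef (mu a ga) x * psi ga x)"
    using psi_entire_eq[OF g, of x] e1 e2 p[OF nz0] unfolding u_def[symmetric]
    by algebra
  then have "(1 + of_real a * of_real b * x) * (1 + of_real a * of_real c * x) * psi ga (u * x)
      + (1 + x) * (u + of_real b * of_real c * x) * psi ga (x / u) = eig_coef (mu a ga) x * psi ga x"
    using nz0 by simp
  then show ?thesis unfolding eig_coef_def u_def[symmetric] by algebra
qed

text \<open>At x = - 1 the factors with \<open>a b\<close> cancel and the series becomes a q-Gauss
  sum with lower parameter \<open>a b c ga\<close>. A nonreal \<open>ga\<close> keeps every
  denominator in the evaluation away from 0.\<close>

lemma psi_minus_1:
  assumes g: "c < norm ga" and im: "Im ga \<noteq> 0"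
  shows "psi ga (- 1) = 1"
proof -
  define A B C where "A = complex_of_real a * ga" and "B = complex_of_real b * ga"
    and "C = complex_of_real a * of_real b * of_real c * ga"
  have g0: "ga \<noteq> 0" using im by auto
  have nz: "complex_of_real a \<noteq> 0" "complex_of_real b \<noteq> 0" "complex_of_real c \<noteq> 0" using a_pos b_pos c_pos by auto
  have Cn: "C * of_real q ^ i \<noteq> 1" for i
  proof
    assume "C * of_real q ^ i = 1"
    then have "Im (C * of_real q ^ i) = 0" by simp
    moreover have "C * of_real q ^ i = of_real (a * b * c * q ^ i) * ga" by (simp add: C_def)
    ultimately have "a * b * c * q ^ i * Im ga = 0" by simp
    then show False using a_pos b_pos c_pos im by simp
  qed
  have CAB: "C / (A * B) = of_real c / ga" "C / A = of_real b * of_real c" "C / B = of_real a * of_real c"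
    using nz g0 by (simp_all add: A_def B_def C_def)
  have lt: "norm (C / (A * B)) < 1" unfolding CAB using g c_pos ratio_less_1 by (simp add: norm_divide)
  have Cpn: "qpoch q C k \<noteq> 0" for k using Cn by (intro qpoch_nonzero)
  have t: "psi_term ga (- 1) k = qinf C * gauss_term A B C k" for k
  proof -
    have "qinf (C * of_real q ^ k) = qinf C / qpoch q C k"
      using qpoch_inf_split[of C k] Cpn[of k] by simp
    then show ?thesis unfolding psi_term_def psi_coef_def gauss_term_def CAB
      using qpoch_ab_nonzero[of k] by (simp add: A_def B_def C_def)
  qed
  have "(\<Sum>k. psi_term ga (- 1) k) = qinf C * suminf (gauss_term A B C)"
    unfolding t by (intro suminf_mult gauss_term_summable Cn lt)
  also have "suminf (gauss_term A B C) = qinf (C / A) * qinf (C / B) / (qinf C * qinf (C / (A * B)))"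
    by (rule q_gauss[OF _ _ Cn lt]) (use nz g0 in \<open>auto simp: A_def B_def\<close>)
  finally have S: "(\<Sum>k. psi_term ga (- 1) k) = qinf C * (qinf (C / A) * qinf (C / B) / (qinf C * qinf (C / (A * B))))" .
  have "qinf C \<noteq> 0" using Cn by (simp add: qpoch_inf_eq_0_iff)
  moreover have "qinf (of_real c / ga) \<noteq> 0"
  proof -
    have "of_real c / ga * of_real q ^ i \<noteq> 1" for i
    proof
      assume "of_real c / ga * of_real q ^ i = 1"
      then have "ga = of_real (c * q ^ i)" using g0 by (simp add: field_simps)
      then show False using im by simp
    qed
    then show ?thesis unfolding qpoch_inf_eq_0_iff by blast
  qed
  moreover have "qinf (complex_of_real b * of_real c) \<noteq> 0"
    using qpoch_inf_pos[OF bc_less_1] unfolding of_real_mult[symmetric] qpoch_inf_of_real by simp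
  ultimately show ?thesis
    unfolding psi_def psi_entire_def S CAB using qpoch_inf_ac_nonzero by simp
qed

end

text \<open>The polynomial core of \<open>phi_term_telescope\<close> at n = m + 1, with
  \<open>r = q^m\<close>, \<open>v = 1 / r\<close>, \<open>s = q^(m+1)\<close>,
  \<open>ui = 1 / u\<close> and \<open>gi = 1 / g\<close>.\<close>

lemma phi_certificate:
  fixes A B C g gi x u ui r v s :: complex
  assumes "g * gi = 1" "u * ui = 1" "r * v = 1" "s = u * r"
  shows "(1 + A*B*x) * (1 + A*C*x) * (r * (1 + u*x) - (x + r))
      + (u + B*C*x) * ((x * (v * ui) + 1) * (x + r) - (1 + x) * (x + r))
      - B*C*x*x * (- ((1 - A*g) * (1 - A*gi))) * (x + r)
    = (1 - s) * (1 - A*B*r) * (1 - A*C*r) * v * (x*x) + B*C * ((1 - A*g * s) * (1 - A*gi * s)) * (v * ui) * (x*x) * (x + r)"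
  using assms by algebra

context big_q begin

text \<open>This is \<open>(-1/x; q)_n x^n\<close>, which makes sense at x = 0 as well. In this
  basis the 3\<phi>2 series becomes an expansion that is analytic near 0 and terminates at the
  points - q^k.\<close>

definition ebas :: "complex \<Rightarrow> nat \<Rightarrow> complex" where
  "ebas x n = (\<Prod>i<n. x + of_real q ^ i)"

definition phi_coef :: "complex \<Rightarrow> nat \<Rightarrow> complex" where
  "phi_coef ga n = qpoch q (of_real a * ga) n * qpoch q (of_real a / ga) n
     / (qpoch q (of_real q) n * qpoch q (of_real a * of_real b) n * qpoch q (of_real a * of_real c) n)
     * (- (of_real b * of_real c)) ^ n"

definition phi_ser :: "complex \<Rightarrow> complex \<Rightarrow> complex" where
  "phi_ser ga x = (\<Sum>n. phi_coef ga n * ebas x n)"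

lemma ebas_0 [simp]: "ebas x 0 = 1" by (simp add: ebas_def)

lemma ebas_Suc: "ebas x (Suc n) = ebas x n * (x + of_real q ^ n)" by (simp add: ebas_def)

lemma ebas_q: "ebas (of_real q * x) (Suc n) = of_real q ^ n * (1 + of_real q * x) * ebas x n"
proof (induction n)
  case (Suc n)
  have "ebas (of_real q * x) (Suc (Suc n)) = ebas (of_real q * x) (Suc n) * (of_real q * x + of_real q ^ Suc n)"
    by (rule ebas_Suc)
  also have "\<dots> = of_real q ^ n * (1 + of_real q * x) * ebas x n * (of_real q * (x + of_real q ^ n))"
    unfolding Suc by (simp add: distrib_left)
  finally show ?case by (simp add: ebas_Suc mult_ac)
qed (simp add: ebas_Suc add.commute)

lemma ebas_div_q: "of_real q ^ n * ((1 + x) * ebas (x / of_real q) n) = (x + of_real q ^ n) * ebas x n"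
proof (induction n)
  case (Suc n)
  have "of_real q ^ Suc n * ((1 + x) * ebas (x / of_real q) (Suc n))
     = (of_real q ^ n * ((1 + x) * ebas (x / of_real q) n)) * (of_real q * (x / of_real q + of_real q ^ n))"
    by (simp add: ebas_Suc mult_ac)
  also have "\<dots> = (x + of_real q ^ n) * ebas x n * (x + of_real q ^ Suc n)"
    unfolding Suc by (simp add: distrib_left)
  finally show ?case by (simp add: ebas_Suc mult_ac)
qed (simp add: add.commute)

lemma ebas_zero: "k < n \<Longrightarrow> ebas (- (of_real q ^ k)) n = 0"
  by (auto simp: ebas_def)

lemma ebas_bound:
  assumes "norm x \<le> r" "0 < r"
  shows "norm (ebas x n) \<le> qinf (- (1 / r)) * r ^ n"
proof -
  have "norm (ebas x n) \<le> qpoch q (- (1 / r)) n * r ^ n"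
  proof (induction n)
    case (Suc n)
    have "norm (x + of_real q ^ n) \<le> r + q ^ n"
      using norm_triangle_ineq[of x "of_real q ^ n"] assms q_pos by (simp add: norm_power)
    also have "\<dots> = (1 + 1 / r * q ^ n) * r" using assms by (simp add: field_simps)
    finally have "norm (ebas x n) * norm (x + of_real q ^ n) \<le> (qpoch q (- (1 / r)) n * r ^ n) * ((1 + 1 / r * q ^ n) * r)"
      using Suc assms qpoch_nonneg_neg[of "1 / r" n] by (intro mult_mono) auto
    then show ?case by (simp add: ebas_Suc qpoch_Suc norm_mult mult_ac)
  qed simp
  also have "\<dots> \<le> qinf (- (1 / r)) * r ^ n"
    using assms by (intro mult_right_mono qpoch_neg_le_inf) auto
  finally show ?thesis .
qed

definition phi_coef_bound :: "real \<Rightarrow> real" where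
  "phi_coef_bound R = qinf (- (a * R)) * qinf (- (a * R)) / (qinf q * qinf (a * b) * qinf (a * c))"

lemma phi_coef_bound_nonneg: "0 \<le> R \<Longrightarrow> 0 \<le> phi_coef_bound R"
  unfolding phi_coef_bound_def using a_pos
  by (intro divide_nonneg_nonneg mult_nonneg_nonneg less_imp_le[OF qpoch_inf_pos[OF q_less_1]]
       less_imp_le[OF qpoch_inf_pos[OF ab_less_1]] less_imp_le[OF qpoch_inf_pos[OF ac_less_1]] qpoch_inf_neg_nonneg) auto

lemma phi_coef_bound:
  assumes "norm ga \<le> R" "norm (1 / ga) \<le> R"
  shows "norm (phi_coef ga k) \<le> phi_coef_bound R * (b * c) ^ k"
proof -
  have R: "0 \<le> R" using assms norm_ge_zero[of ga] by linarith
  have d: "0 < qinf q * qinf (a * b) * qinf (a * c)"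
    by (intro mult_pos_pos qpoch_inf_pos q_less_1 ab_less_1 ac_less_1)
  have 1: "norm (of_real a / ga) \<le> a * R" using assms a_pos mult_left_mono[of "norm (1 / ga)" R a] by (simp add: norm_divide)
  have "norm (qpoch q (of_real a * ga) k * qpoch q (of_real a / ga) k) \<le> qinf (- (a * R)) * qinf (- (a * R))"
    unfolding norm_mult using assms a_pos R
    by (intro mult_mono norm_qpoch_le_inf 1 qpoch_inf_neg_nonneg) (auto simp: norm_mult)
  moreover have "qinf q * qinf (a * b) * qinf (a * c)
     \<le> norm (qpoch q (complex_of_real q) k * qpoch q (of_real a * of_real b) k * qpoch q (of_real a * of_real c) k)"
    unfolding qpoch_ab qpoch_ac qpoch_of_real norm_mult norm_of_real
    using qpoch_pos[OF q_less_1, of k] qpoch_pos[OF ab_less_1, of k] qpoch_pos[OF ac_less_1, of k]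
      qpoch_inf_pos[OF q_less_1] qpoch_inf_pos[OF ab_less_1] qpoch_inf_pos[OF ac_less_1]
      a_pos b_pos c_pos q_pos qpoch_inf_le_qpoch[of q k] qpoch_inf_le_qpoch[of "a * b" k] qpoch_inf_le_qpoch[of "a * c" k]
      q_less_1 ab_less_1 ac_less_1
    by (intro mult_mono) auto
  ultimately have "norm (qpoch q (of_real a * ga) k * qpoch q (of_real a / ga) k
       / (qpoch q (of_real q) k * qpoch q (of_real a * of_real b) k * qpoch q (of_real a * of_real c) k)) \<le> phi_coef_bound R"
    unfolding norm_divide phi_coef_bound_def using d a_pos R
    by (intro frac_le mult_nonneg_nonneg qpoch_inf_neg_nonneg) auto
  then have "norm (qpoch q (of_real a * ga) k * qpoch q (of_real a / ga) k
       / (qpoch q (of_real q) k * qpoch q (of_real a * of_real b) k * qpoch q (of_real a * of_real c) k))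
      * norm ((- (of_real b * of_real c)) ^ k :: complex)
     \<le> phi_coef_bound R * norm ((- (of_real b * of_real c)) ^ k :: complex)" by (intro mult_right_mono) auto
  then show ?thesis unfolding phi_coef_def norm_mult[symmetric] using b_pos c_pos
    by (simp add: norm_power norm_mult power_mult_distrib)
qed

lemma phi_term_bound:
  assumes "norm ga \<le> R" "norm (1 / ga) \<le> R" "norm x \<le> r" "0 < r"
  shows "norm (phi_coef ga n * ebas x n) \<le> phi_coef_bound R * qinf (- (1 / r)) * (b * c * r) ^ n"
proof -
  have R: "0 \<le> R" using assms norm_ge_zero[of ga] by linarith
  have "norm (phi_coef ga n) * norm (ebas x n) \<le> (phi_coef_bound R * (b * c) ^ n) * (qinf (- (1 / r)) * r ^ n)"
    using b_pos c_pos R assms by (intro mult_mono phi_coef_bound ebas_bound mult_nonneg_nonneg phi_coef_bound_nonneg) auto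
  then show ?thesis by (simp add: norm_mult power_mult_distrib mult_ac)
qed

lemma phi_coef_Suc:
  "phi_coef ga (Suc k) * ((1 - of_real q ^ Suc k) * (1 - of_real a * of_real b * of_real q ^ k) * (1 - of_real a * of_real c * of_real q ^ k))
   = phi_coef ga k * ((1 - of_real a * ga * of_real q ^ k) * (1 - of_real a / ga * of_real q ^ k) * (- (of_real b * of_real c)))"
proof -
  have "qpoch q (complex_of_real q) (Suc k) \<noteq> 0" "qpoch q (complex_of_real a * of_real b) (Suc k) \<noteq> 0"
     "qpoch q (complex_of_real a * of_real c) (Suc k) \<noteq> 0"
    by (rule qpoch_q_nonzero qpoch_ab_nonzero qpoch_ac_nonzero)+
  then have "1 - complex_of_real q * of_real q ^ k \<noteq> 0" "1 - complex_of_real a * of_real b * of_real q ^ k \<noteq> 0"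
     "1 - complex_of_real a * of_real c * of_real q ^ k \<noteq> 0"
    by (simp_all only: qpoch_Suc mult_eq_0_iff) auto
  then show ?thesis
    by (simp add: phi_coef_def qpoch_Suc qpoch_q_nonzero qpoch_ab_nonzero qpoch_ac_nonzero mult_ac)
qed

text \<open>The antidifference contains the growing factor q^(-m). Its limit is taken only at the
  points - q^k, where \<open>ebas\<close> is 0 from some index on.\<close>

definition phi_cert :: "complex \<Rightarrow> complex \<Rightarrow> nat \<Rightarrow> complex" where
  "phi_cert ga x n = (case n of 0 \<Rightarrow> 0 | Suc m \<Rightarrow>
     of_real b * of_real c * phi_coef ga m * ((1 - of_real a * ga * of_real q ^ m) * (1 - of_real a / ga * of_real q ^ m))
      * inverse (of_real q ^ m) * (x * x) * ebas x m)"

lemma phi_term_telescope: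
  assumes g: "ga \<noteq> 0"
  shows "(1 + of_real a * of_real b * x) * (1 + of_real a * of_real c * x) * (phi_coef ga n * ebas (of_real q * x) n - phi_coef ga n * ebas x n)
    + (of_real q + of_real b * of_real c * x) * ((1 + x) * (phi_coef ga n * ebas (x / of_real q) n) - (1 + x) * (phi_coef ga n * ebas x n))
    - of_real b * of_real c * x * x * mu a ga * (phi_coef ga n * ebas x n)
    = phi_cert ga x (Suc n) - phi_cert ga x n"
proof -
  define A B C where "A = complex_of_real a" and "B = complex_of_real b" and "C = complex_of_real c"
  define u where "u = complex_of_real q"
  define ui where "ui = inverse u"
  define gi where "gi = inverse ga"
  have gi: "ga * gi = 1" using g by (simp add: gi_def)
  have ui: "u * ui = 1" by (simp add: u_def ui_def)
  have CG: "A / ga = A * gi" by (simp_all add: gi_def divide_inverse)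
  have mu: "mu a ga = - ((1 - A * ga) * (1 - A * gi))" using mu_factor[OF g, of a] by (simp add: A_def CG[unfolded A_def])
  show ?thesis
  proof (cases n)
    case 0
    show ?thesis unfolding 0 phi_cert_def mu CG[unfolded A_def] A_def by (simp add: phi_coef_def algebra_simps)
  next
    case (Suc m)
    define r v s where "r = u ^ m" and "v = inverse (u ^ m)" and "s = u * r"
    have rv: "r * v = 1" by (simp add: r_def v_def u_def)
    define E where "E = ebas x m"
    define \<kappa> where "\<kappa> = phi_coef ga n"
    have e1: "ebas x n = (x + r) * E" by (simp add: Suc ebas_Suc E_def r_def u_def)
    have e2: "ebas (u * x) n = r * (1 + u * x) * E" unfolding Suc u_def ebas_q by (simp add: E_def r_def u_def)
    have e3: "(1 + x) * ebas (x / u) n = (x * (v * ui) + 1) * ((x + r) * E)"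
    proof -
      have "s * (v * ui) = 1" using rv ui by (simp add: s_def mult_ac) (metis mult.assoc mult.commute mult_1_right)
      moreover have "s * ((1 + x) * ebas (x / u) n) = (x + s) * ((x + r) * E)"
        using ebas_div_q[of n x] e1 by (simp add: s_def r_def Suc u_def)
      ultimately show ?thesis by algebra
    qed
    have k: "phi_coef ga m * ((1 - A * ga * r) * (1 - A * gi * r) * (- (B * C))) = \<kappa> * ((1 - s) * (1 - A * B * r) * (1 - A * C * r))"
      using phi_coef_Suc[of ga m, unfolded CG[unfolded A_def]] by (simp add: \<kappa>_def Suc s_def r_def u_def A_def B_def C_def)
    have G0: "phi_cert ga x n = - (\<kappa> * ((1 - s) * (1 - A * B * r) * (1 - A * C * r))) * v * (x * x) * E"
      unfolding phi_cert_def k[symmetric] by (simp add: Suc CG[unfolded A_def] A_def B_def C_def E_def r_def v_def u_def)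
    have G1: "phi_cert ga x (Suc n) = B * C * \<kappa> * ((1 - A * ga * s) * (1 - A * gi * s)) * (v * ui) * (x * x) * ((x + r) * E)"
      unfolding phi_cert_def e1[symmetric] by (simp add: Suc CG[unfolded A_def] A_def B_def C_def r_def v_def u_def \<kappa>_def s_def ui_def mult_ac)
    note c1 = phi_certificate[OF gi ui rv s_def, of A B x C]
    have "(1 + A*B*x) * (1 + A*C*x) * (\<kappa> * ebas (u * x) n - \<kappa> * ebas x n)
       + (u + B*C*x) * ((1 + x) * (\<kappa> * ebas (x / u) n) - (1 + x) * (\<kappa> * ebas x n)) - B*C*x*x * mu a ga * (\<kappa> * ebas x n)
      = \<kappa> * E * ((1 + A*B*x) * (1 + A*C*x) * (r * (1 + u*x) - (x + r))
      + (u + B*C*x) * ((x * (v * ui) + 1) * (x + r) - (1 + x) * (x + r))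
      - B*C*x*x * (- ((1 - A*ga) * (1 - A*gi))) * (x + r))"
      unfolding e1 e2 mu using e3 by algebra
    also have "\<dots> = phi_cert ga x (Suc n) - phi_cert ga x n"
      unfolding c1 G0 G1 by algebra
    finally show ?thesis by (simp add: A_def B_def C_def u_def \<kappa>_def)
  qed
qed

lemma phi_summable:
  assumes "ga \<noteq> 0" "b * c * norm x < 1"
  shows "summable (\<lambda>n. phi_coef ga n * ebas x n)"
proof -
  define R where "R = max (norm ga) (norm (1 / ga))"
  \<comment> \<open>The midpoint between norm x and the radius \<open>1 / (b c)\<close> leaves a
    geometric majorant of ratio \<open>b c r < 1\<close>.\<close>
  define r where "r = (norm x + 1 / (b * c)) / 2"
  have bc: "0 < b * c" using b_pos c_pos by simp
  have "norm x < 1 / (b * c)" using assms(2) bc by (simp add: field_simps)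
  then have r: "norm x \<le> r" "0 < r" "r < 1 / (b * c)"
    using add_nonneg_pos[OF norm_ge_zero[of x], of "1 / (b * c)"] bc by (simp_all add: r_def field_simps)
  then have "b * c * r < 1" using bc by (simp add: field_simps)
  then have s: "summable (\<lambda>n. phi_coef_bound R * qinf (- (1 / r)) * (b * c * r) ^ n)"
    using b_pos c_pos r by (intro summable_mult summable_geometric) (auto simp: abs_mult)
  show ?thesis
    by (rule summable_comparison_test'[OF s, of 0]) (intro phi_term_bound r, simp_all add: R_def)
qed

lemma phi_ser_eq:
  fixes k :: nat
  assumes g: "ga \<noteq> 0"
  defines "x \<equiv> - (complex_of_real q ^ k)"
  shows "(1 + of_real a * of_real b * x) * (1 + of_real a * of_real c * x) * (phi_ser ga (of_real q * x) - phi_ser ga x)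
    + (of_real q + of_real b * of_real c * x) * (1 + x) * (phi_ser ga (x / of_real q) - phi_ser ga x)
    = of_real b * of_real c * x * x * mu a ga * phi_ser ga x"
proof -
  have bc: "0 < b * c" using b_pos c_pos by simp
  have n: "norm x \<le> 1" unfolding x_def norm_minus_cancel norm_power using q_pos q_less_1 by (intro power_le_one) auto
  have bx: "b * c * norm x < 1" using mult_left_mono[OF n, of "b * c"] bc bc_less_1 by simp
  have "b * c * norm (of_real q * x) \<le> b * c * norm x"
    using bc q_pos q_less_1 by (intro mult_left_mono) (auto simp: norm_mult intro: mult_left_le_one_le)
  with bx have bqx: "b * c * norm (of_real q * x) < 1" by simp
  have s1: "(\<lambda>n. phi_coef ga n * ebas x n) sums phi_ser ga x"
    unfolding phi_ser_def by (intro summable_sums phi_summable g bx)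
  have s2: "(\<lambda>n. phi_coef ga n * ebas (of_real q * x) n) sums phi_ser ga (of_real q * x)"
    unfolding phi_ser_def by (intro summable_sums phi_summable g bqx)
  \<comment> \<open>For k = 0 the point x / q = - 1 / q may lie outside the disc of convergence, but
    then the factor \<open>1 + x\<close> is 0.\<close>
  have s3: "(\<lambda>n. (1 + x) * (phi_coef ga n * ebas (x / of_real q) n)) sums ((1 + x) * phi_ser ga (x / of_real q))"
  proof (cases k)
    case 0 then show ?thesis by (simp add: x_def)
  next
    case (Suc j)
    have "norm (x / of_real q) = q ^ j" using q_pos by (simp add: x_def Suc norm_mult norm_divide norm_power)
    also have "\<dots> \<le> 1" using q_pos q_less_1 by (intro power_le_one) auto
    finally have "b * c * norm (x / of_real q) < 1"
      using mult_left_mono[of "norm (x / of_real q)" 1 "b * c"] bc bc_less_1 by simp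
    then show ?thesis unfolding phi_ser_def by (intro sums_mult summable_sums phi_summable g)
  qed
  have "eventually (\<lambda>n. phi_cert ga x n = 0) sequentially"
    using eventually_gt_at_top[of "Suc k"]
  proof eventually_elim
    case (elim n)
    then obtain m where "n = Suc m" "k < m" by (cases n) auto
    then show ?case using ebas_zero[of k m] by (simp add: phi_cert_def x_def)
  qed
  then have "phi_cert ga x \<longlonglongrightarrow> 0" by (rule tendsto_eventually)
  then have "(\<lambda>n. phi_cert ga x (Suc n) - phi_cert ga x n) sums (0 - phi_cert ga x 0)" by (rule telescope_sums)
  then have 1: "(\<lambda>n. phi_cert ga x (Suc n) - phi_cert ga x n) sums 0" by (simp add: phi_cert_def)
  have 2: "(\<lambda>n. phi_cert ga x (Suc n) - phi_cert ga x n) sums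
    ((1 + of_real a * of_real b * x) * (1 + of_real a * of_real c * x) * (phi_ser ga (of_real q * x) - phi_ser ga x)
    + (of_real q + of_real b * of_real c * x) * ((1 + x) * phi_ser ga (x / of_real q) - (1 + x) * phi_ser ga x)
    - of_real b * of_real c * x * x * mu a ga * phi_ser ga x)"
    unfolding phi_term_telescope[OF g, symmetric]
    by (intro sums_diff sums_add sums_mult s1 s2 s3)
  show ?thesis using sums_unique2[OF 1 2] by (simp add: algebra_simps)
qed

lemma phi_ser_minus_1: "phi_ser ga (- 1) = 1"
proof -
  have "phi_ser ga (- 1) = (\<Sum>n\<in>{0}. phi_coef ga n * ebas (- 1) n)"
    unfolding phi_ser_def by (rule suminf_finite) (use ebas_zero[of 0] in auto)
  then show ?thesis by (simp add: phi_coef_def)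
qed

lemma bc_q_pos: "0 < 1 - b * c * q ^ k"
proof -
  have "b * c * q ^ k \<le> b * c * 1" using b_pos c_pos q_pos q_less_1 by (intro mult_left_mono power_le_one) auto
  then show ?thesis using bc_less_1 by simp
qed

lemma ab_q_pos: "0 < 1 - a * b * q ^ k"
proof -
  have "a * b * q ^ k \<le> a * b * 1" using b_pos a_pos q_pos q_less_1 by (intro mult_left_mono power_le_one) auto
  then show ?thesis using ab_less_1 by simp
qed

lemma ac_q_pos: "0 < 1 - a * c * q ^ k"
proof -
  have "a * c * q ^ k \<le> a * c * 1" using a_pos c_pos q_pos q_less_1 by (intro mult_left_mono power_le_one) auto
  then show ?thesis using ac_less_1 by simp
qed

text \<open>At - 1 the recurrence has lost its term at x / q, so its solutions on the points - q^k
  are determined by the value at - 1, which is 1 for both functions.\<close>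

lemma phi_ser_eq_psi_neg:
  assumes g: "c < norm ga" and im: "Im ga \<noteq> 0"
  shows "phi_ser ga (- (of_real q ^ k)) = psi ga (- (of_real q ^ k))"
proof (induction k rule: less_induct)
  case (less k)
  have g0: "ga \<noteq> 0" using im by auto
  show ?case
  proof (cases k)
    case 0 then show ?thesis using phi_ser_minus_1 psi_minus_1[OF g im] by simp
  next
    case (Suc j)
    define x where "x = - (complex_of_real q ^ j)"
    have qx: "of_real q * x = - (of_real q ^ k)" by (simp add: x_def Suc)
    have D: "qinf (- (of_real b * of_real c * x)) \<noteq> 0"
    proof -
      have "- (of_real b * of_real c * x) = of_real (b * c * q ^ j)" by (simp add: x_def)
      then show ?thesis using qpoch_inf_pos[of "b * c * q ^ j"] bc_q_pos[of j] by (simp only: qpoch_inf_of_real) simp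
    qed
    have nz: "(1 + of_real a * of_real b * x) * (1 + of_real a * of_real c * x) \<noteq> 0"
    proof -
      have "(1 + of_real a * of_real b * x) * (1 + of_real a * of_real c * x) = of_real ((1 - a * b * q ^ j) * (1 - a * c * q ^ j))"
        by (simp add: x_def)
      then show ?thesis using ab_q_pos[of j] ac_q_pos[of j] by (simp only: of_real_eq_0_iff) simp
    qed
    have cond: "x = - 1 \<or> of_real q + of_real b * of_real c * x \<noteq> 0"
    proof (cases j)
      case (Suc i)
      have "of_real q + of_real b * of_real c * x = of_real (q * (1 - b * c * q ^ i))"
        by (simp add: x_def Suc algebra_simps)
      then show ?thesis using bc_q_pos[of i] q_pos by (simp only: of_real_eq_0_iff) simp
    qed (simp add: x_def)
    have e0: "phi_ser ga x = psi ga x" using less[of j] Suc by (simp add: x_def)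
    have e1: "(1 + x) * phi_ser ga (x / of_real q) = (1 + x) * psi ga (x / of_real q)"
    proof (cases j)
      case (Suc i)
      have "x / of_real q = - (of_real q ^ i)" by (simp add: x_def Suc)
      then show ?thesis using less[of i] \<open>k = Suc j\<close> Suc by simp
    qed (simp add: x_def)
    have "(1 + of_real a * of_real b * x) * (1 + of_real a * of_real c * x) * phi_ser ga (of_real q * x)
       = (1 + of_real a * of_real b * x) * (1 + of_real a * of_real c * x) * psi ga (of_real q * x)"
      using phi_ser_eq[OF g0, of j] psi_eq[OF g D cond] e1 unfolding x_def[symmetric] e0 by algebra
    then show ?thesis using nz unfolding qx by simp
  qed
qed

lemma holomorphic_phi_ser:
  assumes "ga \<noteq> 0" shows "phi_ser ga holomorphic_on ball 0 (1 / (b * c))"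
proof -
  have bc: "0 < b * c" using b_pos c_pos by simp
  define R where "R = max (norm ga) (norm (1 / ga))"
  have "(\<lambda>x. \<Sum>n. phi_coef ga n * ebas x n) holomorphic_on ball 0 (1 / (b * c))"
  proof (rule holomorphic_suminf)
    show "(\<lambda>x. phi_coef ga k * ebas x k) holomorphic_on ball 0 (1 / (b * c))" for k
      unfolding ebas_def by (intro holomorphic_on_mult holomorphic_on_const holomorphic_on_prod
         holomorphic_on_add holomorphic_on_ident)
    fix x :: complex assume "x \<in> ball 0 (1 / (b * c))"
    then have x: "norm x < 1 / (b * c)" by simp
    define d where "d = (1 / (b * c) - norm x) / 2"
    have d: "0 < d" "norm x + d < 1 / (b * c)" using x by (simp_all add: d_def field_simps)
    define r where "r = norm x + d"
    have r: "0 < r" "r < 1 / (b * c)" using d norm_ge_zero[of x] by (auto simp: r_def intro: add_nonneg_pos)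
    then have br: "b * c * r < 1" using bc by (simp add: field_simps)
    have n: "norm y \<le> r" if "y \<in> cball x d" for y
      using that norm_triangle_ineq3[of y x] by (auto simp: r_def dist_norm norm_minus_commute)
    show "\<exists>d>0. \<exists>M. cball x d \<subseteq> ball 0 (1 / (b * c)) \<and> summable M \<and> (\<forall>y\<in>cball x d. \<forall>k. norm (phi_coef ga k * ebas y k) \<le> M k)"
    proof (intro exI conjI ballI allI)
      show "cball x d \<subseteq> ball 0 (1 / (b * c))" using n r by fastforce
      show "summable (\<lambda>n. phi_coef_bound R * qinf (- (1 / r)) * (b * c * r) ^ n)"
        using b_pos c_pos r br by (intro summable_mult summable_geometric) (auto simp: abs_mult)
      show "norm (phi_coef ga k * ebas y k) \<le> phi_coef_bound R * qinf (- (1 / r)) * (b * c * r) ^ k" if "y \<in> cball x d" for y k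
        by (intro phi_term_bound n that r) (simp_all add: R_def)
    qed (rule d)
  qed simp
  then show ?thesis by (simp add: phi_ser_def[abs_def])
qed

lemma qpoch_inf_bcx_nonzero:
  fixes x :: complex
  assumes "norm x < 1 / (b * c)" shows "qinf (- (of_real b * of_real c * x)) \<noteq> 0"
proof
  have bc: "0 < b * c" using b_pos c_pos by simp
  assume "qinf (- (of_real b * of_real c * x)) = 0"
  then obtain i where "- (of_real b * of_real c * x) * of_real q ^ i = 1" by (auto simp: qpoch_inf_eq_0_iff)
  then have "norm (- (of_real b * of_real c * x) * of_real q ^ i) = 1" by simp
  then have "b * c * norm x * q ^ i = 1" using b_pos c_pos q_pos by (simp add: norm_mult norm_power)
  moreover have "b * c * norm x * q ^ i \<le> b * c * norm x * 1"
    using bc q_pos q_less_1 by (intro mult_left_mono power_le_one) auto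
  moreover have "b * c * norm x < 1" using assms bc by (simp add: field_simps)
  ultimately show False by simp
qed

text \<open>Identity theorem: both functions are holomorphic in the disc and agree at the points -
  q^k, which accumulate at 0.\<close>

lemma phi_ser_eq_psi:
  assumes g: "c < norm ga" and im: "Im ga \<noteq> 0" and x: "norm x < 1 / (b * c)"
  shows "phi_ser ga x = psi ga x"
proof -
  have bc: "0 < b * c" using b_pos c_pos by simp
  have g0: "ga \<noteq> 0" using im by auto
  let ?S = "ball (0::complex) (1 / (b * c))"
  define U where "U = range (\<lambda>k::nat. - (complex_of_real q ^ k))"
  have lim: "(\<lambda>k. - (complex_of_real q ^ k)) \<longlonglongrightarrow> 0" using tendsto_minus[OF cq_power_LIMSEQ] by simp
  have "phi_ser ga x - psi ga x = 0"
  proof (rule analytic_continuation[where f = "\<lambda>x. phi_ser ga x - psi ga x" and S = "?S" and U = U and \<xi> = 0])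
    show "(\<lambda>x. phi_ser ga x - psi ga x) holomorphic_on ?S"
      unfolding psi_def using qpoch_inf_bcx_nonzero
      by (intro holomorphic_on_diff holomorphic_phi_ser g0 holomorphic_on_divide holomorphic_qpoch_inf'
           holomorphic_on_subset[OF holomorphic_psi_entire[OF g]] holomorphic_on_minus holomorphic_on_mult
           holomorphic_on_const holomorphic_on_ident) auto
    have "norm (- (complex_of_real q ^ k)) < 1 / (b * c)" for k
    proof -
      have "norm (- (complex_of_real q ^ k)) \<le> 1"
        unfolding norm_minus_cancel norm_power using q_pos q_less_1 by (intro power_le_one) auto
      also have "1 < 1 / (b * c)" using bc bc_less_1 by simp
      finally show ?thesis .
    qed
    then show "U \<subseteq> ?S" by (auto simp: U_def)
    show "0 \<in> ?S" using bc by simp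
    show "0 islimpt U" unfolding islimpt_sequential
      by (intro exI[of _ "\<lambda>k. - (complex_of_real q ^ k)"]) (use lim in \<open>auto simp: U_def\<close>)
    show "phi_ser ga y - psi ga y = 0" if "y \<in> U" for y
      using that phi_ser_eq_psi_neg[OF g im] by (auto simp: U_def)
  qed (use x in auto)
  then show ?thesis by simp
qed

lemma phi32_eq_phi_ser:
  fixes x :: real
  assumes "x \<noteq> 0"
  shows "phi32 q (of_real a * ga) (of_real a / ga) (of_real (- 1 / x)) (of_real (a * b)) (of_real (a * c)) (of_real (- (b * c * x)))
     = phi_ser ga (of_real x)"
proof -
  have e: "qpoch q (complex_of_real (- 1 / x)) n * of_real (- (b * c * x)) ^ n = (- (of_real b * of_real c)) ^ n * ebas (of_real x) n" for n
  proof (induction n)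
    case (Suc n)
    have "qpoch q (complex_of_real (- 1 / x)) (Suc n) * of_real (- (b * c * x)) ^ Suc n
        = (qpoch q (complex_of_real (- 1 / x)) n * of_real (- (b * c * x)) ^ n) * ((1 - of_real (- 1 / x) * of_real q ^ n) * of_real (- (b * c * x)))"
      by (simp add: qpoch_Suc)
    also have "(1 - complex_of_real (- 1 / x) * of_real q ^ n) * of_real (- (b * c * x)) = - (of_real b * of_real c) * (of_real x + of_real q ^ n)"
      using assms by (simp add: field_simps)
    finally show ?case unfolding Suc by (simp add: ebas_Suc)
  qed simp
  have l: "A * B * X / D * Y = A * B / D * Z * W" if "X * Y = Z * W" for A B X Y Z W D :: complex
    using that by (simp add: mult.assoc)
  show ?thesis
    unfolding phi32_def phi_ser_def phi_coef_def of_real_mult[of a b, symmetric] of_real_mult[of a c, symmetric]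
    by (intro suminf_cong l e)
qed

end

section \<open>Linear functionals given by measures\<close>

text \<open>Integration against a complex measure, encoded as a list of positive measures with
  complex densities. Polarization produces such lists, and subtracting a candidate density amounts
  to appending one more entry.\<close>

definition Lam :: "(real measure \<times> (real \<Rightarrow> complex)) list \<Rightarrow> (real \<Rightarrow> complex) \<Rightarrow> complex" where
  "Lam L \<psi> = (\<Sum>(M, w)\<leftarrow>L. \<integral>t. \<psi> t * w t \<partial>M)"

definition good_list :: "(real measure \<times> (real \<Rightarrow> complex)) list \<Rightarrow> bool" where
  "good_list L \<longleftrightarrow> (\<forall>(M, w)\<in>set L. sets M = sets borel \<and> integrable M w)"

lemma Lam_Nil [simp]: "Lam [] \<psi> = 0"
  and Lam_Cons [simp]: "Lam ((M, w) # L) \<psi> = (\<integral>t. \<psi> t * w t \<partial>M) + Lam L \<psi>"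
  by (simp_all add: Lam_def)

lemma Lam_append: "Lam (L @ L') \<psi> = Lam L \<psi> + Lam L' \<psi>"
  by (simp add: Lam_def)

lemma good_list_Nil [simp]: "good_list []"
  and good_list_Cons [simp]: "good_list ((M, w) # L) \<longleftrightarrow> sets M = sets borel \<and> integrable M w \<and> good_list L"
  and good_list_append [simp]: "good_list (L @ L') \<longleftrightarrow> good_list L \<and> good_list L'"
  by (auto simp: good_list_def)

lemma integrable_bounded_mult:
  fixes \<psi> w :: "real \<Rightarrow> complex"
  assumes "sets M = sets borel" "integrable M w" "\<psi> \<in> borel_measurable borel" "\<And>t. norm (\<psi> t) \<le> C"
  shows "integrable M (\<lambda>t. \<psi> t * w t)"
proof (rule Bochner_Integration.integrable_bound[where f = "\<lambda>t. of_real C * w t"])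
  show "integrable M (\<lambda>t. of_real C * w t)" using assms(2) by simp
  have "\<psi> \<in> borel_measurable M" using assms(1,3) by (simp cong: measurable_cong_sets)
  then show "(\<lambda>t. \<psi> t * w t) \<in> borel_measurable M"
    using assms(2) by (intro borel_measurable_times) auto
  show "AE t in M. norm (\<psi> t * w t) \<le> norm (of_real C * w t)"
  proof (rule AE_I2)
    fix t
    have "norm (\<psi> t) \<le> \<bar>C\<bar>" using assms(4)[of t] by linarith
    then show "norm (\<psi> t * w t) \<le> norm (of_real C * w t)" by (simp add: norm_mult mult_right_mono)
  qed
qed

lemma Lam_add:
  assumes "good_list L" "\<psi>1 \<in> borel_measurable borel" "\<And>t. norm (\<psi>1 t) \<le> C1"
    "\<psi>2 \<in> borel_measurable borel" "\<And>t. norm (\<psi>2 t) \<le> C2"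
  shows "Lam L (\<lambda>t. \<psi>1 t + \<psi>2 t) = Lam L \<psi>1 + Lam L \<psi>2"
  using assms(1)
proof (induction L)
  case (Cons p L)
  obtain M w where p: "p = (M, w)" by (cases p)
  have M: "sets M = sets borel" "integrable M w" "good_list L" using Cons.prems p by simp_all
  have "(\<integral>t. (\<psi>1 t + \<psi>2 t) * w t \<partial>M) = (\<integral>t. \<psi>1 t * w t \<partial>M) + (\<integral>t. \<psi>2 t * w t \<partial>M)"
    unfolding distrib_right
    by (intro Bochner_Integration.integral_add integrable_bounded_mult[OF M(1,2) assms(2,3)] integrable_bounded_mult[OF M(1,2) assms(4,5)])
  then show ?case using Cons.IH M(3) by (simp add: p)
qed simp

lemma Lam_cmult: "Lam L (\<lambda>t. k * \<psi> t) = k * Lam L \<psi>"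
proof (induction L)
  case (Cons p L)
  obtain M w where p: "p = (M, w)" by (cases p)
  show ?case using Cons by (simp add: p mult.assoc distrib_left)
qed simp

lemma Lam_LIMSEQ:
  assumes "good_list L" and m: "\<And>n. \<psi> n \<in> borel_measurable borel" and l: "\<psi>' \<in> borel_measurable borel"
    and b: "\<And>n t. norm (\<psi> n t) \<le> C" and lim: "\<And>t. (\<lambda>n. \<psi> n t) \<longlonglongrightarrow> \<psi>' t"
  shows "(\<lambda>n. Lam L (\<psi> n)) \<longlonglongrightarrow> Lam L \<psi>'"
  using assms(1)
proof (induction L)
  case (Cons p L)
  obtain M w where p: "p = (M, w)" by (cases p)
  have M: "sets M = sets borel" "integrable M w" "good_list L" using Cons.prems p by simp_all
  have C: "0 \<le> C" using b[of 0 0] norm_ge_zero[of "\<psi> 0 0"] by linarith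
  have wm: "w \<in> borel_measurable M" using M by auto
  have "(\<lambda>n. \<integral>t. \<psi> n t * w t \<partial>M) \<longlonglongrightarrow> (\<integral>t. \<psi>' t * w t \<partial>M)"
  proof (rule integral_dominated_convergence[where w = "\<lambda>t. C * norm (w t)"])
    show "(\<lambda>t. \<psi>' t * w t) \<in> borel_measurable M"
      using l M(1) wm by (intro borel_measurable_times) (simp_all cong: measurable_cong_sets)
    show "(\<lambda>t. \<psi> n t * w t) \<in> borel_measurable M" for n
      using m[of n] M(1) wm by (intro borel_measurable_times) (simp_all cong: measurable_cong_sets)
    show "integrable M (\<lambda>t. C * norm (w t))" using M by simp
    show "AE x in M. (\<lambda>i. \<psi> i x * w x) \<longlonglongrightarrow> \<psi>' x * w x"
      using lim by (intro AE_I2 tendsto_mult tendsto_const)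
    show "AE x in M. norm (\<psi> n x * w x) \<le> C * norm (w x)" for n
      using b[of n] by (intro AE_I2) (simp add: norm_mult mult_right_mono)
  qed
  then show ?case unfolding p Lam_Cons by (intro tendsto_add Cons.IH M)
qed simp

lemma Lam_sum:
  assumes "good_list L" "finite I" "\<And>i. i \<in> I \<Longrightarrow> \<psi> i \<in> borel_measurable borel" "\<And>i t. i \<in> I \<Longrightarrow> norm (\<psi> i t) \<le> C i"
  shows "Lam L (\<lambda>t. \<Sum>i\<in>I. \<psi> i t) = (\<Sum>i\<in>I. Lam L (\<psi> i))"
  using assms(2-)
proof (induction I rule: finite_induct)
  case empty
  have "Lam L (\<lambda>t. 0) = 0" using Lam_cmult[of L 0 "\<lambda>t. 0"] by simp
  then show ?case by simp
next
  case (insert i I)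
  have "Lam L (\<lambda>t. \<psi> i t + (\<Sum>i\<in>I. \<psi> i t)) = Lam L (\<psi> i) + Lam L (\<lambda>t. \<Sum>i\<in>I. \<psi> i t)"
  proof (rule Lam_add[OF assms(1)])
    show "\<psi> i \<in> borel_measurable borel" using insert by auto
    show "norm (\<psi> i t) \<le> C i" for t using insert by auto
    show "(\<lambda>t. \<Sum>i\<in>I. \<psi> i t) \<in> borel_measurable borel" using insert by (intro borel_measurable_sum) auto
    show "norm (\<Sum>i\<in>I. \<psi> i t) \<le> (\<Sum>i\<in>I. C i)" for t
      using insert by (intro order.trans[OF norm_sum] sum_mono) auto
  qed
  then show ?case using insert by simp
qed

lemma LIMSEQ_zero_unique: "X \<longlonglongrightarrow> l \<Longrightarrow> (\<And>n. X n = 0) \<Longrightarrow> l = (0 :: complex)"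
proof -
  assume X: "X \<longlonglongrightarrow> l" and z: "\<And>n. X n = 0"
  from z have "X = (\<lambda>n. 0)" by auto
  with X show "l = 0" by (simp add: LIMSEQ_const_iff)
qed

text \<open>Open intervals are an intersection-stable generator of the Borel sets. The whole line is
  a limit of intervals, which settles complements; disjoint unions follow from dominated
  convergence.\<close>

lemma Lam_zero_sets:
  assumes L: "good_list L" and int: "\<And>s t. s < t \<Longrightarrow> Lam L (indicator {s<..<t}) = 0" and S: "S \<in> sets borel"
  shows "Lam L (indicator S) = 0"
proof -
  let ?G = "range (\<lambda>(a, b). {a<..<b::real})"
  have b: "borel = sigma UNIV ?G"
  proof -
    have "(\<lambda>(a, b). box a b :: real set) = (\<lambda>(a, b). {a<..<b})" by (simp add: fun_eq_iff)
    then show ?thesis using borel_eq_box[where 'a = real] by simp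
  qed
  then have sb: "sets borel = sigma_sets UNIV ?G" by (metis sets_measure_of subset_UNIV Pow_UNIV)
  have univ: "Lam L (indicator UNIV) = 0"
  proof -
    have "(\<lambda>n. Lam L (indicator {- real (Suc n)<..<real (Suc n)})) \<longlonglongrightarrow> Lam L (indicator UNIV)"
    proof (rule Lam_LIMSEQ[OF L, where C = 1])
      fix t :: real
      obtain N where N: "\<bar>t\<bar> < real N" using reals_Archimedean2 by blast
      have "eventually (\<lambda>n. indicator {- real (Suc n)<..<real (Suc n)} t = (indicator UNIV t :: complex)) sequentially"
        using eventually_ge_at_top[of N]
      proof eventually_elim
        case (elim n)
        then have "real N \<le> real n" by simp
        then show ?case using N by (auto simp: indicator_def)
      qed
      then show "(\<lambda>n. indicator {- real (Suc n)<..<real (Suc n)} t :: complex) \<longlonglongrightarrow> indicator UNIV t"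
        by (rule tendsto_eventually)
    qed (auto simp: indicator_def)
    moreover have "Lam L (indicator {- real (Suc n)<..<real (Suc n)}) = 0" for n by (rule int) simp
    ultimately show ?thesis by (rule LIMSEQ_zero_unique)
  qed
  have "Int_stable ?G"
  proof (rule Int_stableI)
    fix x y assume "x \<in> ?G" "y \<in> ?G"
    then obtain p r where "x = {fst p<..<snd p}" "y = {fst r<..<snd r}" by (auto simp: split_def)
    then have "x \<inter> y = (\<lambda>(a, b). {a<..<b}) (max (fst p) (fst r), min (snd p) (snd r))"
      by (simp add: Int_greaterThanLessThan)
    then show "x \<inter> y \<in> ?G" by (rule range_eqI)
  qed
  moreover have "?G \<subseteq> Pow UNIV" by simp
  moreover have "S \<in> sigma_sets UNIV ?G" using S sb by simp
  ultimately show ?thesis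
  proof (induction rule: sigma_sets_induct_disjoint)
    case (basic A)
    then obtain a b where "A = {a<..<b}" by auto
    then show ?case using int[of a b] Lam_cmult[of L 0 "\<lambda>t. 0"] by (cases "a < b") (simp_all add: indicator_def[of "{}"])
  next
    case empty
    then show ?case using Lam_cmult[of L 0 "\<lambda>t. 0"] by (simp add: indicator_def)
  next
    case (compl A)
    have A: "A \<in> sets borel" using compl(1) sb by simp
    have "Lam L (\<lambda>t. indicator UNIV t + (- 1) * indicator A t) = Lam L (indicator UNIV) + Lam L (\<lambda>t. (- 1) * indicator A t)"
      using A by (intro Lam_add[OF L, where ?C1.0 = 1 and ?C2.0 = 1]) (auto simp: indicator_def)
    also have "(\<lambda>t. indicator UNIV t + (- 1) * indicator A t) = (indicator (UNIV - A) :: real \<Rightarrow> complex)"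
      by (auto simp: indicator_def fun_eq_iff)
    finally show ?case using univ compl(2) unfolding Lam_cmult by simp
  next
    case (union A)
    have A: "A i \<in> sets borel" for i using union(2) sb by auto
    have eq: "indicator (\<Union>i<n. A i) t = (\<Sum>i<n. indicator (A i) t :: complex)" for n t
      using union(1) by (intro indicator_UN_disjoint) (auto simp: disjoint_family_on_def)
    have "(\<lambda>n. Lam L (indicator (\<Union>i<n. A i))) \<longlonglongrightarrow> Lam L (indicator (\<Union>i. A i))"
    proof (rule Lam_LIMSEQ[OF L, where C = 1])
      show "(indicator (\<Union>i<n. A i) :: real \<Rightarrow> complex) \<in> borel_measurable borel" for n using A by auto
      show "(indicator (\<Union>i. A i) :: real \<Rightarrow> complex) \<in> borel_measurable borel" using A by auto
      show "(\<lambda>n. indicator (\<Union>i<n. A i) t :: complex) \<longlonglongrightarrow> indicator (\<Union>i. A i) t" for t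
        by (rule LIMSEQ_indicator_UN)
    qed (auto simp: indicator_def)
    moreover have "Lam L (indicator (\<Union>i<n. A i)) = 0" for n
    proof -
      have "Lam L (indicator (\<Union>i<n. A i)) = Lam L (\<lambda>t. \<Sum>i<n. indicator (A i) t)" by (rule arg_cong[of _ _ "Lam L"]) (rule ext, rule eq)
      also have "\<dots> = (\<Sum>i<n. Lam L (indicator (A i)))"
        using A by (intro Lam_sum[OF L, where C = "\<lambda>_. 1"]) (auto simp: indicator_def)
      finally show ?thesis using union(3) by simp
    qed
    ultimately show ?case by (rule LIMSEQ_zero_unique)
  qed
qed

text \<open>Boundedness is kept inside the conclusion because the induction passes through
  approximating functions, each of which inherits its bound from the limit.\<close>

lemma Lam_zero_real:
  assumes L: "good_list L" and sets: "\<And>S. S \<in> sets borel \<Longrightarrow> Lam L (indicator S) = 0"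
    and u: "u \<in> borel_measurable borel" "\<And>t. 0 \<le> u t"
  shows "(\<exists>C. \<forall>t. u t \<le> C) \<longrightarrow> Lam L (\<lambda>t. of_real (u t)) = 0"
  using u
proof (induction u rule: borel_measurable_induct_real)
  case (set A)
  have "(\<lambda>t. of_real (indicator A t)) = (indicator A :: real \<Rightarrow> complex)" by (auto simp: indicator_def)
  then show ?case using sets[of A] set by simp
next
  case (mult u k)
  show ?case
  proof (cases "k = 0")
    case True then show ?thesis using Lam_cmult[of L 0 "\<lambda>t. 0"] by simp
  next
    case False
    show ?thesis
    proof
      assume "\<exists>C. \<forall>t. k * u t \<le> C"
      then obtain C where "\<And>t. k * u t \<le> C" by blast
      then have "\<forall>t. u t \<le> C / k" using False mult by (simp add: pos_le_divide_eq mult.commute)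
      then show "Lam L (\<lambda>t. of_real (k * u t)) = 0" using mult Lam_cmult[of L "of_real k" "\<lambda>t. of_real (u t)"] by auto
    qed
  qed
next
  case (add u v)
  show ?case
  proof
    assume "\<exists>C. \<forall>t. v t + u t \<le> C"
    then obtain C where C: "\<And>t. v t + u t \<le> C" by blast
    have uC: "u t \<le> C" "v t \<le> C" for t using C[of t] add(2)[of t] add(4)[of t] by linarith+
    have "Lam L (\<lambda>t. of_real (v t) + of_real (u t)) = Lam L (\<lambda>t. of_real (v t)) + Lam L (\<lambda>t. of_real (u t))"
      using add uC by (intro Lam_add[OF L, where ?C1.0 = C and ?C2.0 = C]) auto
    moreover have "Lam L (\<lambda>t. of_real (v t)) = 0" "Lam L (\<lambda>t. of_real (u t)) = 0"
      using add uC by blast+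
    ultimately show "Lam L (\<lambda>t. of_real (v t + u t)) = 0" by simp
  qed
next
  case (seq U)
  show ?case
  proof
    assume "\<exists>C. \<forall>t. u t \<le> C"
    then obtain C where C: "\<And>t. u t \<le> C" by blast
    have UC: "U i t \<le> C" for i t
    proof -
      have "incseq (\<lambda>i. U i t)" using seq(3) by (auto simp: incseq_def le_fun_def)
      then have "U i t \<le> u t" using seq(4)[of t] by (intro incseq_le) auto
      then show ?thesis using C[of t] by linarith
    qed
    have "(\<lambda>i. Lam L (\<lambda>t. of_real (U i t))) \<longlonglongrightarrow> Lam L (\<lambda>t. of_real (u t))"
    proof (rule Lam_LIMSEQ[OF L, where C = C])
      show "(\<lambda>i. complex_of_real (U i t)) \<longlonglongrightarrow> of_real (u t)" for t
        using seq(4)[of t] by (intro tendsto_of_real) auto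
      show "(\<lambda>t. complex_of_real (u t)) \<in> borel_measurable borel" using u(1) by measurable
      show "(\<lambda>t. complex_of_real (U i t)) \<in> borel_measurable borel" for i using seq(1)[of i] by measurable
      show "cmod (complex_of_real (U i t)) \<le> C" for i t using UC[of i t] seq(2)[of i t] by simp
    qed
    moreover have "Lam L (\<lambda>t. of_real (U i t)) = 0" for i using seq(5)[of i] UC by blast
    ultimately show "Lam L (\<lambda>t. of_real (u t)) = 0" by (rule LIMSEQ_zero_unique)
  qed
qed

text \<open>The transfer principle of the proof: the axioms for E give identities on indicators,
  while the resolvent and the Poisson kernel are bounded measurable functions.\<close>

lemma Lam_zero:
  assumes L: "good_list L" and sets: "\<And>S. S \<in> sets borel \<Longrightarrow> Lam L (indicator S) = 0"
    and m: "\<psi> \<in> borel_measurable borel" and b: "\<And>t. norm (\<psi> t) \<le> C"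
  shows "Lam L \<psi> = 0"
proof -
  have C0: "0 \<le> C" using b[of 0] norm_ge_zero[of "\<psi> 0"] by linarith
  have real: "Lam L (\<lambda>t. of_real (u t)) = 0" if um: "u \<in> borel_measurable borel" and ub: "\<And>t. \<bar>u t\<bar> \<le> C" for u :: "real \<Rightarrow> real"
  proof -
    have bd: "u t \<le> C" "- u t \<le> C" for t using ub[of t] by linarith+
    have 1: "Lam L (\<lambda>t. of_real (max 0 (u t))) = 0"
      using bd C0 um by (intro mp[OF Lam_zero_real[OF L sets]]) (auto intro!: exI[of _ C])
    have 2: "Lam L (\<lambda>t. of_real (max 0 (- u t))) = 0"
      using bd C0 um by (intro mp[OF Lam_zero_real[OF L sets]]) (auto intro!: exI[of _ C])
    have "Lam L (\<lambda>t. of_real (max 0 (u t)) + (- 1) * of_real (max 0 (- u t)))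
        = Lam L (\<lambda>t. of_real (max 0 (u t))) + Lam L (\<lambda>t. (- 1) * of_real (max 0 (- u t)))"
      using bd C0 um by (intro Lam_add[OF L, where ?C1.0 = C and ?C2.0 = C]) auto
    also have "\<dots> = 0" unfolding Lam_cmult 1 2 by simp
    also have "(\<lambda>t. of_real (max 0 (u t)) + (- 1) * of_real (max 0 (- u t))) = (\<lambda>t. complex_of_real (u t))"
      by (auto simp: max_def fun_eq_iff)
    finally show ?thesis .
  qed
  have 1: "Lam L (\<lambda>t. of_real (Re (\<psi> t))) = 0"
    using m order.trans[OF abs_Re_le_cmod b] by (intro real) auto
  have 2: "Lam L (\<lambda>t. of_real (Im (\<psi> t))) = 0"
    using m order.trans[OF abs_Im_le_cmod b] by (intro real) auto
  have "Lam L (\<lambda>t. of_real (Re (\<psi> t)) + \<i> * of_real (Im (\<psi> t))) = Lam L (\<lambda>t. of_real (Re (\<psi> t))) + Lam L (\<lambda>t. \<i> * of_real (Im (\<psi> t)))"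
    using m order.trans[OF abs_Re_le_cmod b] order.trans[OF abs_Im_le_cmod b]
    by (intro Lam_add[OF L, where ?C1.0 = C and ?C2.0 = C]) (auto simp: norm_mult)
  also have "\<dots> = 0" unfolding Lam_cmult 1 2 by simp
  also have "(\<lambda>t. of_real (Re (\<psi> t)) + \<i> * of_real (Im (\<psi> t))) = \<psi>" by (simp add: complex_eq[symmetric])
  finally show ?thesis .
qed

section \<open>The Poisson kernel and its limit\<close>

lemma integral_poisson:
  fixes s t \<epsilon> \<tau> :: real
  assumes "s \<le> t" "0 < \<epsilon>"
  shows "(LINT x:{s..t}|lborel. \<epsilon> / ((\<tau> - x)^2 + \<epsilon>^2)) = arctan ((t - \<tau>) / \<epsilon>) - arctan ((s - \<tau>) / \<epsilon>)"
proof -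
  have pos: "(\<tau> - x)^2 + \<epsilon>^2 > 0" for x using assms(2) by (simp add: add_nonneg_pos)
  have "(\<integral>x. (\<epsilon> / ((\<tau> - x)^2 + \<epsilon>^2)) * indicator {s..t} x \<partial>lborel) = arctan ((t - \<tau>) / \<epsilon>) - arctan ((s - \<tau>) / \<epsilon>)"
  proof (rule integral_FTC_Icc_real[OF assms(1), of "\<lambda>x. arctan ((x - \<tau>) / \<epsilon>)"])
    fix x
    have "((\<lambda>x. arctan ((x - \<tau>) / \<epsilon>)) has_real_derivative (inverse (1 + ((x - \<tau>) / \<epsilon>)^2) * (1 / \<epsilon>))) (at x)"
    proof (rule DERIV_chain2[OF DERIV_arctan])
      have "((\<lambda>x. inverse \<epsilon> * (x - \<tau>)) has_real_derivative inverse \<epsilon> * (1 - 0)) (at x)"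
        by (intro DERIV_cmult DERIV_diff DERIV_ident DERIV_const)
      then show "((\<lambda>x. (x - \<tau>) / \<epsilon>) has_real_derivative 1 / \<epsilon>) (at x)"
        by (simp add: divide_inverse mult.commute)
    qed
    moreover have "inverse (1 + ((x - \<tau>) / \<epsilon>)^2) * (1 / \<epsilon>) = \<epsilon> / ((\<tau> - x)^2 + \<epsilon>^2)"
    proof -
      have "1 + ((x - \<tau>) / \<epsilon>)^2 = ((\<tau> - x)^2 + \<epsilon>^2) / \<epsilon>^2"
        using assms(2) by (simp add: power_divide add_divide_distrib power2_commute)
      then show ?thesis using assms(2) by (simp add: power2_eq_square)
    qed
    ultimately show "((\<lambda>x. arctan ((x - \<tau>) / \<epsilon>)) has_real_derivative (\<epsilon> / ((\<tau> - x)^2 + \<epsilon>^2))) (at x)" by simp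
    show "isCont (\<lambda>x. \<epsilon> / ((\<tau> - x)^2 + \<epsilon>^2)) x" using pos[of x] by (intro continuous_intros) auto
  qed
  then show ?thesis by (simp add: set_lebesgue_integral_def mult.commute)
qed

lemma arctan_scaled_LIMSEQ:
  "(\<lambda>n. arctan (y / (1 / real (Suc n)))) \<longlonglongrightarrow> (if 0 < y then pi / 2 else if y < 0 then - (pi / 2) else 0)"
proof -
  have top: "filterlim (\<lambda>n. real (Suc n)) at_top sequentially"
    by (intro filterlim_compose[OF filterlim_real_sequentially filterlim_Suc])
  consider "0 < y" | "y < 0" | "y = 0" by linarith
  then show ?thesis
  proof cases
    case 1
    then have "filterlim (\<lambda>n. y * real (Suc n)) at_top sequentially"
      by (intro filterlim_tendsto_pos_mult_at_top[OF tendsto_const _ top])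
    then have "(\<lambda>n. arctan (y * real (Suc n))) \<longlonglongrightarrow> pi / 2"
      by (rule filterlim_compose[OF tendsto_arctan_at_top])
    then show ?thesis using 1 by simp
  next
    case 2
    then have "filterlim (\<lambda>n. y * real (Suc n)) at_bot sequentially"
      by (intro filterlim_tendsto_neg_mult_at_bot[OF tendsto_const _ top])
    then have "(\<lambda>n. arctan (y * real (Suc n))) \<longlonglongrightarrow> - (pi / 2)"
      by (rule filterlim_compose[OF tendsto_arctan_at_bot])
    then show ?thesis using 2 by simp
  qed simp
qed

text \<open>Half of the mass of each end point of the interval survives in the limit.\<close>

lemma poisson_limit:
  fixes M :: "real measure"
  assumes "finite_measure M" and M: "sets M = sets borel" and st: "s < t"
  shows "(\<lambda>n. LINT x:{s..t}|lborel. (\<integral>\<tau>. (1 / real (Suc n)) / ((\<tau> - x)^2 + (1 / real (Suc n))^2) \<partial>M))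
    \<longlonglongrightarrow> (\<integral>\<tau>. pi / 2 * (indicator {s..t} \<tau> + indicator {s<..<t} \<tau>) \<partial>M)"
proof -
  interpret M: finite_measure M by fact
  interpret P: pair_sigma_finite M lborel ..
  have mM [measurable_cong]: "sets M = sets borel" by fact
  have eq: "(LINT x:{s..t}|lborel. (\<integral>\<tau>. \<epsilon> / ((\<tau> - x)^2 + \<epsilon>^2) \<partial>M)) = (\<integral>\<tau>. arctan ((t - \<tau>) / \<epsilon>) - arctan ((s - \<tau>) / \<epsilon>) \<partial>M)"
    if e: "0 < \<epsilon>" for \<epsilon>
  proof -
    have int: "integrable (M \<Otimes>\<^sub>M lborel) (\<lambda>(\<tau>, x). indicator {s..t} x * (\<epsilon> / ((\<tau> - x)^2 + \<epsilon>^2)))"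
    proof (rule Bochner_Integration.integrable_bound[where f = "\<lambda>p. indicator (UNIV \<times> {s..t}) p *\<^sub>R (1 / \<epsilon>)"])
      have "emeasure (M \<Otimes>\<^sub>M lborel) (UNIV \<times> {s..t}) = emeasure M UNIV * emeasure lborel {s..t}"
        using M by (intro lborel.emeasure_pair_measure_Times) auto
      also have "\<dots> < \<infinity>" using M.emeasure_finite[of UNIV] st by (auto simp: less_top[symmetric] ennreal_mult_eq_top_iff)
      finally show "integrable (M \<Otimes>\<^sub>M lborel) (\<lambda>p. indicator (UNIV \<times> {s..t}) p *\<^sub>R (1 / \<epsilon>))"
        using M by (intro integrable_scaleR_left integrable_real_indicator) auto
      show "AE p in M \<Otimes>\<^sub>M lborel. norm (case p of (\<tau>, x) \<Rightarrow> indicator {s..t} x * (\<epsilon> / ((\<tau> - x)^2 + \<epsilon>^2)))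
            \<le> norm (indicator (UNIV \<times> {s..t}) p *\<^sub>R (1 / \<epsilon>))"
      proof (rule AE_I2)
        fix p :: "real \<times> real"
        obtain \<tau> x where p: "p = (\<tau>, x)" by (cases p)
        have "\<epsilon> * \<epsilon> \<le> (\<tau> - x)^2 + \<epsilon>^2" by (simp add: power2_eq_square)
        moreover have "(\<tau> - x)^2 + \<epsilon>^2 > 0" using e by (simp add: add_nonneg_pos)
        ultimately have "\<epsilon> / ((\<tau> - x)^2 + \<epsilon>^2) \<le> 1 / \<epsilon>" using e by (simp add: field_simps)
        then show "norm (case p of (\<tau>, x) \<Rightarrow> indicator {s..t} x * (\<epsilon> / ((\<tau> - x)^2 + \<epsilon>^2)))
            \<le> norm (indicator (UNIV \<times> {s..t}) p *\<^sub>R (1 / \<epsilon>))"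
          using e by (simp add: p indicator_def)
      qed
      show "(\<lambda>(\<tau>, x). indicator {s..t} x * (\<epsilon> / ((\<tau> - x)^2 + \<epsilon>^2))) \<in> borel_measurable (M \<Otimes>\<^sub>M lborel)"
        by measurable
    qed
    have "(LINT x:{s..t}|lborel. (\<integral>\<tau>. \<epsilon> / ((\<tau> - x)^2 + \<epsilon>^2) \<partial>M)) = (\<integral>x. (\<integral>\<tau>. indicator {s..t} x * (\<epsilon> / ((\<tau> - x)^2 + \<epsilon>^2)) \<partial>M) \<partial>lborel)"
      unfolding set_lebesgue_integral_def by (simp only: integral_mult_right_zero real_scaleR_def)
    also have "\<dots> = (\<integral>\<tau>. (\<integral>x. indicator {s..t} x * (\<epsilon> / ((\<tau> - x)^2 + \<epsilon>^2)) \<partial>lborel) \<partial>M)"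
      by (rule P.Fubini_integral[OF int])
    also have "\<dots> = (\<integral>\<tau>. arctan ((t - \<tau>) / \<epsilon>) - arctan ((s - \<tau>) / \<epsilon>) \<partial>M)"
    proof (intro Bochner_Integration.integral_cong refl)
      fix \<tau>
      show "(\<integral>x. indicator {s..t} x * (\<epsilon> / ((\<tau> - x)^2 + \<epsilon>^2)) \<partial>lborel) = arctan ((t - \<tau>) / \<epsilon>) - arctan ((s - \<tau>) / \<epsilon>)"
        using integral_poisson[of s t \<epsilon> \<tau>] st e by (simp add: set_lebesgue_integral_def)
    qed
    finally show ?thesis .
  qed
  have arctan_bound: "\<bar>arctan y\<bar> \<le> pi" for y
    using arctan_bounded[of y] pi_gt_zero by (simp add: abs_le_iff)
  have "(\<lambda>n. \<integral>\<tau>. arctan ((t - \<tau>) / (1 / real (Suc n))) - arctan ((s - \<tau>) / (1 / real (Suc n))) \<partial>M)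
     \<longlonglongrightarrow> (\<integral>\<tau>. pi / 2 * (indicator {s..t} \<tau> + indicator {s<..<t} \<tau>) \<partial>M)"
  proof (rule integral_dominated_convergence[where w = "\<lambda>_. 2 * pi"])
    show "AE \<tau> in M. (\<lambda>n. arctan ((t - \<tau>) / (1 / real (Suc n))) - arctan ((s - \<tau>) / (1 / real (Suc n))))
        \<longlonglongrightarrow> pi / 2 * (indicator {s..t} \<tau> + indicator {s<..<t} \<tau>)"
    proof (rule AE_I2)
      fix \<tau>
      have "(\<lambda>n. arctan ((t - \<tau>) / (1 / real (Suc n))) - arctan ((s - \<tau>) / (1 / real (Suc n))))
        \<longlonglongrightarrow> (if 0 < t - \<tau> then pi / 2 else if t - \<tau> < 0 then - (pi / 2) else 0) - (if 0 < s - \<tau> then pi / 2 else if s - \<tau> < 0 then - (pi / 2) else 0)"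
        by (intro tendsto_diff arctan_scaled_LIMSEQ)
      also have "(if 0 < t - \<tau> then pi / 2 else if t - \<tau> < 0 then - (pi / 2) else 0) - (if 0 < s - \<tau> then pi / 2 else if s - \<tau> < 0 then - (pi / 2) else 0)
        = pi / 2 * (indicator {s..t} \<tau> + indicator {s<..<t} \<tau>)"
        using st by (auto simp: indicator_def)
      finally show "(\<lambda>n. arctan ((t - \<tau>) / (1 / real (Suc n))) - arctan ((s - \<tau>) / (1 / real (Suc n))))
        \<longlonglongrightarrow> pi / 2 * (indicator {s..t} \<tau> + indicator {s<..<t} \<tau>)" .
    qed
    show "AE \<tau> in M. norm (arctan ((t - \<tau>) / (1 / real (Suc n))) - arctan ((s - \<tau>) / (1 / real (Suc n)))) \<le> 2 * pi" for n
      using arctan_bound by (intro AE_I2) (smt (verit) real_norm_def)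
    show "integrable M (\<lambda>_. 2 * pi)" by simp
    show "(\<lambda>\<tau>. pi / 2 * (indicator {s..t} \<tau> + indicator {s<..<t} \<tau>)) \<in> borel_measurable M" by measurable
    fix n
    have "(\<lambda>\<tau>. arctan ((t - \<tau>) / (1 / real (Suc n))) - arctan ((s - \<tau>) / (1 / real (Suc n)))) \<in> borel_measurable borel"
      by (intro borel_measurable_continuous_onI continuous_intros) auto
    then show "(\<lambda>\<tau>. arctan ((t - \<tau>) / (1 / real (Suc n))) - arctan ((s - \<tau>) / (1 / real (Suc n)))) \<in> borel_measurable M"
      by (simp cong: measurable_cong_sets)
  qed
  moreover have "(LINT x:{s..t}|lborel. (\<integral>\<tau>. (1 / real (Suc n)) / ((\<tau> - x)^2 + (1 / real (Suc n))^2) \<partial>M))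
     = (\<integral>\<tau>. arctan ((t - \<tau>) / (1 / real (Suc n))) - arctan ((s - \<tau>) / (1 / real (Suc n))) \<partial>M)" for n
    by (rule eq) simp
  ultimately show ?thesis by simp
qed

section \<open>Spectral measures and resolvents\<close>

definition comb :: "complex \<Rightarrow> ('a \<Rightarrow> complex) \<Rightarrow> ('a \<Rightarrow> complex) \<Rightarrow> 'a \<Rightarrow> complex" where
  "comb \<alpha> f g = (\<lambda>x. f x + \<alpha> * g x)"

text \<open>The four units single out the coefficient of \<open>cnj \<alpha>\<close>, because the
  other three terms cancel in the weighted sum.\<close>

lemma polarization:
  fixes Q :: "complex \<Rightarrow> complex"
  assumes "\<And>\<alpha>. Q \<alpha> = x + cnj \<alpha> * y + \<alpha> * w + \<alpha> * cnj \<alpha> * r"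
  shows "1 / 4 * Q 1 + (- (1 / 4) * Q (- 1) + (\<i> / 4 * Q \<i> + (- (\<i> / 4)) * Q (- \<i>))) = y"
proof -
  \<comment> \<open>Replacing the imaginary unit and 1/4 by variables with polynomial relations
    turns the claim into an ideal membership that \<open>algebra\<close> decides.\<close>
  have alg: "k * (x + y + w + r) + (- k * (x - y - w + r) + (j * k * (x - j * y + j * w + r) + (- (j * k)) * (x + j * y - j * w + r))) = y"
    if "j * j = - 1" "4 * k = 1" for j k :: complex
    using that by algebra
  have Q: "Q 1 = x + y + w + r" "Q (- 1) = x - y - w + r" "Q \<i> = x - \<i> * y + \<i> * w + r" "Q (- \<i>) = x + \<i> * y - \<i> * w + r"
    by (simp_all add: assms)
  have i: "\<i> / 4 = \<i> * (1 / 4)" by simp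
  show ?thesis unfolding Q i by (rule alg) simp_all
qed

lemma set_integral_add4:
  fixes F1 F2 F3 F4 :: "real \<Rightarrow> complex"
  assumes "set_integrable M A F1" "set_integrable M A F2" "set_integrable M A F3" "set_integrable M A F4"
  shows "(LINT x:A|M. F1 x + (F2 x + (F3 x + F4 x))) = (LINT x:A|M. F1 x) + ((LINT x:A|M. F2 x) + ((LINT x:A|M. F3 x) + (LINT x:A|M. F4 x)))"
proof -
  note i34 = set_integral_add[OF assms(3,4)]
  note i234 = set_integral_add[OF assms(2) i34(1)]
  show ?thesis using set_integral_add(2)[OF assms(1) i234(1)] i234(2) i34(2) by simp
qed

locale spectral_setup =
  fixes H :: "('a \<Rightarrow> complex) set" and inn T D E
  assumes H_lin: "\<And>f g \<alpha> \<beta>. f \<in> H \<Longrightarrow> g \<in> H \<Longrightarrow> (\<lambda>x. \<alpha> * f x + \<beta> * g x) \<in> H"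
    and inn_lin: "\<And>f g h \<alpha> \<beta>. f \<in> H \<Longrightarrow> g \<in> H \<Longrightarrow> h \<in> H \<Longrightarrow> inn (\<lambda>x. \<alpha> * f x + \<beta> * g x) h = \<alpha> * inn f h + \<beta> * inn g h"
    and inn_sym: "\<And>f g. f \<in> H \<Longrightarrow> g \<in> H \<Longrightarrow> inn f g = cnj (inn g f)"
    and inn_pos: "\<And>f. f \<in> H \<Longrightarrow> 0 \<le> Re (inn f f)"
    and D_lin: "\<And>f g \<alpha> \<beta>. f \<in> D \<Longrightarrow> g \<in> D \<Longrightarrow> (\<lambda>x. \<alpha> * f x + \<beta> * g x) \<in> D"
    and T_lin: "\<And>f g \<alpha> \<beta>. f \<in> D \<Longrightarrow> g \<in> D \<Longrightarrow> T (\<lambda>x. \<alpha> * f x + \<beta> * g x) = (\<lambda>x. \<alpha> * T f x + \<beta> * T g x)"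
    and T_H: "\<And>f. f \<in> D \<Longrightarrow> T f \<in> H"
    and spec: "is_spectral_measure_of H inn T D E"
begin

lemma resolution: "resolution_of_identity H inn E"
  using spec by (simp add: is_spectral_measure_of_def)

lemma D_H: "f \<in> D \<Longrightarrow> f \<in> H"
  using spec unfolding is_spectral_measure_of_def by blast

lemma D_iff: "f \<in> D \<longleftrightarrow> f \<in> H \<and> (\<integral>\<^sup>+ t. ennreal (t^2) \<partial>spectral_meas inn E f) < \<infinity>"
  using spec unfolding is_spectral_measure_of_def by blast

lemma quadratic_form: "f \<in> D \<Longrightarrow> inn (T f) f = of_real (\<integral>t. t \<partial>spectral_meas inn E f)"
  using spec unfolding is_spectral_measure_of_def by blast

lemma E_proj: "S \<in> sets borel \<Longrightarrow> orthogonal_projection_on H inn (E S)"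
  using resolution unfolding resolution_of_identity_def by blast

lemma E_H: "S \<in> sets borel \<Longrightarrow> f \<in> H \<Longrightarrow> E S f \<in> H"
  using E_proj[of S] unfolding orthogonal_projection_on_def by blast

lemma E_lin: "S \<in> sets borel \<Longrightarrow> f \<in> H \<Longrightarrow> g \<in> H \<Longrightarrow> E S (\<lambda>x. \<alpha> * f x + \<beta> * g x) = (\<lambda>x. \<alpha> * E S f x + \<beta> * E S g x)"
  using E_proj[of S] unfolding orthogonal_projection_on_def by blast

lemma E_adj: "S \<in> sets borel \<Longrightarrow> f \<in> H \<Longrightarrow> g \<in> H \<Longrightarrow> inn (E S f) g = inn f (E S g)"
  using E_proj[of S] unfolding orthogonal_projection_on_def by blast

lemma E_Int: "S \<in> sets borel \<Longrightarrow> S' \<in> sets borel \<Longrightarrow> f \<in> H \<Longrightarrow> E S (E S' f) = E (S \<inter> S') f"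
  using resolution unfolding resolution_of_identity_def by metis

lemma E_empty: "f \<in> H \<Longrightarrow> E {} f = (\<lambda>x. 0)"
  using resolution unfolding resolution_of_identity_def by blast

lemma E_UNIV: "f \<in> H \<Longrightarrow> E UNIV f = f"
  using resolution unfolding resolution_of_identity_def by blast

lemma E_sums: "range S \<subseteq> sets borel \<Longrightarrow> disjoint_family S \<Longrightarrow> f \<in> H \<Longrightarrow> g \<in> H \<Longrightarrow>
    (\<lambda>n. inn (E (S n) f) g) sums inn (E (\<Union>n. S n) f) g"
  using resolution unfolding resolution_of_identity_def by blast

lemma comb_eq: "comb \<alpha> f g = (\<lambda>x. 1 * f x + \<alpha> * g x)" by (simp add: comb_def)

lemma comb_H: "f \<in> H \<Longrightarrow> g \<in> H \<Longrightarrow> comb \<alpha> f g \<in> H"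
  unfolding comb_eq by (rule H_lin)

lemma comb_D: "f \<in> D \<Longrightarrow> g \<in> D \<Longrightarrow> comb \<alpha> f g \<in> D"
  unfolding comb_eq by (rule D_lin)

lemma inn_lin2:
  assumes "f \<in> H" "g \<in> H" "h \<in> H"
  shows "inn h (\<lambda>x. \<alpha> * f x + \<beta> * g x) = cnj \<alpha> * inn h f + cnj \<beta> * inn h g"
proof -
  have "inn h (\<lambda>x. \<alpha> * f x + \<beta> * g x) = cnj (inn (\<lambda>x. \<alpha> * f x + \<beta> * g x) h)"
    by (rule inn_sym) (use assms H_lin in auto)
  also have "\<dots> = cnj \<alpha> * cnj (inn f h) + cnj \<beta> * cnj (inn g h)" using assms by (simp add: inn_lin)
  also have "\<dots> = cnj \<alpha> * inn h f + cnj \<beta> * inn h g"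
    using inn_sym[OF assms(3,1)] inn_sym[OF assms(3,2)] by simp
  finally show ?thesis .
qed

lemma inn_expand:
  assumes "F \<in> H" "G \<in> H" "f \<in> H" "g \<in> H"
  shows "inn (\<lambda>x. 1 * F x + \<alpha> * G x) (\<lambda>x. 1 * f x + \<alpha> * g x)
     = inn F f + cnj \<alpha> * inn F g + \<alpha> * inn G f + \<alpha> * cnj \<alpha> * inn G g"
  unfolding inn_lin[OF assms(1,2) H_lin[OF assms(3,4)]] inn_lin2[OF assms(3,4) assms(1)] inn_lin2[OF assms(3,4) assms(2)]
  by (simp add: algebra_simps)

lemma E_inn_eq: "S \<in> sets borel \<Longrightarrow> f \<in> H \<Longrightarrow> inn (E S f) f = inn (E S f) (E S f)"
  using E_adj[of S "E S f" f] E_Int[of S S f] E_H[of S f] by simp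

lemma E_inn_nonneg: "S \<in> sets borel \<Longrightarrow> f \<in> H \<Longrightarrow> 0 \<le> Re (inn (E S f) f)"
  using E_inn_eq[of S f] inn_pos[OF E_H[of S f]] by simp

lemma E_inn_real: "S \<in> sets borel \<Longrightarrow> f \<in> H \<Longrightarrow> inn (E S f) f = of_real (Re (inn (E S f) f))"
proof -
  assume S: "S \<in> sets borel" and f: "f \<in> H"
  have "inn (E S f) f = cnj (inn (E S f) f)"
    unfolding E_inn_eq[OF S f] using inn_sym[OF E_H[OF S f] E_H[OF S f]] .
  then have "Im (inn (E S f) f) = Im (cnj (inn (E S f) f))" by (rule arg_cong)
  then show ?thesis by (simp add: complex_eq_iff)
qed

abbreviation nu :: "('a \<Rightarrow> complex) \<Rightarrow> real measure" where "nu f \<equiv> spectral_meas inn E f"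

lemma sets_nu [simp, measurable_cong]: "sets (nu f) = sets borel"
proof -
  have "sigma_sets UNIV (sets (borel :: real measure)) = sets borel"
    using sets.sigma_sets_eq[of "borel :: real measure"] by simp
  then show ?thesis unfolding spectral_meas_def by (simp add: sets_measure_of)
qed

lemma space_nu [simp]: "space (nu f) = UNIV"
  by (simp add: spectral_meas_def space_measure_of)

lemma emeasure_nu:
  assumes f: "f \<in> H" and S: "S \<in> sets borel"
  shows "emeasure (nu f) S = ennreal (Re (inn (E S f) f))"
proof -
  have E0: "Re (inn (E {} f) f) = 0"
  proof -
    have "inn (\<lambda>x. 0) f = 0" using inn_lin[OF f f f, of 0 0] by simp
    then show ?thesis using E_empty[OF f] by simp
  qed
  show ?thesis
  proof (rule emeasure_measure_of[OF spectral_meas_def])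
    show "positive (sets (nu f)) (\<lambda>S. ennreal (Re (inn (E S f) f)))"
      using E0 by (simp add: positive_def)
    show "countably_additive (sets (nu f)) (\<lambda>S. ennreal (Re (inn (E S f) f)))"
    proof (rule countably_additiveI)
      fix A :: "nat \<Rightarrow> real set"
      assume A: "range A \<subseteq> sets (nu f)" "disjoint_family A"
      then have Ab: "range A \<subseteq> sets borel" by simp
      have sm: "(\<lambda>n. Re (inn (E (A n) f) f)) sums Re (inn (E (\<Union>n. A n) f) f)"
        by (rule sums_Re[OF E_sums[OF Ab A(2) f f]])
      have nn: "0 \<le> Re (inn (E (A n) f) f)" for n using Ab f by (intro E_inn_nonneg) auto
      show "(\<Sum>i. ennreal (Re (inn (E (A i) f) f))) = ennreal (Re (inn (E (\<Union> (range A)) f) f))"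
        using suminf_ennreal_eq[OF nn sm] by simp
    qed
  qed (use S in auto)
qed

lemma finite_nu: "f \<in> H \<Longrightarrow> finite_measure (nu f)"
  by (intro finite_measureI) (simp add: emeasure_nu)

lemma measure_nu: "f \<in> H \<Longrightarrow> S \<in> sets borel \<Longrightarrow> measure (nu f) S = Re (inn (E S f) f)"
  by (simp add: measure_def emeasure_nu E_inn_nonneg)

text \<open>The projections commute and multiply like intersections, so projecting with
  \<open>E S\<close> restricts the spectral measure to \<open>S\<close>.\<close>

lemma nu_E:
  assumes f: "f \<in> H" and S: "S \<in> sets borel"
  shows "nu (E S f) = density (nu f) (indicator S)"
proof (rule measure_eqI)
  fix X assume "X \<in> sets (nu (E S f))"
  then have X: "X \<in> sets borel" by simp
  have "inn (E X (E S f)) (E S f) = inn (E S (E X (E S f))) f"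
    using E_adj[OF S E_H[OF X E_H[OF S f]] f] by simp
  also have "E S (E X (E S f)) = E (S \<inter> X) f"
    using E_Int S X f E_H by (simp add: Int_ac)
  finally have "emeasure (nu (E S f)) X = emeasure (nu f) (S \<inter> X)"
    using f S X E_H by (simp add: emeasure_nu)
  also have "\<dots> = (\<integral>\<^sup>+ x. indicator S x * indicator X x \<partial>nu f)"
    using S X by (subst indicator_inter_arith[symmetric]) simp
  also have "\<dots> = emeasure (density (nu f) (indicator S)) X"
    using S X by (subst emeasure_density) auto
  finally show "emeasure (nu (E S f)) X = emeasure (density (nu f) (indicator S)) X" .
qed simp

lemma integral_nu_E:
  fixes F :: "real \<Rightarrow> complex"
  assumes f: "f \<in> H" and S: "S \<in> sets borel" and F: "F \<in> borel_measurable borel"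
  shows "(\<integral>t. F t \<partial>nu (E S f)) = (\<integral>t. indicator S t * F t \<partial>nu f)"
proof -
  have "(\<integral>t. F t \<partial>density (nu f) (\<lambda>t. ennreal (indicator S t))) = (\<integral>t. indicator S t *\<^sub>R F t \<partial>nu f)"
    using S F by (intro integral_density) (auto cong: measurable_cong_sets)
  moreover have "(\<lambda>t. ennreal (indicator S t)) = indicator S" by (auto simp: indicator_def)
  moreover have "indicator S t *\<^sub>R F t = indicator S t * F t" for t by (simp add: indicator_def)
  ultimately show ?thesis using nu_E[OF f S] by simp
qed

lemma E_D:
  assumes f: "f \<in> D" and S: "S \<in> sets borel"
  shows "E S f \<in> D"
proof -
  have fH: "f \<in> H" by (rule D_H[OF f])
  have "(\<integral>\<^sup>+ t. ennreal (t^2) \<partial>nu (E S f)) = (\<integral>\<^sup>+ t. indicator S t * ennreal (t^2) \<partial>nu f)"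
    unfolding nu_E[OF fH S] using S by (intro nn_integral_density) auto
  also have "\<dots> \<le> (\<integral>\<^sup>+ t. ennreal (t^2) \<partial>nu f)"
    by (intro nn_integral_mono) (auto simp: indicator_def)
  also have "\<dots> < \<infinity>" using f D_iff by blast
  finally show ?thesis using D_iff E_H[OF S fH] by blast
qed

lemma integrable_t:
  assumes "f \<in> D" shows "integrable (nu f) (\<lambda>t. complex_of_real t)"
proof -
  interpret finite_measure "nu f" by (rule finite_nu[OF D_H[OF assms]])
  have "integrable (nu f) (\<lambda>t. t^2)"
  proof (rule integrableI_nonneg)
    show "(\<integral>\<^sup>+ t. ennreal (t^2) \<partial>nu f) < \<infinity>" using assms D_iff by blast
  qed auto
  then have "integrable (nu f) (\<lambda>t. 1 + t^2)" by simp
  then show ?thesis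
  proof (rule Bochner_Integration.integrable_bound)
    have "\<bar>t\<bar> \<le> 1 + t^2" for t :: real
      using zero_le_power2[of "\<bar>t\<bar> - 1"] by (simp add: power2_eq_square algebra_simps)
    then show "AE t in nu f. norm (complex_of_real t) \<le> norm (1 + t^2)" by (auto intro!: AE_I2)
    show "(\<lambda>t. complex_of_real t) \<in> borel_measurable (nu f)" by simp
  qed
qed

lemma integrable_const_nu: "f \<in> H \<Longrightarrow> integrable (nu f) (\<lambda>t. k :: complex)"
  using finite_measure.integrable_const[OF finite_nu] by blast

text \<open>For weight 1 this is the complex measure S -> <E(S) f, g>, assembled from the positive
  measures of f + \<alpha> g with \<alpha> = 1, - 1, i, - i; a weight w multiplies it by the density
  w.\<close>

definition polL :: "('a \<Rightarrow> complex) \<Rightarrow> ('a \<Rightarrow> complex) \<Rightarrow> (real \<Rightarrow> complex) \<Rightarrow> (real measure \<times> (real \<Rightarrow> complex)) list" where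
  "polL f g w = [(nu (comb 1 f g), \<lambda>t. 1 / 4 * w t), (nu (comb (- 1) f g), \<lambda>t. - (1 / 4) * w t),
     (nu (comb \<i> f g), \<lambda>t. \<i> / 4 * w t), (nu (comb (- \<i>) f g), \<lambda>t. - (\<i> / 4) * w t)]"

lemma Lam_polL:
  "Lam (polL f g w) \<psi> = 1 / 4 * (\<integral>t. \<psi> t * w t \<partial>nu (comb 1 f g)) + (- (1 / 4) * (\<integral>t. \<psi> t * w t \<partial>nu (comb (- 1) f g))
     + (\<i> / 4 * (\<integral>t. \<psi> t * w t \<partial>nu (comb \<i> f g)) + (- (\<i> / 4)) * (\<integral>t. \<psi> t * w t \<partial>nu (comb (- \<i>) f g))))"
proof -
  have "(\<integral>t. \<psi> t * (k * w t) \<partial>M) = k * (\<integral>t. \<psi> t * w t \<partial>M)" for M :: "real measure" and k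
    by (simp add: mult.left_commute)
  then show ?thesis by (simp only: polL_def Lam_Cons Lam_Nil add_0_right)
qed

lemma good_polL_const: "f \<in> H \<Longrightarrow> g \<in> H \<Longrightarrow> good_list (polL f g (\<lambda>_. k))"
  unfolding polL_def using integrable_const_nu comb_H by simp

lemma good_polL_affine: "f \<in> D \<Longrightarrow> g \<in> D \<Longrightarrow> good_list (polL f g (\<lambda>t. k * of_real t + l))"
  unfolding polL_def using integrable_t comb_D integrable_const_nu[OF D_H]
  by (simp add: D_H)

lemma Lam_polL_indicator:
  assumes f: "f \<in> H" and g: "g \<in> H" and S: "S \<in> sets borel"
  shows "Lam (polL f g (\<lambda>_. 1)) (indicator S) = inn (E S f) g"
proof -
  have I: "(\<integral>t. indicator S t * 1 \<partial>nu (comb \<alpha> f g)) = inn (E S (comb \<alpha> f g)) (comb \<alpha> f g)" for \<alpha>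
  proof -
    have h: "comb \<alpha> f g \<in> H" using f g by (rule comb_H)
    have "(\<integral>t. indicator S t * 1 \<partial>nu (comb \<alpha> f g)) = complex_of_real (measure (nu (comb \<alpha> f g)) S)"
    proof -
      have "(\<integral>t. indicator S t * 1 \<partial>nu (comb \<alpha> f g)) = (\<integral>t. complex_of_real (indicator S t) \<partial>nu (comb \<alpha> f g))"
        by (intro Bochner_Integration.integral_cong) (auto simp: indicator_def)
      also have "\<dots> = of_real (\<integral>t. indicator S t \<partial>nu (comb \<alpha> f g))"
        using S emeasure_nu[OF h S] by (intro integral_of_real integrable_real_indicator) auto
      also have "(\<integral>t. indicator S t \<partial>nu (comb \<alpha> f g)) = measure (nu (comb \<alpha> f g)) S" using S by simp
      finally show ?thesis .
    qed
    also have "\<dots> = inn (E S (comb \<alpha> f g)) (comb \<alpha> f g)" using E_inn_real[OF S h] measure_nu[OF h S] by simp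
    finally show ?thesis .
  qed
  have Q: "inn (E S (comb \<alpha> f g)) (comb \<alpha> f g) = inn (E S f) f + cnj \<alpha> * inn (E S f) g + \<alpha> * inn (E S g) f + \<alpha> * cnj \<alpha> * inn (E S g) g" for \<alpha>
    unfolding comb_eq E_lin[OF S f g] by (intro inn_expand E_H S f g)
  show ?thesis unfolding Lam_polL I by (rule polarization) (rule Q)
qed

lemma Lam_polL_t:
  assumes f: "f \<in> D" and g: "g \<in> D"
  shows "Lam (polL f g (\<lambda>t. of_real t)) (\<lambda>_. 1) = inn (T f) g"
proof -
  have I: "(\<integral>t. 1 * complex_of_real t \<partial>nu (comb \<alpha> f g)) = inn (T (comb \<alpha> f g)) (comb \<alpha> f g)" for \<alpha>
    using quadratic_form[OF comb_D[OF f g, of \<alpha>]] by simp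
  have Q: "inn (T (comb \<alpha> f g)) (comb \<alpha> f g) = inn (T f) f + cnj \<alpha> * inn (T f) g + \<alpha> * inn (T g) f + \<alpha> * cnj \<alpha> * inn (T g) g" for \<alpha>
    unfolding comb_eq T_lin[OF f g] by (intro inn_expand T_H D_H f g)
  show ?thesis unfolding Lam_polL I by (rule polarization) (rule Q)
qed

lemma Lam_polL_add_weight:
  assumes "\<And>\<alpha>. integrable (nu (comb \<alpha> f g)) (\<lambda>t. \<psi> t * w t)" "\<And>\<alpha>. integrable (nu (comb \<alpha> f g)) (\<lambda>t. \<psi> t * w' t)"
  shows "Lam (polL f g (\<lambda>t. w t + w' t)) \<psi> = Lam (polL f g w) \<psi> + Lam (polL f g w') \<psi>"
  unfolding Lam_polL distrib_left using assms by (simp add: algebra_simps)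

lemma Lam_polL_cmult_weight: "Lam (polL f g (\<lambda>t. k * w t)) \<psi> = k * Lam (polL f g w) \<psi>"
proof -
  have "(\<integral>t. \<psi> t * (k * w t) \<partial>M) = k * (\<integral>t. \<psi> t * w t \<partial>M)" for M :: "real measure"
    by (simp add: mult.left_commute)
  then show ?thesis unfolding Lam_polL by (simp add: algebra_simps)
qed

text \<open>Off S the vector u + \<alpha> E(S) v has the spectral measure of u whatever \<alpha> is,
  and this part cancels in the polarization; on S it has the spectral measure of u + \<alpha> v.
  Thus the integral over the line becomes an integral over S.\<close>

lemma Lam_polL_E:
  assumes u: "u \<in> D" and v: "v \<in> D" and S: "S \<in> sets borel"
  shows "Lam (polL u (E S v) (\<lambda>t. of_real t)) (\<lambda>_. 1) = Lam (polL u v (\<lambda>t. of_real t)) (indicator S)"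
proof -
  have uH: "u \<in> H" and vH: "v \<in> H" using u v D_H by auto
  have S': "- S \<in> sets borel" using S by auto
  have I: "(\<integral>t. 1 * complex_of_real t \<partial>nu (comb \<alpha> u (E S v)))
      = (\<integral>t. indicator (- S) t * complex_of_real t \<partial>nu u) + (\<integral>t. indicator S t * complex_of_real t \<partial>nu (comb \<alpha> u v))" for \<alpha>
  proof -
    define h where "h = comb \<alpha> u (E S v)"
    have hD: "h \<in> D" unfolding h_def by (intro comb_D u E_D v S)
    have hH: "h \<in> H" by (rule D_H[OF hD])
    have 1: "E S h = E S (comb \<alpha> u v)"
      unfolding h_def comb_eq E_lin[OF S uH E_H[OF S vH]] E_lin[OF S uH vH] E_Int[OF S S vH] by simp
    have 2: "E (- S) h = E (- S) u"
      unfolding h_def comb_eq E_lin[OF S' uH E_H[OF S vH]] E_Int[OF S' S vH] using E_empty[OF vH] by simp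
    have i1: "integrable (nu h) (\<lambda>t. indicator S t * complex_of_real t)"
      using S by (intro integrable_bounded_mult[where C = 1] integrable_t hD) (auto simp: indicator_def)
    have i2: "integrable (nu h) (\<lambda>t. indicator (- S) t * complex_of_real t)"
      using S by (intro integrable_bounded_mult[where C = 1] integrable_t hD) (auto simp: indicator_def)
    have "(\<integral>t. 1 * complex_of_real t \<partial>nu h) = (\<integral>t. indicator (- S) t * complex_of_real t + indicator S t * complex_of_real t \<partial>nu h)"
      by (intro Bochner_Integration.integral_cong) (auto simp: indicator_def)
    also have "\<dots> = (\<integral>t. indicator (- S) t * complex_of_real t \<partial>nu h) + (\<integral>t. indicator S t * complex_of_real t \<partial>nu h)"
      by (rule Bochner_Integration.integral_add[OF i2 i1])
    also have "(\<integral>t. indicator (- S) t * complex_of_real t \<partial>nu h) = (\<integral>t. indicator (- S) t * complex_of_real t \<partial>nu u)"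
      using integral_nu_E[OF hH S', of complex_of_real] integral_nu_E[OF uH S', of complex_of_real] 2 by simp
    also have "(\<integral>t. indicator S t * complex_of_real t \<partial>nu h) = (\<integral>t. indicator S t * complex_of_real t \<partial>nu (comb \<alpha> u v))"
      using integral_nu_E[OF hH S, of complex_of_real] integral_nu_E[OF comb_H[OF uH vH] S, of complex_of_real] 1 by simp
    finally show ?thesis unfolding h_def .
  qed
  show ?thesis unfolding Lam_polL I by (simp add: algebra_simps)
qed

text \<open>Localisation of T: the complex measure of T u and v has density t with respect to that
  of u and v. It follows from the form identity for T tested against E(S) v.\<close>

lemma E_T:
  assumes u: "u \<in> D" and v: "v \<in> D" and S: "S \<in> sets borel"
  shows "inn (E S (T u)) v = Lam (polL u v (\<lambda>t. of_real t)) (indicator S)"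
proof -
  have "inn (E S (T u)) v = inn (T u) (E S v)" by (intro E_adj S T_H u D_H v)
  also have "\<dots> = Lam (polL u (E S v) (\<lambda>t. of_real t)) (\<lambda>_. 1)"
    using Lam_polL_t[OF u E_D[OF v S]] by simp
  finally show ?thesis using Lam_polL_E[OF u v S] by simp
qed

text \<open>With f = (T - \<xi>) u the measure of f and v is (t - \<xi>) times the measure of u and
  v; both sides agree on Borel sets, hence on bounded functions.\<close>

lemma Lam_polL_resolvent:
  assumes u: "u \<in> D" and v: "v \<in> D" and f: "f = (\<lambda>x. T u x - \<xi> * u x)"
    and m: "\<psi> \<in> borel_measurable borel" and b: "\<And>t. norm (\<psi> t) \<le> C"
  shows "Lam (polL f v (\<lambda>_. 1)) \<psi> = Lam (polL u v (\<lambda>t. of_real t - \<xi>)) \<psi>"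
proof -
  have uH: "u \<in> H" and vH: "v \<in> H" using u v D_H by auto
  have feq: "f = (\<lambda>x. 1 * T u x + (- \<xi>) * u x)" by (simp add: f)
  have fH: "f \<in> H" unfolding feq by (intro H_lin T_H u uH)
  let ?L = "polL f v (\<lambda>_. 1) @ polL u v (\<lambda>t. - 1 * of_real t + \<xi>)"
  have L: "good_list ?L" unfolding good_list_append by (intro conjI good_polL_const good_polL_affine fH vH u v)
  have w: "Lam (polL u v (\<lambda>t. - 1 * of_real t + \<xi>)) \<psi>' = - Lam (polL u v (\<lambda>t. of_real t - \<xi>)) \<psi>'" for \<psi>'
    using Lam_polL_cmult_weight[of u v "- 1" "\<lambda>t. of_real t - \<xi>" \<psi>'] by simp
  have "Lam ?L \<psi> = 0"
  proof (rule Lam_zero[OF L _ m b])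
    fix S :: "real set" assume S: "S \<in> sets borel"
    have int: "integrable (nu (comb \<alpha> u v)) (\<lambda>t. indicator S t * complex_of_real t)"
      "integrable (nu (comb \<alpha> u v)) (\<lambda>t. indicator S t * (\<lambda>_. - \<xi>) t)" for \<alpha>
      using S by (intro integrable_bounded_mult[where C = 1] integrable_t integrable_const_nu comb_D comb_H u v uH vH;
          auto simp: indicator_def)+
    have "Lam (polL f v (\<lambda>_. 1)) (indicator S) = inn (E S f) v" by (rule Lam_polL_indicator[OF fH vH S])
    also have "E S f = (\<lambda>x. 1 * E S (T u) x + (- \<xi>) * E S u x)" unfolding feq by (intro E_lin S T_H u uH)
    also have "inn \<dots> v = 1 * inn (E S (T u)) v + (- \<xi>) * inn (E S u) v" by (intro inn_lin E_H S T_H u uH vH)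
    also have "\<dots> = Lam (polL u v (\<lambda>t. of_real t)) (indicator S) + Lam (polL u v (\<lambda>t. - \<xi> * 1)) (indicator S)"
      unfolding Lam_polL_cmult_weight E_T[OF u v S] Lam_polL_indicator[OF uH vH S] by simp
    also have "\<dots> = Lam (polL u v (\<lambda>t. of_real t + - \<xi>)) (indicator S)"
      using Lam_polL_add_weight[OF int] by simp
    finally show "Lam ?L (indicator S) = 0" unfolding Lam_append w by simp
  qed
  then show ?thesis unfolding Lam_append w by simp
qed

lemma norm_resolvent_le:
  fixes \<xi> :: complex assumes "Im \<xi> \<noteq> 0"
  shows "norm (1 / (complex_of_real t - \<xi>)) \<le> 1 / \<bar>Im \<xi>\<bar>"
proof -
  have "\<bar>Im \<xi>\<bar> \<le> norm (complex_of_real t - \<xi>)" using abs_Im_le_cmod[of "complex_of_real t - \<xi>"] by simp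
  then show ?thesis using assms by (simp add: norm_divide divide_left_mono frac_le)
qed

text \<open>Dividing the density t - \<xi> out again leaves the total mass of the measure of u and
  v. Any solution u in D of (T - \<xi>) u = f is covered, so a Green function is recognised by its
  equation and its domain.\<close>

theorem resolvent_formula:
  assumes u: "u \<in> D" and v: "v \<in> D" and f: "f = (\<lambda>x. T u x - \<xi> * u x)" and im: "Im \<xi> \<noteq> 0"
  shows "inn u v = Lam (polL f v (\<lambda>_. 1)) (\<lambda>t. 1 / (of_real t - \<xi>))"
proof -
  have uH: "u \<in> H" and vH: "v \<in> H" using u v D_H by auto
  have nz: "complex_of_real t - \<xi> \<noteq> 0" for t using im by (auto simp: complex_eq_iff)
  have "Lam (polL f v (\<lambda>_. 1)) (\<lambda>t. 1 / (of_real t - \<xi>)) = Lam (polL u v (\<lambda>t. of_real t - \<xi>)) (\<lambda>t. 1 / (of_real t - \<xi>))"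
    by (rule Lam_polL_resolvent[OF u v f _ norm_resolvent_le[OF im]]) measurable
  also have "\<dots> = Lam (polL u v (\<lambda>_. 1)) (indicator UNIV)"
    unfolding Lam_polL using nz by simp
  also have "\<dots> = inn u v" using Lam_polL_indicator[OF uH vH, of UNIV] E_UNIV[OF uH] by simp
  finally show ?thesis by simp
qed

text \<open>The polarized lists themselves are not linear in f; the measures they represent are, as
  one sees on Borel sets from the linearity of E.\<close>

lemma Lam_polL_linear:
  assumes f: "f \<in> H" and g: "g \<in> H" and v: "v \<in> H"
    and m: "\<psi> \<in> borel_measurable borel" and b: "\<And>t. norm (\<psi> t) \<le> C"
  shows "Lam (polL (\<lambda>x. \<alpha> * f x + \<beta> * g x) v (\<lambda>_. 1)) \<psi> = \<alpha> * Lam (polL f v (\<lambda>_. 1)) \<psi> + \<beta> * Lam (polL g v (\<lambda>_. 1)) \<psi>"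
proof -
  let ?h = "\<lambda>x. \<alpha> * f x + \<beta> * g x"
  have h: "?h \<in> H" by (intro H_lin f g)
  let ?L = "polL ?h v (\<lambda>_. 1) @ polL f v (\<lambda>_. - \<alpha> * 1) @ polL g v (\<lambda>_. - \<beta> * 1)"
  have L: "good_list ?L" unfolding good_list_append by (intro conjI good_polL_const h f g v)
  have "Lam ?L \<psi> = 0"
  proof (rule Lam_zero[OF L _ m b])
    fix S :: "real set" assume S: "S \<in> sets borel"
    have "inn (E S ?h) v = \<alpha> * inn (E S f) v + \<beta> * inn (E S g) v"
      unfolding E_lin[OF S f g] by (intro inn_lin E_H S f g v)
    then show "Lam ?L (indicator S) = 0"
      unfolding Lam_append Lam_polL_cmult_weight Lam_polL_indicator[OF h v S] Lam_polL_indicator[OF f v S] Lam_polL_indicator[OF g v S]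
      by simp
  qed
  then show ?thesis unfolding Lam_append Lam_polL_cmult_weight by (simp add: algebra_simps eq_neg_iff_add_eq_0)
qed

lemma poisson_kernel:
  fixes \<tau> x \<epsilon> :: real
  assumes "0 < \<epsilon>"
  shows "(1 / (of_real \<tau> - Complex x \<epsilon>) - 1 / (of_real \<tau> - Complex x (- \<epsilon>))) / (2 * \<i>)
     = complex_of_real (\<epsilon> / ((\<tau> - x)^2 + \<epsilon>^2))"
proof -
  define D where "D = (\<tau> - x)^2 + \<epsilon>^2"
  have nz: "complex_of_real \<tau> - Complex x \<epsilon> \<noteq> 0" "complex_of_real \<tau> - Complex x (- \<epsilon>) \<noteq> 0"
    using assms by (auto simp: complex_eq_iff)
  have p: "(complex_of_real \<tau> - Complex x \<epsilon>) * (of_real \<tau> - Complex x (- \<epsilon>)) = of_real ((\<tau> - x)^2 + \<epsilon>^2)"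
    by (simp add: complex_eq_iff power2_eq_square algebra_simps)
  have d: "(of_real \<tau> - Complex x (- \<epsilon>)) - (of_real \<tau> - Complex x \<epsilon>) = 2 * \<i> * of_real \<epsilon>"
    by (simp add: complex_eq_iff)
  have "(1 / (of_real \<tau> - Complex x \<epsilon>) - 1 / (of_real \<tau> - Complex x (- \<epsilon>)))
     = 2 * \<i> * of_real \<epsilon> / of_real D"
    unfolding D_def p[symmetric] d[symmetric] using nz by (simp add: diff_frac_eq)
  then show ?thesis unfolding D_def[symmetric] by simp
qed

text \<open>The family \<open>h\<close> consists of candidates for the resolvent applied to f. The
  function integrated in the conclusion has the value pi inside the interval and pi / 2 at its end
  points.\<close>

theorem stieltjes_inversion:
  assumes f: "f \<in> H" and v: "v \<in> D" and st: "s < t"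
    and h: "\<And>\<xi>. Im \<xi> \<noteq> 0 \<Longrightarrow> h \<xi> \<in> D \<and> f = (\<lambda>x. T (h \<xi>) x - \<xi> * h \<xi> x)"
    and lim: "(\<lambda>n. LINT x:{s..t}|lborel. (inn (h (Complex x (1 / real (Suc n)))) v - inn (h (Complex x (- (1 / real (Suc n))))) v) / (2 * \<i>)) \<longlonglongrightarrow> I"
  shows "Lam (polL f v (\<lambda>_. 1)) (\<lambda>\<tau>. of_real (pi / 2 * (indicator {s..t} \<tau> + indicator {s<..<t} \<tau>))) = I"
proof -
  have vH: "v \<in> H" by (rule D_H[OF v])
  let ?P = "\<lambda>n x \<tau>. (1 / real (Suc n)) / ((\<tau> - x)^2 + (1 / real (Suc n))^2)"
  \<comment> \<open>The difference of the two resolvent kernels at distance 1 / (n + 1) from the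
    real axis, divided by 2 i, is the Poisson kernel of that width.\<close>
  have jump: "(inn (h (Complex x (1 / real (Suc n)))) v - inn (h (Complex x (- (1 / real (Suc n))))) v) / (2 * \<i>)
     = Lam (polL f v (\<lambda>_. 1)) (\<lambda>\<tau>. of_real (?P n x \<tau>))" for n x
  proof -
    define e where "e = 1 / real (Suc n)"
    have e: "0 < e" by (simp add: e_def)
    let ?R = "\<lambda>\<xi> \<tau>. 1 / (complex_of_real \<tau> - \<xi>)"
    have i1: "Im (Complex x e) \<noteq> 0" and i2: "Im (Complex x (- e)) \<noteq> 0" using e by auto
    have L: "good_list (polL f v (\<lambda>_. 1))" by (intro good_polL_const f vH)
    have "Lam (polL f v (\<lambda>_. 1)) (\<lambda>\<tau>. (1 / (2 * \<i>)) * (?R (Complex x e) \<tau> + (- 1) * ?R (Complex x (- e)) \<tau>))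
        = (1 / (2 * \<i>)) * (Lam (polL f v (\<lambda>_. 1)) (?R (Complex x e)) + Lam (polL f v (\<lambda>_. 1)) (\<lambda>\<tau>. (- 1) * ?R (Complex x (- e)) \<tau>))"
    proof -
      have "Lam (polL f v (\<lambda>_. 1)) (\<lambda>\<tau>. ?R (Complex x e) \<tau> + (- 1) * ?R (Complex x (- e)) \<tau>)
          = Lam (polL f v (\<lambda>_. 1)) (?R (Complex x e)) + Lam (polL f v (\<lambda>_. 1)) (\<lambda>\<tau>. (- 1) * ?R (Complex x (- e)) \<tau>)"
        using norm_resolvent_le[OF i1] norm_resolvent_le[OF i2]
        by (intro Lam_add[OF L, where ?C1.0 = "1 / \<bar>e\<bar>" and ?C2.0 = "1 / \<bar>e\<bar>"]) auto
      then show ?thesis unfolding Lam_cmult[of _ "1 / (2 * \<i>)"] by simp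
    qed
    also have "\<dots> = (inn (h (Complex x e)) v - inn (h (Complex x (- e))) v) / (2 * \<i>)"
      unfolding Lam_cmult resolvent_formula[OF conjunct1[OF h[OF i1]] v conjunct2[OF h[OF i1]] i1]
        resolvent_formula[OF conjunct1[OF h[OF i2]] v conjunct2[OF h[OF i2]] i2] by simp
    also have "(\<lambda>\<tau>. (1 / (2 * \<i>)) * (?R (Complex x e) \<tau> + (- 1) * ?R (Complex x (- e)) \<tau>)) = (\<lambda>\<tau>. of_real (e / ((\<tau> - x)^2 + e^2)))"
      unfolding poisson_kernel[OF e, symmetric] by simp
    finally show ?thesis unfolding e_def by simp
  qed
  have pos: "0 < (\<tau> - x)^2 + (1 / real (Suc n))^2" for \<tau> x n by (simp add: add_nonneg_pos)
  have Pb: "\<bar>?P n x \<tau>\<bar> \<le> real (Suc n)" for n x \<tau>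
  proof -
    let ?e = "1 / real (Suc n)"
    have "?e / ((\<tau> - x)^2 + ?e^2) \<le> ?e / ?e^2"
      by (intro divide_left_mono) (use pos[of \<tau> x n] in \<open>auto simp: zero_less_mult_iff\<close>)
    also have "\<dots> = real (Suc n)" by (simp add: power2_eq_square)
    finally show ?thesis using pos[of \<tau> x n] by simp
  qed
  \<comment> \<open>A real integrand reduces the polarized functional to four real integrals over
    finite positive measures, to which \<open>poisson_limit\<close> applies one by one.\<close>
  have lam: "Lam (polL f v (\<lambda>_. 1)) (\<lambda>\<tau>. of_real (u \<tau>)) = 1 / 4 * of_real (\<integral>\<tau>. u \<tau> \<partial>nu (comb 1 f v))
      + (- (1 / 4) * of_real (\<integral>\<tau>. u \<tau> \<partial>nu (comb (- 1) f v))
     + (\<i> / 4 * of_real (\<integral>\<tau>. u \<tau> \<partial>nu (comb \<i> f v)) + (- (\<i> / 4)) * of_real (\<integral>\<tau>. u \<tau> \<partial>nu (comb (- \<i>) f v))))" for u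
    unfolding Lam_polL by simp
  have int: "set_integrable lborel {s..t} (\<lambda>x. \<integral>\<tau>. ?P n x \<tau> \<partial>nu k)" if "k \<in> H" for n k
  proof -
    interpret finite_measure "nu k" by (rule finite_nu[OF that])
    have "integrable lborel (\<lambda>x. indicator {s..t} x *\<^sub>R (\<integral>\<tau>. ?P n x \<tau> \<partial>nu k))"
    proof (rule Bochner_Integration.integrable_bound)
      show "integrable lborel (\<lambda>x. indicator {s..t} x *\<^sub>R (measure (nu k) UNIV * real (Suc n)))"
        by (intro integrable_scaleR_left integrable_real_indicator) (auto simp: emeasure_lborel_Icc_eq)
      have "(\<lambda>x. \<integral>\<tau>. ?P n x \<tau> \<partial>nu k) \<in> borel_measurable lborel"
        by (rule borel_measurable_lebesgue_integral) measurable
      then show "(\<lambda>x. indicator {s..t} x *\<^sub>R (\<integral>\<tau>. ?P n x \<tau> \<partial>nu k)) \<in> borel_measurable lborel" by measurable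
      have "\<bar>\<integral>\<tau>. ?P n x \<tau> \<partial>nu k\<bar> \<le> measure (nu k) UNIV * real (Suc n)" for x
      proof -
        have "norm (\<integral>\<tau>. ?P n x \<tau> \<partial>nu k) \<le> (\<integral>\<tau>. real (Suc n) \<partial>nu k)"
        proof (rule order.trans[OF integral_norm_bound integral_mono])
          have c: "integrable (nu k) (\<lambda>t. real (Suc n))" by simp
          have m: "?P n x \<in> borel_measurable (nu k)" by measurable
          have "integrable (nu k) (?P n x)"
            by (rule Bochner_Integration.integrable_bound[OF c m]) (use Pb in \<open>auto intro!: AE_I2\<close>)
          then show "integrable (nu k) (\<lambda>\<tau>. norm (?P n x \<tau>))" by (rule integrable_norm)
        qed (use Pb in auto)
        then show ?thesis by simp
      qed
      then show "AE x in lborel. norm (indicator {s..t} x *\<^sub>R (\<integral>\<tau>. ?P n x \<tau> \<partial>nu k)) \<le> norm (indicator {s..t} x *\<^sub>R (measure (nu k) UNIV * real (Suc n)))"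
        by (intro AE_I2) (auto simp: indicator_def abs_mult)
    qed
    then show ?thesis by (simp add: set_integrable_def)
  qed
  have int': "set_integrable lborel {s..t} (\<lambda>x. c * complex_of_real (\<integral>\<tau>. ?P n x \<tau> \<partial>nu k))" if "k \<in> H" for n k c
  proof -
    have "integrable lborel (\<lambda>x. c * complex_of_real (indicator {s..t} x *\<^sub>R (\<integral>\<tau>. ?P n x \<tau> \<partial>nu k)))"
      using int[OF that, of n] unfolding set_integrable_def by (intro integrable_mult_right integrable_of_real)
    moreover have "c * complex_of_real (indicator {s..t} x *\<^sub>R y) = indicator {s..t} x *\<^sub>R (c * complex_of_real y)" for x y
      by (simp add: indicator_def)
    ultimately show ?thesis unfolding set_integrable_def by (simp only:)
  qed
  have sint: "(LINT x:{s..t}|lborel. c * complex_of_real (F x)) = c * of_real (LINT x:{s..t}|lborel. F x)" for c F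
  proof -
    have "(LINT x:{s..t}|lborel. c * complex_of_real (F x)) = (\<integral>x. c * complex_of_real (indicator {s..t} x * F x) \<partial>lborel)"
      unfolding set_lebesgue_integral_def by (intro Bochner_Integration.integral_cong) (auto simp: indicator_def)
    also have "\<dots> = c * complex_of_real (\<integral>x. indicator {s..t} x * F x \<partial>lborel)"
      by (simp only: integral_mult_right_zero integral_complex_of_real)
    finally show ?thesis unfolding set_lebesgue_integral_def by (simp only: real_scaleR_def)
  qed
  let ?X = "\<lambda>n \<alpha>. LINT x:{s..t}|lborel. (\<integral>\<tau>. ?P n x \<tau> \<partial>nu (comb \<alpha> f v))"
  have "(LINT x:{s..t}|lborel. Lam (polL f v (\<lambda>_. 1)) (\<lambda>\<tau>. of_real (?P n x \<tau>)))
     = 1 / 4 * of_real (?X n 1) + (- (1 / 4) * of_real (?X n (- 1)) + (\<i> / 4 * of_real (?X n \<i>) + (- (\<i> / 4)) * of_real (?X n (- \<i>))))" for n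
    unfolding lam sint[symmetric] by (intro set_integral_add4 int' comb_H f vH)
  moreover have "(\<lambda>n. 1 / 4 * of_real (?X n 1) + (- (1 / 4) * of_real (?X n (- 1)) + (\<i> / 4 * of_real (?X n \<i>) + (- (\<i> / 4)) * of_real (?X n (- \<i>)))))
    \<longlonglongrightarrow> Lam (polL f v (\<lambda>_. 1)) (\<lambda>\<tau>. of_real (pi / 2 * (indicator {s..t} \<tau> + indicator {s<..<t} \<tau>)))"
    unfolding lam
    by (intro tendsto_add tendsto_mult tendsto_const tendsto_of_real poisson_limit finite_nu comb_H f vH sets_nu st)
  ultimately have "(\<lambda>n. LINT x:{s..t}|lborel. Lam (polL f v (\<lambda>_. 1)) (\<lambda>\<tau>. of_real (?P n x \<tau>)))
    \<longlonglongrightarrow> Lam (polL f v (\<lambda>_. 1)) (\<lambda>\<tau>. of_real (pi / 2 * (indicator {s..t} \<tau> + indicator {s<..<t} \<tau>)))" by simp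
  then show ?thesis using lim unfolding jump by (rule LIMSEQ_unique)
qed

end

section \<open>The q-binomial theorem and the series at infinity for the decaying solution\<close>

lemma chi_certificate:
  fixes A B C g gi x Q u h :: complex
  assumes "g * gi = 1" "h * C * g = 1"
  shows "(1 + A*C*x) * (1 + B*C*x) * ((1 - Q*h) * (1 - u*Q*h)) + (u + A*B*x) * (1 + x) * ((1 - Q) * (1 - u*Q))
      - (B*C*x*x * (- ((1 - A*g) * (1 - A*gi))) + (1 + A*B*x) * (1 + A*C*x) + (u + B*C*x) * (1 + x)) * ((1 - Q*h) * (1 - u*Q))
    = (1 - h) * ((B*C*x + u*Q) * (A*C*x + u*Q) * (1 - Q*h) - (A*B*C*g*x + u*Q) * (x + Q*h) * (1 - u*Q))"
  using assms by algebra

context qbase begin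

text \<open>The first-order functional equation relating y and q y is iterated; the series tends to
  1 as its argument tends to 0.\<close>

lemma q_binomial:
  fixes A y :: complex
  assumes y: "norm y < 1"
  shows "(\<Sum>m. qpoch q A m / qpoch q (of_real q) m * y ^ m) = qinf (A * y) / qinf y"
proof -
  define d where "d m = qpoch q A m / qpoch q (complex_of_real q) m" for m
  define F where "F w = (\<Sum>m. d m * w ^ m)" for w
  have dS: "d (Suc m) * (1 - of_real q ^ Suc m) = d m * (1 - A * of_real q ^ m)" for m
    using qpoch_q_nonzero[of "Suc m"] by (simp add: d_def qpoch_Suc)
  have "d \<longlonglongrightarrow> qinf A / qinf (of_real q)"
    unfolding d_def using qpoch_inf_pos[OF q_less_1]
    by (intro tendsto_divide qpoch_LIMSEQ) (simp add: qpoch_inf_of_real)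
  then have "Bseq d" by (intro convergent_imp_Bseq convergentI)
  then obtain K where K: "K > 0" "\<And>m. norm (d m) \<le> K" by (auto elim!: BseqE)
  have sm: "summable (\<lambda>m. d m * w ^ m)" if "norm w < 1" for w
    by (rule summable_comparison_test'[of "\<lambda>m. K * norm w ^ m" 0])
       (use that K in \<open>auto intro!: summable_mult summable_geometric mult_right_mono simp: norm_mult norm_power\<close>)
  have lt: "norm (y * of_real q ^ n) < 1" for n
  proof -
    have "norm (y * of_real q ^ n) \<le> norm y * 1"
      unfolding norm_mult norm_power using q_pos q_less_1 by (intro mult_left_mono power_le_one) auto
    then show ?thesis using y by simp
  qed
  have step: "(1 - w) * F w = (1 - A * w) * F (w * of_real q)" if w: "norm w < 1" "norm (w * of_real q) < 1" for w
  proof -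
    have "(\<lambda>m. d m * w ^ m - d m * (w * of_real q) ^ m) sums (F w - F (w * of_real q))"
      unfolding F_def by (intro sums_diff summable_sums sm w)
    then have "(\<lambda>m. d (Suc m) * w ^ Suc m - d (Suc m) * (w * of_real q) ^ Suc m) sums (F w - F (w * of_real q))"
      using sums_Suc_iff[of "\<lambda>m. d m * w ^ m - d m * (w * of_real q) ^ m" "F w - F (w * of_real q)"] by simp
    moreover have "(\<lambda>m. w * (d m * w ^ m) - A * w * (d m * (w * of_real q) ^ m)) sums (w * F w - A * w * F (w * of_real q))"
      unfolding F_def by (intro sums_diff sums_mult summable_sums sm w)
    moreover have "d (Suc m) * w ^ Suc m - d (Suc m) * (w * of_real q) ^ Suc m = w * (d m * w ^ m) - A * w * (d m * (w * of_real q) ^ m)" for m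
    proof -
      have "d (Suc m) * w ^ Suc m - d (Suc m) * (w * of_real q) ^ Suc m = (d (Suc m) * (1 - of_real q ^ Suc m)) * w ^ Suc m"
        by (simp add: power_mult_distrib algebra_simps)
      also have "\<dots> = w * (d m * w ^ m) - A * w * (d m * (w * of_real q) ^ m)"
        unfolding dS by (simp add: power_mult_distrib algebra_simps)
      finally show ?thesis .
    qed
    ultimately have "F w - F (w * of_real q) = w * F w - A * w * F (w * of_real q)" using sums_unique2 by fastforce
    then show ?thesis by algebra
  qed
  have nz: "qpoch q y n \<noteq> 0" "qinf y \<noteq> 0" for n
  proof -
    have *: "y * of_real q ^ i \<noteq> 1" for i using lt[of i] by auto
    then show "qpoch q y n \<noteq> 0" by (intro qpoch_nonzero)
    show "qinf y \<noteq> 0" using * by (simp add: qpoch_inf_eq_0_iff)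
  qed
  have it: "qpoch q y n * F y = qpoch q (A * y) n * F (y * of_real q ^ n)" for n
  proof (induction n)
    case (Suc n)
    have "(1 - y * of_real q ^ n) * F (y * of_real q ^ n) = (1 - A * (y * of_real q ^ n)) * F (y * of_real q ^ Suc n)"
      using step[of "y * of_real q ^ n"] lt[of n] lt[of "Suc n"] by (simp add: mult_ac)
    moreover have "qpoch q y (Suc n) * F y = (1 - y * of_real q ^ n) * (qpoch q y n * F y)" by (simp add: qpoch_Suc)
    ultimately show ?case unfolding Suc by (simp add: qpoch_Suc mult_ac)
  qed simp
  have F1: "(\<lambda>n. F (y * of_real q ^ n)) \<longlonglongrightarrow> (\<Sum>m. if m = 0 then 1 else 0)"
    unfolding F_def
  proof (rule tannery_seq)
    show "(\<lambda>n. d m * (y * of_real q ^ n) ^ m) \<longlonglongrightarrow> (if m = 0 then 1 else 0)" for m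
    proof -
      have "(\<lambda>n. d m * (y * of_real q ^ n) ^ m) \<longlonglongrightarrow> d m * (y * 0) ^ m"
        by (intro tendsto_intros cq_power_LIMSEQ)
      then show ?thesis by (simp add: power_0_left d_def split: if_splits)
    qed
    show "norm (d m * (y * of_real q ^ n) ^ m) \<le> K * norm y ^ m" for n m
    proof -
      have "norm (y * of_real q ^ n) \<le> norm y * 1"
        unfolding norm_mult norm_power using q_pos q_less_1 by (intro mult_left_mono power_le_one) auto
      then show ?thesis unfolding norm_mult norm_power using K by (intro mult_mono power_mono) (auto simp: norm_mult norm_power)
    qed
    show "summable (\<lambda>m. K * norm y ^ m)" using y by (intro summable_mult summable_geometric) simp
  qed
  then have F1: "(\<lambda>n. F (y * of_real q ^ n)) \<longlonglongrightarrow> 1" using suminf_finite[of "{0}" "\<lambda>n::nat. if n = 0 then 1 else 0::complex"] by simp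
  have "(\<lambda>n. qpoch q y n * F y) \<longlonglongrightarrow> qinf (A * y) * 1"
    unfolding it by (intro tendsto_mult qpoch_LIMSEQ F1)
  moreover have "(\<lambda>n. qpoch q y n * F y) \<longlonglongrightarrow> qinf y * F y" by (intro tendsto_mult qpoch_LIMSEQ tendsto_const)
  ultimately have "qinf y * F y = qinf (A * y)" using LIMSEQ_unique by fastforce
  then show ?thesis using nz(2) by (simp add: F_def d_def eq_divide_eq mult.commute)
qed

text \<open>The value is q^(-n(n+1)/2), as a product so that no halved exponent occurs.\<close>

definition tri :: "nat \<Rightarrow> complex" where "tri n = (\<Prod>i<n. inverse (of_real q ^ Suc i))"

lemma tri_nonzero: "tri n \<noteq> 0" by (simp add: tri_def)

text \<open>Quasi-periodicity: the first n factors are reversed, which collects all growth in n in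
  \<open>y^n * tri n\<close> and leaves a finite product that converges.\<close>

lemma qpoch_inf_shift:
  assumes "y \<noteq> (0::complex)"
  shows "qinf (- (y / of_real q ^ n)) = qinf (- y) * qpoch q (- (of_real q / y)) n * y ^ n * tri n"
proof (induction n)
  case (Suc n)
  have "qinf (- (y / of_real q ^ Suc n)) = (1 + y / of_real q ^ Suc n) * qinf (- (y / of_real q ^ n))"
    using qpoch_inf_step[of "- (y / of_real q ^ Suc n)"] by simp
  also have "1 + y / of_real q ^ Suc n = (1 - - (of_real q / y) * of_real q ^ n) * y * inverse (of_real q ^ Suc n)"
    using assms by (simp add: field_simps)
  finally show ?case unfolding Suc by (simp add: qpoch_Suc tri_def mult_ac)
qed (simp add: tri_def)

lemma norm_qpoch_neg_ge_1: "0 \<le> y \<Longrightarrow> 1 \<le> norm (qpoch q (- complex_of_real y) n)"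
  using qpoch_nonneg_neg[of y n] unfolding of_real_minus[symmetric] qpoch_of_real by simp

lemma norm_qpoch_inf_neg_ge_1: "0 \<le> y \<Longrightarrow> 1 \<le> norm (qinf (- complex_of_real y))"
  using qpoch_inf_neg_ge_1[of y] unfolding of_real_minus[symmetric] qpoch_inf_of_real by simp

end

context big_q begin

text \<open>Up to the factor \<open>bet ga (1 / x)\<close>, \<open>chi\<close> is a 3\<phi>2 series
  with argument c / ga, numerator parameters q/(c ga), -q/(b c x), -q/(a c x) and denominator
  parameters -q^2/(a b c ga x), -q/(c ga x). Absorbing the infinite products leaves denominators of
  norm at least 1, hence bounds uniform in \<open>ga\<close>.\<close>

definition bet :: "complex \<Rightarrow> real \<Rightarrow> complex" where
  "bet ga y = qinf (- (of_real (q^2 * y / (a * b * c)) / ga)) * qinf (- (of_real (q * y / c) / ga))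
     / (qinf (- of_real (q * y / (b * c))) * qinf (- of_real (q * y / (a * c))))"

definition chi_coef :: "complex \<Rightarrow> nat \<Rightarrow> complex" where
  "chi_coef ga m = qpoch q (of_real (q / c) / ga) m / qpoch q (of_real q) m"

definition chi_term :: "complex \<Rightarrow> real \<Rightarrow> nat \<Rightarrow> complex" where
  "chi_term ga x m = chi_coef ga m * ((of_real c / ga) ^ m * bet ga (q ^ m / x))"

definition chi :: "complex \<Rightarrow> real \<Rightarrow> complex" where
  "chi ga x = (\<Sum>m. chi_term ga x m)"

lemma norm_div_le: "0 \<le> r \<Longrightarrow> 1 \<le> norm ga \<Longrightarrow> norm (- (complex_of_real r / ga)) \<le> r"
  by (simp add: norm_divide divide_le_eq mult_left_le) (metis mult_left_mono mult.right_neutral)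

definition bet_bound :: "real \<Rightarrow> real" where
  "bet_bound Y = qinf (- (q^2 * Y / (a * b * c))) * qinf (- (q * Y / c))"

lemma bet_bound:
  assumes "1 \<le> norm ga" "0 \<le> y" "y \<le> Y"
  shows "norm (bet ga y) \<le> bet_bound Y"
proof -
  have pos: "0 < a * b * c" "0 < b * c" "0 < a * c" using a_pos b_pos c_pos by simp_all
  have n1: "norm (- (complex_of_real (q^2 * y / (a * b * c)) / ga)) \<le> q^2 * Y / (a * b * c)"
  proof -
    have "norm (- (complex_of_real (q^2 * y / (a * b * c)) / ga)) \<le> q^2 * y / (a * b * c)"
      using assms pos q_pos by (intro norm_div_le) auto
    also have "\<dots> \<le> q^2 * Y / (a * b * c)" using assms pos q_pos by (intro divide_right_mono mult_left_mono) auto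
    finally show ?thesis .
  qed
  have n2: "norm (- (complex_of_real (q * y / c) / ga)) \<le> q * Y / c"
  proof -
    have "norm (- (complex_of_real (q * y / c) / ga)) \<le> q * y / c"
      using assms c_pos q_pos by (intro norm_div_le) auto
    also have "\<dots> \<le> q * Y / c" using assms c_pos q_pos by (intro divide_right_mono mult_left_mono) auto
    finally show ?thesis .
  qed
  have d: "1 * 1 \<le> norm (qinf (- complex_of_real (q * y / (b * c)))) * norm (qinf (- complex_of_real (q * y / (a * c))))"
    using assms pos q_pos by (intro mult_mono norm_qpoch_inf_neg_ge_1) auto
  have "norm (bet ga y) \<le> bet_bound Y / 1"
    unfolding bet_def norm_divide norm_mult bet_bound_def using d assms pos q_pos c_pos
    by (intro frac_le mult_mono norm_qpoch_inf_le n1 n2 mult_nonneg_nonneg qpoch_inf_neg_nonneg) auto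
  then show ?thesis by simp
qed

lemma bet_bound_nonneg: "0 \<le> Y \<Longrightarrow> 0 \<le> bet_bound Y"
  unfolding bet_bound_def using a_pos b_pos c_pos q_pos
  by (intro mult_nonneg_nonneg qpoch_inf_neg_nonneg) auto

definition chi_bound :: "real \<Rightarrow> real" where
  "chi_bound Y = qinf (- (q / c)) / qinf q * bet_bound Y"

lemma chi_coef_bound:
  assumes "1 \<le> norm ga" shows "norm (chi_coef ga m) \<le> qinf (- (q / c)) / qinf q"
proof -
  have "norm (complex_of_real (q / c) / ga) \<le> q / c"
    using norm_div_le[of "q / c" ga] assms q_pos c_pos by simp
  then have "norm (qpoch q (complex_of_real (q / c) / ga) m) \<le> qinf (- (q / c))" by (rule norm_qpoch_le_inf)
  moreover have "qinf q \<le> norm (qpoch q (complex_of_real q) m)"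
    using qpoch_inf_le_qpoch[of q m] q_pos q_less_1 by (simp add: qpoch_of_real)
  ultimately show ?thesis unfolding chi_coef_def norm_divide
    using qpoch_inf_pos[OF q_less_1] q_pos c_pos by (intro frac_le qpoch_inf_neg_nonneg) auto
qed

lemma chi_term_bound:
  assumes "1 \<le> norm ga" "0 < x" "1 / x \<le> Y"
  shows "norm (chi_term ga x m) \<le> chi_bound Y * c ^ m"
proof -
  have "q ^ m / x \<le> 1 / x" using assms q_pos q_less_1 by (intro divide_right_mono power_le_one) auto
  then have y: "0 \<le> q ^ m / x" "q ^ m / x \<le> Y" using assms q_pos by auto
  have "0 < 1 / x" using assms by simp
  then have Y: "0 \<le> Y" using assms by linarith
  have "norm (complex_of_real c / ga) \<le> c" using norm_div_le[of c ga] assms c_pos by simp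
  then have "norm (chi_term ga x m) \<le> (qinf (- (q / c)) / qinf q) * (c ^ m * bet_bound Y)"
    unfolding chi_term_def norm_mult norm_power using qpoch_inf_pos[OF q_less_1] q_pos c_pos assms(1)
    by (intro mult_mono chi_coef_bound bet_bound y power_mono mult_nonneg_nonneg bet_bound_nonneg Y divide_nonneg_nonneg qpoch_inf_neg_nonneg) auto
  then show ?thesis by (simp add: chi_bound_def mult_ac)
qed

lemma summable_c: "summable (\<lambda>m. C * c ^ m)"
  using c_pos c_less_1 by (intro summable_mult summable_geometric) auto

lemma chi_summable: "1 \<le> norm ga \<Longrightarrow> 0 < x \<Longrightarrow> summable (chi_term ga x)"
  by (rule summable_comparison_test'[OF summable_c[of "chi_bound (1 / x)"], of 0]) (use chi_term_bound in auto)

lemma continuous_on_bet: "0 \<le> y \<Longrightarrow> continuous_on {ga. 1 \<le> norm ga} (\<lambda>ga. bet ga y)"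
proof -
  assume y: "0 \<le> y"
  have "norm (qinf (- complex_of_real (q * y / (b * c)))) \<noteq> 0" "norm (qinf (- complex_of_real (q * y / (a * c)))) \<noteq> 0"
    using norm_qpoch_inf_neg_ge_1[of "q * y / (b * c)"] norm_qpoch_inf_neg_ge_1[of "q * y / (a * c)"] y q_pos a_pos b_pos c_pos
    by (auto simp del: of_real_divide of_real_mult norm_eq_zero)
  moreover have "ga \<noteq> 0" if "1 \<le> norm ga" for ga :: complex using that by auto
  ultimately show ?thesis unfolding bet_def
    by (intro continuous_on_divide continuous_on_mult continuous_qpoch_inf continuous_on_minus continuous_on_const continuous_on_id) auto
qed

lemma continuous_on_chi: "0 < x \<Longrightarrow> continuous_on {ga. 1 \<le> norm ga} (\<lambda>ga. chi ga x)"
proof -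
  assume x: "0 < x"
  have nz: "ga \<noteq> 0" if "1 \<le> norm ga" for ga :: complex using that by auto
  have "uniform_limit {ga. 1 \<le> norm ga} (\<lambda>n ga. \<Sum>m<n. chi_term ga x m) (\<lambda>ga. chi ga x) sequentially"
    unfolding chi_def
    by (rule Weierstrass_m_test[OF _ summable_c[of "chi_bound (1 / x)"]]) (use chi_term_bound x in auto)
  moreover have "continuous_on {ga. 1 \<le> norm ga} (\<lambda>ga. \<Sum>m<n. chi_term ga x m)" for n
    unfolding chi_term_def chi_coef_def qpoch_def
    by (intro continuous_on_sum continuous_on_mult continuous_on_divide continuous_on_prod continuous_on_bet continuous_on_power
          continuous_on_diff continuous_on_const continuous_on_id)
       (use nz qpoch_q_nonzero x q_pos in \<open>auto simp: qpoch_def\<close>)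
  ultimately show ?thesis by (intro uniform_limit_theorem[OF always_eventually]) auto
qed

lemma bet_step:
  assumes y: "0 \<le> y" and g: "ga \<noteq> 0"
  shows "(1 + of_real (q^2 * y / (a * b * c)) / ga) * (1 + of_real (q * y / c) / ga) * bet ga (q * y)
    = (1 + of_real (q * y / (b * c))) * (1 + of_real (q * y / (a * c))) * bet ga y"
proof -
  have s1: "qinf (- (of_real (q^2 * y / (a * b * c)) / ga)) = (1 + of_real (q^2 * y / (a * b * c)) / ga) * qinf (- (of_real (q^2 * (q * y) / (a * b * c)) / ga))"
    using qpoch_inf_step[of "- (of_real (q^2 * y / (a * b * c)) / ga)"] by (simp add: mult_ac)
  have s2: "qinf (- (of_real (q * y / c) / ga)) = (1 + of_real (q * y / c) / ga) * qinf (- (of_real (q * (q * y) / c) / ga))"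
    using qpoch_inf_step[of "- (of_real (q * y / c) / ga)"] by (simp add: mult_ac)
  have s3: "qinf (- complex_of_real (q * y / (b * c))) = (1 + of_real (q * y / (b * c))) * qinf (- of_real (q * (q * y) / (b * c)))"
    using qpoch_inf_step[of "- complex_of_real (q * y / (b * c))"] by (simp add: mult_ac)
  have s4: "qinf (- complex_of_real (q * y / (a * c))) = (1 + of_real (q * y / (a * c))) * qinf (- of_real (q * (q * y) / (a * c)))"
    using qpoch_inf_step[of "- complex_of_real (q * y / (a * c))"] by (simp add: mult_ac)
  have nz: "qinf (- complex_of_real (q * y / (b * c))) \<noteq> 0" "qinf (- complex_of_real (q * y / (a * c))) \<noteq> 0"
    using norm_qpoch_inf_neg_ge_1[of "q * y / (b * c)"] norm_qpoch_inf_neg_ge_1[of "q * y / (a * c)"] y q_pos a_pos b_pos c_pos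
    by (auto simp del: of_real_divide of_real_mult)
  have gen: "X * Y * (U * U' / (V * W)) = Z * T * ((X * U) * (Y * U') / ((Z * V) * (T * W)))"
    if "Z * V \<noteq> 0" "T * W \<noteq> 0" for X Y Z T U U' V W :: complex
    using that by (simp add: field_simps)
  show ?thesis unfolding bet_def s1 s2 s3 s4
    by (rule gen) (use nz[unfolded s3 s4] in simp_all)
qed

lemma tendsto_bet:
  assumes "(f \<longlongrightarrow> y) F" "0 \<le> y"
  shows "((\<lambda>n. bet ga (f n)) \<longlongrightarrow> bet ga y) F"
proof -
  have nz: "qinf (- complex_of_real (q * y / (b * c))) \<noteq> 0" "qinf (- complex_of_real (q * y / (a * c))) \<noteq> 0"
    using norm_qpoch_inf_neg_ge_1[of "q * y / (b * c)"] norm_qpoch_inf_neg_ge_1[of "q * y / (a * c)"] assms(2) q_pos a_pos b_pos c_pos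
    by (auto simp del: of_real_divide of_real_mult)
  have m: "((\<lambda>n. k * f n / l) \<longlongrightarrow> k * y / l) F" for k l :: real
    unfolding divide_inverse by (intro tendsto_mult tendsto_const assms(1))
  have m': "((\<lambda>n. complex_of_real (k * f n / l) / ga) \<longlongrightarrow> complex_of_real (k * y / l) / ga) F" for k l :: real
    using tendsto_mult[OF tendsto_of_real[OF m[of k l]] tendsto_const[of "inverse ga"]] by (simp add: divide_inverse)
  show ?thesis unfolding bet_def
    by (intro tendsto_divide tendsto_mult tendsto_qpoch_inf tendsto_minus m' tendsto_of_real m) (use nz in simp)
qed

lemma bet_0 [simp]: "bet ga 0 = 1" by (simp add: bet_def)

lemma qm_div_LIMSEQ: "(\<lambda>m. q ^ m / x) \<longlonglongrightarrow> 0"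
  using tendsto_mult[OF q_power_LIMSEQ tendsto_const[of "inverse x"]] by (simp add: divide_inverse)

text \<open>The eigenvalue equation after the factor \<open>(c / ga)^(-k) (-a b x; q)_\<infinity> /
  (-b c x; q)_\<infinity>\<close> of the decaying solution has been removed; the removal produces
  the coefficients ga / c and c / ga.\<close>

lemma chi_eq:
  fixes x :: real
  assumes g: "1 \<le> norm ga" and im: "Im ga \<noteq> 0" and x: "0 < x"
  shows "(1 + of_real a * of_real c * of_real x) * (1 + of_real b * of_real c * of_real x) * (ga / of_real c * chi ga (q * x))
     + (of_real q + of_real a * of_real b * of_real x) * (1 + of_real x) * (of_real c / ga * chi ga (x / q))
     = eig_coef (mu a ga) (of_real x) * chi ga x"
proof -
  define A B C X u where "A = complex_of_real a" and "B = complex_of_real b" and "C = complex_of_real c"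
    and "X = complex_of_real x" and "u = complex_of_real q"
  have g0: "ga \<noteq> 0" using im by auto
  have nz: "A \<noteq> 0" "B \<noteq> 0" "C \<noteq> 0" "X \<noteq> 0" "u \<noteq> 0" using a_pos b_pos c_pos x by (auto simp: A_def B_def C_def X_def u_def)
  define gi where "gi = inverse ga"
  define h where "h = inverse (C * ga)"
  have gi: "ga * gi = 1" using g0 by (simp add: gi_def)
  have "C * ga \<noteq> 0" using g0 nz by simp
  then have h: "h * C * ga = 1" unfolding h_def mult.assoc by (rule left_inverse)
  have CG: "A / ga = A * gi" by (simp add: gi_def divide_inverse)
  have mu: "mu a ga = - ((1 - A * ga) * (1 - A * gi))" using mu_factor[OF g0, of a] by (simp add: A_def CG[unfolded A_def])
  have Cg: "c < norm ga" using g c_less_1 by linarith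
  have hn: "1 - h \<noteq> 0"
  proof
    assume "1 - h = 0"
    then have "C * ga = 1" using h by (simp add: mult.assoc)
    then have "Im (C * ga) = 0" by simp
    then show False using im c_pos by (simp add: C_def)
  qed
  define d where "d m = chi_coef ga m" for m
  \<comment> \<open>With h = 1 / (c ga), the coefficients d (m - 1), d m and d (m + 1) are
    polynomial multiples of e m up to the nonzero factors \<open>1 - h\<close> and
    \<open>1 - q^(m+1)\<close>. Below, \<open>dp\<close> is the shifted coefficient with the value 0
    at m = 0.\<close>
  define e where "e m = qpoch q h m / qpoch q u m" for m
  define t where "t m = (C / ga) ^ m * bet ga (q ^ m / x)" for m
  define dp where "dp m = (case m of 0 \<Rightarrow> 0 | Suc k \<Rightarrow> d k)" for m
  have hq: "of_real (q / c) / ga = h * u" using g0 nz by (simp add: h_def u_def C_def field_simps)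
  have dd: "d m = qpoch q (h * u) m / qpoch q u m" for m
    unfolding d_def chi_coef_def hq by (simp only: u_def)
  have qn: "1 - u * u ^ m \<noteq> 0" for m using q_power_neq_1[of m] by (simp add: u_def)
  have e1: "d m * (1 - h) = e m * (1 - u ^ m * h)" for m
    using qpoch_Suc[of h m] qpoch_Suc'[of h m] by (simp add: dd e_def u_def mult_ac)
  have e2: "e (Suc m) * (1 - u * u ^ m) = e m * (1 - u ^ m * h)" for m
    using qpoch_q_nonzero[of "Suc m"] by (simp add: e_def u_def qpoch_Suc mult_ac)
  have e3: "dp m * (1 - h) = e m * (1 - u ^ m)" for m
  proof (cases m)
    case (Suc k) then show ?thesis using e1[of k] e2[of k] by (simp add: dp_def)
  qed (simp add: dp_def)
  have shuffle: "E * T * ((1 - h) * (R * r - S * N)) = (1 - h) * N * (G' - E * S * T)"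
    if "N * G' = E * r * (R * T)" for E T R r S N G' :: complex
    using that by algebra
  have swap: "D * (H * Q) = (E * Q) * W" if "D * H = E * W" for D E H Q W :: complex
    using that by algebra
  have e4: "d (Suc m) * ((1 - h) * (1 - u * u ^ m)) = e m * ((1 - u ^ m * h) * (1 - u * u ^ m * h))" for m
  proof -
    have "d (Suc m) * ((1 - h) * (1 - u * u ^ m)) = (e (Suc m) * (1 - u * u ^ m)) * (1 - u * u ^ m * h)"
      using e1[of "Suc m"] by (intro swap) simp
    then show ?thesis unfolding e2 by (simp add: mult.assoc)
  qed
  have ts: "(A * B * C * ga * X + u * u ^ Suc m) * (X + u ^ Suc m * h) * t (Suc m) = (B * C * X + u * u ^ m) * (A * C * X + u * u ^ m) * t m" for m
  proof -
    define y where "y = q ^ m / x"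
    have y0: "0 \<le> y" using x q_pos by (simp add: y_def)
    have yy: "q * y = q ^ Suc m / x" by (simp add: y_def)
    have Yc: "complex_of_real y = u ^ m / X" by (simp add: y_def u_def X_def)
    have f1: "A * B * C * ga * X + u * u ^ Suc m = A * B * C * ga * X * (1 + of_real (q^2 * y / (a * b * c)) / ga)"
      using nz g0 by (simp add: Yc A_def[symmetric] B_def[symmetric] C_def[symmetric] u_def[symmetric] field_simps power2_eq_square)
    have f2: "X + u ^ Suc m * h = X * (1 + of_real (q * y / c) / ga)"
      using nz g0 by (simp add: Yc C_def[symmetric] u_def[symmetric] h_def field_simps)
    have f3: "B * C * X + u * u ^ m = B * C * X * (1 + of_real (q * y / (b * c)))"
      using nz by (simp add: Yc B_def[symmetric] C_def[symmetric] u_def[symmetric] field_simps)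
    have f4: "A * C * X + u * u ^ m = A * C * X * (1 + of_real (q * y / (a * c)))"
      using nz by (simp add: Yc A_def[symmetric] C_def[symmetric] u_def[symmetric] field_simps)
    have "(A * B * C * ga * X + u * u ^ Suc m) * (X + u ^ Suc m * h) * t (Suc m)
       = A * B * C * ga * X * X * (C / ga) ^ Suc m * ((1 + of_real (q^2 * y / (a * b * c)) / ga) * (1 + of_real (q * y / c) / ga) * bet ga (q * y))"
      unfolding f1 f2 t_def yy by (simp only: mult_ac)
    also have "\<dots> = A * B * C * ga * X * X * (C / ga) ^ Suc m * ((1 + of_real (q * y / (b * c))) * (1 + of_real (q * y / (a * c))) * bet ga y)"
      unfolding bet_step[OF y0 g0] ..
    also have "A * B * C * ga * X * X * (C / ga) ^ Suc m = (B * C * X) * (A * C * X) * (C / ga) ^ m"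
      using g0 by simp
    finally show ?thesis unfolding f3 f4 t_def y_def[symmetric] by (simp only: mult_ac)
  qed
  define G where "G m = e m * ((A * B * C * ga * X + u * u ^ m) * (X + u ^ m * h)) * t m" for m
  let ?P1 = "(1 + A * C * X) * (1 + B * C * X)" and ?P2 = "(u + A * B * X) * (1 + X)"
  let ?co = "eig_coef (mu a ga) X"
  \<comment> \<open>Multiplied by \<open>(1 - h) (1 - q^(m+1))\<close> and divided by e m t m, this
    is \<open>chi_certificate\<close> at Q = q^m.\<close>
  have tel: "(?P1 * d (Suc m) + ?P2 * dp m - ?co * d m) * t m = G (Suc m) - G m" for m
  proof -
    have "(1 - h) * (1 - u * u ^ m) * ((?P1 * d (Suc m) + ?P2 * dp m - ?co * d m) * t m)
       = (?P1 * (d (Suc m) * ((1 - h) * (1 - u * u ^ m))) + ?P2 * (dp m * (1 - h)) * (1 - u * u ^ m) - ?co * (d m * (1 - h)) * (1 - u * u ^ m)) * t m"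
      by (simp add: algebra_simps)
    also have "\<dots> = e m * t m * ((1 + A*C*X) * (1 + B*C*X) * ((1 - u ^ m * h) * (1 - u * u ^ m * h)) + (u + A*B*X) * (1 + X) * ((1 - u ^ m) * (1 - u * u ^ m))
      - (B*C*X*X * (- ((1 - A*ga) * (1 - A*gi))) + (1 + A*B*X) * (1 + A*C*X) + (u + B*C*X) * (1 + X)) * ((1 - u ^ m * h) * (1 - u * u ^ m)))"
      unfolding e1 e3 e4 eig_coef_def mu A_def[symmetric] B_def[symmetric] C_def[symmetric] u_def[symmetric] by algebra
    also have "\<dots> = e m * t m * ((1 - h) * ((B*C*X + u * u ^ m) * (A*C*X + u * u ^ m) * (1 - u ^ m * h) - (A*B*C*ga*X + u * u ^ m) * (X + u ^ m * h) * (1 - u * u ^ m)))"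
      using chi_certificate[OF gi h, of A X B "u ^ m" u] by simp
    also have "\<dots> = (1 - h) * (1 - u * u ^ m) * (G (Suc m) - G m)"
    proof -
      have "(1 - u * u ^ m) * G (Suc m) = (e (Suc m) * (1 - u * u ^ m)) * ((A * B * C * ga * X + u * u ^ Suc m) * (X + u ^ Suc m * h) * t (Suc m))"
        by (simp add: G_def mult_ac)
      also have "\<dots> = e m * (1 - u ^ m * h) * ((B * C * X + u * u ^ m) * (A * C * X + u * u ^ m) * t m)" unfolding e2 ts ..
      finally show ?thesis unfolding G_def[of m] by (rule shuffle)
    qed
    finally show ?thesis using hn qn[of m] by simp
  qed
  have tl: "t \<longlonglongrightarrow> 0"
  proof -
    have "(\<lambda>m. (C / ga) ^ m) \<longlonglongrightarrow> 0"
      using Cg c_pos by (intro LIMSEQ_power_zero) (auto simp: norm_divide C_def)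
    moreover have "(\<lambda>m. bet ga (q ^ m / x)) \<longlonglongrightarrow> bet ga 0" by (intro tendsto_bet qm_div_LIMSEQ) simp
    ultimately have "t \<longlonglongrightarrow> 0 * bet ga 0" unfolding t_def by (intro tendsto_mult)
    then show ?thesis by simp
  qed
  have "e \<longlonglongrightarrow> qinf h / qinf u"
    unfolding e_def u_def by (intro tendsto_divide qpoch_LIMSEQ qpoch_inf_q_nonzero)
  then have "G \<longlonglongrightarrow> qinf h / qinf u * ((A * B * C * ga * X + u * 0) * (X + 0 * h)) * 0"
    unfolding G_def using tl by (intro tendsto_mult tendsto_add tendsto_const) (simp_all add: u_def cq_power_LIMSEQ)
  then have "G \<longlonglongrightarrow> 0" by simp
  then have "(\<lambda>m. G (Suc m) - G m) sums (0 - G 0)" by (rule telescope_sums)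
  then have 1: "(\<lambda>m. (?P1 * d (Suc m) + ?P2 * dp m - ?co * d m) * t m) sums (- G 0)" unfolding tel by simp
  have qx: "0 < q * x" "0 < x / q" using x q_pos by simp_all
  have c2: "chi_term ga x m = d m * t m" for m by (simp add: chi_term_def d_def t_def C_def)
  have s2: "(\<lambda>m. d m * t m) sums chi ga x"
    unfolding c2[symmetric] chi_def by (intro summable_sums chi_summable g x)
  \<comment> \<open>The factor \<open>bet\<close> depends on m and x through q^m / x only, so
    replacing x by q x or x / q is an index shift of the series.\<close>
  have c1: "ga / C * chi_term ga (q * x) (Suc m) = d (Suc m) * t m" for m
    using g0 nz q_pos by (simp add: chi_term_def d_def t_def C_def[symmetric])
  have s1: "(\<lambda>m. d (Suc m) * t m) sums (ga / C * chi ga (q * x) - ga / C * chi_term ga (q * x) 0)"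
  proof -
    have "(\<lambda>m. ga / C * chi_term ga (q * x) m) sums (ga / C * chi ga (q * x))"
      unfolding chi_def by (intro sums_mult summable_sums chi_summable g qx)
    then have "(\<lambda>m. ga / C * chi_term ga (q * x) (Suc m)) sums (ga / C * chi ga (q * x) - ga / C * chi_term ga (q * x) 0)"
      by (subst sums_Suc_iff) simp
    then show ?thesis unfolding c1 .
  qed
  have c3: "C / ga * chi_term ga (x / q) m = dp (Suc m) * t (Suc m)" for m
    using q_pos by (simp add: chi_term_def d_def dp_def t_def C_def[symmetric] mult_ac)
  have s3: "(\<lambda>m. dp m * t m) sums (C / ga * chi ga (x / q))"
  proof -
    have "(\<lambda>m. C / ga * chi_term ga (x / q) m) sums (C / ga * chi ga (x / q))"
      unfolding chi_def by (intro sums_mult summable_sums chi_summable g qx)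
    then have "(\<lambda>m. dp (Suc m) * t (Suc m)) sums (C / ga * chi ga (x / q))" unfolding c3 .
    then have "(\<lambda>m. dp m * t m) sums (C / ga * chi ga (x / q) + dp 0 * t 0)" by (subst (asm) sums_Suc_iff) simp
    then show ?thesis by (simp add: dp_def)
  qed
  have "(\<lambda>m. ?P1 * (d (Suc m) * t m) + ?P2 * (dp m * t m) - ?co * (d m * t m)) sums
     (?P1 * (ga / C * chi ga (q * x) - ga / C * chi_term ga (q * x) 0) + ?P2 * (C / ga * chi ga (x / q)) - ?co * chi ga x)"
    by (intro sums_diff sums_add sums_mult s1 s2 s3)
  then have 2: "(\<lambda>m. (?P1 * d (Suc m) + ?P2 * dp m - ?co * d m) * t m) sums
     (?P1 * (ga / C * chi ga (q * x) - ga / C * chi_term ga (q * x) 0) + ?P2 * (C / ga * chi ga (x / q)) - ?co * chi ga x)"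
    by (simp only: distrib_right left_diff_distrib mult.assoc)
  \<comment> \<open>The index shift loses the term m = 0 of the series at q x; with its coefficient
    it equals the boundary value of the telescoping sum.\<close>
  have G0: "G 0 = ?P1 * (ga / C * chi_term ga (q * x) 0)"
  proof -
    define y where "y = 1 / (q * x)"
    have y0: "0 \<le> y" using qx by (simp add: y_def)
    have yy: "q * y = 1 / x" by (simp add: y_def)
    have Yc: "complex_of_real y = 1 / (u * X)" by (simp add: y_def u_def X_def)
    have f1: "A * B * C * ga * X + u = A * B * C * ga * X * (1 + of_real (q^2 * y / (a * b * c)) / ga)"
      using nz g0 by (simp add: Yc A_def[symmetric] B_def[symmetric] C_def[symmetric] u_def[symmetric] field_simps power2_eq_square)
    have f2: "X + h = X * (1 + of_real (q * y / c) / ga)"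
      using nz g0 by (simp add: Yc C_def[symmetric] u_def[symmetric] h_def field_simps)
    have f3: "1 + B * C * X = B * C * X * (1 + of_real (q * y / (b * c)))"
      using nz by (simp add: Yc B_def[symmetric] C_def[symmetric] u_def[symmetric] field_simps)
    have f4: "1 + A * C * X = A * C * X * (1 + of_real (q * y / (a * c)))"
      using nz by (simp add: Yc A_def[symmetric] C_def[symmetric] u_def[symmetric] field_simps)
    have "G 0 = (A * B * C * ga * X + u) * (X + h) * bet ga (q * y)" unfolding yy by (simp add: G_def e_def t_def)
    also have "\<dots> = A * B * C * ga * X * X * ((1 + of_real (q^2 * y / (a * b * c)) / ga) * (1 + of_real (q * y / c) / ga) * bet ga (q * y))"
      unfolding f1 f2 by (simp only: mult_ac)
    also have "\<dots> = A * B * C * ga * X * X * ((1 + of_real (q * y / (b * c))) * (1 + of_real (q * y / (a * c))) * bet ga y)"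
      unfolding bet_step[OF y0 g0] ..
    also have "\<dots> = (A * C * X * (1 + of_real (q * y / (a * c)))) * (B * C * X * (1 + of_real (q * y / (b * c)))) * (ga / C * bet ga y)"
      using nz by (simp add: field_simps)
    finally show ?thesis unfolding f3[symmetric] f4[symmetric] by (simp add: chi_term_def chi_coef_def y_def)
  qed
  have "?P1 * (ga / C * chi ga (q * x) - ga / C * chi_term ga (q * x) 0) + ?P2 * (C / ga * chi ga (x / q)) - ?co * chi ga x = - G 0"
    using sums_unique2[OF 2 1] .
  then have "?P1 * (ga / C * chi ga (q * x)) + ?P2 * (C / ga * chi ga (x / q)) = ?co * chi ga x"
    unfolding G0 by algebra
  then show ?thesis by (simp only: A_def B_def C_def X_def u_def)
qed

end

section \<open>Wronskians on the positive half\<close>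

context qbase begin

lemma q_powi_pos [simp]: "0 < q powi k"
  using q_pos by (simp add: power_int_def)

lemma q_powi_Suc: "q powi (k + 1) = q * q powi k"
  by (simp add: power_int_add mult.commute)

lemma q_powi_pred: "q powi (k - 1) = q powi k / q"
  by (simp add: power_int_diff)

end

context big_q begin

definition xk :: "int \<Rightarrow> real" where "xk k = z * q powi k"

lemma xk_pos: "0 < xk k" using z_pos by (simp add: xk_def)

lemma xk_Suc: "xk (k + 1) = q * xk k" by (simp add: xk_def q_powi_Suc)

lemma xk_pred: "xk (k - 1) = xk k / q" by (simp add: xk_def q_powi_pred)

lemma xk_neg: "xk (- int n) = z / q ^ n" by (simp add: xk_def power_int_minus divide_inverse)

definition solves :: "complex \<Rightarrow> (int \<Rightarrow> complex) \<Rightarrow> bool" where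
  "solves m f \<longleftrightarrow> (\<forall>k. of_real (coeffA a b c (xk k)) * (f (k + 1) - f k) + of_real (coeffB q b c (xk k)) * (f (k - 1) - f k) = m * f k)"

lemma coeffA_alt: "x \<noteq> 0 \<Longrightarrow> coeffA a b c x = (1 + a * b * x) * (1 + a * c * x) / (b * c * x * x)"
  using a_pos b_pos c_pos by (simp add: coeffA_def field_simps power2_eq_square)

lemma coeffB_alt: "x \<noteq> 0 \<Longrightarrow> coeffB q b c x = (q + b * c * x) * (1 + x) / (b * c * x * x)"
  using b_pos c_pos by (simp add: coeffB_def field_simps)

lemma coeffB_pos: "0 < x \<Longrightarrow> 0 < coeffB q b c x"
  using q_pos b_pos c_pos by (simp add: coeffB_def add_pos_pos)

lemma recurrence_iff:
  fixes x :: real and f0 f1 f2 m :: complex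
  assumes "x \<noteq> 0"
  shows "of_real (coeffA a b c x) * (f1 - f0) + of_real (coeffB q b c x) * (f2 - f0) = m * f0 \<longleftrightarrow>
    (1 + of_real a * of_real b * of_real x) * (1 + of_real a * of_real c * of_real x) * (f1 - f0)
    + (of_real q + of_real b * of_real c * of_real x) * (1 + of_real x) * (f2 - f0)
    = of_real b * of_real c * of_real x * of_real x * m * f0"
proof -
  define D where "D = complex_of_real (b * c * x * x)"
  have D: "D \<noteq> 0" using assms b_pos c_pos by (simp add: D_def)
  have A: "D * of_real (coeffA a b c x) = (1 + of_real a * of_real b * of_real x) * (1 + of_real a * of_real c * of_real x)"
    using D assms unfolding coeffA_alt[OF assms] D_def by simp
  have B: "D * of_real (coeffB q b c x) = (of_real q + of_real b * of_real c * of_real x) * (1 + of_real x)"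
    using D assms unfolding coeffB_alt[OF assms] D_def by simp
  have "of_real (coeffA a b c x) * (f1 - f0) + of_real (coeffB q b c x) * (f2 - f0) = m * f0 \<longleftrightarrow>
    D * (of_real (coeffA a b c x) * (f1 - f0) + of_real (coeffB q b c x) * (f2 - f0)) = D * (m * f0)"
    using D by simp
  also have "D * (of_real (coeffA a b c x) * (f1 - f0) + of_real (coeffB q b c x) * (f2 - f0))
    = (D * of_real (coeffA a b c x)) * (f1 - f0) + (D * of_real (coeffB q b c x)) * (f2 - f0)"
    by (simp add: distrib_left mult.assoc)
  also have "D * (m * f0) = of_real b * of_real c * of_real x * of_real x * m * f0" by (simp add: D_def mult.assoc)
  finally show ?thesis unfolding A B .
qed

definition psis :: "complex \<Rightarrow> int \<Rightarrow> complex" where "psis ga k = psi ga (of_real (xk k))"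

lemma qpoch_inf_pos_arg_nonzero: "0 < x \<Longrightarrow> qinf (- complex_of_real x) \<noteq> 0"
  using norm_qpoch_inf_neg_ge_1[of x] by auto

lemma solves_psis:
  assumes "c < norm ga" shows "solves (mu a ga) (psis ga)"
  unfolding solves_def
proof
  fix k
  let ?x = "complex_of_real (xk k)"
  have x: "0 < xk k" by (rule xk_pos)
  have bcx: "0 < b * c * xk k" using x b_pos c_pos by simp
  have n: "qinf (- (of_real b * of_real c * ?x)) \<noteq> 0"
    using qpoch_inf_pos_arg_nonzero[OF bcx] by simp
  have "q + b * c * xk k \<noteq> 0" using bcx q_pos by linarith
  then have "complex_of_real (q + b * c * xk k) \<noteq> 0" by (simp only: of_real_eq_0_iff not_False_eq_True)
  then have n2: "of_real q + of_real b * of_real c * ?x \<noteq> 0" by simp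
  have e: "of_real q * ?x = of_real (xk (k + 1))" "?x / of_real q = of_real (xk (k - 1))"
    by (simp_all add: xk_Suc xk_pred)
  show "of_real (coeffA a b c (xk k)) * (psis ga (k + 1) - psis ga k) + of_real (coeffB q b c (xk k)) * (psis ga (k - 1) - psis ga k) = mu a ga * psis ga k"
    using psi_eq[OF assms n disjI2[OF n2]] x unfolding e psis_def recurrence_iff[OF less_imp_neq[OF x, symmetric]] by blast
qed

text \<open>The limit of the unnormalised solution divided by (a / ga)^n: the first quotient is the
  q-binomial sum of the limiting series, the theta quotient comes from the two infinite products in
  front.\<close>

definition Phi_norm :: "complex \<Rightarrow> complex" where
  "Phi_norm ga = qinf (of_real q / ga^2) / qinf (of_real c / ga) *
     (of_real (qtheta q (- (a * b * z))) / of_real (qtheta q (- (b * c * z))))"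

definition Phi :: "complex \<Rightarrow> int \<Rightarrow> complex" where
  "Phi ga k = (of_real c / ga) powi (- k) * (qinf (- of_real (a * b * xk k)) / qinf (- of_real (b * c * xk k)))
     * chi ga (xk k) / Phi_norm ga"

lemma solves_scale: "solves m f \<Longrightarrow> solves m (\<lambda>k. f k / r)"
  unfolding solves_def
proof
  fix k assume h: "\<forall>k. of_real (coeffA a b c (xk k)) * (f (k + 1) - f k) + of_real (coeffB q b c (xk k)) * (f (k - 1) - f k) = m * f k"
  have "of_real (coeffA a b c (xk k)) * (f (k + 1) / r - f k / r) + of_real (coeffB q b c (xk k)) * (f (k - 1) / r - f k / r)
     = (of_real (coeffA a b c (xk k)) * (f (k + 1) - f k) + of_real (coeffB q b c (xk k)) * (f (k - 1) - f k)) / r"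
    by (simp add: diff_divide_distrib[symmetric] add_divide_distrib)
  then show "of_real (coeffA a b c (xk k)) * (f (k + 1) / r - f k / r) + of_real (coeffB q b c (xk k)) * (f (k - 1) / r - f k / r) = m * (f k / r)"
    using h by simp
qed

lemma solves_Phi:
  assumes g: "1 \<le> norm ga" and im: "Im ga \<noteq> 0"
  shows "solves (mu a ga) (Phi ga)"
  unfolding Phi_def
proof (rule solves_scale, unfold solves_def, rule allI)
  fix k
  have g0: "ga \<noteq> 0" using im by auto
  define A B C X u where "A = complex_of_real a" and "B = complex_of_real b" and "C = complex_of_real c"
    and "X = complex_of_real (xk k)" and "u = complex_of_real q"
  have nz: "A \<noteq> 0" "B \<noteq> 0" "C \<noteq> 0" "u \<noteq> 0" using a_pos b_pos c_pos by (auto simp: A_def B_def C_def u_def)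
  define V where "V j = qinf (- complex_of_real (a * b * xk j))" for j
  define D where "D j = qinf (- complex_of_real (b * c * xk j))" for j
  define p where "p = (C / ga) powi (- k)"
  have p1: "(C / ga) powi (- (k + 1)) = p * (ga / C)" "(C / ga) powi (- (k - 1)) = p * (C / ga)"
    using g0 nz by (simp_all add: p_def power_int_diff power_int_add power_int_minus field_simps)
  have Dn: "D j \<noteq> 0" for j using qpoch_inf_pos_arg_nonzero[of "b * c * xk j"] xk_pos b_pos c_pos by (simp add: D_def)
  have V1: "V k = (1 + A * B * X) * V (k + 1)"
    using qpoch_inf_step[of "- complex_of_real (a * b * xk k)"] by (simp add: V_def A_def B_def X_def xk_Suc mult_ac)
  have D1: "D k = (1 + B * C * X) * D (k + 1)"
    using qpoch_inf_step[of "- complex_of_real (b * c * xk k)"] by (simp add: D_def B_def C_def X_def xk_Suc mult_ac)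
  have V2: "u * V (k - 1) = (u + A * B * X) * V k"
    using qpoch_inf_step[of "- complex_of_real (a * b * xk (k - 1))"] nz
    by (simp add: V_def A_def B_def X_def u_def xk_pred field_simps)
  have D2: "u * D (k - 1) = (u + B * C * X) * D k"
    using qpoch_inf_step[of "- complex_of_real (b * c * xk (k - 1))"] nz
    by (simp add: D_def B_def C_def X_def u_def xk_pred field_simps)
  \<comment> \<open>The prefactor moves \<open>1 + a b x\<close> to \<open>1 + b c x\<close> and,
    below, \<open>q + b c x\<close> to \<open>q + a b x\<close>; this converts the coefficients of L
    into those of \<open>chi_eq\<close>.\<close>
  have r1: "(1 + A * B * X) * (V (k + 1) / D (k + 1)) = (1 + B * C * X) * (V k / D k)"
    using V1 D1 Dn[of k] Dn[of "k + 1"] by (simp add: field_simps)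
  have r2: "(u + B * C * X) * (V (k - 1) / D (k - 1)) = (u + A * B * X) * (V k / D k)"
  proof -
    have "u * ((u + B * C * X) * D k * V (k - 1)) = u * ((u + A * B * X) * V k * D (k - 1))"
      using V2 D2 by algebra
    then have "(u + B * C * X) * D k * V (k - 1) = (u + A * B * X) * V k * D (k - 1)"
      by (rule mult_left_cancel[OF nz(4), THEN iffD1])
    then show ?thesis using Dn[of k] Dn[of "k - 1"] by (simp add: field_simps)
  qed
  have ce: "(1 + A * C * X) * (1 + B * C * X) * (ga / C * chi ga (xk (k + 1)))
     + (u + A * B * X) * (1 + X) * (C / ga * chi ga (xk (k - 1))) = eig_coef (mu a ga) X * chi ga (xk k)"
    using chi_eq[OF g im xk_pos[of k]] by (simp add: A_def B_def C_def X_def u_def xk_Suc xk_pred)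
  let ?f = "\<lambda>k. (C / ga) powi (- k) * (V k / D k) * chi ga (xk k)"
  have "(1 + A * B * X) * (1 + A * C * X) * (?f (k + 1) - ?f k) + (u + B * C * X) * (1 + X) * (?f (k - 1) - ?f k)
     = B * C * X * X * mu a ga * ?f k"
  proof -
    have 1: "(1 + A * B * X) * (1 + A * C * X) * ?f (k + 1) = p * (V k / D k) * ((1 + A * C * X) * (1 + B * C * X) * (ga / C * chi ga (xk (k + 1))))"
      unfolding p1 using arg_cong[OF r1, of "\<lambda>y. y * (p * (ga / C) * (1 + A * C * X) * chi ga (xk (k + 1)))"] by (simp only: mult_ac)
    have 2: "(u + B * C * X) * (1 + X) * ?f (k - 1) = p * (V k / D k) * ((u + A * B * X) * (1 + X) * (C / ga * chi ga (xk (k - 1))))"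
      unfolding p1 using arg_cong[OF r2, of "\<lambda>y. y * (p * (C / ga) * (1 + X) * chi ga (xk (k - 1)))"] by (simp only: mult_ac)
    have "(1 + A * B * X) * (1 + A * C * X) * ?f (k + 1) + (u + B * C * X) * (1 + X) * ?f (k - 1) = p * (V k / D k) * (eig_coef (mu a ga) X * chi ga (xk k))"
      unfolding 1 2 ce[symmetric] by (simp only: distrib_left)
    also have "\<dots> = eig_coef (mu a ga) X * ?f k" by (simp only: p_def mult_ac)
    finally have e: "(1 + A * B * X) * (1 + A * C * X) * ?f (k + 1) + (u + B * C * X) * (1 + X) * ?f (k - 1) = eig_coef (mu a ga) X * ?f k" .
    have gen: "P1 * (f1 - f0) + P2 * (f2 - f0) = m * f0" if "P1 * f1 + P2 * f2 = (m + P1 + P2) * f0" for P1 P2 f0 f1 f2 m :: complex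
      using that by algebra
    show ?thesis using e unfolding eig_coef_def A_def[symmetric] B_def[symmetric] C_def[symmetric] u_def[symmetric] by (rule gen)
  qed
  then show "of_real (coeffA a b c (xk k)) * ((of_real c / ga) powi (- (k + 1)) * (qinf (- of_real (a * b * xk (k + 1))) / qinf (- of_real (b * c * xk (k + 1)))) * chi ga (xk (k + 1))
      - (of_real c / ga) powi (- k) * (qinf (- of_real (a * b * xk k)) / qinf (- of_real (b * c * xk k))) * chi ga (xk k))
    + of_real (coeffB q b c (xk k)) * ((of_real c / ga) powi (- (k - 1)) * (qinf (- of_real (a * b * xk (k - 1))) / qinf (- of_real (b * c * xk (k - 1)))) * chi ga (xk (k - 1))
      - (of_real c / ga) powi (- k) * (qinf (- of_real (a * b * xk k)) / qinf (- of_real (b * c * xk k))) * chi ga (xk k))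
    = mu a ga * ((of_real c / ga) powi (- k) * (qinf (- of_real (a * b * xk k)) / qinf (- of_real (b * c * xk k))) * chi ga (xk k))"
    unfolding A_def B_def C_def X_def u_def V_def D_def
    recurrence_iff[OF less_imp_neq[OF xk_pos, symmetric]] .
qed

text \<open>B is positive on the positive half, so the recurrence can be solved for f (k - 1) and
  extends agreement near 0 outwards to large x.\<close>

lemma solves_unique:
  assumes f: "solves m f" and g: "solves m g" and eq: "\<And>k. k0 \<le> k \<Longrightarrow> f k = g k"
  shows "f k = g k"
proof -
  have "f (k0 - int n) = g (k0 - int n)" for n
  proof (induction n rule: less_induct)
    case (less n)
    show ?case
    proof (cases n)
      case (Suc j)
      define k where "k = k0 - int j"
      have k: "k0 - int n = k - 1" by (simp add: k_def Suc)
      have e0: "f k = g k" using less[of j] Suc by (simp add: k_def)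
      have e1: "f (k + 1) = g (k + 1)"
      proof (cases j)
        case 0 then show ?thesis using eq[of "k + 1"] by (simp add: k_def)
      next
        case (Suc i) then show ?thesis using less[of i] \<open>n = Suc j\<close> by (simp add: k_def)
      qed
      have B: "complex_of_real (coeffB q b c (xk k)) \<noteq> 0" using coeffB_pos[OF xk_pos[of k]] by simp
      have "of_real (coeffB q b c (xk k)) * (f (k - 1) - f k) = of_real (coeffB q b c (xk k)) * (g (k - 1) - g k)"
        using f[unfolded solves_def, rule_format, of k] g[unfolded solves_def, rule_format, of k] unfolding e0 e1 by (metis add_left_cancel)
      then show ?thesis using B e0 by (simp add: k)
    qed (use eq in simp)
  qed
  from this[of "nat (k0 - k)"] show ?thesis using eq[of k] by (cases "k0 \<le> k") auto
qed

definition wt :: "real \<Rightarrow> real" where "wt x = (1 - q) * \<bar>x\<bar> / pfun q a b c x"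

lemma qpoch_inf_neg_pos: "0 < y \<Longrightarrow> 0 < qinf (- y :: real)"
  by (rule qpoch_inf_pos) simp

lemma qtheta_neg_pos: "0 < y \<Longrightarrow> 0 < qtheta q (- y :: real)"
  unfolding qtheta_def using qpoch_inf_neg_pos[of y] qpoch_inf_neg_pos[of "q / y"] q_pos by simp

lemma pfun_pos: "0 < x \<Longrightarrow> 0 < pfun q a b c x"
  unfolding pfun_def using a_pos b_pos c_pos q_pos
  by (intro divide_pos_pos mult_pos_pos qpoch_inf_neg_pos)

lemma wt_pos: "0 < x \<Longrightarrow> 0 < wt x"
  using pfun_pos[of x] q_less_1 by (simp add: wt_def)

text \<open>Detailed balance: this is the symmetry of L with respect to the weight, and the reason
  why \<open>Wr\<close> is constant. The nonvanishing conditions guard the quotients in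
  \<open>pfun\<close>.\<close>

lemma wt_balance:
  assumes x: "x \<noteq> 0" and p: "pfun q a b c (q * x) \<noteq> 0" "1 + b * c * x \<noteq> 0" "1 + q * x \<noteq> 0"
    "1 + a * b * x \<noteq> 0" "1 + a * c * x \<noteq> 0"
  shows "coeffA a b c x * wt x = coeffB q b c (q * x) * wt (q * x)"
proof -
  have s: "qinf (- (k * x)) = (1 + k * x) * qinf (- (k * (q * x)))" for k :: real
    using qpoch_inf_step[of "- (k * x)"] by (simp add: mult_ac)
  have pf: "pfun q a b c x * ((1 + b * c * x) * (1 + q * x)) = pfun q a b c (q * x) * ((1 + a * b * x) * (1 + a * c * x))"
    unfolding pfun_def s[of "a * b"] s[of "a * c"] s[of "b * c"] s[of q] using p by simp
  have nz: "pfun q a b c x \<noteq> 0" using pf p by auto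
  have wq: "wt (q * x) * ((1 + b * c * x) * (1 + q * x)) = q * wt x * ((1 + a * b * x) * (1 + a * c * x))"
  proof -
    have "wt (q * x) * ((1 + b * c * x) * (1 + q * x)) = (1 - q) * q * \<bar>x\<bar> * ((1 + b * c * x) * (1 + q * x)) / pfun q a b c (q * x)"
      using q_pos by (simp add: wt_def abs_mult)
    also have "\<dots> = (1 - q) * q * \<bar>x\<bar> * ((1 + a * b * x) * (1 + a * c * x)) / pfun q a b c x"
      using pf nz p(1) by (simp add: frac_eq_eq) (metis mult.commute mult.left_commute)
    finally show ?thesis by (simp add: wt_def)
  qed
  have "coeffB q b c (q * x) = (1 + b * c * x) * (1 + q * x) / (b * c * q * x * x)"
  proof -
    have "q + b * c * (q * x) = q * (1 + b * c * x)" by (simp add: algebra_simps)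
    moreover have "q * Y * Y' / (b * c * (q * x) * (q * x)) = Y * Y' / (b * c * q * x * x)" for Y Y'
      using x b_pos c_pos by (simp add: frac_eq_eq)
    ultimately show ?thesis using x by (subst coeffB_alt) auto
  qed
  then have "coeffB q b c (q * x) * wt (q * x) = (wt (q * x) * ((1 + b * c * x) * (1 + q * x))) / (b * c * q * x * x)"
    by (simp add: mult_ac)
  also have "\<dots> = coeffA a b c x * wt x" unfolding wq coeffA_alt[OF x] by (simp add: mult_ac)
  finally show ?thesis by simp
qed

text \<open>The weight of the bond between neighbouring points x_(k-1) and x_k; the next lemma
  expresses the same number from the other end.\<close>

definition J :: "int \<Rightarrow> real" where "J k = coeffB q b c (xk k) * wt (xk k)"

lemma J_Suc: "J (k + 1) = coeffA a b c (xk k) * wt (xk k)"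
proof -
  have x: "0 < xk k" by (rule xk_pos)
  have "0 < b * c * xk k" "0 < q * xk k" "0 < a * b * xk k" "0 < a * c * xk k"
    using x a_pos b_pos c_pos q_pos by simp_all
  then show ?thesis unfolding J_def xk_Suc
    using pfun_pos[of "q * xk k"] x by (intro wt_balance[symmetric]) auto
qed

definition Wr :: "(int \<Rightarrow> complex) \<Rightarrow> (int \<Rightarrow> complex) \<Rightarrow> int \<Rightarrow> complex" where
  "Wr f g k = of_real (J k) * (f k * g (k - 1) - f (k - 1) * g k)"

lemma Wr_Suc:
  assumes "solves m f" "solves m g" shows "Wr f g (k + 1) = Wr f g k"
proof -
  let ?A = "complex_of_real (coeffA a b c (xk k))" and ?B = "complex_of_real (coeffB q b c (xk k))" and ?w = "complex_of_real (wt (xk k))"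
  have f: "?A * (f (k + 1) - f k) + ?B * (f (k - 1) - f k) = m * f k"
    and g: "?A * (g (k + 1) - g k) + ?B * (g (k - 1) - g k) = m * g k"
    using assms unfolding solves_def by blast+
  have "?A * (f (k + 1) * g k - f k * g (k + 1)) = ?B * (f k * g (k - 1) - f (k - 1) * g k)"
    using f g by algebra
  then show ?thesis unfolding Wr_def J_Suc by (simp add: J_def)
qed

lemma Wr_const:
  assumes "solves m f" "solves m g" shows "Wr f g k = Wr f g l"
proof -
  have "Wr f g (l + int n) = Wr f g l" for n l
  proof (induction n)
    case (Suc n) then show ?case using Wr_Suc[OF assms, of "l + int n"] by (simp add: algebra_simps)
  qed simp
  from this[of l "nat (k - l)"] this[of k "nat (l - k)"] show ?thesis by (cases "l \<le> k") auto
qed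

text \<open>Constancy allows evaluation far out, where f behaves like lf r^n and g like lg s^n. The
  relation r s = a^2 cancels the decay of J, and the determinant leaves s - r.\<close>

lemma Wr_LIMSEQ:
  assumes s: "solves m f" "solves m g"
    and f: "(\<lambda>n. f (- int n) / r ^ n) \<longlonglongrightarrow> lf" and g: "(\<lambda>n. g (- int n) / s ^ n) \<longlonglongrightarrow> lg"
    and J: "(\<lambda>n. J (- int n) * a ^ (2 * n)) \<longlonglongrightarrow> K" and rs: "r * s = of_real a ^ 2" "r \<noteq> 0" "s \<noteq> 0"
  shows "Wr f g k = of_real K * lf * lg * (s - r)"
proof -
  have eq: "Wr f g (- int n) = of_real (J (- int n) * a ^ (2 * n)) *
      (f (- int n) / r ^ n * (g (- int (Suc n)) / s ^ Suc n * s) - f (- int (Suc n)) / r ^ Suc n * r * (g (- int n) / s ^ n))" for n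
  proof -
    have a2: "complex_of_real (a ^ (2 * n)) = r ^ n * s ^ n" using rs(1) by (simp add: power_mult power_mult_distrib[symmetric])
    have i: "- int n - 1 = - int (Suc n)" by simp
    show ?thesis unfolding Wr_def i of_real_mult[of "J _"] a2 using rs(2,3) by (simp add: field_simps)
  qed
  have "(\<lambda>n. Wr f g (- int n)) \<longlonglongrightarrow> of_real K * (lf * (lg * s) - lf * r * lg)"
    unfolding eq using LIMSEQ_Suc[OF f] LIMSEQ_Suc[OF g]
    by (intro tendsto_mult tendsto_diff tendsto_of_real J f g tendsto_const)
  moreover have "Wr f g (- int n) = Wr f g k" for n by (rule Wr_const[OF s])
  ultimately have "(\<lambda>n::nat. Wr f g k) \<longlonglongrightarrow> of_real K * (lf * (lg * s) - lf * r * lg)" by simp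
  then have "Wr f g k = of_real K * (lf * (lg * s) - lf * r * lg)" by (simp add: LIMSEQ_const_iff)
  then show ?thesis by (simp add: algebra_simps)
qed

lemma qpoch_inf_xk:
  assumes "0 < k"
  shows "qinf (- complex_of_real (k * xk (- int n)))
     = qinf (- of_real (k * z)) * qpoch q (- (of_real q / of_real (k * z))) n * of_real (k * z) ^ n * tri n"
  using qpoch_inf_shift[of "of_real (k * z)" n] assms z_pos by (simp add: xk_neg)

lemma qtheta_neg:
  assumes "0 < y"
  shows "complex_of_real (qtheta q (- y)) = qinf (- of_real y) * qinf (- (of_real q / of_real y))"
  unfolding qtheta_def of_real_mult qpoch_inf_of_real[symmetric] by simp

text \<open>The origin of K. Each infinite product at z q^(-n) is the product at z times a finite
  product whose limit completes a theta function; the remaining powers combine to a^(-2n), and B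
  tends to 1.\<close>

lemma J_LIMSEQ: "(\<lambda>n. J (- int n) * a ^ (2 * n)) \<longlonglongrightarrow> Kconst q z a b c"
proof -
  define P where "P k n = qpoch q (- (of_real q / complex_of_real (k * z))) n" for k n
  define I where "I k = qinf (- complex_of_real (k * z))" for k
  have pos: "0 < a * b" "0 < a * c" "0 < b * c" "0 < q" using a_pos b_pos c_pos q_pos by simp_all
  have In: "I k \<noteq> 0" if "0 < k" for k unfolding I_def using that z_pos by (intro qpoch_inf_pos_arg_nonzero) simp
  have Pn: "P k n \<noteq> 0" if "0 < k" for k n
    using norm_qpoch_neg_ge_1[of "q / (k * z)" n] that z_pos q_pos by (auto simp: P_def)
  have Pl: "P k \<longlonglongrightarrow> qinf (- (of_real q / complex_of_real (k * z)))" for k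
    unfolding P_def by (rule qpoch_LIMSEQ)
  have w: "complex_of_real (wt (xk (- int n)) * a ^ (2 * n)) = of_real ((1 - q) * z) * (I (b * c) * P (b * c) n * (I q * P q n)) / (I (a * b) * P (a * b) n * (I (a * c) * P (a * c) n))" for n
  proof -
    define Q where "Q k = qinf (- complex_of_real (k * xk (- int n)))" for k
    have Q: "Q k = I k * P k n * of_real (k * z) ^ n * tri n" if "0 < k" for k
      unfolding Q_def I_def P_def by (rule qpoch_inf_xk[OF that])
    have "complex_of_real (wt (xk (- int n))) = of_real ((1 - q) * (z / q ^ n)) * (Q (b * c) * Q q) / (Q (a * b) * Q (a * c))"
    proof -
      have qr: "complex_of_real (qinf (- (k * xk (- int n)))) = Q k" for k
        unfolding Q_def qpoch_inf_of_real[symmetric] by simp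
      have ab: "\<bar>xk (- int n)\<bar> = z / q ^ n"
        by (rule trans[OF abs_of_pos[OF xk_pos] xk_neg])
      show ?thesis unfolding wt_def pfun_def ab of_real_divide of_real_mult qr by simp
    qed
    also have "Q (b * c) * Q q = I (b * c) * P (b * c) n * (I q * P q n) * (of_real (b * c * z) * of_real (q * z)) ^ n * (tri n * tri n)"
      unfolding Q[OF pos(3)] Q[OF pos(4)] by (simp only: power_mult_distrib mult_ac)
    also have "Q (a * b) * Q (a * c) = I (a * b) * P (a * b) n * (I (a * c) * P (a * c) n) * (of_real (a * b * z) * of_real (a * c * z)) ^ n * (tri n * tri n)"
      unfolding Q[OF pos(1)] Q[OF pos(2)] by (simp only: power_mult_distrib mult_ac)
    also have "complex_of_real ((1 - q) * (z / q ^ n)) * (I (b * c) * P (b * c) n * (I q * P q n) * (of_real (b * c * z) * of_real (q * z)) ^ n * (tri n * tri n))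
        / (I (a * b) * P (a * b) n * (I (a * c) * P (a * c) n) * (of_real (a * b * z) * of_real (a * c * z)) ^ n * (tri n * tri n))
      = of_real ((1 - q) * z) * (I (b * c) * P (b * c) n * (I q * P q n)) / (I (a * b) * P (a * b) n * (I (a * c) * P (a * c) n))
        * (of_real (b * c * z) * of_real (q * z)) ^ n / ((of_real (a * b * z) * of_real (a * c * z)) ^ n * of_real q ^ n)"
    proof -
      have gen: "w / un * (N * x * (t * t)) / (M * y * (t * t)) = w * N / M * x / (y * un)"
        if "t \<noteq> 0" for w un N x t M y :: complex
        using that by (simp add: mult_ac)
      have "complex_of_real ((1 - q) * (z / q ^ n)) = of_real ((1 - q) * z) / of_real q ^ n" by simp
      then show ?thesis by (simp only: gen[OF tri_nonzero])
    qed
    also have "\<dots> = of_real ((1 - q) * z) * (I (b * c) * P (b * c) n * (I q * P q n)) / (I (a * b) * P (a * b) n * (I (a * c) * P (a * c) n)) / of_real (a ^ (2 * n))"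
    proof -
      \<comment> \<open>The rate comes from (a b z)(a c z) q = (b c z)(q z) a^2.\<close>
      have "(complex_of_real (a * b * z) * of_real (a * c * z)) ^ n * of_real q ^ n = (of_real (b * c * z) * of_real (q * z)) ^ n * of_real (a ^ (2 * n))"
        unfolding power_mult_distrib[symmetric] of_real_power power_mult
        by (simp add: power_mult_distrib[symmetric] power2_eq_square mult_ac)
      moreover have "(complex_of_real (b * c * z) * of_real (q * z)) ^ n \<noteq> 0" using b_pos c_pos z_pos by simp
      moreover have "R * x / y = R / s" if "y = x * s" "x \<noteq> 0" for R x y s :: complex using that by simp
      ultimately show ?thesis by blast
    qed
    finally have f: "complex_of_real (wt (xk (- int n))) = of_real ((1 - q) * z) * (I (b * c) * P (b * c) n * (I q * P q n)) / (I (a * b) * P (a * b) n * (I (a * c) * P (a * c) n)) / of_real (a ^ (2 * n))" .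
    have "complex_of_real (a ^ (2 * n)) \<noteq> 0" using a_pos by simp
    then have "R / of_real (a ^ (2 * n)) * of_real (a ^ (2 * n)) = R" for R :: complex by (metis nonzero_eq_divide_eq)
    then show ?thesis unfolding of_real_mult[of "wt (xk (- int n))"] f .
  qed
  have "(\<lambda>n. complex_of_real (wt (xk (- int n)) * a ^ (2 * n))) \<longlonglongrightarrow> of_real ((1 - q) * z) *
     (I (b * c) * qinf (- (of_real q / complex_of_real (b * c * z))) * (I q * qinf (- (of_real q / complex_of_real (q * z)))))
     / (I (a * b) * qinf (- (of_real q / complex_of_real (a * b * z))) * (I (a * c) * qinf (- (of_real q / complex_of_real (a * c * z)))))"
  proof -
    have "qinf (- (of_real q / complex_of_real (k * z))) \<noteq> 0" if "0 < k" for k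
      using qpoch_inf_pos_arg_nonzero[of "q / (k * z)"] that q_pos z_pos by simp
    then show ?thesis unfolding w
      using In pos by (intro tendsto_divide tendsto_mult tendsto_const Pl) (auto simp del: of_real_mult)
  qed
  also have "of_real ((1 - q) * z) *
     (I (b * c) * qinf (- (of_real q / complex_of_real (b * c * z))) * (I q * qinf (- (of_real q / complex_of_real (q * z)))))
     / (I (a * b) * qinf (- (of_real q / complex_of_real (a * b * z))) * (I (a * c) * qinf (- (of_real q / complex_of_real (a * c * z)))))
     = complex_of_real (Kconst q z a b c)"
    unfolding Kconst_def of_real_divide of_real_mult[of "(1 - q) * z"] of_real_mult[of "qtheta _ _"]
    using z_pos pos by (simp only: I_def qtheta_neg mult_pos_pos)
  finally have wl: "(\<lambda>n. wt (xk (- int n)) * a ^ (2 * n)) \<longlonglongrightarrow> Kconst q z a b c" unfolding tendsto_of_real_iff .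
  have "(\<lambda>n. 1 / xk (- int n)) \<longlonglongrightarrow> 0"
    using tendsto_mult[OF q_power_LIMSEQ tendsto_const[of "1 / z"]] by (simp add: xk_neg)
  then have "(\<lambda>n. (1 + q / (b * c) * (1 / xk (- int n))) * (1 + 1 / xk (- int n))) \<longlonglongrightarrow> (1 + q / (b * c) * 0) * (1 + 0)"
    by (intro tendsto_intros)
  then have bl: "(\<lambda>n. coeffB q b c (xk (- int n))) \<longlonglongrightarrow> 1" unfolding coeffB_def by simp
  show ?thesis using tendsto_mult[OF bl wl] unfolding J_def by (simp add: mult.assoc)
qed

lemma Kconst_pos: "0 < Kconst q z a b c"
  unfolding Kconst_def using q_less_1 q_pos z_pos a_pos b_pos c_pos
  by (intro divide_pos_pos mult_pos_pos qtheta_neg_pos) auto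

lemma Phi_norm_nonzero:
  assumes g: "1 \<le> norm ga" shows "Phi_norm ga \<noteq> 0"
proof -
  have lt: "norm y < 1 \<Longrightarrow> qinf y \<noteq> 0" for y :: complex
  proof -
    assume y: "norm y < 1"
    have "y * of_real q ^ i \<noteq> 1" for i
    proof -
      have "norm (y * of_real q ^ i) \<le> norm y * 1"
        unfolding norm_mult norm_power using q_pos q_less_1 by (intro mult_left_mono power_le_one) auto
      then show ?thesis using y by auto
    qed
    then show ?thesis unfolding qpoch_inf_eq_0_iff by blast
  qed
  have "1 \<le> norm (ga^2)" using g by (simp add: norm_power)
  then have 1: "norm (complex_of_real q / ga^2) < 1"
    using q_pos q_less_1 by (simp add: norm_divide divide_less_eq)
  have 2: "norm (complex_of_real c / ga) < 1" using g c_less_1 c_pos by (simp add: norm_divide divide_less_eq)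
  have "0 < qtheta q (- (a * b * z))" "0 < qtheta q (- (b * c * z))" using a_pos b_pos c_pos z_pos by (auto intro!: qtheta_neg_pos)
  then show ?thesis unfolding Phi_norm_def using lt[OF 1] lt[OF 2] by simp
qed

text \<open>The limit of \<open>chi\<close> is a q-binomial series, since \<open>bet\<close> tends
  to 1; the majorant in m is uniform in n because c < 1 and norm ga is at least 1.\<close>

lemma Phi_LIMSEQ:
  assumes g: "1 \<le> norm ga" and im: "Im ga \<noteq> 0"
  shows "(\<lambda>n. Phi ga (- int n) / (of_real a / ga) ^ n) \<longlonglongrightarrow> 1"
proof -
  define P where "P k n = qpoch q (- (of_real q / complex_of_real (k * z))) n" for k n
  define I where "I k = qinf (- complex_of_real (k * z))" for k
  have g0: "ga \<noteq> 0" using im by auto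
  have pos: "0 < a * b" "0 < b * c" using a_pos b_pos c_pos by simp_all
  have In: "I k \<noteq> 0" if "0 < k" for k unfolding I_def using that z_pos by (intro qpoch_inf_pos_arg_nonzero) simp
  have Pl: "P k \<longlonglongrightarrow> qinf (- (of_real q / complex_of_real (k * z)))" for k
    unfolding P_def by (rule qpoch_LIMSEQ)
  have Pn: "qinf (- (of_real q / complex_of_real (k * z))) \<noteq> 0" if "0 < k" for k
    using qpoch_inf_pos_arg_nonzero[of "q / (k * z)"] that q_pos z_pos by simp
  have eq: "Phi ga (- int n) / (of_real a / ga) ^ n = I (a * b) * P (a * b) n / (I (b * c) * P (b * c) n) * chi ga (xk (- int n)) / Phi_norm ga" for n
  proof -
    have quot: "i * p * y * t / (i' * p' * y' * t) = i * p / (i' * p') * (y / y')" if "t \<noteq> 0" for i p y t i' p' y' :: complex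
      using that by simp
    have "(complex_of_real (a * b * z)) ^ n / complex_of_real (b * c * z) ^ n = (of_real a / of_real c) ^ n"
      using b_pos z_pos by (simp add: power_divide[symmetric])
    then have r: "qinf (- of_real (a * b * xk (- int n))) / qinf (- of_real (b * c * xk (- int n)))
       = I (a * b) * P (a * b) n / (I (b * c) * P (b * c) n) * (of_real a / of_real c) ^ n"
      unfolding qpoch_inf_xk[OF pos(1)] qpoch_inf_xk[OF pos(2)] I_def[symmetric] P_def[symmetric]
      by (metis quot[OF tri_nonzero])
    have "(of_real c / ga) powi (- (- int n)) * (of_real a / of_real c) ^ n = (of_real a / ga) ^ n"
      using c_pos by (simp add: power_mult_distrib[symmetric])
    then have "Phi ga (- int n) = I (a * b) * P (a * b) n / (I (b * c) * P (b * c) n) * chi ga (xk (- int n)) / Phi_norm ga * (of_real a / ga) ^ n"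
      unfolding Phi_def r by (simp add: mult_ac)
    then show ?thesis using a_pos g0 by simp
  qed
  have "(\<lambda>n. chi ga (xk (- int n))) \<longlonglongrightarrow> (\<Sum>m. chi_coef ga m * (of_real c / ga) ^ m)"
    unfolding chi_def
  proof (rule tannery_seq)
    show "(\<lambda>n. chi_term ga (xk (- int n)) m) \<longlonglongrightarrow> chi_coef ga m * (of_real c / ga) ^ m" for m
    proof -
      have "(\<lambda>n. q ^ m / z * q ^ n) \<longlonglongrightarrow> q ^ m / z * 0" by (intro tendsto_intros q_power_LIMSEQ)
      then have "(\<lambda>n. q ^ m / xk (- int n)) \<longlonglongrightarrow> 0" by (simp add: xk_neg)
      then have "(\<lambda>n. bet ga (q ^ m / xk (- int n))) \<longlonglongrightarrow> bet ga 0" by (rule tendsto_bet) simp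
      then have "(\<lambda>n. chi_coef ga m * ((of_real c / ga) ^ m * bet ga (q ^ m / xk (- int n)))) \<longlonglongrightarrow> chi_coef ga m * ((of_real c / ga) ^ m * bet ga 0)"
        by (intro tendsto_mult tendsto_const)
      then show ?thesis by (simp add: chi_term_def)
    qed
    show "norm (chi_term ga (xk (- int n)) m) \<le> chi_bound (1 / z) * c ^ m" for n m
    proof (rule chi_term_bound[OF g xk_pos])
      show "1 / xk (- int n) \<le> 1 / z" unfolding xk_neg using z_pos q_pos q_less_1 by (simp add: divide_right_mono power_le_one)
    qed
  qed (rule summable_c)
  moreover have "(\<Sum>m. chi_coef ga m * (of_real c / ga) ^ m) = qinf (of_real q / ga^2) / qinf (of_real c / ga)"
  proof -
    have lt: "norm (complex_of_real c / ga) < 1" using g c_less_1 c_pos by (simp add: norm_divide divide_less_eq)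
    have "of_real (q / c) / ga * (of_real c / ga) = of_real q / ga^2" using c_pos by (simp add: power2_eq_square)
    then show ?thesis unfolding chi_coef_def q_binomial[OF lt] by simp
  qed
  ultimately have cl: "(\<lambda>n. chi ga (xk (- int n))) \<longlonglongrightarrow> qinf (of_real q / ga^2) / qinf (of_real c / ga)" by simp
  have "(\<lambda>n. I (a * b) * P (a * b) n / (I (b * c) * P (b * c) n) * chi ga (xk (- int n)) / Phi_norm ga) \<longlonglongrightarrow>
     I (a * b) * qinf (- (of_real q / complex_of_real (a * b * z))) / (I (b * c) * qinf (- (of_real q / complex_of_real (b * c * z))))
      * (qinf (of_real q / ga^2) / qinf (of_real c / ga)) / Phi_norm ga"
  proof -
    have "Phi_norm ga \<noteq> 0" by (rule Phi_norm_nonzero[OF g])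
    then show ?thesis using In[OF pos(2)] Pn[OF pos(2)] by (intro tendsto_divide tendsto_mult tendsto_const Pl cl) auto
  qed
  also have "I (a * b) * qinf (- (of_real q / complex_of_real (a * b * z))) / (I (b * c) * qinf (- (of_real q / complex_of_real (b * c * z))))
      * (qinf (of_real q / ga^2) / qinf (of_real c / ga)) = Phi_norm ga"
    unfolding Phi_norm_def I_def using pos z_pos by (simp only: qtheta_neg mult_pos_pos mult.commute)
  finally show ?thesis unfolding eq using Phi_norm_nonzero[OF g] by simp
qed

end

section \<open>Asymptotics of the regular solution at infinity\<close>

context big_q begin

text \<open>The k-th term of the series at z q^(-n), divided by the expected growth (a ga)^n and by
  the denominator of \<open>psi\<close>.\<close>

definition psi_ratio :: "complex \<Rightarrow> nat \<Rightarrow> nat \<Rightarrow> complex" where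
  "psi_ratio ga n k = psi_term ga (of_real (xk (- int n))) k
     / (qinf (- (of_real b * of_real c * of_real (xk (- int n)))) * (of_real a * ga) ^ n)"

context
  fixes ga :: complex and A B C Z u Y1 Y2 Y3 :: complex
  assumes g0: "ga \<noteq> 0"
  defines "A \<equiv> complex_of_real a" and "B \<equiv> complex_of_real b" and "C \<equiv> complex_of_real c"
    and "Z \<equiv> complex_of_real z" and "u \<equiv> complex_of_real q"
    and "Y1 \<equiv> complex_of_real a * of_real b * of_real z"
    and "Y2 \<equiv> complex_of_real a * of_real b * of_real c * ga * of_real z"
    and "Y3 \<equiv> complex_of_real b * of_real c * of_real z"
begin

lemma Y_nonzero: "Y1 \<noteq> 0" "Y2 \<noteq> 0" "Y3 \<noteq> 0" "C \<noteq> 0" "A \<noteq> 0"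
  using a_pos b_pos c_pos z_pos g0 by (auto simp: Y1_def Y2_def Y3_def C_def A_def)

lemma Y_pos: "Y1 = of_real (a * b * z)" "Y3 = of_real (b * c * z)" "0 < a * b * z" "0 < b * c * z"
  using a_pos b_pos c_pos z_pos by (auto simp: Y1_def Y3_def)

text \<open>For n = k + m every infinite product is shifted back to the argument at z, and the
  powers and \<open>tri\<close> factors cancel. As \<open>psi_coef\<close> decays like (c / ga)^k,
  the term is of size ga^(-2k).\<close>

lemma psi_ratio_le:
  "psi_ratio ga (k + m) k = psi_coef ga k * (1 / (C * ga)) ^ k
     * (qpoch q (- (u / Y1)) (k + m) / qpoch q (- (u / Y1)) m * (qinf (- Y2) * qpoch q (- (u / Y2)) m)
        / (qinf (- Y3) * qpoch q (- (u / Y3)) (k + m)))"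
proof -
  define n where "n = k + m"
  have x: "complex_of_real (xk (- int n)) = Z / u ^ n" by (simp add: xk_neg Z_def u_def)
  have u0: "u \<noteq> 0" by (simp add: u_def)
  have y1: "- (of_real a * of_real b * (Z / u ^ n)) = - (Y1 / u ^ n)" by (simp add: Y1_def Z_def)
  have y2: "- (of_real a * of_real b * of_real c * ga * (Z / u ^ n)) * u ^ k = - (Y2 / u ^ m)"
    using u0 by (simp add: Y2_def Z_def n_def power_add)
  have y3: "- (of_real b * of_real c * (Z / u ^ n)) = - (Y3 / u ^ n)" by (simp add: Y3_def Z_def)
  have s1: "qinf (- (Y1 / u ^ j)) = qinf (- Y1) * qpoch q (- (u / Y1)) j * Y1 ^ j * tri j" for j
    unfolding u_def by (rule qpoch_inf_shift[OF Y_nonzero(1)])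
  have s2: "qinf (- (Y2 / u ^ j)) = qinf (- Y2) * qpoch q (- (u / Y2)) j * Y2 ^ j * tri j" for j
    unfolding u_def by (rule qpoch_inf_shift[OF Y_nonzero(2)])
  have s3: "qinf (- (Y3 / u ^ j)) = qinf (- Y3) * qpoch q (- (u / Y3)) j * Y3 ^ j * tri j" for j
    unfolding u_def by (rule qpoch_inf_shift[OF Y_nonzero(3)])
  have nzI: "qinf (- Y1) \<noteq> 0" "qinf (- Y3) \<noteq> 0"
    unfolding Y_pos(1,2) using Y_pos(3,4) by (auto intro!: qpoch_inf_pos_arg_nonzero simp del: of_real_mult)
  have nzP: "qpoch q (- (u / Y1)) j \<noteq> 0" "qpoch q (- (u / Y3)) j \<noteq> 0" for j
    using norm_qpoch_neg_ge_1[of "q / (a * b * z)" j] norm_qpoch_neg_ge_1[of "q / (b * c * z)" j] Y_pos(3,4) q_pos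
    unfolding Y_pos(1,2) u_def by auto
  have q1: "qpoch q (- (Y1 / u ^ n)) k * (qinf (- Y1) * qpoch q (- (u / Y1)) m * Y1 ^ m * tri m)
     = qinf (- Y1) * qpoch q (- (u / Y1)) n * Y1 ^ n * tri n"
  proof -
    have e: "- (Y1 / u ^ n) * u ^ k = - (Y1 / u ^ m)" using u0 by (simp add: n_def power_add)
    have "qinf (- (Y1 / u ^ n)) = qpoch q (- (Y1 / u ^ n)) k * qinf (- (Y1 / u ^ n) * u ^ k)"
      unfolding u_def by (rule qpoch_inf_split)
    then show ?thesis unfolding e s1 by (rule sym)
  qed
  have tn: "tri j \<noteq> 0" for j by (rule tri_nonzero)
  have q1': "qpoch q (- (Y1 / u ^ n)) k = qpoch q (- (u / Y1)) n / qpoch q (- (u / Y1)) m * Y1 ^ k * (tri n / tri m)"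
  proof -
    have "qpoch q (- (Y1 / u ^ n)) k * (qpoch q (- (u / Y1)) m * tri m) * (qinf (- Y1) * Y1 ^ m)
       = (qpoch q (- (u / Y1)) n * Y1 ^ k * tri n) * (qinf (- Y1) * Y1 ^ m)"
      using q1 by (simp add: n_def power_add mult_ac)
    then have "qpoch q (- (Y1 / u ^ n)) k * (qpoch q (- (u / Y1)) m * tri m) = qpoch q (- (u / Y1)) n * Y1 ^ k * tri n"
      using nzI Y_nonzero by simp
    then show ?thesis using nzP(1)[of m] tn[of m] by (simp add: field_simps)
  qed
  have pw: "Y1 ^ k * Y2 ^ m = Y3 ^ n * (A * ga) ^ n * (1 / (C * ga)) ^ k"
  proof -
    have e1: "Y1 = Y3 * (A * ga) * (1 / (C * ga))" and e2: "Y2 = Y3 * (A * ga)"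
      using g0 Y_nonzero by (auto simp: Y1_def Y2_def Y3_def A_def C_def)
    show ?thesis unfolding e1 e2 n_def power_add power_mult_distrib by (simp only: mult_ac)
  qed
  have "psi_ratio ga n k = psi_coef ga k * (qpoch q (- (u / Y1)) n / qpoch q (- (u / Y1)) m * Y1 ^ k * (tri n / tri m))
     * (qinf (- Y2) * qpoch q (- (u / Y2)) m * Y2 ^ m * tri m)
     / (qinf (- Y3) * qpoch q (- (u / Y3)) n * Y3 ^ n * tri n * (A * ga) ^ n)"
    unfolding psi_ratio_def psi_term_def x y1 u_def[symmetric] y2 y3 s2 s3 q1' A_def ..
  also have "\<dots> = psi_coef ga k * (qpoch q (- (u / Y1)) n / qpoch q (- (u / Y1)) m * (qinf (- Y2) * qpoch q (- (u / Y2)) m)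
        / (qinf (- Y3) * qpoch q (- (u / Y3)) n)) * (Y1 ^ k * Y2 ^ m) / (Y3 ^ n * (A * ga) ^ n)"
    using tn[of n] tn[of m] by (simp add: mult_ac)
  also have "\<dots> = psi_coef ga k * (1 / (C * ga)) ^ k
     * (qpoch q (- (u / Y1)) n / qpoch q (- (u / Y1)) m * (qinf (- Y2) * qpoch q (- (u / Y2)) m)
        / (qinf (- Y3) * qpoch q (- (u / Y3)) n))"
  proof -
    have "Y3 ^ n * (A * ga) ^ n \<noteq> 0" using Y_nonzero g0 by simp
    moreover have "X * R * (D * K) / D = X * K * R" if "D \<noteq> 0" for X R D K :: complex using that by simp
    ultimately show ?thesis unfolding pw by blast
  qed
  finally show ?thesis by (simp only: n_def)
qed

text \<open>For k = n + m the finite product crosses the index at which its argument falls back to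
  z; it is split there, since only its first n factors grow.\<close>

lemma psi_ratio_gt:
  "psi_ratio ga n (n + m) = psi_coef ga (n + m) * (1 / (C * ga)) ^ n
     * (qpoch q (- (u / Y1)) n * qpoch q (- Y1) m * qinf (- (Y2 * u ^ m))
        / (qinf (- Y3) * qpoch q (- (u / Y3)) n))"
proof -
  have x: "complex_of_real (xk (- int n)) = Z / u ^ n" by (simp add: xk_neg Z_def u_def)
  have u0: "u \<noteq> 0" by (simp add: u_def)
  have y1: "- (of_real a * of_real b * (Z / u ^ n)) = - (Y1 / u ^ n)" by (simp add: Y1_def Z_def)
  have y2: "- (of_real a * of_real b * of_real c * ga * (Z / u ^ n)) * u ^ (n + m) = - (Y2 * u ^ m)"
    using u0 by (simp add: Y2_def Z_def power_add)
  have y3: "- (of_real b * of_real c * (Z / u ^ n)) = - (Y3 / u ^ n)" by (simp add: Y3_def Z_def)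
  have s1: "qinf (- (Y1 / u ^ j)) = qinf (- Y1) * qpoch q (- (u / Y1)) j * Y1 ^ j * tri j" for j
    unfolding u_def by (rule qpoch_inf_shift[OF Y_nonzero(1)])
  have s3: "qinf (- (Y3 / u ^ j)) = qinf (- Y3) * qpoch q (- (u / Y3)) j * Y3 ^ j * tri j" for j
    unfolding u_def by (rule qpoch_inf_shift[OF Y_nonzero(3)])
  have nzI: "qinf (- Y1) \<noteq> 0"
    unfolding Y_pos(1,2) using Y_pos(3,4) by (auto intro!: qpoch_inf_pos_arg_nonzero simp del: of_real_mult)
  have e: "- (Y1 / u ^ n) * u ^ n = - Y1" using u0 by simp
  have q0: "qpoch q (- (Y1 / u ^ n)) n = qpoch q (- (u / Y1)) n * Y1 ^ n * tri n"
    using qpoch_inf_split[of "- (Y1 / u ^ n)" n] nzI unfolding s1 u_def[symmetric] e by (simp add: mult.assoc)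
  have q1: "qpoch q (- (Y1 / u ^ n)) (n + m) = qpoch q (- (u / Y1)) n * Y1 ^ n * tri n * qpoch q (- Y1) m"
    unfolding qpoch_add u_def[symmetric] e q0 ..
  have pw: "Y1 ^ n = Y3 ^ n * (A * ga) ^ n * (1 / (C * ga)) ^ n"
  proof -
    have e1: "Y1 = Y3 * (A * ga) * (1 / (C * ga))"
      using g0 Y_nonzero by (auto simp: Y1_def Y2_def Y3_def A_def C_def)
    show ?thesis unfolding e1 power_mult_distrib by (simp only: mult_ac)
  qed
  have tn: "tri n \<noteq> 0" by (rule tri_nonzero)
  have "psi_ratio ga n (n + m) = psi_coef ga (n + m) * (qpoch q (- (u / Y1)) n * Y1 ^ n * tri n * qpoch q (- Y1) m) * qinf (- (Y2 * u ^ m))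
     / (qinf (- Y3) * qpoch q (- (u / Y3)) n * Y3 ^ n * tri n * (A * ga) ^ n)"
    unfolding psi_ratio_def psi_term_def x y1 u_def[symmetric] y2 y3 s3 q1 A_def ..
  also have "\<dots> = psi_coef ga (n + m) * (qpoch q (- (u / Y1)) n * qpoch q (- Y1) m * qinf (- (Y2 * u ^ m))
        / (qinf (- Y3) * qpoch q (- (u / Y3)) n)) * Y1 ^ n / (Y3 ^ n * (A * ga) ^ n)"
    using tn by (simp add: mult_ac)
  also have "\<dots> = psi_coef ga (n + m) * (1 / (C * ga)) ^ n
     * (qpoch q (- (u / Y1)) n * qpoch q (- Y1) m * qinf (- (Y2 * u ^ m))
        / (qinf (- Y3) * qpoch q (- (u / Y3)) n))"
  proof -
    have "Y3 ^ n * (A * ga) ^ n \<noteq> 0" using Y_nonzero g0 by simp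
    moreover have "X * R * (D * K) / D = X * K * R" if "D \<noteq> 0" for X R D K :: complex using that by simp
    ultimately show ?thesis unfolding pw by blast
  qed
  finally show ?thesis .
qed

text \<open>One majorant for both regimes, independent of n: ga^(-2k) dominates the terms with k <=
  n, and the sum of the two geometric terms dominates the others.\<close>

lemma psi_ratio_bound:
  obtains M where "\<And>n k. norm (psi_ratio ga n k) \<le> M * ((1 / norm ga ^ 2) ^ k + (c / norm ga) ^ k)"
proof -
  define r where "r = norm ga"
  have r: "0 < r" using g0 by (simp add: r_def)
  define K where "K = psi_coef_bound r"
  have K: "0 \<le> K" unfolding K_def using r by (intro psi_coef_bound_nonneg) simp
  define P1 P2 N1 N2 where "P1 = qinf (- norm (u / Y1))" and "P2 = qinf (- norm (u / Y2))"
    and "N1 = qinf (- norm Y1)" and "N2 = qinf (- norm Y2)"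
  have P: "1 \<le> P1" "1 \<le> P2" "1 \<le> N1" "1 \<le> N2"
    by (simp_all add: P1_def P2_def N1_def N2_def qpoch_inf_neg_ge_1)
  have g1: "1 \<le> norm (qpoch q (- (u / Y1)) j)" "1 \<le> norm (qpoch q (- (u / Y3)) j)" "1 \<le> norm (qinf (- Y3))" for j
    using norm_qpoch_neg_ge_1[of "q / (a * b * z)" j] norm_qpoch_neg_ge_1[of "q / (b * c * z)" j]
      norm_qpoch_inf_neg_ge_1[of "b * c * z"] Y_pos(3,4) q_pos
    unfolding Y_pos(1,2) u_def by auto
  have b1: "norm (qpoch q (- (u / Y1)) j) \<le> P1" "norm (qpoch q (- (u / Y2)) j) \<le> P2" "norm (qpoch q (- Y1) j) \<le> N1"
     "norm (qinf (- Y2)) \<le> N2" for j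
    unfolding P1_def P2_def N1_def N2_def by (intro norm_qpoch_le_inf norm_qpoch_inf_le, simp)+
  have b2: "norm (qinf (- (Y2 * u ^ m))) \<le> N2" for m
  proof -
    have "norm (Y2 * u ^ m) \<le> norm Y2 * 1"
      unfolding norm_mult norm_power u_def using q_pos q_less_1 by (intro mult_left_mono power_le_one) auto
    then show ?thesis unfolding N2_def by (intro norm_qpoch_inf_le) simp
  qed
  define M where "M = K * (P1 * (N2 * P2) + P1 * N1 * N2)"
  have nC: "norm (1 / (C * ga)) = 1 / (c * r)" using c_pos by (simp add: norm_divide norm_mult C_def r_def)
  have cr: "c / r * (1 / (c * r)) = 1 / r ^ 2" using c_pos r by (simp add: power2_eq_square)
  have M0: "0 \<le> P1 * (N2 * P2)" "0 \<le> P1 * N1 * N2" using P by (auto intro!: mult_nonneg_nonneg)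
  have "norm (psi_ratio ga n k) \<le> M * ((1 / r ^ 2) ^ k + (c / r) ^ k)" for n k
  proof (cases "k \<le> n")
    case True
    then obtain m where n: "n = k + m" using le_Suc_ex by blast
    have "norm (qpoch q (- (u / Y1)) (k + m) / qpoch q (- (u / Y1)) m * (qinf (- Y2) * qpoch q (- (u / Y2)) m)
        / (qinf (- Y3) * qpoch q (- (u / Y3)) (k + m))) \<le> P1 / 1 * (N2 * P2) / (1 * 1)"
      unfolding norm_divide norm_mult using P
      by (intro frac_le mult_mono b1 g1 divide_nonneg_nonneg mult_nonneg_nonneg) (auto intro: order.trans[OF _ g1(1)])
    then have "norm (psi_ratio ga n k) \<le> (K * (c / r) ^ k) * (1 / (c * r)) ^ k * (P1 / 1 * (N2 * P2) / (1 * 1))"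
      unfolding n psi_ratio_le norm_mult[of "_ * _"] norm_mult[of "psi_coef _ _"] norm_power nC K_def
      using psi_coef_bound[of ga r k] r c_pos K M0
      by (intro mult_mono mult_nonneg_nonneg) (auto simp: r_def K_def)
    also have "\<dots> = K * (P1 * (N2 * P2)) * (1 / r ^ 2) ^ k"
      unfolding cr[symmetric] power_mult_distrib by simp
    also have "\<dots> \<le> M * (1 / r ^ 2) ^ k" unfolding M_def using K M0 r by (intro mult_right_mono mult_left_mono) auto
    also have "\<dots> \<le> M * ((1 / r ^ 2) ^ k + (c / r) ^ k)"
      using K M0 r c_pos unfolding M_def by (intro mult_left_mono mult_nonneg_nonneg) auto
    finally show ?thesis .
  next
    case False
    then obtain m where k: "k = n + m" using le_Suc_ex[of n k] by auto
    have "norm (qpoch q (- (u / Y1)) n * qpoch q (- Y1) m * qinf (- (Y2 * u ^ m))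
        / (qinf (- Y3) * qpoch q (- (u / Y3)) n)) \<le> P1 * N1 * N2 / (1 * 1)"
      unfolding norm_divide norm_mult using P
      by (intro frac_le mult_mono b1 b2 g1 mult_nonneg_nonneg) (auto intro: order.trans[OF _ g1(1)])
    then have 1: "norm (psi_ratio ga n k) \<le> (K * (c / r) ^ k) * (1 / (c * r)) ^ n * (P1 * N1 * N2 / (1 * 1))"
      unfolding k psi_ratio_gt norm_mult[of "_ * _"] norm_mult[of "psi_coef _ _"] norm_power nC K_def
      using psi_coef_bound[of ga r "n + m"] r c_pos K M0
      by (intro mult_mono mult_nonneg_nonneg) (auto simp: r_def K_def)
    \<comment> \<open>If 1 / (c norm ga) is at most 1 its power is dropped; otherwise n <= k allows
      the exponent n to be raised to k.\<close>
    have 2: "(c / r) ^ k * (1 / (c * r)) ^ n \<le> (1 / r ^ 2) ^ k + (c / r) ^ k"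
    proof (cases "1 / (c * r) \<le> 1")
      case True
      then have "(c / r) ^ k * (1 / (c * r)) ^ n \<le> (c / r) ^ k * 1"
        using c_pos r by (intro mult_left_mono power_le_one) auto
      also have "\<dots> \<le> (1 / r ^ 2) ^ k + (c / r) ^ k" using r by simp
      finally show ?thesis .
    next
      case F: False
      have "(c / r) ^ k * (1 / (c * r)) ^ n \<le> (c / r) ^ k * (1 / (c * r)) ^ k"
        using c_pos r F False by (intro mult_left_mono power_increasing) auto
      also have "\<dots> = (1 / r ^ 2) ^ k" unfolding cr[symmetric] power_mult_distrib ..
      also have "\<dots> \<le> (1 / r ^ 2) ^ k + (c / r) ^ k" using r c_pos by simp
      finally show ?thesis .
    qed
    have "(K * (c / r) ^ k) * (1 / (c * r)) ^ n * (P1 * N1 * N2 / (1 * 1)) = K * (P1 * N1 * N2) * ((c / r) ^ k * (1 / (c * r)) ^ n)"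
      by (simp add: mult_ac)
    also have "\<dots> \<le> M * ((1 / r ^ 2) ^ k + (c / r) ^ k)"
      unfolding M_def using K M0 2 r c_pos by (intro mult_mono mult_left_mono mult_nonneg_nonneg) auto
    finally show ?thesis using 1 by linarith
  qed
  then show ?thesis unfolding r_def by (rule that)
qed

lemma psi_ratio_LIMSEQ:
  "(\<lambda>n. psi_ratio ga n k) \<longlonglongrightarrow> psi_coef ga k * (1 / (C * ga)) ^ k *
     (qinf (- Y2) * qinf (- (u / Y2)) / (qinf (- Y3) * qinf (- (u / Y3))))"
\<comment> \<open>Shifting n by k makes the formula for k <= n available at every index.\<close>
proof (rule LIMSEQ_offset[of _ k])
  have nz: "qinf (- (u / Y1)) \<noteq> 0" "qinf (- (u / Y3)) \<noteq> 0" "qinf (- Y3) \<noteq> 0"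
    using norm_qpoch_inf_neg_ge_1[of "q / (a * b * z)"] norm_qpoch_inf_neg_ge_1[of "q / (b * c * z)"]
      norm_qpoch_inf_neg_ge_1[of "b * c * z"] Y_pos(3,4) q_pos
    unfolding Y_pos(1,2) u_def by auto
  have sh: "(\<lambda>m. qpoch q y (k + m)) \<longlonglongrightarrow> qinf y" for y :: complex
    using LIMSEQ_ignore_initial_segment[OF qpoch_LIMSEQ, of y k] by (simp add: add.commute)
  have "(\<lambda>m. psi_ratio ga (k + m) k) \<longlonglongrightarrow> psi_coef ga k * (1 / (C * ga)) ^ k *
     (qinf (- (u / Y1)) / qinf (- (u / Y1)) * (qinf (- Y2) * qinf (- (u / Y2))) / (qinf (- Y3) * qinf (- (u / Y3))))"
    unfolding psi_ratio_le using nz by (intro tendsto_mult tendsto_divide tendsto_const sh qpoch_LIMSEQ) auto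
  then show "(\<lambda>m. psi_ratio ga (m + k) k) \<longlonglongrightarrow> psi_coef ga k * (1 / (C * ga)) ^ k *
     (qinf (- Y2) * qinf (- (u / Y2)) / (qinf (- Y3) * qinf (- (u / Y3))))"
    using nz by (simp add: add.commute)
qed

text \<open>The limiting series is a q-Gauss sum with argument 1 / ga^2, which yields the product
  form of c. On the unit circle the majorant is no longer summable; the circle is reached through
  Wronskians instead.\<close>

lemma psis_LIMSEQ:
  assumes g: "1 < norm ga"
  shows "(\<lambda>n. psis ga (- int n) / (of_real a * ga) ^ n) \<longlonglongrightarrow> cfun q z a b c ga"
proof -
  have cg: "c < norm ga" using g c_less_1 by linarith
  let ?K = "qinf (of_real c / ga) / qinf (of_real a * of_real c)"
  define L where "L = qinf (- Y2) * qinf (- (u / Y2)) / (qinf (- Y3) * qinf (- (u / Y3)))"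
  have eq: "psis ga (- int n) / (of_real a * ga) ^ n = ?K * (\<Sum>k. psi_ratio ga n k)" for n
  proof -
    let ?d = "qinf (- (of_real b * of_real c * of_real (xk (- int n)))) * (of_real a * ga) ^ n"
    have "(\<Sum>k. psi_ratio ga n k) = (\<Sum>k. psi_term ga (of_real (xk (- int n))) k) / ?d"
      unfolding psi_ratio_def by (rule suminf_divide[OF psi_term_summable[OF cg]])
    then show ?thesis unfolding psis_def psi_def psi_entire_def by simp
  qed
  obtain M where M: "\<And>n k. norm (psi_ratio ga n k) \<le> M * ((1 / norm ga ^ 2) ^ k + (c / norm ga) ^ k)"
    using psi_ratio_bound by blast
  have n2: "1 < norm ga ^ 2" using g by (simp add: one_less_power)
  have n3: "1 / norm ga ^ 2 < 1" using n2 pos_divide_less_eq[of "norm ga ^ 2" 1 1] by linarith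
  have lim: "(\<lambda>n. \<Sum>k. psi_ratio ga n k) \<longlonglongrightarrow> (\<Sum>k. psi_coef ga k * (1 / (C * ga)) ^ k * L)"
  proof (rule tannery_seq[OF _ M])
    show "(\<lambda>n. psi_ratio ga n k) \<longlonglongrightarrow> psi_coef ga k * (1 / (C * ga)) ^ k * L" for k
      unfolding L_def by (rule psi_ratio_LIMSEQ)
    show "summable (\<lambda>k. M * ((1 / norm ga ^ 2) ^ k + (c / norm ga) ^ k))"
    proof (intro summable_mult summable_add summable_geometric)
      from n3 show "norm (1 / norm ga ^ 2) < 1" by (simp only: real_norm_def abs_of_nonneg zero_le_divide_1_iff zero_le_power norm_ge_zero)
      show "norm (c / norm ga) < 1" using cg c_pos by simp
    qed
  qed
  have Cn: "complex_of_real a * of_real b * of_real q ^ i \<noteq> 1" for i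
  proof -
    have "complex_of_real a * of_real b * of_real q ^ i = of_real (a * b * q ^ i)" by simp
    moreover have "a * b * q ^ i \<noteq> 1" using ab_q_pos[of i] by simp
    ultimately show ?thesis by (metis of_real_eq_1_iff)
  qed
  have arg: "of_real a * of_real b / (of_real a * ga * (of_real b * ga)) = 1 / ga ^ 2"
    using a_pos b_pos g0 by (simp add: power2_eq_square)
  have lt: "norm (of_real a * of_real b / (of_real a * ga * (of_real b * ga))) < 1"
    unfolding arg by (simp only: norm_divide norm_power norm_one n3)
  have gt: "psi_coef ga k * (1 / (C * ga)) ^ k = gauss_term (of_real a * ga) (of_real b * ga) (of_real a * of_real b) k" for k
  proof -
    have "of_real c / ga * (1 / (C * ga)) = 1 / ga ^ 2"
      using g0 Y_nonzero(4) unfolding C_def by (simp add: power2_eq_square)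
    then have e: "(of_real c / ga) ^ k * (1 / (C * ga)) ^ k = (1 / ga ^ 2) ^ k"
      by (metis power_mult_distrib)
    show ?thesis unfolding psi_coef_def gauss_term_def arg by (simp only: mult.assoc e)
  qed
  have "(\<Sum>k. psi_coef ga k * (1 / (C * ga)) ^ k * L) = suminf (gauss_term (of_real a * ga) (of_real b * ga) (of_real a * of_real b)) * L"
    unfolding gt by (rule suminf_mult2[symmetric]) (rule gauss_term_summable[OF Cn lt])
  also have "suminf (gauss_term (of_real a * ga) (of_real b * ga) (of_real a * of_real b))
     = qinf (of_real b / ga) * qinf (of_real a / ga) / (qinf (of_real a * of_real b) * qinf (1 / ga ^ 2))"
  proof -
    have "of_real a * of_real b / (of_real a * ga) = of_real b / ga" "of_real a * of_real b / (of_real b * ga) = of_real a / ga"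
      using a_pos b_pos by simp_all
    then show ?thesis using q_gauss[OF _ _ Cn lt] a_pos b_pos g0 unfolding arg by simp
  qed
  finally have S: "(\<Sum>k. psi_coef ga k * (1 / (C * ga)) ^ k * L) = qinf (of_real b / ga) * qinf (of_real a / ga) / (qinf (of_real a * of_real b) * qinf (1 / ga ^ 2)) * L" .
  have kc: "?K * (\<Sum>k. psi_coef ga k * (1 / (C * ga)) ^ k * L) = cfun q z a b c ga"
  proof -
    have t1: "complex_of_real (qtheta q (- (b * c * z))) = qinf (- Y3) * qinf (- (u / Y3))"
      unfolding Y_pos(2) u_def by (rule qtheta_neg[OF Y_pos(4)])
    have t2: "qtheta q (- (of_real q / (of_real (a * b * c * z) * ga))) = qinf (- (u / Y2)) * qinf (- Y2)"
    proof -
      have "of_real (a * b * c * z) * ga = Y2" by (simp add: Y2_def mult_ac)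
      moreover have "of_real q / - (u / Y2) = - Y2" using Y_nonzero by (simp add: u_def)
      ultimately show ?thesis unfolding qtheta_def u_def by simp
    qed
    show ?thesis unfolding S unfolding cfun_def L_def of_real_mult[of "_ * _" "qtheta _ _"] of_real_mult[of "qpoch_inf _ _"] t1 t2
        qpoch_inf_ab[symmetric] qpoch_inf_ac[symmetric]
      by (simp add: mult_ac)
  qed
  show ?thesis unfolding eq kc[symmetric] by (intro tendsto_mult tendsto_const lim)
qed

end

section \<open>Wronskians up to the unit circle and the connection formula\<close>

lemma continuous_on_Phi: "continuous_on {ga. 1 \<le> norm ga} (\<lambda>ga. Phi ga k)"
proof -
  have nz: "ga \<noteq> 0" if "1 \<le> norm ga" for ga :: complex using that by auto
  have cnz: "qinf (of_real c / ga) \<noteq> 0" if "1 \<le> norm ga" for ga :: complex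
    using Phi_norm_nonzero[OF that] by (auto simp: Phi_norm_def)
  have 1: "continuous_on {ga. 1 \<le> norm ga} Phi_norm"
    unfolding Phi_norm_def
    by (intro continuous_on_mult continuous_on_divide continuous_qpoch_inf continuous_on_const continuous_on_power continuous_on_id)
       (use nz cnz in auto)
  have 2: "continuous_on {ga::complex. 1 \<le> norm ga} (\<lambda>ga. (of_real c / ga) powi (- k))"
    by (intro continuous_on_power_int continuous_on_divide continuous_on_const continuous_on_id) (use nz c_pos in auto)
  show ?thesis unfolding Phi_def
    by (intro continuous_on_divide continuous_on_mult 1 2 continuous_on_chi xk_pos continuous_on_const)
       (use Phi_norm_nonzero in auto)
qed

lemma continuous_on_psis: "continuous_on {ga. 1 \<le> norm ga} (\<lambda>ga. psis ga k)"
  unfolding psis_def by (rule continuous_on_subset[OF continuous_on_psi_gamma]) (use c_less_1 in auto)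

text \<open>A zero would give ga^2 = q^i, whence i = 0 by the norm and ga = 1 or ga = - 1.\<close>

lemma qpoch_inf_inv_sq_nonzero:
  assumes "1 \<le> norm ga" "Im ga \<noteq> 0" shows "qinf (1 / ga^2) \<noteq> 0"
proof
  assume "qinf (1 / ga^2) = 0"
  then obtain i where i: "1 / ga^2 * of_real q ^ i = 1" by (auto simp: qpoch_inf_eq_0_iff)
  have g0: "ga \<noteq> 0" using assms by auto
  have e: "ga^2 = of_real (q ^ i)" using i g0 by (simp add: field_simps)
  then have "norm ga ^ 2 = q ^ i" using q_pos by (metis abs_of_nonneg less_imp_le norm_of_real norm_power zero_less_power)
  moreover have "1 \<le> norm ga ^ 2" using assms by (simp add: one_le_power)
  moreover have "i \<noteq> 0 \<Longrightarrow> q ^ i < 1" using q_pos q_less_1 by (simp add: power_less_one_iff)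
  ultimately have "i = 0" by (metis not_less)
  with e have "ga^2 = 1" by simp
  then have "ga = 1 \<or> ga = - 1" by (simp add: power2_eq_1_iff)
  then show False using assms by auto
qed

lemma continuous_on_cfun: "continuous_on {ga. 1 \<le> norm ga \<and> Im ga \<noteq> 0} (cfun q z a b c)"
proof -
  have th: "qtheta q (- (of_real q / (of_real (a * b * c * z) * ga))) = qinf (- (of_real q / (of_real (a * b * c * z) * ga)))
      * qinf (- (of_real (a * b * c * z) * ga))" if "ga \<noteq> 0" for ga
    unfolding qtheta_def using that by simp
  have nz: "complex_of_real (qinf (a * b) * qinf (a * c) * qtheta q (- (b * c * z))) \<noteq> 0"
    using qpoch_inf_pos[OF ab_less_1] qpoch_inf_pos[OF ac_less_1] qtheta_neg_pos[of "b * c * z"] b_pos c_pos z_pos by simp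
  have pz: "complex_of_real (a * b * c * z) \<noteq> 0" using a_pos b_pos c_pos z_pos by simp
  let ?S = "{ga::complex. 1 \<le> norm ga \<and> Im ga \<noteq> 0}"
  have "continuous_on ?S (\<lambda>ga. 1 / of_real (qinf (a * b) * qinf (a * c) * qtheta q (- (b * c * z))) *
     (qinf (of_real a / ga) * qinf (of_real b / ga) * qinf (of_real c / ga) *
      (qinf (- (of_real q / (of_real (a * b * c * z) * ga))) * qinf (- (of_real (a * b * c * z) * ga)))) /
     qinf (1 / ga^2))"
    using pz by (intro continuous_on_divide continuous_on_mult continuous_qpoch_inf continuous_on_minus continuous_on_const
        continuous_on_power continuous_on_id) (auto simp del: of_real_mult simp: qpoch_inf_inv_sq_nonzero)
  then show ?thesis
  proof (rule continuous_on_eq)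
    fix ga :: complex assume "ga \<in> ?S"
    then have "ga \<noteq> 0" by auto
    from th[OF this] show "1 / of_real (qinf (a * b) * qinf (a * c) * qtheta q (- (b * c * z))) *
     (qinf (of_real a / ga) * qinf (of_real b / ga) * qinf (of_real c / ga) *
      (qinf (- (of_real q / (of_real (a * b * c * z) * ga))) * qinf (- (of_real (a * b * c * z) * ga)))) /
     qinf (1 / ga^2) = cfun q z a b c ga" unfolding cfun_def by simp
  qed
qed

lemma qpoch_inf_nonreal_nonzero:
  assumes "Im ga \<noteq> 0" "r \<noteq> 0"
  shows "qinf (of_real r / ga) \<noteq> 0" "qinf (of_real r * ga) \<noteq> 0"
proof -
  have g0: "ga \<noteq> 0" using assms by auto
  show "qinf (of_real r / ga) \<noteq> 0"
  proof
    assume "qinf (of_real r / ga) = 0"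
    then obtain i where "of_real r / ga * of_real q ^ i = 1" by (auto simp: qpoch_inf_eq_0_iff)
    then have "ga = of_real (r * q ^ i)" using g0 by (simp add: field_simps)
    then show False using assms by simp
  qed
  show "qinf (of_real r * ga) \<noteq> 0"
  proof
    assume "qinf (of_real r * ga) = 0"
    then obtain i where "of_real r * ga * of_real q ^ i = 1" by (auto simp: qpoch_inf_eq_0_iff)
    then have "of_real (r * q ^ i) * ga = 1" by (simp add: mult_ac)
    then have "Im (of_real (r * q ^ i) * ga) = 0" by simp
    then show False using assms by simp
  qed
qed

text \<open>Every zero of a numerator factor of c is a real \<open>ga\<close>.\<close>

lemma cfun_nonzero:
  assumes "1 \<le> norm ga" "Im ga \<noteq> 0" shows "cfun q z a b c ga \<noteq> 0"
proof -
  have g0: "ga \<noteq> 0" using assms by auto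
  have p: "0 < a * b * c * z" using a_pos b_pos c_pos z_pos by simp
  have "of_real q / (of_real (a * b * c * z) * ga) = of_real (q / (a * b * c * z)) / ga" by simp
  then have e1: "- (of_real q / (of_real (a * b * c * z) * ga)) = of_real (- (q / (a * b * c * z))) / ga" by simp
  have e2: "of_real q / (of_real (- (q / (a * b * c * z))) / ga) = of_real (- (a * b * c * z)) * ga"
    using p q_pos by simp
  have "qtheta q (- (of_real q / (of_real (a * b * c * z) * ga))) \<noteq> 0"
  proof -
    have r: "- (q / (a * b * c * z)) \<noteq> 0" "- (a * b * c * z) \<noteq> 0" using p q_pos by auto
    show ?thesis unfolding qtheta_def e1 e2
      by (intro no_zero_divisors qpoch_inf_nonreal_nonzero assms(2) r)
  qed
  then show ?thesis unfolding cfun_def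
    using qpoch_inf_nonreal_nonzero(1)[OF assms(2)] a_pos b_pos c_pos qpoch_inf_inv_sq_nonzero[OF assms]
      qpoch_inf_pos[OF ab_less_1] qpoch_inf_pos[OF ac_less_1] qtheta_neg_pos[of "b * c * z"] z_pos by simp
qed

text \<open>Outside the circle the asymptotics of both solutions give the value. All quantities are
  continuous for nonreal \<open>ga\<close> up to the circle, so the formula extends there.\<close>

lemma Wr_psi_Phi:
  assumes g: "1 \<le> norm ga" and im: "Im ga \<noteq> 0"
  shows "Wr (psis ga) (Phi ga) k = of_real (Kconst q z a b c * a) * cfun q z a b c ga * (1 / ga - ga)"
proof -
  have strict: "Wr (psis ga) (Phi ga) k = of_real (Kconst q z a b c * a) * cfun q z a b c ga * (1 / ga - ga)"
    if g: "1 < norm ga" and im: "Im ga \<noteq> 0" for ga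
  proof -
    have g0: "ga \<noteq> 0" using im by auto
    have "Wr (psis ga) (Phi ga) k = of_real (Kconst q z a b c) * cfun q z a b c ga * 1 * (of_real a / ga - of_real a * ga)"
      using g c_less_1 im g0 a_pos
      by (intro Wr_LIMSEQ[OF solves_psis solves_Phi psis_LIMSEQ Phi_LIMSEQ J_LIMSEQ]) (auto simp: power2_eq_square)
    then show ?thesis by (simp add: algebra_simps)
  qed
  \<comment> \<open>Radial approach to \<open>ga\<close> from outside the circle.\<close>
  define r where "r n = 1 + 1 / real (Suc n)" for n
  have r1: "1 < r n" for n by (simp add: r_def)
  have rl: "r \<longlonglongrightarrow> 1" unfolding r_def using tendsto_add[OF tendsto_const LIMSEQ_inverse_real_of_nat, of 1] by (simp add: inverse_eq_divide)
  define h where "h n = of_real (r n) * ga" for n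
  have hl: "h \<longlonglongrightarrow> ga" unfolding h_def using tendsto_mult[OF tendsto_of_real[OF rl] tendsto_const[of ga]] by simp
  have hn: "1 < norm (h n)" for n
  proof -
    have "1 < r n * 1" using r1 by simp
    also have "\<dots> \<le> r n * norm ga" using r1[of n] g by (intro mult_left_mono) auto
    finally show ?thesis using r1[of n] by (simp add: h_def norm_mult)
  qed
  have him: "Im (h n) \<noteq> 0" for n using r1[of n] im by (simp add: h_def)
  have seq: "(\<lambda>n. F (h n)) \<longlonglongrightarrow> F ga" if "continuous_on {ga. 1 \<le> norm ga \<and> Im ga \<noteq> 0} F" for F :: "complex \<Rightarrow> complex"
    using continuous_on_tendsto_compose[OF that hl] g im hn him by (simp add: less_imp_le)
  have sub: "{ga::complex. 1 \<le> norm ga \<and> Im ga \<noteq> 0} \<subseteq> {ga. 1 \<le> norm ga}" by auto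
  have "(\<lambda>n. Wr (psis (h n)) (Phi (h n)) k) \<longlonglongrightarrow> Wr (psis ga) (Phi ga) k"
    unfolding Wr_def
    by (intro seq continuous_on_mult continuous_on_diff continuous_on_const
         continuous_on_subset[OF continuous_on_psis sub] continuous_on_subset[OF continuous_on_Phi sub])
  moreover have "(\<lambda>n. Wr (psis (h n)) (Phi (h n)) k) \<longlonglongrightarrow> of_real (Kconst q z a b c * a) * cfun q z a b c ga * (1 / ga - ga)"
    unfolding strict[OF hn him]
    by (intro seq continuous_on_mult continuous_on_diff continuous_on_divide continuous_on_const continuous_on_id continuous_on_cfun) auto
  ultimately show ?thesis by (rule LIMSEQ_unique)
qed

text \<open>On the circle \<open>ga\<close> and \<open>1 / ga\<close> both belong to the region
  where the asymptotics of \<open>Phi\<close> hold, and they share the eigenvalue.\<close>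

lemma Wr_Phi_Phi:
  assumes g: "norm ga = 1" and im: "Im ga \<noteq> 0"
  shows "Wr (Phi ga) (Phi (1 / ga)) k = of_real (Kconst q z a b c * a) * (ga - 1 / ga)"
proof -
  have g0: "ga \<noteq> 0" using im by auto
  have gi: "norm (1 / ga) = 1" using g by (simp add: norm_divide)
  have "Im (inverse ga) = - Im ga / (norm ga)^2" by (simp add: inverse_complex.simps cmod_power2)
  then have imi: "Im (1 / ga) \<noteq> 0" using im g by (simp add: inverse_eq_divide)
  have m: "mu a (1 / ga) = mu a ga" by (simp add: mu_def inverse_eq_divide add.commute)
  have "Wr (Phi ga) (Phi (1 / ga)) k = of_real (Kconst q z a b c) * 1 * 1 * (of_real a * ga - of_real a / ga)"
    using solves_Phi[of ga] solves_Phi[of "1 / ga"] Phi_LIMSEQ[of ga] Phi_LIMSEQ[of "1 / ga"] g gi im imi g0 a_pos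
    by (intro Wr_LIMSEQ[where m = "mu a ga" and r = "of_real a / ga" and s = "of_real a * ga"] J_LIMSEQ) (auto simp: m power2_eq_square)
  then show ?thesis by (simp add: algebra_simps)
qed

text \<open>Invisible from the series for \<open>psi\<close>, but the coefficients of
  \<open>phi_ser\<close> are symmetric. This gives equality near 0, and the recurrence carries it
  outwards.\<close>

lemma psis_inverse:
  assumes g: "norm ga = 1" and im: "Im ga \<noteq> 0"
  shows "psis (1 / ga) k = psis ga k"
proof -
  have g0: "ga \<noteq> 0" using im by auto
  have gi: "norm (1 / ga) = 1" using g by (simp add: norm_divide)
  have "Im (inverse ga) = - Im ga / (norm ga)^2" by (simp add: inverse_complex.simps cmod_power2)
  then have imi: "Im (1 / ga) \<noteq> 0" using im g by (simp add: inverse_eq_divide)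
  have m: "mu a (1 / ga) = mu a ga" by (simp add: mu_def inverse_eq_divide add.commute)
  have bc: "0 < b * c" using b_pos c_pos by simp
  \<comment> \<open>From this index on the points lie in the disc where \<open>phi_ser\<close>
    represents the solution.\<close>
  obtain n :: nat where "q ^ n < 1 / (b * c * z)"
    using real_arch_pow_inv[of "1 / (b * c * z)" q] q_less_1 bc z_pos by auto
  from mult_strict_left_mono[OF this z_pos] have n: "z * q ^ n < 1 / (b * c)" using z_pos by simp
  have c1: "c < norm ga" "c < norm (1 / ga)" using g gi c_less_1 by auto
  have "psis (1 / ga) j = psis ga j" if "int n \<le> j" for j
  proof -
    from that obtain i :: nat where "j = int n + int i" using zle_iff_zadd[of "int n" j] by auto
    then have j: "j = int (n + i)" by simp
    have "xk j = z * q ^ n * q ^ i" unfolding xk_def j power_int_of_nat by (simp add: power_add)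
    also have "\<dots> \<le> z * q ^ n * 1" using q_pos q_less_1 z_pos by (intro mult_left_mono power_le_one) auto
    finally have "xk j < 1 / (b * c)" using n by simp
    then have x: "norm (complex_of_real (xk j)) < 1 / (b * c)" using xk_pos[of j] by simp
    have "phi_ser (1 / ga) (of_real (xk j)) = phi_ser ga (of_real (xk j))"
      by (simp add: phi_ser_def phi_coef_def mult.commute)
    then show ?thesis unfolding psis_def using phi_ser_eq_psi[OF c1(1) im x] phi_ser_eq_psi[OF c1(2) imi x] by simp
  qed
  then show ?thesis by (rule solves_unique[OF solves_psis[OF c1(2), unfolded m] solves_psis[OF c1(1)]])
qed

lemma psis_connection:
  assumes g: "norm ga = 1" and im: "Im ga \<noteq> 0"
  shows "psis ga k = cfun q z a b c ga * Phi (1 / ga) k + cfun q z a b c (1 / ga) * Phi ga k"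
proof -
  have g0: "ga \<noteq> 0" using im by auto
  have gi: "norm (1 / ga) = 1" using g by (simp add: norm_divide)
  have "Im (inverse ga) = - Im ga / (norm ga)^2" by (simp add: inverse_complex.simps cmod_power2)
  then have imi: "Im (1 / ga) \<noteq> 0" using im g by (simp add: inverse_eq_divide)
  let ?\<kappa> = "complex_of_real (Kconst q z a b c * a)"
  have eq: "psis (1 / ga) = psis ga" using psis_inverse[OF g im] by auto
  have w1: "Wr (psis ga) (Phi ga) k = ?\<kappa> * cfun q z a b c ga * (1 / ga - ga)"
    using g by (intro Wr_psi_Phi im) simp
  have w2: "Wr (psis ga) (Phi (1 / ga)) k = ?\<kappa> * cfun q z a b c (1 / ga) * (ga - 1 / ga)"
    using Wr_psi_Phi[of "1 / ga" k] gi imi unfolding eq by simp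
  note w3 = Wr_Phi_Phi[OF g im, of k]
  \<comment> \<open>Cramer's rule for expanding in the basis of the two solutions
    \<open>Phi ga\<close> and \<open>Phi (1 / ga)\<close>; it is an identity between 2 x 2
    determinants.\<close>
  have "psis ga k * Wr (Phi ga) (Phi (1 / ga)) k = Phi ga k * Wr (psis ga) (Phi (1 / ga)) k - Phi (1 / ga) k * Wr (psis ga) (Phi ga) k"
    unfolding Wr_def by algebra
  then have "?\<kappa> * (ga - 1 / ga) * psis ga k = ?\<kappa> * (ga - 1 / ga) * (cfun q z a b c ga * Phi (1 / ga) k + cfun q z a b c (1 / ga) * Phi ga k)"
    unfolding w1 w2 w3 by algebra
  moreover have "?\<kappa> * (ga - 1 / ga) \<noteq> 0"
  proof -
    have "Im (1 / ga) = - Im ga" using \<open>Im (inverse ga) = _\<close> g by (simp add: inverse_eq_divide)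
    then have "Im (ga - 1 / ga) \<noteq> 0" using im by simp
    then have "ga - 1 / ga \<noteq> 0" by (metis zero_complex.simps(2))
    then show ?thesis using Kconst_pos a_pos by simp
  qed
  ultimately show ?thesis by simp
qed

end

section \<open>The Hilbert space\<close>

context big_q begin

abbreviation II :: "real set" where "II \<equiv> Iset q z"

definition xn :: "nat \<Rightarrow> real" where "xn n = - (q ^ n)"

lemma xn_neg: "xn n < 0" using q_pos by (simp add: xn_def)

lemma xn_Suc: "xn (Suc n) = q * xn n" by (simp add: xn_def)

lemma xn_0: "xn 0 = - 1" by (simp add: xn_def)

lemma II_eq: "II = range xn \<union> range xk"
  by (simp add: Iset_def xn_def[abs_def] xk_def[abs_def])

lemma inj_xn: "inj xn"
proof (rule injI)
  fix m n assume "xn m = xn n"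
  then have e: "q ^ m = q ^ n" by (simp add: xn_def)
  show "m = n"
    using power_strict_decreasing[of m n q] power_strict_decreasing[of n m q] q_pos q_less_1 e
    by (cases m n rule: linorder_cases) auto
qed

lemma xk_less: "k < l \<Longrightarrow> xk l < xk k"
proof -
  assume "k < l"
  then obtain n where l: "l = k + int (Suc n)" using zless_iff_Suc_zadd by auto
  have "xk l = xk k * q ^ Suc n" unfolding xk_def l by (simp add: power_int_add power_int_of_nat del: of_nat_Suc)
  also have "\<dots> < xk k * 1"
    using xk_pos[of k] q_pos q_less_1 by (intro mult_strict_left_mono power_Suc_less_one) auto
  finally show "xk l < xk k" by simp
qed

lemma inj_xk: "inj xk"
  by (rule injI) (metis less_irrefl linorder_neqE xk_less)

lemma xn_neq_xk: "xn n \<noteq> xk k"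
  using xn_neg[of n] xk_pos[of k] by linarith

lemma xn_in [simp]: "xn n \<in> II" and xk_in [simp]: "xk k \<in> II"
  by (auto simp: II_eq)

lemma II_cases: assumes "x \<in> II" obtains n where "x = xn n" | k where "x = xk k"
  using assms by (auto simp: II_eq)

lemma xn_eq_iff [simp]: "xn m = xn n \<longleftrightarrow> m = n" using inj_xn by (auto dest: injD)

lemma xk_eq_iff [simp]: "xk k = xk l \<longleftrightarrow> k = l" using inj_xk by (auto dest: injD)

lemma wneg_eq: "wneg q a b c n = wt (xn n)"
  using q_pos by (simp add: wneg_def wt_def xn_def)

lemma wpos_eq: "wpos q z a b c k = wt (xk k)"
  using xk_pos[of k] by (simp add: wpos_def wt_def xk_def)

lemma pfun_xn_pos: "0 < pfun q a b c (xn n)"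
proof -
  have "q ^ Suc n < 1" using q_pos q_less_1 by (intro power_Suc_less_one) auto
  then show ?thesis
    unfolding pfun_def xn_def using ab_q_pos[of n] ac_q_pos[of n] bc_q_pos[of n]
    by (intro divide_pos_pos mult_pos_pos qpoch_inf_pos) auto
qed

lemma wt_II_pos: "x \<in> II \<Longrightarrow> 0 < wt x"
proof (erule II_cases)
  fix n assume "x = xn n"
  then show "0 < wt x" unfolding wt_def using pfun_xn_pos[of n] xn_neg[of n] q_less_1
    by (intro divide_pos_pos mult_pos_pos) auto
next
  fix k assume "x = xk k"
  then show "0 < wt x" using wt_pos[OF xk_pos[of k]] by simp
qed

lemma summable_II:
  fixes F :: "real \<Rightarrow> 'b::banach"
  shows "F summable_on II \<longleftrightarrow> (\<lambda>n. F (xn n)) summable_on UNIV \<and> (\<lambda>k. F (xk k)) summable_on UNIV"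
proof -
  have d: "range xn \<inter> range xk = {}" using xn_neq_xk by auto
  have r1: "F summable_on range xn \<longleftrightarrow> (\<lambda>n. F (xn n)) summable_on UNIV"
    using summable_on_reindex[OF inj_xn, of F] by (simp add: o_def)
  have r2: "F summable_on range xk \<longleftrightarrow> (\<lambda>k. F (xk k)) summable_on UNIV"
    using summable_on_reindex[OF inj_xk, of F] by (simp add: o_def)
  show ?thesis unfolding r1[symmetric] r2[symmetric] II_eq
    using summable_on_Un_disjoint[OF _ _ d, of F] summable_on_subset_banach[of F "range xn \<union> range xk"] by blast
qed

lemma infsum_II:
  fixes F :: "real \<Rightarrow> 'b::banach"
  assumes "F summable_on II"
  shows "infsum F II = (\<Sum>\<^sub>\<infinity>n. F (xn n)) + (\<Sum>\<^sub>\<infinity>k. F (xk k))"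
proof -
  have d: "range xn \<inter> range xk = {}" using xn_neq_xk by auto
  have r1: "infsum F (range xn) = (\<Sum>\<^sub>\<infinity>n. F (xn n))"
    using infsum_reindex[OF inj_xn, of F] by (simp add: o_def)
  have r2: "infsum F (range xk) = (\<Sum>\<^sub>\<infinity>k. F (xk k))"
    using infsum_reindex[OF inj_xk, of F] by (simp add: o_def)
  show ?thesis unfolding r1[symmetric] r2[symmetric] II_eq
    using assms unfolding II_eq by (intro infsum_Un_disjoint d summable_on_subset_banach[OF assms[unfolded II_eq]]) auto
qed

abbreviation HH :: "(real \<Rightarrow> complex) set" where "HH \<equiv> Hspace q z a b c"
abbreviation inn :: "(real \<Rightarrow> complex) \<Rightarrow> (real \<Rightarrow> complex) \<Rightarrow> complex" where "inn \<equiv> ip q z a b c"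
abbreviation TT :: "(real \<Rightarrow> complex) \<Rightarrow> real \<Rightarrow> complex" where "TT \<equiv> opL q z a b c"
abbreviation DD :: "(real \<Rightarrow> complex) set" where "DD \<equiv> Ddom q z a b c"

lemma HH_iff: "f \<in> HH \<longleftrightarrow> f \<in> funs_on II \<and> (\<lambda>x. norm (f x) ^ 2 * wt x) summable_on II"
  unfolding Hspace_def summable_II by (simp add: wneg_eq wpos_eq xn_def xk_def)

lemma inn_eq:
  assumes "(\<lambda>x. f x * cnj (g x) * of_real (wt x)) summable_on II"
  shows "inn f g = (\<Sum>\<^sub>\<infinity>x\<in>II. f x * cnj (g x) * of_real (wt x))"
  unfolding infsum_II[OF assms] ip_def by (simp add: wneg_eq wpos_eq xn_def xk_def)

lemma summable_comparison_II:
  fixes F :: "real \<Rightarrow> 'b::banach" and G :: "real \<Rightarrow> real"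
  assumes "G summable_on II" "\<And>x. x \<in> II \<Longrightarrow> norm (F x) \<le> G x"
  shows "F summable_on II"
proof (rule abs_summable_summable, rule Infinite_Sum.abs_summable_on_comparison_test[where g = G])
  have "norm (G x) = G x" if "x \<in> II" for x using order.trans[OF norm_ge_zero assms(2)[OF that]] by simp
  then have "(\<lambda>x. norm (G x)) summable_on II \<longleftrightarrow> G summable_on II" by (rule summable_on_cong)
  then show "(\<lambda>x. norm (G x)) summable_on II" using assms(1) by simp
  show "norm (F x) \<le> norm (G x)" if "x \<in> II" for x using assms(2)[OF that] by simp
qed

lemma HH_prod_summable:
  assumes "f \<in> HH" "g \<in> HH"
  shows "(\<lambda>x. f x * cnj (g x) * of_real (wt x)) summable_on II"
proof (rule summable_comparison_II)
  show "(\<lambda>x. norm (f x) ^ 2 * wt x + norm (g x) ^ 2 * wt x) summable_on II"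
    using assms by (intro summable_on_add) (auto simp: HH_iff)
  fix x assume x: "x \<in> II"
  have "norm (f x) * norm (g x) \<le> norm (f x) ^ 2 + norm (g x) ^ 2"
    using sum_squares_bound[of "norm (f x)" "norm (g x)"] mult_nonneg_nonneg[OF norm_ge_zero norm_ge_zero, of "f x" "g x"] by linarith
  then have "norm (f x) * norm (g x) * wt x \<le> (norm (f x) ^ 2 + norm (g x) ^ 2) * wt x"
    using wt_II_pos[OF x] by (intro mult_right_mono) auto
  then show "norm (f x * cnj (g x) * of_real (wt x)) \<le> norm (f x) ^ 2 * wt x + norm (g x) ^ 2 * wt x"
    using wt_II_pos[OF x] by (simp add: norm_mult algebra_simps)
qed

lemmas inn_HH = inn_eq[OF HH_prod_summable]

lemma HH_lin:
  assumes "f \<in> HH" "g \<in> HH" shows "(\<lambda>x. \<alpha> * f x + \<beta> * g x) \<in> HH"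
  unfolding HH_iff
proof
  show "(\<lambda>x. \<alpha> * f x + \<beta> * g x) \<in> funs_on II" using assms by (auto simp: HH_iff funs_on_def)
  show "(\<lambda>x. norm (\<alpha> * f x + \<beta> * g x) ^ 2 * wt x) summable_on II"
  proof (rule summable_comparison_II)
    show "(\<lambda>x. 2 * norm \<alpha> ^ 2 * (norm (f x) ^ 2 * wt x) + 2 * norm \<beta> ^ 2 * (norm (g x) ^ 2 * wt x)) summable_on II"
      using assms by (intro summable_on_add summable_on_cmult_right) (auto simp: HH_iff)
    fix x assume x: "x \<in> II"
    have "norm (\<alpha> * f x + \<beta> * g x) ^ 2 \<le> (norm (\<alpha> * f x) + norm (\<beta> * g x)) ^ 2"
      by (intro power_mono norm_triangle_ineq) auto
    also have "\<dots> \<le> 2 * norm (\<alpha> * f x) ^ 2 + 2 * norm (\<beta> * g x) ^ 2"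
      using sum_squares_bound[of "norm (\<alpha> * f x)" "norm (\<beta> * g x)"] by (simp add: power2_sum)
    finally have "norm (\<alpha> * f x + \<beta> * g x) ^ 2 * wt x \<le> (2 * norm (\<alpha> * f x) ^ 2 + 2 * norm (\<beta> * g x) ^ 2) * wt x"
      using wt_II_pos[OF x] by (intro mult_right_mono) auto
    then show "norm (norm (\<alpha> * f x + \<beta> * g x) ^ 2 * wt x) \<le> 2 * norm \<alpha> ^ 2 * (norm (f x) ^ 2 * wt x) + 2 * norm \<beta> ^ 2 * (norm (g x) ^ 2 * wt x)"
      using wt_II_pos[OF x] by (simp add: norm_mult power_mult_distrib algebra_simps)
  qed
qed

lemma inn_lin_HH:
  assumes "f \<in> HH" "g \<in> HH" "h \<in> HH"
  shows "inn (\<lambda>x. \<alpha> * f x + \<beta> * g x) h = \<alpha> * inn f h + \<beta> * inn g h"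
proof -
  have "inn (\<lambda>x. \<alpha> * f x + \<beta> * g x) h = (\<Sum>\<^sub>\<infinity>x\<in>II. \<alpha> * (f x * cnj (h x) * of_real (wt x)) + \<beta> * (g x * cnj (h x) * of_real (wt x)))"
    unfolding inn_HH[OF HH_lin[OF assms(1,2)] assms(3)] by (simp add: algebra_simps)
  also have "\<dots> = (\<Sum>\<^sub>\<infinity>x\<in>II. \<alpha> * (f x * cnj (h x) * of_real (wt x))) + (\<Sum>\<^sub>\<infinity>x\<in>II. \<beta> * (g x * cnj (h x) * of_real (wt x)))"
    by (intro infsum_add summable_on_cmult_right HH_prod_summable assms)
  also have "\<dots> = \<alpha> * inn f h + \<beta> * inn g h"
    unfolding inn_HH[OF assms(1,3)] inn_HH[OF assms(2,3)] by (simp only: infsum_cmult_right')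
  finally show ?thesis .
qed

lemma inn_sym_HH: assumes "f \<in> HH" "g \<in> HH" shows "inn f g = cnj (inn g f)"
proof -
  have "cnj (inn g f) = (\<Sum>\<^sub>\<infinity>x\<in>II. cnj (g x * cnj (f x) * of_real (wt x)))"
    unfolding inn_HH[OF assms(2,1)] by (rule infsum_cnj[symmetric])
  also have "\<dots> = inn f g" unfolding inn_HH[OF assms] by (simp add: mult_ac)
  finally show ?thesis by simp
qed

lemma inn_pos_HH: assumes "f \<in> HH" shows "0 \<le> Re (inn f f)"
proof -
  have "inn f f = (\<Sum>\<^sub>\<infinity>x\<in>II. complex_of_real (norm (f x) ^ 2 * wt x))"
    unfolding inn_HH[OF assms assms] by (intro infsum_cong) (simp add: complex_norm_square[symmetric])
  also have "\<dots> = complex_of_real (\<Sum>\<^sub>\<infinity>x\<in>II. norm (f x) ^ 2 * wt x)"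
    by (rule infsumI, rule has_sum_of_real, rule has_sum_infsum) (use assms HH_iff in blast)
  finally have "Re (inn f f) = (\<Sum>\<^sub>\<infinity>x\<in>II. norm (f x) ^ 2 * wt x)" by simp
  also have "\<dots> \<ge> 0" by (intro infsum_nonneg mult_nonneg_nonneg) (auto intro: less_imp_le wt_II_pos)
  finally show ?thesis .
qed

lemma TT_lin: "TT (\<lambda>x. \<alpha> * f x + \<beta> * g x) = (\<lambda>x. \<alpha> * TT f x + \<beta> * TT g x)"
  by (auto simp: opL_def fun_eq_iff algebra_simps)

lemma DD_lin:
  assumes f: "f \<in> DD" and g: "g \<in> DD" shows "(\<lambda>x. \<alpha> * f x + \<beta> * g x) \<in> DD"
proof -
  let ?h = "\<lambda>x. \<alpha> * f x + \<beta> * g x"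
  from f obtain l1 l1' where f: "f \<in> HH" "TT f \<in> HH" "(\<lambda>k::nat. f (z * q ^ k)) \<longlonglongrightarrow> l1" "(\<lambda>k::nat. f (- (q ^ k))) \<longlonglongrightarrow> l1"
     "(\<lambda>k::nat. qderiv q f (z * q ^ k)) \<longlonglongrightarrow> l1'" "(\<lambda>k::nat. qderiv q f (- (q ^ k))) \<longlonglongrightarrow> l1'"
    unfolding Ddom_def by blast
  from g obtain l2 l2' where g: "g \<in> HH" "TT g \<in> HH" "(\<lambda>k::nat. g (z * q ^ k)) \<longlonglongrightarrow> l2" "(\<lambda>k::nat. g (- (q ^ k))) \<longlonglongrightarrow> l2"
     "(\<lambda>k::nat. qderiv q g (z * q ^ k)) \<longlonglongrightarrow> l2'" "(\<lambda>k::nat. qderiv q g (- (q ^ k))) \<longlonglongrightarrow> l2'"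
    unfolding Ddom_def by blast
  have qd: "qderiv q ?h x = \<alpha> * qderiv q f x + \<beta> * qderiv q g x" for x
    unfolding qderiv_def by (simp add: algebra_simps add_divide_distrib diff_divide_distrib)
  have "(\<lambda>k::nat. ?h (z * q ^ k)) \<longlonglongrightarrow> \<alpha> * l1 + \<beta> * l2" "(\<lambda>k::nat. ?h (- (q ^ k))) \<longlonglongrightarrow> \<alpha> * l1 + \<beta> * l2"
    "(\<lambda>k::nat. qderiv q ?h (z * q ^ k)) \<longlonglongrightarrow> \<alpha> * l1' + \<beta> * l2'" "(\<lambda>k::nat. qderiv q ?h (- (q ^ k))) \<longlonglongrightarrow> \<alpha> * l1' + \<beta> * l2'"
    unfolding qd by (intro tendsto_add tendsto_mult tendsto_const f g)+
  moreover have "?h \<in> HH" by (intro HH_lin f g)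
  moreover have "TT ?h \<in> HH" unfolding TT_lin by (intro HH_lin f g)
  ultimately show ?thesis unfolding Ddom_def by blast
qed

lemma spectral_setup_big_q:
  assumes "is_spectral_measure_of HH inn TT DD E"
  shows "spectral_setup HH inn TT DD E"
proof
  show "\<And>f. f \<in> DD \<Longrightarrow> TT f \<in> HH" by (simp add: Ddom_def)
qed (rule HH_lin inn_lin_HH inn_sym_HH inn_pos_HH DD_lin TT_lin assms; assumption)+

definition delta :: "real \<Rightarrow> real \<Rightarrow> complex" where "delta y = (\<lambda>x. if x = y then 1 else 0)"

lemma finite_support_HH:
  assumes "f \<in> funs_on II" "finite {x. f x \<noteq> 0}" shows "f \<in> HH"
proof -
  have "(\<lambda>x. norm (f x) ^ 2 * wt x) summable_on II \<longleftrightarrow> (\<lambda>x. norm (f x) ^ 2 * wt x) summable_on {x. f x \<noteq> 0}"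
    using assms(1) by (intro summable_on_cong_neutral) (auto simp: funs_on_def)
  then show ?thesis using assms by (simp add: HH_iff)
qed

lemma inn_finite_support:
  assumes "finite X" "X \<subseteq> II" "\<And>x. x \<notin> X \<Longrightarrow> f x * cnj (g x) = 0"
  shows "inn f g = (\<Sum>x\<in>X. f x * cnj (g x) * of_real (wt x))"
proof -
  have s: "(\<lambda>x. f x * cnj (g x) * of_real (wt x)) summable_on II \<longleftrightarrow> (\<lambda>x. f x * cnj (g x) * of_real (wt x)) summable_on X"
    using assms by (intro summable_on_cong_neutral) auto
  have "inn f g = (\<Sum>\<^sub>\<infinity>x\<in>II. f x * cnj (g x) * of_real (wt x))"
    using s assms(1) by (intro inn_eq) simp
  also have "\<dots> = (\<Sum>\<^sub>\<infinity>x\<in>X. f x * cnj (g x) * of_real (wt x))"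
    using assms by (intro infsum_cong_neutral) auto
  finally show ?thesis using assms(1) by simp
qed

lemma inn_delta: "y \<in> II \<Longrightarrow> inn f (delta y) = f y * of_real (wt y)"
  using inn_finite_support[of "{y}" f "delta y"] by (simp add: delta_def)

lemma II_mult: "x \<in> II \<Longrightarrow> q * x \<in> II"
  by (erule II_cases) (simp_all add: xn_Suc[symmetric] xk_Suc[symmetric])

lemma finite_support_TT:
  assumes "f \<in> funs_on II" "finite {x. f x \<noteq> 0}"
  shows "TT f \<in> funs_on II" "finite {x. TT f x \<noteq> 0}"
proof -
  show "TT f \<in> funs_on II" by (simp add: funs_on_def opL_def)
  have "{x. TT f x \<noteq> 0} \<subseteq> {x. f x \<noteq> 0} \<union> (\<lambda>x. x / q) ` {x. f x \<noteq> 0} \<union> (\<lambda>x. q * x) ` {x. f x \<noteq> 0} \<union> {- 1}"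
  proof
    fix x assume x: "x \<in> {x. TT f x \<noteq> 0}"
    have "f x \<noteq> 0 \<or> f (q * x) \<noteq> 0 \<or> f (x / q) \<noteq> 0 \<or> x = - 1"
      using x by (auto simp: opL_def split: if_splits)
    moreover have "x = (q * x) / q" "x = q * (x / q)" using q_pos by simp_all
    ultimately show "x \<in> {x. f x \<noteq> 0} \<union> (\<lambda>x. x / q) ` {x. f x \<noteq> 0} \<union> (\<lambda>x. q * x) ` {x. f x \<noteq> 0} \<union> {- 1}"
      by blast
  qed
  then show "finite {x. TT f x \<noteq> 0}" by (rule finite_subset) (use assms in auto)
qed

lemma eventually_not_in_finite:
  assumes "finite (X :: real set)" "inj s" shows "eventually (\<lambda>k::nat. s k \<notin> X) sequentially"
proof -
  have "finite (s -` X)" using assms by (intro finite_vimageI)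
  then obtain N where "\<forall>k\<in>s -` X. k < N" using finite_nat_set_iff_bounded by blast
  then show ?thesis unfolding eventually_sequentially by (intro exI[of _ N]) (auto simp: vimage_def not_less[symmetric])
qed

lemma finite_support_DD:
  assumes "f \<in> funs_on II" "finite {x. f x \<noteq> 0}" shows "f \<in> DD"
proof -
  have i1: "inj (\<lambda>k::nat. z * q ^ k)" and i2: "inj (\<lambda>k::nat. - (q ^ k))"
  proof -
    have "(\<lambda>k::nat. z * q ^ k) = (\<lambda>k. xk (int k))" by (simp add: xk_def)
    then show "inj (\<lambda>k::nat. z * q ^ k)" by (auto intro: injI)
    have "(\<lambda>k::nat. - (q ^ k)) = xn" by (auto simp: xn_def)
    then show "inj (\<lambda>k::nat. - (q ^ k))" using inj_xn by simp
  qed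
  have lim: "(\<lambda>k::nat. f (s k)) \<longlonglongrightarrow> 0" "(\<lambda>k::nat. qderiv q f (s k)) \<longlonglongrightarrow> 0" if "inj s" for s
  proof -
    have i: "inj (\<lambda>k. q * s k)" using that q_pos by (auto simp: inj_def)
    have "eventually (\<lambda>k. f (s k) = 0) sequentially"
      using eventually_not_in_finite[OF assms(2) that] by simp
    then show "(\<lambda>k::nat. f (s k)) \<longlonglongrightarrow> 0" by (rule tendsto_eventually)
    have "eventually (\<lambda>k. qderiv q f (s k) = 0) sequentially"
      using eventually_not_in_finite[OF assms(2) that] eventually_not_in_finite[OF assms(2) i]
      by eventually_elim (simp add: qderiv_def)
    then show "(\<lambda>k::nat. qderiv q f (s k)) \<longlonglongrightarrow> 0" by (rule tendsto_eventually)
  qed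
  show ?thesis unfolding Ddom_def
    using finite_support_HH[OF assms] finite_support_HH[OF finite_support_TT[OF assms]] lim[OF i1] lim[OF i2] by blast
qed

lemma delta_support: "y \<in> II \<Longrightarrow> delta y \<in> funs_on II" "finite {x. delta y x \<noteq> 0}"
  by (auto simp: delta_def funs_on_def)

lemma delta_DD: "y \<in> II \<Longrightarrow> delta y \<in> DD" by (intro finite_support_DD delta_support)

lemma delta_HH: "y \<in> II \<Longrightarrow> delta y \<in> HH" by (intro finite_support_HH delta_support)

lemma TT_xk: "TT f (xk k) = of_real (coeffA a b c (xk k)) * (f (xk (k + 1)) - f (xk k)) + of_real (coeffB q b c (xk k)) * (f (xk (k - 1)) - f (xk k))"
  using xk_pos[of k] by (auto simp: opL_def xk_Suc xk_pred)

lemma coeffB_minus_1: "coeffB q b c (- 1) = 0" by (simp add: coeffB_def)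

text \<open>For n = 0 the truncated difference n - 1 is 0 again; the formula stays true since B(- 1)
  = 0.\<close>

lemma TT_xn:
  "TT f (xn n) = of_real (coeffA a b c (xn n)) * (f (xn (Suc n)) - f (xn n)) + of_real (coeffB q b c (xn n)) * (f (xn (n - 1)) - f (xn n))"
proof (cases n)
  case 0
  then show ?thesis using xn_in[of 0] by (simp add: opL_def xn_0 xn_Suc coeffB_minus_1)
next
  case (Suc m)
  have "xn n \<noteq> - 1" using xn_eq_iff[of n 0] Suc by (simp add: xn_0)
  moreover have "xn n / q = xn (n - 1)" using Suc by (simp add: xn_Suc)
  ultimately show ?thesis using xn_in[of n] by (simp add: opL_def xn_Suc del: xn_in)
qed

definition fphi :: "complex \<Rightarrow> real \<Rightarrow> complex" where
  "fphi ga x = (if x \<in> II then psi ga (of_real x) else 0)"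

lemma fphi_xk [simp]: "fphi ga (xk k) = psis ga k" by (simp add: fphi_def psis_def)

lemma xn_nz: "xn n \<noteq> 0" using xn_neg[of n] by simp

lemma TT_fphi_xk: "c < norm ga \<Longrightarrow> TT (fphi ga) (xk k) = mu a ga * fphi ga (xk k)"
  using solves_psis[of ga] unfolding TT_xk solves_def by simp

lemma qpoch_inf_xn_nonzero: "qinf (- (of_real b * of_real c * of_real (xn n))) \<noteq> (0::complex)"
proof -
  have "- (of_real b * of_real c * of_real (xn n)) = complex_of_real (b * c * q ^ n)" by (simp add: xn_def)
  then show ?thesis using qpoch_inf_pos[of "b * c * q ^ n"] bc_q_pos[of n] by (simp only: qpoch_inf_of_real) simp
qed

lemma TT_fphi_xn:
  assumes "c < norm ga" shows "TT (fphi ga) (xn n) = mu a ga * fphi ga (xn n)"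
proof -
  have cond: "complex_of_real (xn n) = - 1 \<or> of_real q + of_real b * of_real c * complex_of_real (xn n) \<noteq> 0"
  proof (cases n)
    case (Suc i)
    have "of_real q + of_real b * of_real c * complex_of_real (xn n) = of_real (q * (1 - b * c * q ^ i))"
      by (simp add: xn_def Suc algebra_simps)
    then show ?thesis using bc_q_pos[of i] q_pos by (simp only: of_real_eq_0_iff) simp
  qed (simp add: xn_0)
  note e = psi_eq[OF assms qpoch_inf_xn_nonzero cond]
  have 1: "psi ga (of_real q * of_real (xn n)) = fphi ga (xn (Suc n))"
    using xn_in[of "Suc n"] by (simp add: fphi_def xn_Suc del: xn_in)
  have 0: "psi ga (of_real (xn n)) = fphi ga (xn n)" by (simp add: fphi_def)
  have 2: "(of_real q + of_real b * of_real c * of_real (xn n)) * (1 + of_real (xn n)) * (psi ga (of_real (xn n) / of_real q) - fphi ga (xn n))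
     = (of_real q + of_real b * of_real c * of_real (xn n)) * (1 + of_real (xn n)) * (fphi ga (xn (n - 1)) - fphi ga (xn n))"
  proof (cases n)
    case (Suc m)
    have "psi ga (of_real (xn n) / of_real q) = fphi ga (xn (n - 1))" by (simp add: Suc fphi_def xn_Suc)
    then show ?thesis by simp
  qed (simp add: xn_0)
  show ?thesis unfolding TT_xn recurrence_iff[OF xn_nz] using e unfolding 0 1 2 .
qed

text \<open>All negative points satisfy \<open>b c |x| < 1\<close>, so only large positive points
  remain, and these are reached by the recurrence. It is what makes the definite description in
  \<open>phi\<close> well defined.\<close>

lemma phi_unique:
  assumes f: "f \<in> funs_on II" "\<And>x. x \<in> II - {- 1} \<Longrightarrow> TT f x = m * f x"
    and g: "g \<in> funs_on II" "\<And>x. x \<in> II - {- 1} \<Longrightarrow> TT g x = m * g x"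
    and eq: "\<And>x. x \<in> II \<Longrightarrow> b * c * \<bar>x\<bar> < 1 \<Longrightarrow> f x = g x"
  shows "f = g"
proof
  fix x
  have bc: "0 < b * c" using b_pos c_pos by simp
  show "f x = g x"
  proof (cases "x \<in> II")
    case True
    then show ?thesis
    proof (cases rule: II_cases)
      case (1 n)
      have "b * c * \<bar>x\<bar> < 1" using bc_q_pos[of n] q_pos by (simp add: 1 xn_def)
      then show ?thesis using eq True by blast
    next
      case (2 k)
      have ne: "xk j \<in> II - {- 1}" for j using xk_pos[of j] by auto
      have sf: "solves m (\<lambda>k. f (xk k))" unfolding solves_def using f(2)[OF ne] unfolding TT_xk by blast
      have sg: "solves m (\<lambda>k. g (xk k))" unfolding solves_def using g(2)[OF ne] unfolding TT_xk by blast
      obtain n :: nat where "q ^ n < 1 / (b * c * z)"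
        using real_arch_pow_inv[of "1 / (b * c * z)" q] q_less_1 bc z_pos by auto
      from mult_strict_left_mono[OF this z_pos] have n: "z * q ^ n < 1 / (b * c)" using z_pos by simp
      have "f (xk j) = g (xk j)" if "int n \<le> j" for j
      proof (rule eq)
        have "xk j \<le> xk (int n)" using that xk_less[of "int n" j] by (cases "int n = j") auto
        then have "xk j < 1 / (b * c)" using n by (simp add: xk_def)
        then have "b * c * xk j < 1" using bc by (simp add: field_simps)
        then show "b * c * \<bar>xk j\<bar> < 1" using xk_pos[of j] by simp
      qed simp
      then have "f (xk k) = g (xk k)" by (rule solves_unique[OF sf sg, where k = k])
      then show ?thesis by (simp add: 2)
    qed
  qed (use f g in \<open>auto simp: funs_on_def\<close>)
qed

text \<open>The extension demanded in the definition of \<open>phi\<close> is realised by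
  \<open>psi\<close>: it equals the series inside the disc and satisfies the equation
  everywhere.\<close>

lemma phi_eq_fphi:
  assumes g: "c < norm ga" and im: "Im ga \<noteq> 0"
  shows "phi q z a b c ga = fphi ga"
  unfolding phi_def
proof (rule the_equality)
  have bc: "0 < b * c" using b_pos c_pos by simp
  have ser: "fphi ga x = phi32 q (of_real a * ga) (of_real a / ga) (of_real (- 1 / x)) (of_real (a * b)) (of_real (a * c)) (of_real (- (b * c * x)))"
    if "x \<in> II" "b * c * \<bar>x\<bar> < 1" for x
  proof -
    have x0: "x \<noteq> 0" using that(1) by (rule II_cases) (use xn_nz xk_pos less_irrefl in metis)+
    have "norm (complex_of_real x) < 1 / (b * c)" using that bc by (simp add: field_simps)
    then show ?thesis unfolding phi32_eq_phi_ser[OF x0] using phi_ser_eq_psi[OF g im] that(1) by (simp add: fphi_def)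
  qed
  have eig: "TT (fphi ga) x = mu a ga * fphi ga x" if "x \<in> II" for x
    using that by (rule II_cases) (use TT_fphi_xk[OF g] TT_fphi_xn[OF g] in auto)
  have fo: "fphi ga \<in> funs_on II" by (simp add: funs_on_def fphi_def)
  show "fphi ga \<in> funs_on II \<and>
     (\<forall>x \<in> II. b * c * \<bar>x\<bar> < 1 \<longrightarrow>
        fphi ga x = phi32 q (of_real a * ga) (of_real a / ga) (of_real (- 1 / x))
                (of_real (a * b)) (of_real (a * c)) (of_real (- (b * c * x)))) \<and>
     (\<forall>x \<in> II - {-1}. TT (fphi ga) x = mu a ga * fphi ga x)"
    using fo ser eig by blast
  fix f assume f: "f \<in> funs_on II \<and>
     (\<forall>x \<in> II. b * c * \<bar>x\<bar> < 1 \<longrightarrow>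
        f x = phi32 q (of_real a * ga) (of_real a / ga) (of_real (- 1 / x))
                (of_real (a * b)) (of_real (a * c)) (of_real (- (b * c * x)))) \<and>
     (\<forall>x \<in> II - {-1}. TT f x = mu a ga * f x)"
  show "f = fphi ga"
    by (rule phi_unique[where m = "mu a ga"]) (use f fo ser eig in auto)
qed

end

section \<open>The Green function and its jump\<close>

lemma LIMSEQ_bounded:
  fixes X :: "nat \<Rightarrow> 'a::real_normed_vector"
  assumes "X \<longlonglongrightarrow> l" obtains C where "0 \<le> C" "\<And>n. norm (X n) \<le> C"
  using convergent_imp_Bseq[OF convergentI[OF assms]] by (auto elim!: BseqE intro: less_imp_le)

lemma summable_on_geometric:
  fixes F :: "nat \<Rightarrow> real"
  assumes "\<And>n. norm (F n) \<le> K * r ^ n" "0 \<le> r" "r < 1" shows "F summable_on UNIV"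
proof (rule norm_summable_imp_summable_on, rule summable_comparison_test'[where N = 0])
  show "summable (\<lambda>n. K * r ^ n)" using assms(2,3) by (intro summable_mult summable_geometric) auto
  show "norm (norm (F n)) \<le> K * r ^ n" for n using assms(1)[of n] by simp
qed

context big_q begin

text \<open>The q-derivative of \<open>phi_ser\<close>, obtained from D_q ebas_(n+1) = (1 - q^(n+1))
  / (1 - q) ebas_n.\<close>

definition phi_dser :: "complex \<Rightarrow> complex \<Rightarrow> complex" where
  "phi_dser ga x = (\<Sum>n. phi_coef ga (Suc n) * ((1 - of_real q ^ Suc n) / (1 - of_real q)) * ebas x n)"

lemma phi_dser_term_bound:
  assumes "norm ga \<le> R" "norm (1 / ga) \<le> R" "norm x \<le> 1"
  shows "norm (phi_coef ga (Suc n) * ((1 - of_real q ^ Suc n) / (1 - of_real q)) * ebas x n)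
    \<le> phi_coef_bound R * qinf (- 1) / (1 - q) * (b * c) ^ Suc n"
proof -
  have R: "0 \<le> R" using assms norm_ge_zero[of ga] by linarith
  have q: "0 \<le> 1 - q ^ Suc n" "1 - q ^ Suc n \<le> 1" using q_pos q_less_1 power_le_one[of q "Suc n"] by auto
  have "(1 - complex_of_real q ^ Suc n) / (1 - of_real q) = of_real ((1 - q ^ Suc n) / (1 - q))" by simp
  then have n2: "norm ((1 - complex_of_real q ^ Suc n) / (1 - of_real q)) \<le> 1 / (1 - q)"
    using q q_less_1 by (simp only: norm_of_real) (simp add: divide_right_mono)
  have n3: "norm (ebas x n) \<le> qinf (- 1)" using ebas_bound[of x 1 n] assms by simp
  have "norm (phi_coef ga (Suc n) * ((1 - of_real q ^ Suc n) / (1 - of_real q)) * ebas x n)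
     \<le> (phi_coef_bound R * (b * c) ^ Suc n * (1 / (1 - q))) * qinf (- 1)"
    unfolding norm_mult[of _ "ebas x n"] norm_mult[of "phi_coef ga (Suc n)"]
    using q_less_1 b_pos c_pos R
    by (intro mult_mono n2 n3 phi_coef_bound assms mult_nonneg_nonneg phi_coef_bound_nonneg) auto
  then show ?thesis by (simp add: mult_ac)
qed

lemma summable_bc: "summable (\<lambda>n. K * (b * c) ^ Suc n :: real)" "summable (\<lambda>n. K * (b * c) ^ n :: real)"
proof -
  have s: "summable (\<lambda>n. (b * c) ^ n)" using bc_less_1 b_pos c_pos by (intro summable_geometric) auto
  show "summable (\<lambda>n. K * (b * c) ^ n :: real)" using s by (rule summable_mult)
  then show "summable (\<lambda>n. K * (b * c) ^ Suc n :: real)" by (rule summable_Suc_iff[THEN iffD2])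
qed

lemma ebas_diff_q: "ebas x (Suc n) - ebas (of_real q * x) (Suc n) = (1 - of_real q ^ Suc n) * x * ebas x n"
  unfolding ebas_q ebas_Suc[of x] by (simp add: algebra_simps)

lemma phi_ser_diff_q:
  assumes g: "ga \<noteq> 0" and x: "norm x \<le> 1"
  shows "phi_ser ga x - phi_ser ga (of_real q * x) = (1 - of_real q) * x * phi_dser ga x"
proof -
  have bx: "b * c * norm y < 1" if "norm y \<le> 1" for y :: complex
  proof -
    have "b * c * norm y \<le> b * c * 1" using that b_pos c_pos by (intro mult_left_mono) auto
    then show ?thesis using bc_less_1 by simp
  qed
  have qx: "norm (of_real q * x) \<le> 1" using mult_le_one[of q "norm x"] x q_pos q_less_1 by (simp add: norm_mult)
  have s: "summable (\<lambda>n. phi_coef ga n * ebas x n - phi_coef ga n * ebas (of_real q * x) n)"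
    by (intro summable_diff phi_summable g bx x qx)
  have "phi_ser ga x - phi_ser ga (of_real q * x) = (\<Sum>n. phi_coef ga n * ebas x n - phi_coef ga n * ebas (of_real q * x) n)"
    unfolding phi_ser_def by (intro suminf_diff phi_summable g bx x qx)
  also have "\<dots> = (\<Sum>n. phi_coef ga (Suc n) * ebas x (Suc n) - phi_coef ga (Suc n) * ebas (of_real q * x) (Suc n))"
    using suminf_split_head[OF s] by simp
  also have "\<dots> = (\<Sum>n. (1 - of_real q) * x * (phi_coef ga (Suc n) * ((1 - of_real q ^ Suc n) / (1 - of_real q)) * ebas x n))"
  proof (rule suminf_cong)
    fix n
    have q1: "1 - complex_of_real q \<noteq> 0" using q_less_1 by simp
    have al: "Q \<noteq> 0 \<Longrightarrow> P * (U * x * e) = Q * x * (P * (U / Q) * e)" for P Q U e :: complex by simp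
    show "phi_coef ga (Suc n) * ebas x (Suc n) - phi_coef ga (Suc n) * ebas (of_real q * x) (Suc n)
      = (1 - of_real q) * x * (phi_coef ga (Suc n) * ((1 - of_real q ^ Suc n) / (1 - of_real q)) * ebas x n)"
      unfolding right_diff_distrib[symmetric] ebas_diff_q by (rule al[OF q1])
  qed
  also have "\<dots> = (1 - of_real q) * x * phi_dser ga x" unfolding phi_dser_def
  proof (rule suminf_mult)
    show "summable (\<lambda>n. phi_coef ga (Suc n) * ((1 - of_real q ^ Suc n) / (1 - of_real q)) * ebas x n)"
    proof (rule summable_comparison_test'[where N = 0])
      show "norm (phi_coef ga (Suc n) * ((1 - of_real q ^ Suc n) / (1 - of_real q)) * ebas x n)
        \<le> phi_coef_bound (max (norm ga) (norm (1 / ga))) * qinf (- 1) / (1 - q) * (b * c) ^ Suc n" for n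
        by (rule phi_dser_term_bound) (use x in auto)
    qed (rule summable_bc)
  qed
  finally show ?thesis .
qed

lemma phi_series_near_0:
  assumes s: "s \<longlonglongrightarrow> 0" and s1: "\<And>j. norm (s j) \<le> 1"
  shows "(\<lambda>j. phi_ser ga (s j)) \<longlonglongrightarrow> phi_ser ga 0" "(\<lambda>j. phi_dser ga (s j)) \<longlonglongrightarrow> phi_dser ga 0"
proof -
  define R where "R = max (norm ga) (norm (1 / ga))"
  have e: "(\<lambda>j. ebas (s j) n) \<longlonglongrightarrow> ebas 0 n" for n
    unfolding ebas_def by (intro tendsto_prod tendsto_add s tendsto_const)
  show "(\<lambda>j. phi_ser ga (s j)) \<longlonglongrightarrow> phi_ser ga 0" unfolding phi_ser_def
  proof (rule tannery_seq)
    show "(\<lambda>j. phi_coef ga n * ebas (s j) n) \<longlonglongrightarrow> phi_coef ga n * ebas 0 n" for n by (intro tendsto_mult e tendsto_const)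
    show "norm (phi_coef ga n * ebas (s j) n) \<le> phi_coef_bound R * qinf (- 1) * (b * c) ^ n" for j n
      using phi_term_bound[of ga R "s j" 1 n] s1 by (simp add: R_def)
  qed (rule summable_bc)
  show "(\<lambda>j. phi_dser ga (s j)) \<longlonglongrightarrow> phi_dser ga 0" unfolding phi_dser_def
  proof (rule tannery_seq)
    show "(\<lambda>j. phi_coef ga (Suc n) * ((1 - of_real q ^ Suc n) / (1 - of_real q)) * ebas (s j) n)
      \<longlonglongrightarrow> phi_coef ga (Suc n) * ((1 - of_real q ^ Suc n) / (1 - of_real q)) * ebas 0 n" for n
      by (intro tendsto_mult e tendsto_const)
    show "norm (phi_coef ga (Suc n) * ((1 - of_real q ^ Suc n) / (1 - of_real q)) * ebas (s j) n)
      \<le> phi_coef_bound R * qinf (- 1) / (1 - q) * (b * c) ^ Suc n" for j n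
      by (rule phi_dser_term_bound) (use s1 in \<open>auto simp: R_def\<close>)
  qed (rule summable_bc)
qed

lemma fphi_phi_ser:
  assumes g: "c < norm ga" and im: "Im ga \<noteq> 0" and x: "x \<in> II" "\<bar>x\<bar> \<le> 1"
  shows "fphi ga x = phi_ser ga (of_real x)"
proof -
  have "1 < 1 / (b * c)" using bc_less_1 b_pos c_pos by simp
  then show ?thesis using phi_ser_eq_psi[OF g im, of "of_real x"] x by (simp add: fphi_def)
qed

lemma qderiv_fphi:
  assumes g: "c < norm ga" and im: "Im ga \<noteq> 0" and x: "x \<in> II" "\<bar>x\<bar> \<le> 1"
  shows "qderiv q (fphi ga) x = phi_dser ga (of_real x)"
proof -
  have qx: "\<bar>q * x\<bar> \<le> 1" using mult_le_one[of q "\<bar>x\<bar>"] x q_pos q_less_1 by (simp add: abs_mult)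
  have g0: "ga \<noteq> 0" using im by auto
  have x0: "x \<noteq> 0" using x(1) by (rule II_cases) (use xn_nz xk_pos less_irrefl in metis)+
  have "fphi ga x - fphi ga (q * x) = (1 - of_real q) * of_real x * phi_dser ga (of_real x)"
    using fphi_phi_ser[OF g im x] fphi_phi_ser[OF g im II_mult[OF x(1)] qx] phi_ser_diff_q[OF g0, of "of_real x"] x by simp
  then show ?thesis using x0 q_less_1 by (simp add: qderiv_def)
qed

text \<open>The limits do not depend on the sequence. Applied to z q^k and to - q^k this is the
  matching condition of the domain.\<close>

lemma fphi_near_0:
  assumes g: "c < norm ga" and im: "Im ga \<noteq> 0" and s: "s \<longlonglongrightarrow> 0" "\<And>j. s j \<in> II"
  shows "(\<lambda>j. fphi ga (s j)) \<longlonglongrightarrow> phi_ser ga 0" "(\<lambda>j. qderiv q (fphi ga) (s j)) \<longlonglongrightarrow> phi_dser ga 0"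
proof -
  have ev: "eventually (\<lambda>j. \<bar>s j\<bar> \<le> 1) sequentially"
    using tendstoD[OF s(1), of 1] by (simp add: dist_norm eventually_mono less_imp_le)
  \<comment> \<open>The bounds on the series hold in the unit disc, so the finitely many points
    outside it are replaced by 0.\<close>
  define s' where "s' j = (if \<bar>s j\<bar> \<le> 1 then complex_of_real (s j) else 0)" for j
  have ev2: "eventually (\<lambda>j. complex_of_real (s j) = s' j) sequentially"
    using ev by eventually_elim (simp add: s'_def)
  have s'0: "s' \<longlonglongrightarrow> 0" using Lim_transform_eventually[OF tendsto_of_real[OF s(1)] ev2] by simp
  have s'1: "norm (s' j) \<le> 1" for j by (simp add: s'_def)
  note l = phi_series_near_0[OF s'0 s'1, of ga]
  show "(\<lambda>j. fphi ga (s j)) \<longlonglongrightarrow> phi_ser ga 0"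
    by (rule Lim_transform_eventually[OF l(1)])
       (use ev in eventually_elim, simp add: s'_def fphi_phi_ser[OF g im s(2)])
  show "(\<lambda>j. qderiv q (fphi ga) (s j)) \<longlonglongrightarrow> phi_dser ga 0"
    by (rule Lim_transform_eventually[OF l(2)])
       (use ev in eventually_elim, simp add: s'_def qderiv_fphi[OF g im s(2)])
qed

lemma xn_LIMSEQ: "xn \<longlonglongrightarrow> 0"
proof -
  have "(\<lambda>n. - (q ^ n)) \<longlonglongrightarrow> - 0" by (intro tendsto_minus q_power_LIMSEQ)
  then show ?thesis by (simp add: xn_def[abs_def])
qed

lemma xk_LIMSEQ: "(\<lambda>n. xk (int n)) \<longlonglongrightarrow> 0"
proof -
  have "(\<lambda>n. z * q ^ n) \<longlonglongrightarrow> z * 0" by (intro tendsto_mult tendsto_const q_power_LIMSEQ)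
  then show ?thesis by (simp add: xk_def)
qed

lemma wt_bound_near_0:
  assumes s: "s \<longlonglongrightarrow> 0"
  obtains M where "\<And>n::nat. wt (s n) \<le> M * \<bar>s n\<bar>" "0 \<le> M"
proof -
  have "(\<lambda>n. (1 - q) / pfun q a b c (s n)) \<longlonglongrightarrow> (1 - q) / pfun q a b c 0"
    unfolding pfun_def by (intro tendsto_intros s) simp_all
  then obtain M where M: "0 \<le> M" "\<And>n. norm ((1 - q) / pfun q a b c (s n)) \<le> M" by (rule LIMSEQ_bounded) blast
  show thesis
  proof (rule that)
    fix n
    have "wt (s n) = (1 - q) / pfun q a b c (s n) * \<bar>s n\<bar>" by (simp add: wt_def)
    also have "\<dots> \<le> M * \<bar>s n\<bar>"
      by (rule mult_right_mono[OF order.trans[OF abs_ge_self M(2)[of n, unfolded real_norm_def]]]) simp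
    finally show "wt (s n) \<le> M * \<bar>s n\<bar>" .
  qed (use M in simp)
qed

text \<open>The weight is of order |x| near 0, hence geometric along the sequence, and a convergent
  f is bounded there.\<close>

lemma summable_near_0:
  fixes f :: "real \<Rightarrow> complex"
  assumes s: "\<And>n. s n = u * q ^ n" "\<And>n::nat. s n \<in> II" and f: "(\<lambda>n. f (s n)) \<longlonglongrightarrow> l"
  shows "(\<lambda>n. norm (f (s n)) ^ 2 * wt (s n)) summable_on UNIV"
proof -
  have s0: "s \<longlonglongrightarrow> 0"
  proof -
    have "(\<lambda>n. u * q ^ n) \<longlonglongrightarrow> u * 0" by (intro tendsto_mult tendsto_const q_power_LIMSEQ)
    moreover have "s = (\<lambda>n. u * q ^ n)" using s(1) by (rule ext)
    ultimately show ?thesis by simp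
  qed
  obtain M where M: "\<And>n. wt (s n) \<le> M * \<bar>s n\<bar>" "0 \<le> M" using wt_bound_near_0[OF s0] by blast
  obtain C where C: "\<And>n. norm (f (s n)) \<le> C" by (rule LIMSEQ_bounded[OF f]) blast
  have b: "norm (norm (f (s n)) ^ 2 * wt (s n)) \<le> C ^ 2 * M * \<bar>u\<bar> * q ^ n" for n
  proof -
    have "norm (f (s n)) ^ 2 * wt (s n) \<le> C ^ 2 * (M * \<bar>s n\<bar>)"
      using C M wt_II_pos[OF s(2)[of n]] by (intro mult_mono power_mono) auto
    moreover have "\<bar>s n\<bar> = \<bar>u\<bar> * q ^ n" using q_pos by (simp add: s(1) abs_mult)
    ultimately show ?thesis using wt_II_pos[OF s(2)[of n]] by (simp add: mult_ac)
  qed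
  show ?thesis by (rule summable_on_geometric[OF b]) (use q_pos q_less_1 in auto)
qed

lemma summable_on_int:
  fixes F :: "int \<Rightarrow> real"
  assumes "(\<lambda>n. F (int n)) summable_on UNIV" "(\<lambda>n. F (- int n)) summable_on UNIV"
  shows "F summable_on UNIV"
proof -
  have 1: "F summable_on range int"
    using assms(1) summable_on_reindex[of int UNIV F] by (simp add: o_def)
  have 2: "F summable_on range (\<lambda>n. - int n)"
    using assms(2) summable_on_reindex[of "\<lambda>n. - int n" UNIV F] by (simp add: o_def inj_def)
  have 3: "F summable_on range (\<lambda>n. - int n) - range int"
    by (rule summable_on_subset_banach[OF 2]) auto
  have "UNIV = range int \<union> (range (\<lambda>n. - int n) - range int)"
  proof (intro equalityI subsetI)
    fix x :: int
    show "x \<in> range int \<union> (range (\<lambda>n. - int n) - range int)" by (cases x rule: int_cases2) auto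
  qed simp
  then show ?thesis using summable_on_Un_disjoint[OF 1 3] by simp
qed

text \<open>|Phi|^2 is of order (a / norm ga)^(2n) and the weight of order a^(-2n), so the terms
  decay like norm ga ^ (-2n); this needs \<open>ga\<close> strictly outside the circle.\<close>

lemma Phi_summable:
  assumes g: "1 < norm ga" and im: "Im ga \<noteq> 0"
  shows "(\<lambda>n. norm (Phi ga (- int n)) ^ 2 * wt (xk (- int n))) summable_on UNIV"
proof -
  have g0: "ga \<noteq> 0" using im by auto
  have g1: "1 \<le> norm ga" using g by simp
  obtain C where C: "\<And>n. norm (Phi ga (- int n) / (of_real a / ga) ^ n) \<le> C"
    by (rule LIMSEQ_bounded[OF Phi_LIMSEQ[OF g1 im]]) blast
  obtain M where M: "\<And>n. norm (J (- int n) * a ^ (2 * n)) \<le> M"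
    by (rule LIMSEQ_bounded[OF J_LIMSEQ]) blast
  have C0: "0 \<le> C" using C[of 0] norm_ge_zero order.trans by blast
  have b: "norm (norm (Phi ga (- int n)) ^ 2 * wt (xk (- int n))) \<le> C ^ 2 * M * ((1 / norm ga) ^ 2) ^ n" for n
  proof -
    let ?x = "xk (- int n)"
    have x: "0 < ?x" by (rule xk_pos)
    have "1 * 1 \<le> coeffB q b c ?x" unfolding coeffB_def using x b_pos c_pos q_pos
      by (intro mult_mono) auto
    then have "1 * wt ?x \<le> coeffB q b c ?x * wt ?x" using wt_pos[OF x] by (intro mult_right_mono) auto
    then have w: "wt ?x * a ^ (2 * n) \<le> M" using M[of n] mult_right_mono[of "wt ?x" "J (- int n)" "a ^ (2 * n)"] a_pos
      by (simp add: J_def)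
    have "norm (Phi ga (- int n)) = norm (Phi ga (- int n) / (of_real a / ga) ^ n) * (a / norm ga) ^ n"
    proof -
      have "Phi ga (- int n) = Phi ga (- int n) / (of_real a / ga) ^ n * (of_real a / ga) ^ n" using a_pos g0 by simp
      then have "norm (Phi ga (- int n)) = norm (Phi ga (- int n) / (of_real a / ga) ^ n) * norm ((of_real a / ga) ^ n)"
        by (metis norm_mult)
      then show ?thesis using a_pos by (simp add: norm_power norm_divide)
    qed
    also have "\<dots> \<le> C * (a / norm ga) ^ n" using C a_pos by (intro mult_right_mono) auto
    finally have "norm (Phi ga (- int n)) ^ 2 * wt ?x \<le> (C * (a / norm ga) ^ n) ^ 2 * wt ?x"
      using wt_pos[OF x] by (intro mult_right_mono power_mono) auto
    also have "\<dots> = C ^ 2 * ((1 / norm ga) ^ 2) ^ n * (wt ?x * a ^ (2 * n))"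
      by (simp add: power_mult_distrib power_divide power_mult[symmetric] mult.commute[of n 2])
    also have "\<dots> \<le> C ^ 2 * ((1 / norm ga) ^ 2) ^ n * M" using w by (intro mult_left_mono) auto
    finally show ?thesis using wt_pos[OF x] by (simp add: mult_ac)
  qed
  have "(1 / norm ga) ^ 2 < 1" using one_less_power[OF g, of 2] by (simp add: power_divide divide_less_eq_1)
  then show ?thesis by (intro summable_on_geometric[OF b]) auto
qed

text \<open>To the left of the pole \<open>xk k\<close>, including all negative points, it is a
  multiple of the regular solution; \<open>Phi\<close> enters only at points larger than the pole,
  hence on the positive half. The Wronskian is constant, so its index 0 is a choice.\<close>

definition green :: "complex \<Rightarrow> int \<Rightarrow> real \<Rightarrow> complex" where
  "green ga k x = (if x \<in> II then of_real (wt (xk k)) / Wr (psis ga) (Phi ga) 0 *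
     (if x \<le> xk k then Phi ga k * fphi ga x else psis ga k * Phi ga (inv xk x)) else 0)"

lemma xk_le_iff: "xk l \<le> xk k \<longleftrightarrow> k \<le> l"
  using xk_less[of k l] xk_less[of l k] by (cases k l rule: linorder_cases) auto

lemma green_xk: "green ga k (xk l) = of_real (wt (xk k)) / Wr (psis ga) (Phi ga) 0 *
     (if k \<le> l then Phi ga k * psis ga l else psis ga k * Phi ga l)"
  using inj_xk by (simp add: green_def xk_le_iff)

lemma green_xn: "green ga k (xn n) = of_real (wt (xk k)) / Wr (psis ga) (Phi ga) 0 * Phi ga k * fphi ga (xn n)"
  using xn_neg[of n] xk_pos[of k] by (simp add: green_def)

lemma Wr_psi_Phi_nonzero:
  assumes g: "1 \<le> norm ga" and im: "Im ga \<noteq> 0" shows "Wr (psis ga) (Phi ga) k \<noteq> 0"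
proof -
  have "1 / ga - ga \<noteq> 0"
  proof
    assume "1 / ga - ga = 0"
    moreover have "ga \<noteq> 0" using im by auto
    ultimately have "ga * ga = 1" by (simp add: field_simps)
    then have "ga = 1 \<or> ga = - 1" by (simp add: square_eq_1_iff)
    then show False using im by auto
  qed
  then show ?thesis unfolding Wr_psi_Phi[OF g im] using cfun_nonzero[OF g im] Kconst_pos a_pos by simp
qed

lemma TT_green:
  assumes g: "1 < norm ga" and im: "Im ga \<noteq> 0"
  shows "delta (xk k) = (\<lambda>x. TT (green ga k) x - mu a ga * green ga k x)"
proof
  fix x
  have g1: "1 \<le> norm ga" and gc: "c < norm ga" using g c_less_1 by auto
  define \<kappa> where "\<kappa> = of_real (wt (xk k)) / Wr (psis ga) (Phi ga) 0"
  show "delta (xk k) x = TT (green ga k) x - mu a ga * green ga k x"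
  proof (cases "x \<in> II")
    case False
    then show ?thesis by (auto simp: opL_def green_def delta_def)
  next
    case True
    then show ?thesis
    proof (cases rule: II_cases)
      case (1 n)
      have "TT (green ga k) (xn n) = \<kappa> * Phi ga k * TT (fphi ga) (xn n)"
        unfolding TT_xn green_xn \<kappa>_def[symmetric] by (simp add: algebra_simps)
      then show ?thesis unfolding 1 TT_fphi_xn[OF gc] using xn_neq_xk[of n k]
        by (simp add: green_xn \<kappa>_def delta_def)
    next
      case (2 l)
      let ?A = "complex_of_real (coeffA a b c (xk l))" and ?B = "complex_of_real (coeffB q b c (xk l))"
      have p: "?A * (psis ga (l + 1) - psis ga l) + ?B * (psis ga (l - 1) - psis ga l) = mu a ga * psis ga l"
        using solves_psis[OF gc] unfolding solves_def by blast
      have P: "?A * (Phi ga (l + 1) - Phi ga l) + ?B * (Phi ga (l - 1) - Phi ga l) = mu a ga * Phi ga l"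
        using solves_Phi[OF g1 im] unfolding solves_def by blast
      have T: "TT (green ga k) (xk l) = ?A * (green ga k (xk (l + 1)) - green ga k (xk l)) + ?B * (green ga k (xk (l - 1)) - green ga k (xk l))"
        by (rule TT_xk)
      note G = green_xk[of ga k, folded \<kappa>_def]
      consider "l < k" | "k < l" | "l = k" by linarith
      then show ?thesis
      proof cases
        case lk: 1
        have e: "green ga k (xk (l + 1)) = \<kappa> * psis ga k * Phi ga (l + 1)" "green ga k (xk l) = \<kappa> * psis ga k * Phi ga l"
          "green ga k (xk (l - 1)) = \<kappa> * psis ga k * Phi ga (l - 1)"
          unfolding G using lk by (cases "l + 1 = k"; simp)+
        have "TT (green ga k) (xk l) = \<kappa> * psis ga k * (mu a ga * Phi ga l)"
          unfolding T e P[symmetric] by (simp add: algebra_simps)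
        then show ?thesis using lk e by (simp add: 2 delta_def)
      next
        case lk: 2
        have e: "green ga k (xk (l + 1)) = \<kappa> * Phi ga k * psis ga (l + 1)" "green ga k (xk l) = \<kappa> * Phi ga k * psis ga l"
          "green ga k (xk (l - 1)) = \<kappa> * Phi ga k * psis ga (l - 1)"
          unfolding G using lk by auto
        have "TT (green ga k) (xk l) = \<kappa> * Phi ga k * (mu a ga * psis ga l)"
          unfolding T e p[symmetric] by (simp add: algebra_simps)
        then show ?thesis using lk e by (simp add: 2 delta_def)
      next
        case lk: 3
        have e: "green ga k (xk (l + 1)) = \<kappa> * Phi ga k * psis ga (l + 1)" "green ga k (xk l) = \<kappa> * Phi ga k * psis ga l"
          "green ga k (xk (l - 1)) = \<kappa> * psis ga k * Phi ga (l - 1)"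
          unfolding G using lk by auto
        \<comment> \<open>At the pole only the outer neighbour \<open>xk (k - 1)\<close> follows
          \<open>Phi\<close> instead of \<open>psis\<close>; the defect in the recurrence is the
          Casorati determinant at k.\<close>
        have "TT (green ga k) (xk l) - mu a ga * green ga k (xk l)
          = \<kappa> * Phi ga k * (?A * (psis ga (l + 1) - psis ga l) + ?B * (psis ga (l - 1) - psis ga l) - mu a ga * psis ga l)
           + \<kappa> * (?B * (psis ga l * Phi ga (l - 1) - psis ga (l - 1) * Phi ga l))"
          unfolding T e by (simp add: lk algebra_simps)
        also have "\<dots> = \<kappa> * (?B * (psis ga l * Phi ga (l - 1) - psis ga (l - 1) * Phi ga l))" unfolding p by simp
        also have "\<dots> = Wr (psis ga) (Phi ga) k / Wr (psis ga) (Phi ga) 0"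
          unfolding Wr_def[of _ _ k] J_def \<kappa>_def lk by simp
        also have "\<dots> = 1"
          using Wr_const[OF solves_psis[OF gc] solves_Phi[OF g1 im], of k 0] Wr_psi_Phi_nonzero[OF g1 im] by simp
        finally show ?thesis by (simp add: 2 lk delta_def)
      qed
    qed
  qed
qed

text \<open>Near 0 from both sides it is a multiple of the regular solution, which satisfies the
  matching conditions; far out it is a multiple of \<open>Phi\<close>, which is square
  summable.\<close>

lemma green_DD:
  assumes g: "1 < norm ga" and im: "Im ga \<noteq> 0"
  shows "green ga k \<in> DD"
proof -
  have gc: "c < norm ga" using g c_less_1 by auto
  define \<kappa> where "\<kappa> = of_real (wt (xk k)) / Wr (psis ga) (Phi ga) 0 * Phi ga k"
  define \<kappa>' where "\<kappa>' = of_real (wt (xk k)) / Wr (psis ga) (Phi ga) 0 * psis ga k"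
  have eq: "green ga k x = \<kappa> * fphi ga x" if "x \<le> xk k" for x
    using that by (simp add: green_def fphi_def \<kappa>_def)
  have lim: "(\<lambda>j. green ga k (s j)) \<longlonglongrightarrow> \<kappa> * phi_ser ga 0 \<and> (\<lambda>j. qderiv q (green ga k) (s j)) \<longlonglongrightarrow> \<kappa> * phi_dser ga 0"
    if s: "s \<longlonglongrightarrow> 0" "\<And>j. s j \<in> II" for s
  proof -
    have "eventually (\<lambda>j. s j < xk k) sequentially" "eventually (\<lambda>j. q * s j < xk k) sequentially"
      using order_tendstoD(2)[OF s(1) xk_pos] order_tendstoD(2)[OF tendsto_mult[OF tendsto_const s(1), of q], of "xk k"] xk_pos by simp_all
    then have ev: "eventually (\<lambda>j. s j \<le> xk k \<and> q * s j \<le> xk k) sequentially" by eventually_elim simp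
    have "eventually (\<lambda>j. \<kappa> * fphi ga (s j) = green ga k (s j)) sequentially"
      using ev by eventually_elim (simp add: eq)
    moreover have "eventually (\<lambda>j. \<kappa> * qderiv q (fphi ga) (s j) = qderiv q (green ga k) (s j)) sequentially"
      using ev by eventually_elim (simp add: eq qderiv_def right_diff_distrib)
    ultimately show ?thesis
      using Lim_transform_eventually[OF tendsto_mult[OF tendsto_const fphi_near_0(1)[OF gc im s]]]
        Lim_transform_eventually[OF tendsto_mult[OF tendsto_const fphi_near_0(2)[OF gc im s]]] by simp
  qed
  have lk: "(\<lambda>j. green ga k (z * q ^ j)) \<longlonglongrightarrow> \<kappa> * phi_ser ga 0 \<and> (\<lambda>j. qderiv q (green ga k) (z * q ^ j)) \<longlonglongrightarrow> \<kappa> * phi_dser ga 0"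
    using lim[OF xk_LIMSEQ xk_in] by (simp add: xk_def)
  have ln: "(\<lambda>j. green ga k (- (q ^ j))) \<longlonglongrightarrow> \<kappa> * phi_ser ga 0 \<and> (\<lambda>j. qderiv q (green ga k) (- (q ^ j))) \<longlonglongrightarrow> \<kappa> * phi_dser ga 0"
    using lim[OF xn_LIMSEQ xn_in] by (simp add: xn_def)
  have far: "(\<lambda>n. norm (green ga k (xk (- int n))) ^ 2 * wt (xk (- int n))) summable_on UNIV"
  proof -
    have s: "(\<lambda>n. norm \<kappa>' ^ 2 * (norm (Phi ga (- int n)) ^ 2 * wt (xk (- int n)))) summable_on UNIV"
      by (intro summable_on_cmult_right Phi_summable g im)
    let ?N = "{n. k \<le> - int n}"
    \<comment> \<open>Only finitely many of the far points lie at or to the left of the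
      pole.\<close>
    have "finite ?N" by (rule finite_subset[of _ "{..nat (- k)}"]) auto
    have 1: "(\<lambda>n. norm (green ga k (xk (- int n))) ^ 2 * wt (xk (- int n))) summable_on (- ?N)"
    proof (rule summable_on_cong[THEN iffD1])
      show "(\<lambda>n. norm \<kappa>' ^ 2 * (norm (Phi ga (- int n)) ^ 2 * wt (xk (- int n)))) summable_on (- ?N)"
        by (rule summable_on_subset_banach[OF s]) simp
      fix n assume "n \<in> - ?N"
      then have "green ga k (xk (- int n)) = \<kappa>' * Phi ga (- int n)" by (simp add: green_xk \<kappa>'_def)
      then show "norm \<kappa>' ^ 2 * (norm (Phi ga (- int n)) ^ 2 * wt (xk (- int n))) = norm (green ga k (xk (- int n))) ^ 2 * wt (xk (- int n))"
        by (simp add: norm_mult power_mult_distrib mult_ac)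
    qed
    have "(\<lambda>n. norm (green ga k (xk (- int n))) ^ 2 * wt (xk (- int n))) summable_on (?N \<union> - ?N)"
      using \<open>finite ?N\<close> by (intro summable_on_Un_disjoint 1) auto
    then show ?thesis by simp
  qed
  have hH: "green ga k \<in> HH"
    unfolding HH_iff summable_II
  proof (intro conjI)
    show "green ga k \<in> funs_on II" by (simp add: funs_on_def green_def)
    show "(\<lambda>n. norm (green ga k (xn n)) ^ 2 * wt (xn n)) summable_on UNIV"
      by (rule summable_near_0[where u = "- 1" and l = "\<kappa> * phi_ser ga 0"]) (use lim[OF xn_LIMSEQ xn_in] in \<open>simp_all, simp add: xn_def\<close>)
    show "(\<lambda>j. norm (green ga k (xk j)) ^ 2 * wt (xk j)) summable_on UNIV"
    proof (rule summable_on_int)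
      show "(\<lambda>n. norm (green ga k (xk (int n))) ^ 2 * wt (xk (int n))) summable_on UNIV"
        by (rule summable_near_0[where u = z and l = "\<kappa> * phi_ser ga 0" and s = "\<lambda>n. xk (int n)"])
           (use lim[OF xk_LIMSEQ xk_in] in \<open>simp_all, simp add: xk_def\<close>)
    qed (rule far)
  qed
  \<comment> \<open>The equation expresses the image under L through the function itself and a delta
    function, so it lies in the Hilbert space as well.\<close>
  have T: "TT (green ga k) = (\<lambda>x. mu a ga * green ga k x + 1 * delta (xk k) x)"
    using TT_green[OF g im, of k] by (auto simp: fun_eq_iff)
  have "TT (green ga k) \<in> HH" unfolding T by (intro HH_lin hH delta_HH xk_in)
  then show ?thesis unfolding Ddom_def using hH lk ln by blast
qed

end

section \<open>The boundary values of the Green function on the spectral interval\<close>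

context qbase begin

lemma qpoch_inf_cnj: "cnj (qinf x) = qinf (cnj x)"
proof -
  have "(\<lambda>n. cnj (qpoch q x n)) \<longlonglongrightarrow> cnj (qinf x)" by (intro tendsto_cnj qpoch_LIMSEQ)
  moreover have "cnj (qpoch q x n) = qpoch q (cnj x) n" for n by (simp add: qpoch_def)
  ultimately show ?thesis using LIMSEQ_unique[OF _ qpoch_LIMSEQ] by simp
qed

end

context big_q begin

abbreviation cf :: "complex \<Rightarrow> complex" where "cf \<equiv> cfun q z a b c"
abbreviation KK :: real where "KK \<equiv> Kconst q z a b c"

lemma cfun_cnj: "cnj (cf ga) = cf (cnj ga)"
  unfolding cfun_def qtheta_def[where 'a = complex] by (simp add: qpoch_inf_cnj)

lemma norm_1_inverse: "norm ga = 1 \<Longrightarrow> 1 / ga = cnj ga"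
  using complex_div_cnj[of 1 ga] by simp

lemma phi_coef_inverse: "phi_coef (1 / ga) n = phi_coef ga n"
  by (simp add: phi_coef_def mult_ac)

lemma fphi_inverse:
  assumes g: "norm ga = 1" and im: "Im ga \<noteq> 0" shows "fphi (1 / ga) x = fphi ga x"
proof (cases "x \<in> II")
  case True
  have gi: "norm (1 / ga) = 1" "Im (1 / ga) \<noteq> 0" using g im by (simp_all add: norm_1_inverse)
  from True show ?thesis
  proof (cases rule: II_cases)
    case (1 n)
    have "\<bar>x\<bar> \<le> 1" using q_pos q_less_1 by (simp add: 1 xn_def power_le_one)
    then show ?thesis using fphi_phi_ser[of ga x] fphi_phi_ser[of "1 / ga" x] True gi g im c_less_1
      by (simp add: phi_ser_def phi_coef_inverse)
  next
    case (2 k)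
    then show ?thesis using psis_inverse[OF g im] by simp
  qed
qed (simp add: fphi_def)

text \<open>A matrix entry of the Green function with the Wronskian in closed form. Unlike
  \<open>green\<close> it is used up to the unit circle, where it stays continuous in
  \<open>ga\<close>.\<close>

definition GG :: "complex \<Rightarrow> real \<Rightarrow> int \<Rightarrow> complex" where
  "GG ga x k = of_real (wt x * wt (xk k)) * fphi ga x * Phi ga k / (of_real (KK * a) * cf ga * (1 / ga - ga))"

lemma inn_green:
  assumes "1 < norm ga" "Im ga \<noteq> 0" "x \<in> II" "x \<le> xk k"
  shows "inn (green ga k) (delta x) = GG ga x k"
proof -
  have W: "Wr (psis ga) (Phi ga) 0 = of_real (KK * a) * cf ga * (1 / ga - ga)"
    using assms by (intro Wr_psi_Phi) auto
  have al: "w / d * (P * F) * w' = w' * w * F * P / d" for w d P F w' :: complex by simp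
  show ?thesis unfolding inn_delta[OF assms(3)] GG_def green_def W using assms(3,4) by (simp only: if_True al of_real_mult)
qed

lemma continuous_on_GG: "continuous_on {ga. 1 \<le> norm ga \<and> Im ga \<noteq> 0} (\<lambda>ga. GG ga x k)"
proof -
  let ?S = "{ga::complex. 1 \<le> norm ga \<and> Im ga \<noteq> 0}"
  have f: "continuous_on ?S (\<lambda>ga. fphi ga x)"
    unfolding fphi_def using c_less_1
    by (cases "x \<in> II") (auto intro: continuous_on_subset[OF continuous_on_psi_gamma])
  have P: "continuous_on ?S (\<lambda>ga. Phi ga k)" by (rule continuous_on_subset[OF continuous_on_Phi]) auto
  have nz: "of_real (KK * a) * cf ga * (1 / ga - ga) \<noteq> 0" if "ga \<in> ?S" for ga
    using Wr_psi_Phi_nonzero[of ga 0] Wr_psi_Phi[of ga 0] that by simp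
  show ?thesis unfolding GG_def
    by (intro continuous_on_divide continuous_on_mult continuous_on_diff f P continuous_on_const continuous_on_id continuous_on_cfun)
       (use nz in auto)
qed

text \<open>The regular solution is the same on both sides and 1 / ga - ga changes sign, so over a
  common denominator the numerator is c(ga) Phi(1/ga) + c(1/ga) Phi(ga). The connection formula
  turns it into the regular solution, and c(ga) c(1/ga) = |c(ga)|^2.\<close>

lemma jump:
  assumes g: "norm ga = 1" and im: "Im ga \<noteq> 0"
  shows "(GG ga x k - GG (1 / ga) x k) / (2 * \<i>)
    = of_real (wt x * wt (xk k) / (4 * KK * a * Im ga * (cmod (cf ga))^2)) * fphi ga x * psis ga k"
proof -
  have gi: "norm (1 / ga) = 1" "Im (1 / ga) \<noteq> 0" using g im by (simp_all add: norm_1_inverse)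
  have nz: "cf ga \<noteq> 0" "cf (1 / ga) \<noteq> 0" using cfun_nonzero g im gi by simp_all
  have alg: "(w * F * P / (ka * u * d) - w * F * P' / (ka * u' * (- d))) / r = w / (ka * (d * r) * (u * u')) * F * (u * P' + u' * P)"
    if "u \<noteq> 0" "u' \<noteq> 0" "d \<noteq> 0" "ka \<noteq> 0" "r \<noteq> 0" for w F P P' ka u u' d r :: complex
    using that by (simp add: field_simps)
  have ka: "complex_of_real (KK * a) \<noteq> 0" "2 * \<i> \<noteq> 0" using Kconst_pos a_pos by simp_all
  have d': "1 / (1 / ga) - 1 / ga = - (1 / ga - ga)" by simp
  have d: "1 / ga - ga = - (2 * \<i> * of_real (Im ga))"
    unfolding norm_1_inverse[OF g] by (simp add: complex_eq_iff)
  have d0: "1 / ga - ga \<noteq> 0" unfolding d using im by simp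
  have cc: "cf ga * cf (1 / ga) = of_real ((cmod (cf ga))^2)"
    unfolding norm_1_inverse[OF g] cfun_cnj[symmetric] by (rule complex_norm_square[symmetric])
  have "(GG ga x k - GG (1 / ga) x k) / (2 * \<i>) = of_real (wt x * wt (xk k)) / (of_real (KK * a) * ((1 / ga - ga) * (2 * \<i>)) * (cf ga * cf (1 / ga)))
      * fphi ga x * psis ga k"
    unfolding psis_connection[OF g im, of k] GG_def fphi_inverse[OF g im] d' by (rule alg[OF nz d0 ka])
  also have "(1 / ga - ga) * (2 * \<i>) = of_real (4 * Im ga)" unfolding d by (simp add: complex_eq_iff)
  finally show ?thesis unfolding cc by (simp add: mult_ac)
qed

text \<open>Inverting \<xi> = mu(ga): \<open>om\<close> is (ga + 1/ga) / 2, and \<open>gr\<close> is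
  the root obtained from Arccos, continuous across the open interval; \<open>gam\<close> selects the
  root outside the circle and therefore jumps there.\<close>

definition om :: "complex \<Rightarrow> complex" where "om \<xi> = (\<xi> + 1 + of_real (a^2)) / (2 * of_real a)"
definition gr :: "complex \<Rightarrow> complex" where "gr \<xi> = exp (\<i> * Arccos (om \<xi>))"
definition gam :: "complex \<Rightarrow> complex" where "gam \<xi> = (if 1 < norm (gr \<xi>) then gr \<xi> else inverse (gr \<xi>))"

lemma gr_nz: "gr \<xi> \<noteq> 0" by (simp add: gr_def)

lemma gr_sum: "gr \<xi> + inverse (gr \<xi>) = 2 * om \<xi>"
  using cos_Arccos[of "om \<xi>"] unfolding cos_exp_eq gr_def by (simp add: exp_minus)

lemma mu_gr: "mu a (gr \<xi>) = \<xi>" "mu a (inverse (gr \<xi>)) = \<xi>"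
proof -
  have "- 1 - of_real (a^2) + of_real a * (2 * om \<xi>) = \<xi>" using a_pos by (simp add: om_def field_simps)
  then show "mu a (gr \<xi>) = \<xi>" "mu a (inverse (gr \<xi>)) = \<xi>"
    unfolding mu_def using gr_sum[of \<xi>] by (simp_all add: add.commute)
qed

lemma Im_om: "Im (om \<xi>) = Im \<xi> / (2 * a)"
proof -
  have "om \<xi> = (\<xi> + 1 + of_real (a^2)) / of_real (2 * a)" by (simp add: om_def)
  then show ?thesis by (simp only: Im_divide_of_real) simp
qed

lemma Re_om: "Re (om \<xi>) = (Re \<xi> + 1 + a^2) / (2 * a)"
proof -
  have "om \<xi> = (\<xi> + 1 + of_real (a^2)) / of_real (2 * a)" by (simp add: om_def)
  then show ?thesis by (simp only: Re_divide_of_real) simp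
qed

text \<open>Compares the position of \<open>gr\<close> relative to the unit circle with the half
  plane of \<xi>.\<close>

lemma Im_gr_sum: "Im (gr \<xi>) * (1 - 1 / norm (gr \<xi>) ^ 2) = Im \<xi> / a"
proof -
  have "Im (gr \<xi> + inverse (gr \<xi>)) = Im \<xi> / a" unfolding gr_sum using Im_om[of \<xi>] by simp
  then show ?thesis by (simp add: cmod_power2 right_diff_distrib)
qed

lemma gam:
  assumes im: "Im \<xi> \<noteq> 0"
  shows "1 < norm (gam \<xi>)" "Im (gam \<xi>) \<noteq> 0" "mu a (gam \<xi>) = \<xi>"
proof -
  have n1: "norm (gr \<xi>) \<noteq> 1" and i: "Im (gr \<xi>) \<noteq> 0" using Im_gr_sum[of \<xi>] im a_pos by auto
  show "1 < norm (gam \<xi>)" using n1 gr_nz[of \<xi>] by (auto simp: gam_def norm_inverse one_less_inverse_iff)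
  show "Im (gam \<xi>) \<noteq> 0" using i gr_nz[of \<xi>] by (auto simp: gam_def)
  show "mu a (gam \<xi>) = \<xi>" by (simp add: gam_def mu_gr)
qed

abbreviation "u1 \<equiv> - ((1 + a)^2)"
abbreviation "u2 \<equiv> - ((1 - a)^2)"

lemma om_range: "u1 < Re \<xi> \<Longrightarrow> Re \<xi> < u2 \<Longrightarrow> \<bar>Re (om \<xi>)\<bar> < 1"
  using a_pos by (simp add: Re_om abs_less_iff divide_less_eq less_divide_eq power2_eq_square algebra_simps)

lemma gr_im_pos: assumes "u1 < Re \<xi>" "Re \<xi> < u2" shows "0 < Im (gr \<xi>)"
proof -
  have "0 < Re (Arccos (om \<xi>)) \<and> Re (Arccos (om \<xi>)) < pi" by (intro Arccos_bounds om_range assms)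
  then show ?thesis by (simp add: gr_def Im_exp sin_gt_zero)
qed

text \<open>Over the interval \<open>gr\<close> has positive imaginary part, so by
  \<open>Im_gr_sum\<close> the sign of norm gr - 1 is that of Im \<xi>.\<close>

lemma norm_gr:
  assumes r: "u1 < Re \<xi>" "Re \<xi> < u2"
  shows "0 < Im \<xi> \<Longrightarrow> 1 < norm (gr \<xi>)" "0 \<le> Im \<xi> \<Longrightarrow> 1 \<le> norm (gr \<xi>)"
    "Im \<xi> < 0 \<Longrightarrow> norm (gr \<xi>) < 1" "Im \<xi> \<le> 0 \<Longrightarrow> norm (gr \<xi>) \<le> 1"
proof -
  note p = gr_im_pos[OF r]
  have n: "0 < norm (gr \<xi>)" using gr_nz by simp
  have s: "sgn (1 - 1 / norm (gr \<xi>) ^ 2) = sgn (Im \<xi>)"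
    using arg_cong[OF Im_gr_sum[of \<xi>], of sgn] p a_pos by (simp add: sgn_mult sgn_divide)
  have sq: "1 < x ^ 2 \<longleftrightarrow> 1 < x" "x ^ 2 < 1 \<longleftrightarrow> x < 1" if "0 < x" for x :: real
    using that abs_square_less_1[of x] abs_square_le_1[of x] by auto
  show "0 < Im \<xi> \<Longrightarrow> 1 < norm (gr \<xi>)"
    using s n sq(1)[OF n] by (auto simp: sgn_if divide_less_eq_1 split: if_splits)
  show "Im \<xi> < 0 \<Longrightarrow> norm (gr \<xi>) < 1"
    using s n sq(2)[OF n] by (auto simp: sgn_if divide_less_eq_1 less_divide_eq_1 split: if_splits)
  show "0 \<le> Im \<xi> \<Longrightarrow> 1 \<le> norm (gr \<xi>)"
    using s n sq(2)[OF n] by (auto simp: sgn_if divide_less_eq_1 less_divide_eq_1 not_less[symmetric] split: if_splits)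
  show "Im \<xi> \<le> 0 \<Longrightarrow> norm (gr \<xi>) \<le> 1"
    using s n sq(1)[OF n] by (auto simp: sgn_if divide_less_eq_1 less_divide_eq_1 not_less[symmetric] split: if_splits)
qed

definition mur :: "real \<Rightarrow> real" where "mur \<theta> = - 1 - a^2 + 2 * a * cos \<theta>"
text \<open>The clamping makes \<open>tht\<close> continuous on the whole line.\<close>

definition tht :: "real \<Rightarrow> real" where "tht t = arccos (max (- 1) (min 1 ((t + 1 + a^2) / (2 * a))))"

lemma tht_bounds: "0 \<le> tht t" "tht t \<le> pi"
  unfolding tht_def by (intro arccos_lbound arccos_ubound; simp)+

lemma continuous_on_tht: "continuous_on UNIV tht"
  unfolding tht_def using a_pos by (intro continuous_intros) auto

lemma tht_mur: "0 \<le> \<theta> \<Longrightarrow> \<theta> \<le> pi \<Longrightarrow> tht (mur \<theta>) = \<theta>"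
proof -
  assume t: "0 \<le> \<theta>" "\<theta> \<le> pi"
  have "(mur \<theta> + 1 + a^2) / (2 * a) = cos \<theta>" using a_pos by (simp add: mur_def)
  then show ?thesis using t by (simp add: tht_def min_absorb2 max_absorb2 arccos_cos)
qed

lemma mur_tht: "u1 \<le> t \<Longrightarrow> t \<le> u2 \<Longrightarrow> mur (tht t) = t"
proof -
  assume t: "u1 \<le> t" "t \<le> u2"
  have b: "- 1 \<le> (t + 1 + a^2) / (2 * a)" "(t + 1 + a^2) / (2 * a) \<le> 1"
    using t a_pos by (simp_all add: divide_le_eq le_divide_eq power2_eq_square algebra_simps)
  then have "cos (tht t) = (t + 1 + a^2) / (2 * a)" by (simp add: tht_def max_def min_def cos_arccos)
  then show ?thesis using a_pos by (simp add: mur_def)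
qed

lemma mu_cis: "mu a (cis \<theta>) = of_real (mur \<theta>)"
proof -
  have "cis \<theta> + inverse (cis \<theta>) = of_real (2 * cos \<theta>)" by (simp add: complex_eq_iff cis_inverse)
  then show ?thesis by (simp add: mu_def mur_def)
qed

lemma mur_less_iff:
  assumes "0 \<le> \<theta>" "\<theta> \<le> pi" "0 \<le> \<theta>'" "\<theta>' \<le> pi"
  shows "mur \<theta> < mur \<theta>' \<longleftrightarrow> \<theta>' < \<theta>"
proof -
  have "mur \<theta> < mur \<theta>' \<longleftrightarrow> cos \<theta> < cos \<theta>'" using a_pos by (simp add: mur_def)
  then show ?thesis using cos_mono_less_eq[OF assms] by blast
qed

lemma gr_real:
  assumes "u1 < x" "x < u2" shows "gr (of_real x) = cis (tht x)"
proof -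
  have e: "om (of_real x) = of_real ((x + 1 + a^2) / (2 * a))" by (simp add: om_def)
  have b: "\<bar>(x + 1 + a^2) / (2 * a)\<bar> < 1" using om_range[of "of_real x"] assms by (simp add: Re_om)
  have "arccos (max (- 1) (min 1 X)) = arccos X" if "\<bar>X\<bar> < 1" for X using that by simp
  from this[OF b] have t: "tht x = arccos ((x + 1 + a^2) / (2 * a))" by (simp only: tht_def)
  show ?thesis unfolding gr_def e using of_real_arccos[OF less_imp_le[OF b]] by (simp add: t cis_conv_exp)
qed

text \<open>The jump times 2 a sin \<theta>, the derivative of the eigenvalue up to sign; this
  replaces \<open>4 K a sin \<theta>\<close> by \<open>2 K\<close> in the denominator.\<close>

definition dj :: "real \<Rightarrow> int \<Rightarrow> real \<Rightarrow> complex" where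
  "dj x k \<theta> = of_real (wt x * wt (xk k) / (2 * KK * (cmod (cf (cis \<theta>)))^2)) * fphi (cis \<theta>) x * psis (cis \<theta>) k"

text \<open>The integrand extends continuously to distance 0 from the real axis, uniformly on closed
  intervals strictly inside the spectral one, so the limit passes under the integral; substitution
  then introduces \<theta>.\<close>

lemma jump_integral:
  assumes s: "u1 < s" "s < t" "t < u2" and x: "x \<in> II" "x \<le> xk k"
  shows "(\<lambda>n. LINT y:{s..t}|lborel. (inn (green (gam (Complex y (1 / real (Suc n)))) k) (delta x)
      - inn (green (gam (Complex y (- (1 / real (Suc n))))) k) (delta x)) / (2 * \<i>))
    \<longlonglongrightarrow> integral {tht t..tht s} (dj x k)"
proof -
  \<comment> \<open>Written with \<open>gr\<close> above and its inverse below the axis. This agrees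
    with \<open>gam\<close> for positive distance and, unlike \<open>gam\<close>, is continuous at
    distance 0.\<close>
  define F where "F \<epsilon> y = (GG (gr (Complex y \<epsilon>)) x k - GG (inverse (gr (Complex y (- \<epsilon>)))) x k) / (2 * \<i>)" for \<epsilon> y
  let ?R = "{0..1::real} \<times> cbox s t"
  have re: "u1 < Re (Complex y \<epsilon>)" "Re (Complex y \<epsilon>) < u2" if "y \<in> cbox s t" for y \<epsilon> using that s by auto
  have cgr: "continuous_on ?R (\<lambda>(\<epsilon>, y). gr (Complex y (\<sigma> * \<epsilon>)))" for \<sigma>
  proof -
    have "continuous_on ?R (\<lambda>p. Arccos (om (of_real (snd p) + \<i> * of_real (\<sigma> * fst p))))"
    proof (rule continuous_on_compose2[OF continuous_on_Arccos[of "{w. \<bar>Re w\<bar> < 1}"]])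
      show "continuous_on ?R (\<lambda>p. om (of_real (snd p) + \<i> * of_real (\<sigma> * fst p)))"
        unfolding om_def using a_pos by (intro continuous_intros) auto
      show "(\<lambda>p. om (of_real (snd p) + \<i> * of_real (\<sigma> * fst p))) ` ?R \<subseteq> {w. \<bar>Re w\<bar> < 1}"
      proof (rule image_subsetI)
        fix p assume "p \<in> ?R"
        then have "snd p \<in> cbox s t" by auto
        from om_range[OF re[OF this], of "\<sigma> * fst p"]
        show "om (of_real (snd p) + \<i> * of_real (\<sigma> * fst p)) \<in> {w. \<bar>Re w\<bar> < 1}" by (simp only: Complex_eq mem_Collect_eq)
      qed
    qed simp
    then have "continuous_on ?R (\<lambda>p. exp (\<i> * Arccos (om (of_real (snd p) + \<i> * of_real (\<sigma> * fst p)))))"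
      by (intro continuous_intros)
    then show ?thesis by (simp add: gr_def Complex_eq case_prod_beta')
  qed
  have cF: "continuous_on ?R (\<lambda>(\<epsilon>, y). F \<epsilon> y)"
  proof -
    have 1: "continuous_on ?R (\<lambda>p. GG (gr (Complex (snd p) (fst p))) x k)"
    proof (rule continuous_on_compose2[OF continuous_on_GG])
      show "continuous_on ?R (\<lambda>p. gr (Complex (snd p) (fst p)))" using cgr[of 1] by (simp add: case_prod_beta')
      show "(\<lambda>p. gr (Complex (snd p) (fst p))) ` ?R \<subseteq> {ga. 1 \<le> norm ga \<and> Im ga \<noteq> 0}"
      proof (rule image_subsetI)
        fix p assume p: "p \<in> ?R"
        then have y: "snd p \<in> cbox s t" by auto
        show "gr (Complex (snd p) (fst p)) \<in> {ga. 1 \<le> norm ga \<and> Im ga \<noteq> 0}"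
          using norm_gr(2)[OF re[OF y], of "fst p"] gr_im_pos[OF re[OF y], of "fst p"] p by auto
      qed
    qed
    have 2: "continuous_on ?R (\<lambda>p. GG (inverse (gr (Complex (snd p) (- fst p)))) x k)"
    proof (rule continuous_on_compose2[OF continuous_on_GG])
      show "continuous_on ?R (\<lambda>p. inverse (gr (Complex (snd p) (- fst p))))"
        using cgr[of "- 1"] gr_nz by (intro continuous_on_inverse) (auto simp: case_prod_beta')
      have "1 \<le> norm (inverse (gr (Complex y (- \<epsilon>))))" "Im (inverse (gr (Complex y (- \<epsilon>)))) \<noteq> 0"
        if "y \<in> cbox s t" "0 \<le> \<epsilon>" for y \<epsilon>
      proof -
        have "0 < norm (gr (Complex y (- \<epsilon>)))" using gr_nz by simp
        then show "1 \<le> norm (inverse (gr (Complex y (- \<epsilon>))))"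
          using norm_gr(4)[OF re[OF that(1)], of "- \<epsilon>"] that by (simp add: norm_inverse one_le_inverse_iff)
        show "Im (inverse (gr (Complex y (- \<epsilon>)))) \<noteq> 0" using gr_im_pos[OF re[OF that(1)], of "- \<epsilon>"] gr_nz[of "Complex y (- \<epsilon>)"] by auto
      qed
      then show "(\<lambda>p. inverse (gr (Complex (snd p) (- fst p)))) ` ?R \<subseteq> {ga. 1 \<le> norm ga \<and> Im ga \<noteq> 0}" by auto
    qed
    show ?thesis unfolding F_def case_prod_beta' by (intro continuous_on_divide continuous_on_diff 1 2 continuous_on_const) simp
  qed
  have cI: "continuous_on {0..1} (\<lambda>\<epsilon>. integral (cbox s t) (F \<epsilon>))"
    by (rule integral_continuous_on_param[OF cF])
  have cFe: "continuous_on {s..t} (F \<epsilon>)" if "\<epsilon> \<in> {0..1}" for \<epsilon>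
  proof -
    have "continuous_on {s..t} (\<lambda>y. (\<lambda>(\<epsilon>, y). F \<epsilon> y) (\<epsilon>, y))"
      by (rule continuous_on_compose2[OF cF, of "{s..t}" "\<lambda>y. (\<epsilon>, y)"]) (use that in \<open>auto intro!: continuous_on_Pair continuous_on_const continuous_on_id\<close>)
    then show ?thesis by simp
  qed
  have lint: "(LINT y:{s..t}|lborel. (inn (green (gam (Complex y \<epsilon>)) k) (delta x) - inn (green (gam (Complex y (- \<epsilon>))) k) (delta x)) / (2 * \<i>))
     = integral (cbox s t) (F \<epsilon>)" if e: "0 < \<epsilon>" "\<epsilon> \<le> 1" for \<epsilon>
  proof -
    have "(LINT y:{s..t}|lborel. (inn (green (gam (Complex y \<epsilon>)) k) (delta x) - inn (green (gam (Complex y (- \<epsilon>))) k) (delta x)) / (2 * \<i>))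
       = (LINT y:{s..t}|lborel. F \<epsilon> y)"
    proof (rule set_lebesgue_integral_cong)
      show "\<forall>y. y \<in> {s..t} \<longrightarrow> (inn (green (gam (Complex y \<epsilon>)) k) (delta x) - inn (green (gam (Complex y (- \<epsilon>))) k) (delta x)) / (2 * \<i>) = F \<epsilon> y"
      proof (intro allI impI)
        fix y assume y: "y \<in> {s..t}"
        have "gam (Complex y \<epsilon>) = gr (Complex y \<epsilon>)" using norm_gr(1)[OF re, of y \<epsilon>] y e by (simp add: gam_def)
        moreover have "gam (Complex y (- \<epsilon>)) = inverse (gr (Complex y (- \<epsilon>)))"
          using norm_gr(3)[OF re, of y "- \<epsilon>"] y e by (simp add: gam_def)
        ultimately show "(inn (green (gam (Complex y \<epsilon>)) k) (delta x) - inn (green (gam (Complex y (- \<epsilon>))) k) (delta x)) / (2 * \<i>) = F \<epsilon> y"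
          using inn_green[OF gam(1,2)[of "Complex y \<epsilon>"] x] inn_green[OF gam(1,2)[of "Complex y (- \<epsilon>)"] x] e by (simp add: F_def)
      qed
    qed simp
    also have "\<dots> = integral (cbox s t) (F \<epsilon>)"
      using set_borel_integral_eq_integral(2)[OF borel_integrable_atLeastAtMost'[OF cFe[of \<epsilon>]]] e by simp
    finally show ?thesis .
  qed
  have "(\<lambda>n. 1 / real (Suc n)) \<longlonglongrightarrow> 0" using LIMSEQ_inverse_real_of_nat by (simp add: inverse_eq_divide)
  from continuous_on_tendsto_compose[OF cI this]
  have lim: "(\<lambda>n. integral (cbox s t) (F (1 / real (Suc n)))) \<longlonglongrightarrow> integral (cbox s t) (F 0)" by simp
  have "integral {s..t} (F 0) = integral {tht t..tht s} (dj x k)"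
  proof -
    have us: "u1 \<le> s" "s \<le> u2" "u1 \<le> t" "t \<le> u2" using s by auto
    have ts: "tht t \<le> tht s" using mur_less_iff[of "tht s" "tht t"] tht_bounds mur_tht us s by simp
    have sub: "mur ` {tht t..tht s} \<subseteq> {s..t}"
    proof (rule image_subsetI)
      fix \<theta> assume th: "\<theta> \<in> {tht t..tht s}"
      then have b: "0 \<le> \<theta>" "\<theta> \<le> pi" using tht_bounds[of t] tht_bounds[of s] by auto
      have "\<not> mur \<theta> < mur (tht s)" "\<not> mur (tht t) < mur \<theta>"
        using mur_less_iff[OF b tht_bounds] mur_less_iff[OF tht_bounds b] th by auto
      then show "mur \<theta> \<in> {s..t}" using mur_tht us by simp
    qed
    have cm: "continuous_on {tht t..tht s} mur" unfolding mur_def by (intro continuous_intros)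
    have dv: "(mur has_field_derivative (- 2 * a * sin \<theta>)) (at \<theta> within S)" for \<theta> S
      unfolding mur_def by (auto intro!: derivative_eq_intros)
    have hi: "((\<lambda>\<theta>. (- 2 * a * sin \<theta>) *\<^sub>R F 0 (mur \<theta>)) has_integral
        (integral {mur (tht t)..mur (tht s)} (F 0) - integral {mur (tht s)..mur (tht t)} (F 0))) {tht t..tht s}"
      by (rule has_integral_substitution_general[OF finite.emptyI ts sub cFe cm dv]) simp
    have m: "mur (tht t) = t" "mur (tht s) = s" using mur_tht us by simp_all
    \<comment> \<open>\<open>mur\<close> decreases, so the integral over the reversed interval in
      \<open>hi\<close> is 0 and the remaining one carries a minus sign.\<close>
    have hi': "((\<lambda>\<theta>. - ((- 2 * a * sin \<theta>) *\<^sub>R F 0 (mur \<theta>))) has_integral integral {s..t} (F 0)) {tht t..tht s}"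
      using has_integral_neg[OF hi] s by (simp add: m)
    have eq: "- ((- 2 * a * sin \<theta>) *\<^sub>R F 0 (mur \<theta>)) = dj x k \<theta>" if "\<theta> \<in> {tht t..tht s}" for \<theta>
    proof -
      have b: "0 \<le> \<theta>" "\<theta> \<le> pi" using that tht_bounds[of t] tht_bounds[of s] by auto
      have mm: "mur \<theta> \<in> {s..t}" using sub that by blast
      have c0: "Complex (mur \<theta>) 0 = of_real (mur \<theta>)" by (simp add: complex_of_real_def)
      have g: "gr (of_real (mur \<theta>)) = cis \<theta>" using gr_real[of "mur \<theta>"] mm s tht_mur[OF b] by simp
      have im: "Im (cis \<theta>) \<noteq> 0" using gr_im_pos[of "of_real (mur \<theta>)"] mm s unfolding g by auto
      have "F 0 (mur \<theta>) = of_real (wt x * wt (xk k) / (4 * KK * a * Im (cis \<theta>) * (cmod (cf (cis \<theta>)))^2)) * fphi (cis \<theta>) x * psis (cis \<theta>) k"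
        using jump[OF _ im, of x k] by (simp add: F_def c0 g inverse_eq_divide)
      moreover have al: "- (r' *\<^sub>R (complex_of_real w1 * f * p)) = of_real w2 * f * p" if "r * w1 = w2" "r' = - r" for r r' w1 w2 f p
        using that by (auto simp: scaleR_conv_of_real)
      moreover have "2 * a * sin \<theta> * (wt x * wt (xk k) / (4 * KK * a * Im (cis \<theta>) * (cmod (cf (cis \<theta>)))^2)) = wt x * wt (xk k) / (2 * KK * (cmod (cf (cis \<theta>)))^2)"
        using a_pos im by (simp add: field_simps)
      ultimately show ?thesis unfolding dj_def by (simp only:) (rule al, assumption, simp)
    qed
    have "(dj x k has_integral integral {s..t} (F 0)) {tht t..tht s}" by (rule has_integral_eq[OF eq hi'])
    then show ?thesis by (rule integral_unique[symmetric])
  qed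
  moreover have "(LINT y:{s..t}|lborel. (inn (green (gam (Complex y (1 / real (Suc n)))) k) (delta x)
      - inn (green (gam (Complex y (- (1 / real (Suc n))))) k) (delta x)) / (2 * \<i>)) = integral {s..t} (F (1 / real (Suc n)))" for n
    unfolding interval_cbox by (rule lint[unfolded interval_cbox]) auto
  ultimately show ?thesis using lim by (simp only: interval_cbox)
qed

end

section \<open>The spectral measure\<close>

lemma Lam_mult:
  assumes "F \<in> borel_measurable borel" "\<And>t. norm (F t) \<le> C" "good_list L"
  shows "good_list (map (\<lambda>(M, w). (M, \<lambda>t. F t * w t)) L)"
    "Lam (map (\<lambda>(M, w). (M, \<lambda>t. F t * w t)) L) \<psi> = Lam L (\<lambda>t. \<psi> t * F t)"
proof -
  show "good_list (map (\<lambda>(M, w). (M, \<lambda>t. F t * w t)) L)"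
    using assms(3) by (auto simp: good_list_def intro!: integrable_bounded_mult[OF _ _ assms(1,2)])
  show "Lam (map (\<lambda>(M, w). (M, \<lambda>t. F t * w t)) L) \<psi> = Lam L (\<lambda>t. \<psi> t * F t)"
    by (induction L) (auto simp: mult.assoc)
qed

text \<open>The factor F is absorbed into the densities, which gives a new complex measure that
  vanishes on all Borel sets.\<close>

lemma Lam_mult_zero:
  assumes L: "good_list L" and F: "F \<in> borel_measurable borel" "\<And>t. norm (F t) \<le> B"
    and sets: "\<And>S. S \<in> sets borel \<Longrightarrow> Lam L (\<lambda>t. indicator S t * F t) = 0"
    and \<psi>: "\<psi> \<in> borel_measurable borel" "\<And>t. norm (\<psi> t) \<le> C"
  shows "Lam L (\<lambda>t. \<psi> t * F t) = 0"
proof -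
  note r = Lam_mult[OF F L]
  have "Lam (map (\<lambda>(M, w). (M, \<lambda>t. F t * w t)) L) \<psi> = 0"
    by (rule Lam_zero[OF r(1) _ \<psi>]) (simp only: r(2) sets)
  then show ?thesis unfolding r(2) .
qed

text \<open>An open interval is exhausted by closed intervals from inside. Along them the sums of
  closed and open indicators tend to twice the indicator of the open interval, so end point masses
  play no part in the limit.\<close>

lemma Lam_zero_on_interval:
  assumes L: "good_list L"
    and int: "\<And>s t. u < s \<Longrightarrow> s < t \<Longrightarrow> t < v \<Longrightarrow> Lam L (\<lambda>\<tau>. indicator {s..t} \<tau> + indicator {s<..<t} \<tau>) = 0"
    and \<psi>: "\<psi> \<in> borel_measurable borel" "\<And>t. norm (\<psi> t) \<le> C"
  shows "Lam L (\<lambda>\<tau>. \<psi> \<tau> * indicator {u<..<v} \<tau>) = 0"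
proof -
  let ?L = "map (\<lambda>(M, w). (M, \<lambda>t. indicator {u<..<v} t * w t)) L"
  have S: "(indicator {u<..<v} :: real \<Rightarrow> complex) \<in> borel_measurable borel" "\<And>t. norm (indicator {u<..<v} t :: complex) \<le> 1"
    by (auto simp: indicator_def)
  note r = Lam_mult[OF S L]
  have "Lam ?L (indicator {s<..<t}) = 0" for s t
  proof -
    define s' t' where "s' = max s u" and "t' = min t v"
    have e: "(\<lambda>\<tau>. indicator {s<..<t} \<tau> * indicator {u<..<v} \<tau>) = (indicator {s'<..<t'} :: real \<Rightarrow> complex)"
      by (auto simp: s'_def t'_def fun_eq_iff indicator_def)
    have "Lam L (indicator {s'<..<t'}) = 0"
    proof (cases "s' < t'")
      case False
      then have "(indicator {s'<..<t'} :: real \<Rightarrow> complex) = (\<lambda>\<tau>. 0 * 0)" by (auto simp: fun_eq_iff indicator_def)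
      then show ?thesis using Lam_cmult[of L 0 "\<lambda>_. 0"] by simp
    next
      case True
      define d where "d = t' - s'"
      have d: "0 < d" using True by (simp add: d_def)
      \<comment> \<open>The offset 3 ensures 2 e n < d from n = 0 on, so the shrunken interval is
        never empty.\<close>
      define e where "e n = d / real (n + 3)" for n :: nat
      have e: "0 < e n" "2 * e n < d" for n using d by (simp_all add: e_def field_simps add_pos_nonneg)
      have el: "e \<longlonglongrightarrow> 0" unfolding e_def by real_asymp
      define \<psi>' :: "nat \<Rightarrow> real \<Rightarrow> complex" where "\<psi>' n \<tau> = indicator {s' + e n..t' - e n} \<tau> + indicator {s' + e n<..<t' - e n} \<tau>" for n \<tau>
      have z: "Lam L (\<psi>' n) = 0" for n
        unfolding \<psi>'_def using e[of n] by (intro int) (auto simp: d_def s'_def t'_def)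
      have "(\<lambda>n. Lam L (\<psi>' n)) \<longlonglongrightarrow> Lam L (\<lambda>\<tau>. 2 * indicator {s'<..<t'} \<tau>)"
      proof (rule Lam_LIMSEQ[OF L, where C = 2])
        show "\<psi>' n \<in> borel_measurable borel" for n unfolding \<psi>'_def by measurable
        show "(\<lambda>\<tau>. 2 * indicator {s'<..<t'} \<tau> :: complex) \<in> borel_measurable borel" by measurable
        show "norm (\<psi>' n t) \<le> 2" for n t by (simp add: \<psi>'_def indicator_def)
        show "(\<lambda>n. \<psi>' n \<tau>) \<longlonglongrightarrow> 2 * indicator {s'<..<t'} \<tau>" for \<tau>
        proof (cases "s' < \<tau> \<and> \<tau> < t'")
          case True
          have l: "(\<lambda>n. s' + e n) \<longlonglongrightarrow> s'" "(\<lambda>n. t' - e n) \<longlonglongrightarrow> t'"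
            using tendsto_add[OF tendsto_const el, of s'] tendsto_diff[OF tendsto_const el, of t'] by simp_all
          have "eventually (\<lambda>n. s' + e n < \<tau>) sequentially" "eventually (\<lambda>n. \<tau> < t' - e n) sequentially"
            using True by (auto intro: order_tendstoD(2)[OF l(1)] order_tendstoD(1)[OF l(2)])
          then have "eventually (\<lambda>n. \<psi>' n \<tau> = 2 * indicator {s'<..<t'} \<tau>) sequentially"
            by eventually_elim (use True in \<open>simp add: \<psi>'_def\<close>)
          then show ?thesis by (rule tendsto_eventually)
        next
          case False
          have "\<psi>' n \<tau> = 2 * indicator {s'<..<t'} \<tau>" for n
            using False e(1)[of n] by (auto simp: \<psi>'_def indicator_def)
          then show ?thesis by simp
        qed
      qed
      then have "Lam L (\<lambda>\<tau>. 2 * indicator {s'<..<t'} \<tau>) = 0" using z by (rule LIMSEQ_zero_unique)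
      then show ?thesis using Lam_cmult[of L 2 "indicator {s'<..<t'}"] by simp
    qed
    then show ?thesis unfolding r(2) e .
  qed
  from Lam_zero_sets[OF r(1) this] have "Lam ?L \<psi> = 0" by (rule Lam_zero[OF r(1) _ \<psi>])
  then show ?thesis unfolding r(2) .
qed

context big_q begin

lemma gen_ne: "u \<in> {a^2, b^2, c^2, a^2 * b^2 * c^2 * z^2} \<Longrightarrow> u \<noteq> q powi k"
  using gen unfolding Vgen_def by blast

lemma q_powi_sq: "q powi i * q powi i = q powi (2 * i)"
  using q_pos by (simp flip: power_int_add)

text \<open>A zero on the unit circle would make r an integer power of q and r^2 an even one, which
  genericity excludes. The sign \<sigma> covers arguments with r in the denominator.\<close>

lemma no_unit_circle_zero:
  assumes r: "0 < r" "r^2 \<in> {a^2, b^2, c^2, a^2 * b^2 * c^2 * z^2}" and y: "norm y = r powi \<sigma> * q powi j" "\<sigma> = 1 \<or> \<sigma> = - 1"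
  shows "qinf (y :: complex) \<noteq> 0"
proof
  assume "qinf y = 0"
  then obtain i :: nat where "y * of_real q ^ i = 1" by (auto simp: qpoch_inf_eq_0_iff)
  then have "norm (y * of_real q ^ i) = 1" by simp
  then have e: "r powi \<sigma> * (q powi j * q powi (int i)) = 1" using y(1) q_pos by (simp add: norm_mult norm_power)
  have e': "r powi \<sigma> * q powi (j + int i) = 1" using e q_pos by (simp add: power_int_add)
  from y(2) show False
  proof
    assume "\<sigma> = 1"
    then have "q powi (j + int i) * r = 1" using e' by (simp add: mult.commute)
    then have "r = q powi (- (j + int i))" unfolding power_int_minus by (rule inverse_unique[symmetric])
    then have "r^2 = q powi (2 * (- (j + int i)))" by (simp add: power2_eq_square q_powi_sq)
    then show False using gen_ne[OF r(2)] by blast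
  next
    assume "\<sigma> = - 1"
    then have "r = q powi (j + int i)" using e' r(1) by (simp add: power_int_minus field_simps)
    then have "r^2 = q powi (2 * (j + int i))" by (simp add: power2_eq_square q_powi_sq)
    then show False using gen_ne[OF r(2)] by blast
  qed
qed

text \<open>At \<open>ga = 1, -1\<close> the function \<open>c\<close> has a pole; the convention \<open>x / 0 = 0\<close> gives its inverse the right
  value 0.\<close>

lemma continuous_on_inverse_cfun: "continuous_on {ga. norm ga = 1} (\<lambda>ga. inverse (cf ga))"
proof -
  let ?S = "{ga::complex. norm ga = 1}"
  let ?p = "a * b * c * z"
  have p: "0 < ?p" using a_pos b_pos c_pos z_pos by simp
  have p2: "?p^2 \<in> {a^2, b^2, c^2, a^2 * b^2 * c^2 * z^2}" by (simp add: power_mult_distrib)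
  have eq: "inverse (cf ga) = of_real (qinf (a * b) * qinf (a * c) * qtheta q (- (b * c * z))) * qinf (1 / ga^2)
    / (qinf (of_real a / ga) * qinf (of_real b / ga) * qinf (of_real c / ga) *
      (qinf (- (of_real q / (of_real ?p * ga))) * qinf (- (of_real ?p * ga))))" if "ga \<in> ?S" for ga
  proof -
    have "ga \<noteq> 0" using that by auto
    then have "of_real q / (- (of_real q / (of_real ?p * ga))) = - (of_real ?p * ga)" using q_pos by simp
    then show ?thesis unfolding cfun_def qtheta_def[where 'a = complex] by (simp add: inverse_eq_divide)
  qed
  have nz: "qinf (of_real r / ga) \<noteq> 0" if "ga \<in> ?S" "r = a \<or> r = b \<or> r = c" for r ga
    by (rule no_unit_circle_zero[where r = r and \<sigma> = 1 and j = 0]) (use that a_pos b_pos c_pos in \<open>auto simp: norm_divide\<close>)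
  have nz1: "qinf (- (of_real q / (of_real ?p * ga))) \<noteq> 0" if "ga \<in> ?S" for ga
    by (rule no_unit_circle_zero[OF p p2, where \<sigma> = "- 1" and j = 1])
       (use that q_pos p in \<open>simp_all add: norm_divide norm_mult power_int_minus field_simps del: of_real_mult\<close>)
  have nz2: "qinf (- (of_real ?p * ga)) \<noteq> 0" if "ga \<in> ?S" for ga
    by (rule no_unit_circle_zero[OF p p2, where \<sigma> = 1 and j = 0])
       (use that q_pos p in \<open>simp_all add: norm_mult del: of_real_mult\<close>)
  have g: "ga \<noteq> 0" if "ga \<in> ?S" for ga :: complex using that by auto
  show ?thesis
  proof (rule continuous_on_eq[OF _ eq[symmetric]])
    show "continuous_on ?S (\<lambda>ga. of_real (qinf (a * b) * qinf (a * c) * qtheta q (- (b * c * z))) * qinf (1 / ga^2)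
    / (qinf (of_real a / ga) * qinf (of_real b / ga) * qinf (of_real c / ga) *
      (qinf (- (of_real q / (of_real ?p * ga))) * qinf (- (of_real ?p * ga)))))"
      using nz nz1 nz2 g p
      by (intro continuous_on_divide continuous_on_mult continuous_qpoch_inf continuous_on_minus continuous_on_const
        continuous_on_power continuous_on_id) (auto simp del: of_real_mult)
  qed
qed

text \<open>The factor of \<open>dj\<close> times the 1 / pi of the inversion: the spectral density
  in \<theta>.\<close>

definition kap :: "real \<Rightarrow> real" where "kap \<theta> = 1 / (2 * pi * KK * (cmod (cf (cis \<theta>)))^2)"

lemma kap_nonneg: "0 \<le> kap \<theta>" using Kconst_pos by (simp add: kap_def)

lemma continuous_on_cis: "continuous_on S cis"
  unfolding cis_conv_exp[abs_def] by (intro continuous_intros)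

lemma continuous_on_kap: "continuous_on S kap"
proof -
  have "continuous_on S (\<lambda>\<theta>. inverse (cf (cis \<theta>)))"
    by (rule continuous_on_compose2[OF continuous_on_inverse_cfun continuous_on_cis]) auto
  then have "continuous_on S (\<lambda>\<theta>. norm (inverse (cf (cis \<theta>))) ^ 2 / (2 * pi * KK))"
    using Kconst_pos by (intro continuous_on_divide continuous_on_power continuous_on_norm continuous_on_const) auto
  moreover have "norm (inverse w) ^ 2 / M = 1 / (M * (cmod w)^2)" for w :: complex and M :: real
    by (simp add: norm_inverse power_inverse divide_inverse mult.commute)
  ultimately show ?thesis unfolding kap_def[abs_def] by (simp only:)
qed

lemma continuous_on_fphi_cis: "continuous_on S (\<lambda>\<theta>. fphi (cis \<theta>) x)"
proof (cases "x \<in> II")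
  case True
  have "continuous_on S (\<lambda>\<theta>. psi (cis \<theta>) (of_real x))"
    by (rule continuous_on_compose2[OF continuous_on_psi_gamma continuous_on_cis]) (use c_less_1 in auto)
  then show ?thesis using True by (simp add: fphi_def)
qed (simp add: fphi_def)

text \<open>The regular solution as a function of the spectral parameter; the clamping in
  \<open>tht\<close> makes it continuous and bounded on the whole line.\<close>

definition PP :: "real \<Rightarrow> real \<Rightarrow> complex" where "PP x t = fphi (cis (tht t)) x"

lemma continuous_on_PP: "continuous_on UNIV (PP x)"
  unfolding PP_def using continuous_on_compose2[OF continuous_on_fphi_cis[of UNIV x] continuous_on_tht] by simp

lemma borel_PP [measurable]: "PP x \<in> borel_measurable borel"
  by (rule borel_measurable_continuous_onI[OF continuous_on_PP])

lemma PP_bounded: obtains B where "\<And>t. norm (PP x t) \<le> B" "0 \<le> B"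
proof -
  have "compact ((\<lambda>\<theta>. fphi (cis \<theta>) x) ` {0..pi})"
    by (intro compact_continuous_image continuous_on_fphi_cis) simp
  from compact_imp_bounded[OF this] obtain B where B0: "0 < B" "\<forall>y\<in>(\<lambda>\<theta>. fphi (cis \<theta>) x) ` {0..pi}. norm y \<le> B"
    unfolding bounded_pos by (elim exE conjE)
  note B = B0(1) bspec[OF B0(2)]
  have "norm (PP x t) \<le> B" for t unfolding PP_def using tht_bounds[of t] by (intro B(2)) auto
  then show thesis by (rule that) (use B(1) in simp)
qed

text \<open>The spectral density transported from \<theta> to the spectral parameter. All matrix
  entries of E on the interval will have a density with respect to this one measure.\<close>

definition NN :: "real measure" where
  "NN = distr (density lborel (\<lambda>\<theta>. ennreal (indicator {0..pi} \<theta> * kap \<theta>))) borel mur"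

lemma borel_kap [measurable]: "kap \<in> borel_measurable borel"
  by (rule borel_measurable_continuous_onI[OF continuous_on_kap])

lemma borel_mur [measurable]: "mur \<in> borel_measurable borel"
  unfolding mur_def by measurable

lemma sets_NN [simp, measurable_cong]: "sets NN = sets borel" by (simp add: NN_def)

lemma integral_NN:
  fixes F :: "real \<Rightarrow> complex"
  assumes [measurable]: "F \<in> borel_measurable borel"
  shows "(\<integral>t. F t \<partial>NN) = (LINT \<theta>:{0..pi}|lborel. of_real (kap \<theta>) * F (mur \<theta>))"
proof -
  have "(\<integral>t. F t \<partial>NN) = (\<integral>\<theta>. F (mur \<theta>) \<partial>density lborel (\<lambda>\<theta>. ennreal (indicator {0..pi} \<theta> * kap \<theta>)))"
    unfolding NN_def by (rule integral_distr) measurable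
  also have "\<dots> = (\<integral>\<theta>. (indicator {0..pi} \<theta> * kap \<theta>) *\<^sub>R F (mur \<theta>) \<partial>lborel)"
    by (rule integral_density) (measurable, auto simp: kap_nonneg)
  finally show ?thesis by (simp add: set_lebesgue_integral_def scaleR_conv_of_real mult.assoc)
qed

lemma finite_NN: "finite_measure NN"
proof (rule finite_measureI)
  have "integrable lborel (\<lambda>\<theta>. indicator {0..pi} \<theta> * kap \<theta>)"
    using borel_integrable_atLeastAtMost'[OF continuous_on_kap, of 0 pi] by (simp add: set_integrable_def)
  then have "(\<integral>\<^sup>+ \<theta>. ennreal (indicator {0..pi} \<theta> * kap \<theta>) \<partial>lborel) < \<infinity>"
    by (subst nn_integral_eq_integral) (auto simp: kap_nonneg)
  moreover have "emeasure NN (space NN) = (\<integral>\<^sup>+ \<theta>. ennreal (indicator {0..pi} \<theta> * kap \<theta>) \<partial>lborel)"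
    unfolding NN_def by (subst emeasure_distr) (auto simp: emeasure_density)
  ultimately show "emeasure NN (space NN) \<noteq> \<infinity>" by simp
qed

definition wPP :: "real \<Rightarrow> real \<Rightarrow> real \<Rightarrow> complex" where
  "wPP x y t = of_real (wt x * wt y) * PP x t * PP y t"

lemma borel_wPP [measurable]: "wPP x y \<in> borel_measurable borel"
  unfolding wPP_def by measurable

lemma integrable_bounded_NN:
  fixes F :: "real \<Rightarrow> complex"
  assumes "F \<in> borel_measurable borel" "\<And>t. norm (F t) \<le> B" shows "integrable NN F"
proof (rule finite_measure.integrable_const_bound[OF finite_NN, where B = B])
  show "AE t in NN. norm (F t) \<le> B" using assms(2) by simp
  show "F \<in> borel_measurable NN" using assms(1) by (simp cong: measurable_cong_sets)
qed

lemma wPP_bounded: obtains B where "\<And>t. norm (wPP x y t) \<le> B"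
proof -
  obtain B1 B2 where B: "\<And>t. norm (PP x t) \<le> B1" "0 \<le> B1" "\<And>t. norm (PP y t) \<le> B2"
    using PP_bounded[of x] PP_bounded[of y] by metis
  have "norm (wPP x y t) \<le> \<bar>wt x * wt y\<bar> * B1 * B2" for t
    unfolding wPP_def norm_mult norm_of_real by (intro mult_mono B mult_nonneg_nonneg) (use B in auto)
  then show thesis by (rule that)
qed

lemma integrable_wPP: "integrable NN (wPP x y)"
  by (rule wPP_bounded[of x y]) (rule integrable_bounded_NN[OF borel_wPP])

lemma wPP_mur: "\<theta> \<in> {0..pi} \<Longrightarrow> of_real (kap \<theta>) * wPP x (xk k) (mur \<theta>) = dj x k \<theta> / of_real pi"
  by (simp add: wPP_def PP_def tht_mur dj_def kap_def)

text \<open>Open and closed intervals have the same integral because \<open>NN\<close> comes from a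
  density in \<theta>; this matches the half weights in the inversion.\<close>

lemma integral_NN_interval:
  assumes s: "u1 < s" "s < t" "t < u2" and S: "S = {s..t} \<and> S' = {tht t..tht s} \<or> S = {s<..<t} \<and> S' = {tht t<..<tht s}"
  shows "(\<integral>\<tau>. indicator S \<tau> * wPP x (xk k) \<tau> \<partial>NN) = integral {tht t..tht s} (dj x k) / of_real pi"
proof -
  have us: "u1 \<le> s" "s \<le> u2" "u1 \<le> t" "t \<le> u2" using s by auto
  have m: "mur (tht t) = t" "mur (tht s) = s" using mur_tht us by simp_all
  have iff: "mur \<theta> \<in> S \<longleftrightarrow> \<theta> \<in> S'" if "\<theta> \<in> {0..pi}" for \<theta>
    using S mur_less_iff[of \<theta> "tht s"] mur_less_iff[of "tht s" \<theta>] mur_less_iff[of \<theta> "tht t"] mur_less_iff[of "tht t" \<theta>]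
      that tht_bounds by (auto simp: m not_less[symmetric])
  have sub2: "S' \<subseteq> {tht t..tht s}" using S by auto
  moreover have "{tht t..tht s} \<subseteq> {0..pi}" using tht_bounds[of s] tht_bounds[of t] by simp
  ultimately have sub1: "S' \<subseteq> {0..pi}" by (rule order.trans)
  note sub = sub1 sub2
  have Sb [measurable]: "S \<in> sets borel" "S' \<in> sets borel" using S by auto
  define G where "G \<theta> = of_real (kap \<theta>) * (of_real (wt x * wt (xk k)) * fphi (cis \<theta>) x * psis (cis \<theta>) k)" for \<theta>
  have G: "G \<theta> = dj x k \<theta> / of_real pi" for \<theta> by (simp add: G_def dj_def kap_def)
  have cG: "continuous_on {tht t..tht s} G" unfolding G_def fphi_xk[symmetric]
    by (intro continuous_on_mult continuous_on_of_real continuous_on_kap continuous_on_const continuous_on_fphi_cis)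
  have "(\<integral>\<tau>. indicator S \<tau> * wPP x (xk k) \<tau> \<partial>NN) = (LINT \<theta>:{0..pi}|lborel. of_real (kap \<theta>) * (indicator S (mur \<theta>) * wPP x (xk k) (mur \<theta>)))"
    by (rule integral_NN) measurable
  also have "\<dots> = (LINT \<theta>:S'|lborel. G \<theta>)"
    unfolding set_lebesgue_integral_def
  proof (rule Bochner_Integration.integral_cong)
    fix \<theta>
    show "indicator {0..pi} \<theta> *\<^sub>R (of_real (kap \<theta>) * (indicator S (mur \<theta>) * wPP x (xk k) (mur \<theta>))) = indicator S' \<theta> *\<^sub>R G \<theta>"
    proof (cases "\<theta> \<in> {0..pi}")
      case True
      then show ?thesis using iff[OF True] wPP_mur[OF True, of x k] by (auto simp: indicator_def G)
    qed (use sub in \<open>auto simp: indicator_def\<close>)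
  qed simp
  also have "\<dots> = integral S' G"
  proof (rule set_borel_integral_eq_integral(2))
    show "set_integrable lborel S' G"
      by (rule set_integrable_subset[OF borel_integrable_atLeastAtMost'[OF cG]]) (use Sb sub in auto)
  qed
  also have "\<dots> = integral {tht t..tht s} G" using S integral_open_interval_real[of "tht t" "tht s" G] by auto
  also have "\<dots> = integral {tht t..tht s} (dj x k) / of_real pi" unfolding G by (rule integral_divide)
  finally show ?thesis .
qed

lemma cnj_psi: assumes "c < norm ga" shows "cnj (psi ga x) = psi (cnj ga) (cnj x)"
proof -
  have "cnj (psi_term ga x k) = psi_term (cnj ga) (cnj x) k" for k
    by (simp add: psi_term_def psi_coef_def qpoch_def qpoch_inf_cnj)
  then have "cnj (\<Sum>k. psi_term ga x k) = (\<Sum>k. psi_term (cnj ga) (cnj x) k)"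
    using bounded_linear.suminf[OF bounded_linear_cnj psi_term_summable[OF assms, of x]] by simp
  then show ?thesis by (simp add: psi_def psi_entire_def qpoch_inf_cnj)
qed

text \<open>On the unit circle conjugation of \<open>ga\<close> is inversion, and the regular
  solution is symmetric under inversion.\<close>

lemma fphi_real: assumes g: "norm ga = 1" shows "cnj (fphi ga x) = fphi ga x"
proof -
  have "cnj (fphi ga x) = fphi (cnj ga) x" using cnj_psi[of ga "of_real x"] g c_less_1 by (simp add: fphi_def)
  also have "\<dots> = fphi ga x"
  proof (cases "Im ga = 0")
    case True
    then have "cnj ga = ga" by (simp add: complex_eq_iff)
    then show ?thesis by simp
  next
    case False
    then show ?thesis using fphi_inverse[OF g False] norm_1_inverse[OF g] by simp
  qed
  finally show ?thesis .
qed

lemma PP_real: "cnj (PP x t) = PP x t" unfolding PP_def by (rule fphi_real) simp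

end

section \<open>Matrix entries of E with at least one positive point\<close>

locale big_q_E = big_q +
  fixes E :: "real set \<Rightarrow> (real \<Rightarrow> complex) \<Rightarrow> (real \<Rightarrow> complex)"
  assumes spectral_E: "is_spectral_measure_of HH inn TT DD E"
begin

sublocale SS: spectral_setup HH inn TT DD E by (rule spectral_setup_big_q[OF spectral_E])

abbreviation PL :: "(real \<Rightarrow> complex) \<Rightarrow> (real \<Rightarrow> complex) \<Rightarrow> (real measure \<times> (real \<Rightarrow> complex)) list" where
  "PL f g \<equiv> SS.polL f g (\<lambda>_. 1)"

abbreviation UU :: "real set" where "UU \<equiv> {u1<..<u2}"

lemma Lam_green:
  assumes s: "u1 < s" "s < t" "t < u2" and x: "x \<in> II" "x \<le> xk k"
  shows "Lam (PL (delta (xk k)) (delta x)) (\<lambda>\<tau>. of_real (pi / 2 * (indicator {s..t} \<tau> + indicator {s<..<t} \<tau>)))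
    = integral {tht t..tht s} (dj x k)"
proof (rule SS.stieltjes_inversion[where h = "\<lambda>\<xi>. green (gam \<xi>) k"])
  show "delta (xk k) \<in> HH" "delta x \<in> DD" by (intro delta_HH delta_DD x xk_in)+
  show "s < t" by fact
  show "green (gam \<xi>) k \<in> DD \<and> delta (xk k) = (\<lambda>x. TT (green (gam \<xi>) k) x - \<xi> * green (gam \<xi>) k x)" if "Im \<xi> \<noteq> 0" for \<xi>
    using green_DD[OF gam(1,2)[OF that]] TT_green[OF gam(1,2)[OF that]] gam(3)[OF that] by simp
qed (rule jump_integral[OF s x])

text \<open>The inverted Green function and \<open>NN\<close> give the same value on sums of closed
  and open indicators of every inner interval; \<open>Lam_zero_on_interval\<close> then yields all
  bounded functions.\<close>

lemma Lam_pos: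
  assumes x: "x \<in> II" "x \<le> xk k" and \<psi>: "\<psi> \<in> borel_measurable borel" "\<And>t. norm (\<psi> t) \<le> C"
  shows "Lam (PL (delta (xk k)) (delta x)) (\<lambda>t. \<psi> t * indicator UU t) = (\<integral>t. \<psi> t * indicator UU t * wPP x (xk k) t \<partial>NN)"
proof -
  let ?P = "PL (delta (xk k)) (delta x)"
  let ?L = "?P @ [(NN, \<lambda>t. - wPP x (xk k) t)]"
  have L: "good_list ?L" unfolding good_list_append
    using integrable_wPP by (simp add: SS.good_polL_const delta_HH x)
  have Leq: "Lam ?L \<phi> = Lam ?P \<phi> - (\<integral>t. \<phi> t * wPP x (xk k) t \<partial>NN)" for \<phi> by (simp add: Lam_append)
  have "Lam ?L (\<lambda>t. \<psi> t * indicator UU t) = 0"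
  proof (rule Lam_zero_on_interval[OF L _ \<psi>])
    fix s t assume s: "u1 < s" "s < t" "t < u2"
    let ?I = "integral {tht t..tht s} (dj x k)"
    have i: "integrable NN (\<lambda>\<tau>. indicator S \<tau> * wPP x (xk k) \<tau>)" if "S \<in> sets borel" for S
      by (rule integrable_bounded_mult[OF sets_NN integrable_wPP, where C = 1]) (use that in \<open>auto simp: indicator_def\<close>)
    have "(\<lambda>\<tau>. of_real (pi / 2 * (indicator {s..t} \<tau> + indicator {s<..<t} \<tau>))) = (\<lambda>\<tau>. complex_of_real (pi / 2) * (indicator {s..t} \<tau> + indicator {s<..<t} \<tau>))"
      by (auto simp: indicator_def)
    with Lam_green[OF s x] have "of_real (pi / 2) * Lam ?P (\<lambda>\<tau>. indicator {s..t} \<tau> + indicator {s<..<t} \<tau>) = ?I"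
      by (simp only: Lam_cmult)
    then have 1: "Lam ?P (\<lambda>\<tau>. indicator {s..t} \<tau> + indicator {s<..<t} \<tau>) = 2 * ?I / of_real pi"
      by (simp add: field_simps)
    have "(\<integral>\<tau>. (indicator {s..t} \<tau> + indicator {s<..<t} \<tau>) * wPP x (xk k) \<tau> \<partial>NN)
      = (\<integral>\<tau>. indicator {s..t} \<tau> * wPP x (xk k) \<tau> \<partial>NN) + (\<integral>\<tau>. indicator {s<..<t} \<tau> * wPP x (xk k) \<tau> \<partial>NN)"
      unfolding distrib_right by (intro Bochner_Integration.integral_add i) auto
    also have "\<dots> = 2 * ?I / of_real pi"
      using integral_NN_interval[OF s, of "{s..t}" "{tht t..tht s}" x k] integral_NN_interval[OF s, of "{s<..<t}" "{tht t<..<tht s}" x k] by simp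
    finally show "Lam ?L (\<lambda>\<tau>. indicator {s..t} \<tau> + indicator {s<..<t} \<tau>) = 0" unfolding Leq 1 by simp
  qed
  then show ?thesis unfolding Leq by simp
qed

end

section \<open>The regular solution and its q-derivative at 0\<close>

context big_q begin

text \<open>Majorants independent of \<open>ga\<close> on the circle and of x, for dominated
  convergence when x tends to 0 under a spectral integral.\<close>

lemma fphi_uniform_bound:
  obtains B where "\<And>ga x. norm ga = 1 \<Longrightarrow> Im ga \<noteq> 0 \<Longrightarrow> x \<in> II \<Longrightarrow> \<bar>x\<bar> \<le> 1 \<Longrightarrow> norm (fphi ga x) \<le> B"
    "\<And>ga x. norm ga = 1 \<Longrightarrow> Im ga \<noteq> 0 \<Longrightarrow> x \<in> II \<Longrightarrow> \<bar>x\<bar> \<le> 1 \<Longrightarrow> norm (qderiv q (fphi ga) x) \<le> B"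
proof -
  define B1 where "B1 = (\<Sum>n. phi_coef_bound 1 * qinf (- 1) * (b * c) ^ n)"
  define B2 where "B2 = (\<Sum>n. phi_coef_bound 1 * qinf (- 1) / (1 - q) * (b * c) ^ Suc n)"
  have 1: "norm (fphi ga x) \<le> B1" if g: "norm ga = 1" "Im ga \<noteq> 0" "x \<in> II" "\<bar>x\<bar> \<le> 1" for ga x
  proof -
    have cg: "c < norm ga" using g c_less_1 by simp
    show ?thesis unfolding fphi_phi_ser[OF cg g(2-)] phi_ser_def B1_def
      using phi_term_bound[of ga 1 "of_real x" 1] g by (intro norm_suminf_le summable_bc) (simp add: norm_divide)
  qed
  have 2: "norm (qderiv q (fphi ga) x) \<le> B2" if g: "norm ga = 1" "Im ga \<noteq> 0" "x \<in> II" "\<bar>x\<bar> \<le> 1" for ga x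
  proof -
    have cg: "c < norm ga" using g c_less_1 by simp
    show ?thesis unfolding qderiv_fphi[OF cg g(2-)] phi_dser_def B2_def
      using phi_dser_term_bound[of ga 1 "of_real x"] g by (intro norm_suminf_le summable_bc) (simp add: norm_divide)
  qed
  show thesis
    by (rule that[of "max B1 B2"]) (use 1 2 in \<open>auto simp: le_max_iff_disj\<close>)
qed

lemma xn_abs: "\<bar>xn n\<bar> = q ^ n" "\<bar>xn n\<bar> \<le> 1"
  using q_pos q_less_1 by (simp_all add: xn_def power_le_one)

lemma fphi_minus_1: "norm ga = 1 \<Longrightarrow> Im ga \<noteq> 0 \<Longrightarrow> fphi ga (- 1) = 1"
  using psi_minus_1[of ga] c_less_1 xn_in[of 0] by (simp add: fphi_def xn_0)

text \<open>The recurrence at - q^(n+1) solved for the q-derivative at the next point towards - 1: a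
  first-order system for the value and the q-derivative, leading from 0 to - 1.\<close>

lemma fphi_xn_step:
  assumes g: "norm ga = 1"
  shows "qderiv q (fphi ga) (xn n) = of_real (q * (b * c * xn (Suc n)) / ((1 - q) * ((q + b * c * xn (Suc n)) * (1 + xn (Suc n))))) * (mu a ga * fphi ga (xn (Suc n)))
    + of_real (q * ((1 + a * b * xn (Suc n)) * (1 + a * c * xn (Suc n))) / ((q + b * c * xn (Suc n)) * (1 + xn (Suc n)))) * qderiv q (fphi ga) (xn (Suc n))"
proof -
  define x where "x = xn (Suc n)"
  have x0: "x \<noteq> 0" using xn_nz by (simp add: x_def)
  have cg: "c < norm ga" using g c_less_1 by simp
  have d1: "q + b * c * x \<noteq> 0" using bc_q_pos[of n] q_pos by (simp add: x_def xn_def algebra_simps)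
  have d2: "1 + x \<noteq> 0" using power_Suc_less_one[OF q_pos q_less_1, of n] by (simp add: x_def xn_def)
  define f0 f1 f2 where "f0 = fphi ga (xn n)" and "f1 = fphi ga x" and "f2 = fphi ga (xn (Suc (Suc n)))"
  have rec: "(1 + of_real a * of_real b * of_real x) * (1 + of_real a * of_real c * of_real x) * (f2 - f1)
    + (of_real q + of_real b * of_real c * of_real x) * (1 + of_real x) * (f0 - f1)
    = of_real b * of_real c * of_real x * of_real x * mu a ga * f1"
    using TT_fphi_xn[OF cg, of "Suc n"] recurrence_iff[OF x0] unfolding TT_xn f0_def f1_def f2_def x_def by simp
  have q0: "qderiv q (fphi ga) (xn n) = (f0 - f1) / of_real ((1 - q) * (x / q))"
    using q_pos by (simp add: qderiv_def f0_def f1_def x_def xn_Suc)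
  have q1: "qderiv q (fphi ga) x = (f1 - f2) / of_real ((1 - q) * x)"
    by (simp add: qderiv_def f1_def f2_def x_def xn_Suc)
  have alg: "F0 / (Q * (X / u)) = (u * (BC * X) / (Q * (D1 * D2))) * m + (u * NA / (D1 * D2)) * (- F2 / (Q * X))"
    if "NA * F2 + D1 * D2 * F0 = BC * X * X * m" "D1 \<noteq> 0" "D2 \<noteq> 0" "X \<noteq> 0" "Q \<noteq> 0" "u \<noteq> 0" for F0 F2 NA D1 D2 BC X m Q u :: complex
  proof -
    have "u * (NA * F2 + D1 * D2 * F0) = u * (BC * X * X * m)" using that(1) by simp
    then show ?thesis using that(2-) by (simp add: field_simps)
  qed
  have nz: "complex_of_real q + of_real b * of_real c * of_real x \<noteq> 0" "1 + complex_of_real x \<noteq> 0" "complex_of_real x \<noteq> 0" "1 - complex_of_real q \<noteq> 0" "complex_of_real q \<noteq> 0"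
  proof -
    have "complex_of_real q + of_real b * of_real c * of_real x = of_real (q + b * c * x)" "1 + complex_of_real x = of_real (1 + x)" by simp_all
    then show "complex_of_real q + of_real b * of_real c * of_real x \<noteq> 0" "1 + complex_of_real x \<noteq> 0" using d1 d2 by (simp_all only: of_real_eq_0_iff not_False_eq_True)
  qed (use x0 q_less_1 q_pos in auto)
  have "(f0 - f1) / ((1 - of_real q) * (of_real x / of_real q)) = (of_real q * ((of_real b * of_real c) * of_real x) / ((1 - of_real q) * ((of_real q + of_real b * of_real c * of_real x) * (1 + of_real x)))) * (mu a ga * f1)
    + (of_real q * ((1 + of_real a * of_real b * of_real x) * (1 + of_real a * of_real c * of_real x)) / ((of_real q + of_real b * of_real c * of_real x) * (1 + of_real x))) * (- (f2 - f1) / ((1 - of_real q) * of_real x))"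
    by (rule alg[OF _ nz]) (use rec in \<open>simp add: mult.assoc\<close>)
  then show ?thesis unfolding q0 q1 x_def[symmetric] f1_def[symmetric] by (simp add: mult_ac)
qed

text \<open>A discrete Gronwall estimate bounds the data at - 1 by a fixed multiple of the data near
  0. If both limits at 0 vanished, the value at - 1 would be 0, but it is 1.\<close>

lemma fphi_near_0_nonzero:
  assumes g: "norm ga = 1" and im: "Im ga \<noteq> 0"
  shows "phi_ser ga 0 \<noteq> 0 \<or> phi_dser ga 0 \<noteq> 0"
proof (rule ccontr)
  assume "\<not> ?thesis"
  then have z: "phi_ser ga 0 = 0" "phi_dser ga 0 = 0" by auto
  have cg: "c < norm ga" using g c_less_1 by simp
  define F G where "F n = norm (fphi ga (xn n))" and "G n = norm (qderiv q (fphi ga) (xn n))" for n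
  have FG: "(\<lambda>n. F n + G n) \<longlonglongrightarrow> 0"
    using tendsto_add[OF tendsto_norm[OF fphi_near_0(1)[OF cg im xn_LIMSEQ xn_in]] tendsto_norm[OF fphi_near_0(2)[OF cg im xn_LIMSEQ xn_in]]]
    by (simp add: z F_def G_def)
  \<comment> \<open>D q^n bounds the influence of the value on the q-derivative in one step;
    \<open>r n\<close> below collects the reciprocals of the denominators.\<close>
  define D where "D = norm (mu a ga) * (b * c) / (1 - q)"
  have D: "0 \<le> D" using b_pos c_pos q_less_1 by (simp add: D_def)
  define r where "r n = 1 / ((1 - b * c * q ^ n) * (1 - q * q ^ n))" for n
  have dn: "0 < 1 - b * c * q ^ n" "1 - b * c * q ^ n \<le> 1" "0 < 1 - q * q ^ n" "1 - q * q ^ n \<le> 1" for n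
    using bc_q_pos[of n] power_Suc_less_one[OF q_pos q_less_1, of n] b_pos c_pos q_pos by simp_all
  have r1: "1 \<le> r n" for n
    unfolding r_def using dn[of n] mult_le_one[of "1 - b * c * q ^ n" "1 - q * q ^ n"] by (simp add: le_divide_eq_1)
  have G: "G n \<le> r n * (D * q ^ n * F (Suc n) + G (Suc n))" for n
  proof -
    define x where "x = xn (Suc n)"
    have x: "x = - (q * q ^ n)" by (simp add: x_def xn_def)
    have e1: "q + b * c * x = q * (1 - b * c * q ^ n)" by (simp add: x algebra_simps)
    have e2: "1 + x = 1 - q * q ^ n" by (simp add: x)
    have c1: "\<bar>q * (b * c * x) / ((1 - q) * ((q + b * c * x) * (1 + x)))\<bar> \<le> r n * (b * c / (1 - q) * q ^ n)"
    proof -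
      have "q * (b * c * x) / ((1 - q) * ((q + b * c * x) * (1 + x))) = - (r n * (b * c / (1 - q) * (q * q ^ n)))"
        unfolding e1 e2 r_def using q_pos by (simp add: x mult_ac)
      moreover have "r n * (b * c / (1 - q) * (q * q ^ n)) \<le> r n * (b * c / (1 - q) * q ^ n)"
        using r1[of n] b_pos c_pos q_pos q_less_1 by (intro mult_left_mono) auto
      moreover have "0 \<le> r n * (b * c / (1 - q) * (q * q ^ n))" using r1[of n] b_pos c_pos q_pos q_less_1 by simp
      moreover have "y = - v \<Longrightarrow> v \<le> w \<Longrightarrow> 0 \<le> v \<Longrightarrow> \<bar>y\<bar> \<le> w" for y v w :: real by simp
      ultimately show ?thesis by blast
    qed
    have c2: "\<bar>q * ((1 + a * b * x) * (1 + a * c * x)) / ((q + b * c * x) * (1 + x))\<bar> \<le> r n"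
    proof -
      have p: "0 < 1 + a * b * x" "1 + a * b * x \<le> 1" "0 < 1 + a * c * x" "1 + a * c * x \<le> 1"
        using ab_q_pos[of "Suc n"] ac_q_pos[of "Suc n"] a_pos b_pos c_pos q_pos by (simp_all add: x)
      have "q * ((1 + a * b * x) * (1 + a * c * x)) / ((q + b * c * x) * (1 + x)) = r n * ((1 + a * b * x) * (1 + a * c * x))"
        unfolding e1 e2 r_def using q_pos by simp
      moreover have "r n * ((1 + a * b * x) * (1 + a * c * x)) \<le> r n * 1"
        using p r1[of n] by (intro mult_left_mono mult_le_one) auto
      ultimately show ?thesis using p r1[of n] by simp
    qed
    have "G n \<le> \<bar>q * (b * c * x) / ((1 - q) * ((q + b * c * x) * (1 + x)))\<bar> * (norm (mu a ga) * F (Suc n))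
       + \<bar>q * ((1 + a * b * x) * (1 + a * c * x)) / ((q + b * c * x) * (1 + x))\<bar> * G (Suc n)"
      unfolding G_def[of n] fphi_xn_step[OF g, of n] x_def[symmetric]
      by (rule order.trans[OF norm_triangle_ineq]) (simp only: norm_mult norm_of_real F_def G_def x_def order_refl)
    also have "\<dots> \<le> r n * (b * c / (1 - q) * q ^ n) * (norm (mu a ga) * F (Suc n)) + r n * G (Suc n)"
      by (intro add_mono mult_right_mono c1 c2) (auto simp: F_def G_def)
    also have "\<dots> = r n * (D * q ^ n * F (Suc n) + G (Suc n))" by (simp add: D_def algebra_simps)
    finally show ?thesis .
  qed
  have F: "F n \<le> F (Suc n) + q ^ n * G n" for n
  proof -
    have "fphi ga (xn n) = fphi ga (xn (Suc n)) + of_real ((1 - q) * xn n) * qderiv q (fphi ga) (xn n)"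
      using xn_nz[of n] q_less_1 by (simp add: qderiv_def xn_Suc)
    then have "F n \<le> F (Suc n) + \<bar>(1 - q) * xn n\<bar> * G n"
      unfolding F_def G_def by (metis norm_mult norm_of_real norm_triangle_ineq)
    also have "\<bar>(1 - q) * xn n\<bar> \<le> 1 * q ^ n" unfolding abs_mult xn_abs using q_pos q_less_1 by (intro mult_right_mono) auto
    then have "F (Suc n) + \<bar>(1 - q) * xn n\<bar> * G n \<le> F (Suc n) + q ^ n * G n" by (simp add: mult_right_mono G_def)
    finally show ?thesis .
  qed
  \<comment> \<open>The product over i < n of the step factors
    \<open>(1 + q^i) r i (1 + D q^i)\<close>. Written with shifted factorials it visibly
    converges.\<close>
  define W where "W n = qpoch q (- 1) n * qpoch q (- D) n / (qpoch q (b * c) n * qpoch q q n)" for n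
  have Wl: "W \<longlonglongrightarrow> qinf (- 1) * qinf (- D) / (qinf (b * c) * qinf q)"
    unfolding W_def by (intro tendsto_divide tendsto_mult qpoch_LIMSEQ) (use qpoch_inf_pos[OF bc_less_1] qpoch_inf_pos[OF q_less_1] in auto)
  have Wp: "0 < W n" for n unfolding W_def
    using D bc_less_1 q_less_1 by (intro divide_pos_pos mult_pos_pos qpoch_pos) auto
  have WS: "W (Suc n) = W n * ((1 + q ^ n) * r n * (1 + D * q ^ n))" for n
    by (simp add: W_def qpoch_Suc r_def mult_ac)
  have S: "F 0 + G 0 \<le> W n * (F n + G n)" for n
  proof (induction n)
    case 0 then show ?case by (simp add: W_def qpoch_def)
  next
    case (Suc n)
    have nn: "0 \<le> F m" "0 \<le> G m" "0 \<le> q ^ m" for m using q_pos by (simp_all add: F_def G_def)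
    have DF: "0 \<le> D * q ^ n * F (Suc n)" "0 \<le> D * q ^ n * G (Suc n)" using D nn by simp_all
    have "F n + G n \<le> F (Suc n) + (1 + q ^ n) * G n" using F[of n] by (simp add: algebra_simps)
    also have "\<dots> \<le> F (Suc n) + (1 + q ^ n) * (r n * (D * q ^ n * F (Suc n) + G (Suc n)))"
      using G[of n] nn(3)[of n] by (intro add_left_mono mult_left_mono) auto
    also have "\<dots> \<le> (1 + q ^ n) * r n * F (Suc n) + (1 + q ^ n) * (r n * (D * q ^ n * F (Suc n) + G (Suc n)))"
    proof -
      have "1 * 1 \<le> (1 + q ^ n) * r n" using r1[of n] nn(3)[of n] by (intro mult_mono) auto
      from mult_right_mono[OF this nn(1)] show ?thesis by simp
    qed
    also have "\<dots> = (1 + q ^ n) * r n * (F (Suc n) + (D * q ^ n * F (Suc n) + G (Suc n)))" by (simp add: algebra_simps)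
    also have "\<dots> \<le> (1 + q ^ n) * r n * ((1 + D * q ^ n) * (F (Suc n) + G (Suc n)))"
      using r1[of n] nn(3)[of n] DF by (intro mult_left_mono) (auto simp: algebra_simps)
    finally have "W n * (F n + G n) \<le> W n * ((1 + q ^ n) * r n * ((1 + D * q ^ n) * (F (Suc n) + G (Suc n))))"
      using Wp[of n] by (intro mult_left_mono) auto
    also have "\<dots> = W (Suc n) * (F (Suc n) + G (Suc n))" unfolding WS by (simp only: mult.assoc)
    finally show ?case using Suc by simp
  qed
  have "F 0 + G 0 \<le> qinf (- 1) * qinf (- D) / (qinf (b * c) * qinf q) * 0"
    by (rule LIMSEQ_le_const[OF tendsto_mult[OF Wl FG]]) (use S in blast)
  moreover have "F 0 = 1" using fphi_minus_1[OF g im] by (simp add: F_def xn_0)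
  moreover have "0 \<le> G 0" by (simp add: G_def)
  ultimately show False by simp
qed

end

lemma indicator_Int: "(indicator (S \<inter> U) :: real \<Rightarrow> complex) = (\<lambda>t. indicator S t * indicator U t)"
  by (auto simp: indicator_def fun_eq_iff)

section \<open>The delta functions at the negative points\<close>

context big_q begin

text \<open>Normalised by the weight, so that pairing with it evaluates at - q^j.\<close>

definition ee :: "nat \<Rightarrow> real \<Rightarrow> complex" where
  "ee j x = (if x = xn j then 1 / of_real (wt (xn j)) else 0)"

lemma ee_eq: "ee j = (\<lambda>x. (1 / of_real (wt (xn j))) * delta (xn j) x + 0 * delta (xn j) x)"
  by (auto simp: ee_def delta_def fun_eq_iff)

lemma ee_DD: "ee j \<in> DD" unfolding ee_eq by (intro DD_lin delta_DD xn_in)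

lemma ee_HH: "ee j \<in> HH" unfolding ee_eq by (intro HH_lin delta_HH xn_in)

lemma inn_ee: "inn f (ee j) = f (xn j)"
proof -
  have "0 < wt (xn j)" by (intro wt_II_pos xn_in)
  then show ?thesis using inn_finite_support[of "{xn j}" f "ee j"] by (simp add: ee_def)
qed

abbreviation An :: "nat \<Rightarrow> complex" where "An n \<equiv> of_real (coeffA a b c (xn n))"
abbreviation Bn :: "nat \<Rightarrow> complex" where "Bn n \<equiv> of_real (coeffB q b c (xn n))"

lemma An_nonzero: "An n \<noteq> 0"
proof -
  have "1 + 1 / (y * xn n) \<noteq> 0" if "0 < y" "0 < 1 - y * q ^ n" for y
    using that xn_nz[of n] q_pos by (simp add: xn_def field_simps)
  from this[of "a * b"] this[of "a * c"] have "coeffA a b c (xn n) \<noteq> 0"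
    using ab_q_pos[of n] ac_q_pos[of n] a_pos b_pos c_pos by (simp add: coeffA_def)
  then show ?thesis by (simp only: of_real_eq_0_iff not_False_eq_True)
qed

lemma xn_balance: "coeffA a b c (xn n) * wt (xn n) = coeffB q b c (xn (Suc n)) * wt (xn (Suc n))"
  unfolding xn_Suc
proof (rule wt_balance[OF xn_nz])
  show "pfun q a b c (q * xn n) \<noteq> 0" using pfun_xn_pos[of "Suc n"] by (simp add: xn_Suc)
  show "1 + q * xn n \<noteq> 0" using power_Suc_less_one[OF q_pos q_less_1, of n] by (simp add: xn_def)
qed (use ab_q_pos[of n] ac_q_pos[of n] bc_q_pos[of n] in \<open>simp_all add: xn_def\<close>)

text \<open>L is symmetric and pairing with \<open>ee j\<close> evaluates, so L acts on these
  vectors by the coefficients of its own recurrence. Hence \<open>ee j\<close> is obtained from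
  \<open>ee 0\<close> by the recurrence that also generates \<open>PP (xn j)\<close>.\<close>

lemma TT_ee: "TT (ee j) = (\<lambda>x. Bn j * ee (j - 1) x - (An j + Bn j) * ee j x + An j * ee (Suc j) x)"
proof
  fix x
  have w: "0 < wt (xn n)" for n by (intro wt_II_pos xn_in)
  have bal: "An n / of_real (wt (xn (Suc n))) = Bn (Suc n) / of_real (wt (xn n))" for n
    using arg_cong[OF xn_balance[of n], of complex_of_real] w[of n] w[of "Suc n"] by (simp add: field_simps)
  have B0: "Bn 0 = 0" by (simp add: xn_0 coeffB_minus_1)
  show "TT (ee j) x = Bn j * ee (j - 1) x - (An j + Bn j) * ee j x + An j * ee (Suc j) x"
  proof (cases "x \<in> II")
    case False
    then have "x \<noteq> xn n" for n by auto
    then show ?thesis using False by (simp add: opL_def ee_def)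
  next
    case True
    then show ?thesis
    proof (cases rule: II_cases)
      case (2 k)
      have "ee i (xk l) = 0" for i l using xn_neq_xk[of i l] by (simp add: ee_def eq_commute)
      then show ?thesis by (simp add: 2 TT_xk)
    next
      case (1 i)
      consider "i = j" "j = 0" | "i = j" "0 < j" | "j = Suc i" | "i = Suc j" | "i \<noteq> j" "j \<noteq> Suc i" "i \<noteq> Suc j" by auto
      then show ?thesis
      proof cases
        case ij: 1
        show ?thesis unfolding 1 TT_xn using ij B0 by (simp add: ee_def)
      next
        case ij: 2
        then show ?thesis unfolding 1 TT_xn by (auto simp: ee_def algebra_simps)
      next
        case ij: 3
        then show ?thesis unfolding 1 TT_xn using bal[of i] by (auto simp: ee_def)
      next
        case ij: 4
        then show ?thesis unfolding 1 TT_xn using bal[of j] by (auto simp: ee_def)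
      next
        case ij: 5
        then have "Bn j * ee (j - 1) (xn i) = 0" using B0 by (cases j) (auto simp: ee_def)
        moreover have "Bn i * ee j (xn (i - 1)) = 0" using B0 ij by (cases i) (auto simp: ee_def)
        ultimately show ?thesis unfolding 1 TT_xn using ij by (simp add: ee_def algebra_simps)
      qed
    qed
  qed
qed

lemma cis_tht:
  assumes "t \<in> {u1<..<u2}"
  shows "norm (cis (tht t)) = 1" "Im (cis (tht t)) \<noteq> 0" "mu a (cis (tht t)) = of_real t" "c < norm (cis (tht t))"
proof -
  show "norm (cis (tht t)) = 1" "c < norm (cis (tht t))" using c_less_1 by simp_all
  show "Im (cis (tht t)) \<noteq> 0" using gr_im_pos[of "of_real t"] gr_real[of t] assms by auto
  show "mu a (cis (tht t)) = of_real t" unfolding mu_cis using mur_tht[of t] assms by simp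
qed

lemma PP_minus_1: "t \<in> {u1<..<u2} \<Longrightarrow> PP (- 1) t = 1"
  unfolding PP_def by (intro fphi_minus_1 cis_tht)

lemma PP_rec:
  assumes "t \<in> {u1<..<u2}"
  shows "An n * PP (xn (Suc n)) t = (of_real t + (An n + Bn n)) * PP (xn n) t - Bn n * PP (xn (n - 1)) t"
  using TT_fphi_xn[OF cis_tht(4)[OF assms], of n] unfolding TT_xn cis_tht(3)[OF assms] PP_def[symmetric]
  by (simp add: algebra_simps)

definition QP :: "real \<Rightarrow> real \<Rightarrow> complex" where "QP x t = qderiv q (fphi (cis (tht t))) x"

lemma QP_eq: "QP x t = (PP x t - PP (q * x) t) / of_real ((1 - q) * x)"
  by (simp add: QP_def qderiv_def PP_def)

lemma borel_QP [measurable]: "QP x \<in> borel_measurable borel"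
  unfolding QP_eq[abs_def] by measurable

text \<open>\<open>F0\<close> and \<open>F1\<close> are the value and the q-derivative at 0 of the
  regular solution, as functions of the spectral parameter, cut off outside the interval.\<close>

definition F0 :: "real \<Rightarrow> complex" where "F0 t = phi_ser (cis (tht t)) 0 * indicator {u1<..<u2} t"
definition F1 :: "real \<Rightarrow> complex" where "F1 t = phi_dser (cis (tht t)) 0 * indicator {u1<..<u2} t"

lemma PP_QP_LIMSEQ:
  assumes "s \<longlonglongrightarrow> 0" "\<And>j. s j \<in> II"
  shows "(\<lambda>j. PP (s j) t * indicator {u1<..<u2} t) \<longlonglongrightarrow> F0 t" "(\<lambda>j. QP (s j) t * indicator {u1<..<u2} t) \<longlonglongrightarrow> F1 t"
proof -
  show "(\<lambda>j. PP (s j) t * indicator {u1<..<u2} t) \<longlonglongrightarrow> F0 t"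
  proof (cases "t \<in> {u1<..<u2}")
    case True
    show ?thesis unfolding F0_def PP_def
      by (intro tendsto_mult tendsto_const fphi_near_0(1)[OF cis_tht(4,2)[OF True] assms])
  qed (simp add: F0_def)
  show "(\<lambda>j. QP (s j) t * indicator {u1<..<u2} t) \<longlonglongrightarrow> F1 t"
  proof (cases "t \<in> {u1<..<u2}")
    case True
    show ?thesis unfolding F1_def QP_def
      by (intro tendsto_mult tendsto_const fphi_near_0(2)[OF cis_tht(4,2)[OF True] assms])
  qed (simp add: F1_def)
qed

lemma PP_QP_bound:
  obtains B where "\<And>x t. x \<in> II \<Longrightarrow> \<bar>x\<bar> \<le> 1 \<Longrightarrow> norm (PP x t * indicator {u1<..<u2} t) \<le> B"
    "\<And>x t. x \<in> II \<Longrightarrow> \<bar>x\<bar> \<le> 1 \<Longrightarrow> norm (QP x t * indicator {u1<..<u2} t) \<le> B"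
proof -
  obtain B where B: "\<And>ga x. norm ga = 1 \<Longrightarrow> Im ga \<noteq> 0 \<Longrightarrow> x \<in> II \<Longrightarrow> \<bar>x\<bar> \<le> 1 \<Longrightarrow> norm (fphi ga x) \<le> B"
    "\<And>ga x. norm ga = 1 \<Longrightarrow> Im ga \<noteq> 0 \<Longrightarrow> x \<in> II \<Longrightarrow> \<bar>x\<bar> \<le> 1 \<Longrightarrow> norm (qderiv q (fphi ga) x) \<le> B"
    by (rule fphi_uniform_bound) blast
  show thesis
  proof (rule that[of "max 0 B"])
    fix x t assume x: "x \<in> II" "\<bar>x\<bar> \<le> 1"
    show "norm (PP x t * indicator {u1<..<u2} t) \<le> max 0 B"
      using B(1)[OF cis_tht(1,2) x, of t] by (cases "t \<in> {u1<..<u2}") (simp_all add: PP_def le_max_iff_disj)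
    show "norm (QP x t * indicator {u1<..<u2} t) \<le> max 0 B"
      using B(2)[OF cis_tht(1,2) x, of t] by (cases "t \<in> {u1<..<u2}") (simp_all add: QP_def le_max_iff_disj)
  qed
qed

lemma F0_F1_measurable [measurable]: "F0 \<in> borel_measurable borel" "F1 \<in> borel_measurable borel"
  by (rule borel_measurable_LIMSEQ_metric[OF _ PP_QP_LIMSEQ(1)[OF xn_LIMSEQ xn_in]], measurable)
     (rule borel_measurable_LIMSEQ_metric[OF _ PP_QP_LIMSEQ(2)[OF xn_LIMSEQ xn_in]], measurable)

lemma F0_F1_bounded: obtains B where "\<And>t. norm (F0 t) \<le> B" "\<And>t. norm (F1 t) \<le> B" "0 \<le> B"
proof -
  obtain B where B: "\<And>x t. x \<in> II \<Longrightarrow> \<bar>x\<bar> \<le> 1 \<Longrightarrow> norm (PP x t * indicator {u1<..<u2} t) \<le> B"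
    "\<And>x t. x \<in> II \<Longrightarrow> \<bar>x\<bar> \<le> 1 \<Longrightarrow> norm (QP x t * indicator {u1<..<u2} t) \<le> B"
    by (rule PP_QP_bound) blast
  have 0: "norm (F0 t) \<le> B" for t
    by (rule LIMSEQ_le_const2[OF tendsto_norm[OF PP_QP_LIMSEQ(1)[OF xn_LIMSEQ xn_in]]]) (intro exI allI impI B(1) xn_in xn_abs)
  have 1: "norm (F1 t) \<le> B" for t
    by (rule LIMSEQ_le_const2[OF tendsto_norm[OF PP_QP_LIMSEQ(2)[OF xn_LIMSEQ xn_in]]]) (intro exI allI impI B(2) xn_in xn_abs)
  show thesis by (rule that[OF 0 1 order.trans[OF norm_ge_zero 0[of 0]]])
qed

lemma F0_F1_nonzero: "t \<in> {u1<..<u2} \<Longrightarrow> F0 t \<noteq> 0 \<or> F1 t \<noteq> 0"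
  using fphi_near_0_nonzero[OF cis_tht(1,2)[of t]] by (simp add: F0_def F1_def)

text \<open>If the values of u near 0 are integrals of \<open>PP\<close> against a complex measure,
  the boundary data of u are the integrals of \<open>F0\<close> and \<open>F1\<close>. It serves on
  both sides of 0, with a different measure on each.\<close>

lemma boundary_values:
  assumes L: "good_list L" and S [measurable]: "S \<in> sets borel" and s: "s \<longlonglongrightarrow> 0" "\<And>j. s j \<in> II" "\<And>j. \<bar>s j\<bar> \<le> 1"
    and val: "\<And>j. cnj (u (s j)) = Lam L (\<lambda>t. indicator S t * (PP (s j) t * indicator {u1<..<u2} t))"
    and valq: "\<And>j. cnj (u (q * s j)) = Lam L (\<lambda>t. indicator S t * (PP (q * s j) t * indicator {u1<..<u2} t))"
    and l: "(\<lambda>j. u (s j)) \<longlonglongrightarrow> l" "(\<lambda>j. qderiv q u (s j)) \<longlonglongrightarrow> l'"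
  shows "Lam L (\<lambda>t. indicator S t * F0 t) = cnj l" "Lam L (\<lambda>t. indicator S t * F1 t) = cnj l'"
proof -
  obtain B where B: "\<And>x t. x \<in> II \<Longrightarrow> \<bar>x\<bar> \<le> 1 \<Longrightarrow> norm (PP x t * indicator {u1<..<u2} t) \<le> B"
    "\<And>x t. x \<in> II \<Longrightarrow> \<bar>x\<bar> \<le> 1 \<Longrightarrow> norm (QP x t * indicator {u1<..<u2} t) \<le> B"
    by (rule PP_QP_bound) blast
  have B0: "0 \<le> B" using order.trans[OF norm_ge_zero B(1)[OF s(2,3)]] .
  have bd: "norm (indicator S t * y) \<le> B" if "norm y \<le> B" for t and y :: complex
    using that B0 by (simp add: indicator_def)
  have qs: "q * s j \<in> II" "\<bar>q * s j\<bar> \<le> 1" for j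
    using II_mult[OF s(2)] mult_le_one[of q "\<bar>s j\<bar>"] s(3)[of j] q_pos q_less_1 by (simp_all add: abs_mult)
  have qd: "cnj (qderiv q u (s j)) = Lam L (\<lambda>t. indicator S t * (QP (s j) t * indicator {u1<..<u2} t))" for j
  proof -
    define K where "K = 1 / complex_of_real ((1 - q) * s j)"
    have e: "indicator S t * (QP (s j) t * indicator {u1<..<u2} t)
      = K * (indicator S t * (PP (s j) t * indicator {u1<..<u2} t) + (- 1) * (indicator S t * (PP (q * s j) t * indicator {u1<..<u2} t)))" for t
      by (simp add: QP_eq K_def algebra_simps diff_divide_distrib)
    have bq: "norm ((- 1) * (indicator S t * (PP (q * s j) t * indicator {u1<..<u2} t))) \<le> B" for t
      using bd[OF B(1)[OF qs]] by simp
    have "Lam L (\<lambda>t. indicator S t * (QP (s j) t * indicator {u1<..<u2} t))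
      = K * (Lam L (\<lambda>t. indicator S t * (PP (s j) t * indicator {u1<..<u2} t)) + (- 1) * Lam L (\<lambda>t. indicator S t * (PP (q * s j) t * indicator {u1<..<u2} t)))"
      unfolding e Lam_cmult[of L K]
      by (subst Lam_add[OF L _ bd[OF B(1)[OF s(2,3)]] _ bq]) (measurable, simp only: Lam_cmult)
    also have "\<dots> = K * (cnj (u (s j)) - cnj (u (q * s j)))" unfolding val valq by simp
    finally show ?thesis by (simp add: qderiv_def K_def)
  qed
  have "(\<lambda>j. cnj (u (s j))) \<longlonglongrightarrow> Lam L (\<lambda>t. indicator S t * F0 t)"
    unfolding val
  proof (rule Lam_LIMSEQ[OF L, where C = B])
    show "(\<lambda>j. indicator S t * (PP (s j) t * indicator {u1<..<u2} t)) \<longlonglongrightarrow> indicator S t * F0 t" for t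
      by (intro tendsto_mult tendsto_const PP_QP_LIMSEQ s)
  qed (measurable, rule bd[OF B(1)[OF s(2,3)]])
  then show "Lam L (\<lambda>t. indicator S t * F0 t) = cnj l" using tendsto_cnj[OF l(1)] by (rule LIMSEQ_unique)
  have "(\<lambda>j. cnj (qderiv q u (s j))) \<longlonglongrightarrow> Lam L (\<lambda>t. indicator S t * F1 t)"
    unfolding qd
  proof (rule Lam_LIMSEQ[OF L, where C = B])
    show "(\<lambda>j. indicator S t * (QP (s j) t * indicator {u1<..<u2} t)) \<longlonglongrightarrow> indicator S t * F1 t" for t
      by (intro tendsto_mult tendsto_const PP_QP_LIMSEQ s)
  qed (measurable, rule bd[OF B(2)[OF s(2,3)]])
  then show "Lam L (\<lambda>t. indicator S t * F1 t) = cnj l'" using tendsto_cnj[OF l(2)] by (rule LIMSEQ_unique)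
qed

text \<open>Multiplying by the conjugates and dividing by h = |F0|^2 + |F1|^2, which is positive on
  the interval, combines the two hypotheses to the constant 1.\<close>

lemma Lam_F0_F1_zero:
  assumes L: "good_list L" and S [measurable]: "S \<in> sets borel"
    and z: "\<And>S. S \<in> sets borel \<Longrightarrow> Lam L (\<lambda>t. indicator S t * F0 t) = 0"
      "\<And>S. S \<in> sets borel \<Longrightarrow> Lam L (\<lambda>t. indicator S t * F1 t) = 0"
  shows "Lam L (\<lambda>t. indicator S t * indicator {u1<..<u2} t) = 0"
proof -
  obtain B where B: "\<And>t. norm (F0 t) \<le> B" "\<And>t. norm (F1 t) \<le> B" "0 \<le> B" by (rule F0_F1_bounded) blast
  define h where "h t = (norm (F0 t))^2 + (norm (F1 t))^2" for t
  have h0: "0 \<le> h t" for t by (simp add: h_def)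
  have hp: "0 < h t" if "t \<in> {u1<..<u2}" for t
    using F0_F1_nonzero[OF that] by (auto simp: h_def add_pos_nonneg add_nonneg_pos)
  have hm [measurable]: "h \<in> borel_measurable borel" unfolding h_def by measurable
  \<comment> \<open>On these sets 1 / h is bounded, so the multipliers are admissible; they exhaust
    the interval.\<close>
  define A where "A n = {t. 1 / real (Suc n) < h t}" for n
  have Am [measurable]: "A n \<in> sets borel" for n unfolding A_def by measurable
  define \<phi> where "\<phi> F n t = indicator S t * indicator {u1<..<u2} t * indicator (A n) t * (cnj (F t) / of_real (h t))" for F :: "real \<Rightarrow> complex" and n t
  have \<phi>b: "norm (\<phi> F n t) \<le> B * real (Suc n)" if "\<And>t. norm (F t) \<le> B" for F n t
  proof (cases "t \<in> A n")
    case True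
    then have hn: "1 / real (Suc n) < h t" by (simp add: A_def)
    have "norm (\<phi> F n t) \<le> norm (F t) / h t" using h0[of t] by (simp add: \<phi>_def norm_mult norm_divide indicator_def)
    also have "\<dots> \<le> B / (1 / real (Suc n))" using hn that[of t] B(3) by (intro frac_le) auto
    finally show ?thesis by simp
  qed (use B(3) in \<open>simp add: \<phi>_def\<close>)
  have \<phi>m: "\<phi> F n \<in> borel_measurable borel" if [measurable]: "F \<in> borel_measurable borel" for F n
  proof -
    have [measurable]: "(\<lambda>t. cnj (F t)) \<in> borel_measurable borel" "(\<lambda>t. complex_of_real (h t)) \<in> borel_measurable borel"
      by (intro measurable_compose[OF that] measurable_compose[OF hm] borel_measurable_continuous_onI continuous_intros)+
    show ?thesis unfolding \<phi>_def by measurable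
  qed
  have z2: "Lam L (\<lambda>t. \<phi> F0 n t * F0 t) = 0" "Lam L (\<lambda>t. \<phi> F1 n t * F1 t) = 0" for n
    by (rule Lam_mult_zero[OF L F0_F1_measurable(1) B(1) z(1) \<phi>m[OF F0_F1_measurable(1)] \<phi>b[OF B(1)]], assumption)
       (rule Lam_mult_zero[OF L F0_F1_measurable(2) B(2) z(2) \<phi>m[OF F0_F1_measurable(2)] \<phi>b[OF B(2)]], assumption)
  have pb: "norm (\<phi> F n t * F t) \<le> B * real (Suc n) * B" if "\<And>t. norm (F t) \<le> B" for F n t
    unfolding norm_mult using B(3) by (intro mult_mono \<phi>b that) auto
  have e: "\<phi> F0 n t * F0 t + \<phi> F1 n t * F1 t = indicator S t * indicator {u1<..<u2} t * indicator (A n) t" for n t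
  proof (cases "t \<in> {u1<..<u2}")
    case True
    have "cnj (F0 t) * F0 t + cnj (F1 t) * F1 t = of_real (h t)"
      by (simp only: h_def of_real_add complex_norm_square mult.commute)
    then have "cnj (F0 t) / of_real (h t) * F0 t + cnj (F1 t) / of_real (h t) * F1 t = 1"
      using hp[OF True] by (simp add: add_divide_distrib[symmetric])
    then have "indicator S t * indicator {u1<..<u2} t * indicator (A n) t * (cnj (F0 t) / of_real (h t) * F0 t + cnj (F1 t) / of_real (h t) * F1 t)
      = indicator S t * indicator {u1<..<u2} t * indicator (A n) t" by simp
    then show ?thesis unfolding \<phi>_def by (simp only: distrib_left mult.assoc)
  qed (simp add: \<phi>_def)
  have z3: "Lam L (\<lambda>t. indicator S t * indicator {u1<..<u2} t * indicator (A n) t) = 0" for n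
  proof -
    have "Lam L (\<lambda>t. \<phi> F0 n t * F0 t + \<phi> F1 n t * F1 t) = Lam L (\<lambda>t. \<phi> F0 n t * F0 t) + Lam L (\<lambda>t. \<phi> F1 n t * F1 t)"
      by (rule Lam_add[OF L _ pb[OF B(1)] _ pb[OF B(2)]]) (use \<phi>m in measurable)
    then show ?thesis unfolding e z2 by simp
  qed
  have "(\<lambda>n. Lam L (\<lambda>t. indicator S t * indicator {u1<..<u2} t * indicator (A n) t)) \<longlonglongrightarrow> Lam L (\<lambda>t. indicator S t * indicator {u1<..<u2} t)"
  proof (rule Lam_LIMSEQ[OF L, where C = 1])
    fix t
    show "(\<lambda>n. indicator S t * indicator {u1<..<u2} t * indicator (A n) t) \<longlonglongrightarrow> (indicator S t * indicator {u1<..<u2} t :: complex)"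
    proof (cases "t \<in> {u1<..<u2}")
      case True
      have "(\<lambda>n. 1 / real (Suc n)) \<longlonglongrightarrow> 0" using LIMSEQ_inverse_real_of_nat by (simp add: inverse_eq_divide)
      then have "eventually (\<lambda>n. 1 / real (Suc n) < h t) sequentially" using hp[OF True] by (rule order_tendstoD)
      then have "eventually (\<lambda>n. indicator S t * indicator {u1<..<u2} t * indicator (A n) t = (indicator S t * indicator {u1<..<u2} t :: complex)) sequentially"
        by eventually_elim (simp add: A_def)
      then show ?thesis by (rule tendsto_eventually)
    qed simp
  qed (measurable, auto simp: indicator_def)
  then show ?thesis using z3 by (rule LIMSEQ_zero_unique)
qed

end

section \<open>Matrix entries of E between arbitrary points\<close>

context big_q_E begin

text \<open>On the interval the measure of \<open>ee j\<close> and v has density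
  \<open>PP (xn j)\<close> with respect to that of \<open>ee 0\<close> and v: L acts as
  multiplication by t, and both sides obey the same recurrence with the same start. Strong induction
  is used because the recurrence reaches two steps back.\<close>

lemma Lam_ee:
  assumes v: "v \<in> DD" and \<psi>: "\<psi> \<in> borel_measurable borel" "\<And>t. norm (\<psi> t) \<le> C"
  shows "Lam (PL (ee j) v) (\<lambda>t. \<psi> t * indicator UU t) = Lam (PL (ee 0) v) (\<lambda>t. \<psi> t * PP (xn j) t * indicator UU t)"
  using \<psi>
proof (induction j arbitrary: \<psi> C rule: less_induct)
  case (less j)
  note [measurable] = less.prems(1)
  have vH: "v \<in> HH" by (rule SS.D_H[OF v])
  show ?case
  proof (cases j)
    case 0
    have "(\<lambda>t. \<psi> t * PP (xn 0) t * indicator UU t) = (\<lambda>t. \<psi> t * indicator UU t)"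
      using PP_minus_1 by (auto simp: fun_eq_iff xn_0 indicator_def)
    then show ?thesis using 0 by simp
  next
    case (Suc i)
    let ?N = "Lam (PL (ee 0) v)"
    define \<phi> where "\<phi> t = \<psi> t * indicator UU t" for t
    have \<phi>m [measurable]: "\<phi> \<in> borel_measurable borel" unfolding \<phi>_def by measurable
    have \<phi>b: "norm (\<phi> t) \<le> C" for t
      using less.prems(2)[of t] order.trans[OF norm_ge_zero less.prems(2)[of t]] by (simp add: \<phi>_def indicator_def)
    \<comment> \<open>A bound for |t| on the interval; cutting t off there keeps the multiplier
      \<tau> bounded.\<close>
    define M where "M = (1 + a)^2 + (1 - a)^2"
    define \<tau> where "\<tau> t = (of_real t * indicator UU t :: complex)" for t
    have \<tau>m [measurable]: "\<tau> \<in> borel_measurable borel" unfolding \<tau>_def by measurable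
    have \<tau>b: "norm (\<tau> t * \<psi> t) \<le> M * C" for t
    proof -
      have "\<bar>t\<bar> \<le> M" if "u1 < t" "t < u2"
        unfolding M_def using that zero_le_power2[of "1 + a"] zero_le_power2[of "1 - a"] by linarith
      then have "norm (\<tau> t) \<le> M" by (auto simp: \<tau>_def indicator_def M_def)
      then show ?thesis unfolding norm_mult by (intro mult_mono less.prems(2)) (auto simp: M_def)
    qed
    define f1 where "f1 = (\<lambda>x. 1 * TT (ee i) x + (An i + Bn i) * ee i x)"
    have TH: "TT (ee i) \<in> HH" using ee_DD by (rule SS.T_H)
    have f1H: "f1 \<in> HH" unfolding f1_def by (intro HH_lin TH ee_HH)
    \<comment> \<open>\<open>TT_ee\<close> solved for its last term.\<close>
    have es: "ee (Suc i) = (\<lambda>x. (1 / An i) * f1 x + (- (Bn i / An i)) * ee (i - 1) x)"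
      using An_nonzero[of i] by (auto simp: fun_eq_iff f1_def TT_ee field_simps)
    have l1: "Lam (PL (ee (Suc i)) v) \<phi> = (1 / An i) * Lam (PL f1 v) \<phi> + (- (Bn i / An i)) * Lam (PL (ee (i - 1)) v) \<phi>"
      unfolding es by (rule SS.Lam_polL_linear[OF f1H ee_HH vH \<phi>m \<phi>b])
    have l2: "Lam (PL f1 v) \<phi> = 1 * Lam (PL (TT (ee i)) v) \<phi> + (An i + Bn i) * Lam (PL (ee i) v) \<phi>"
      unfolding f1_def by (rule SS.Lam_polL_linear[OF TH ee_HH vH \<phi>m \<phi>b])
    have l3: "Lam (PL (TT (ee i)) v) \<phi> = Lam (PL (ee i) v) (\<lambda>t. (\<tau> t * \<psi> t) * indicator UU t)"
    proof -
      have "Lam (PL (TT (ee i)) v) \<phi> = Lam (SS.polL (ee i) v (\<lambda>t. of_real t - 0)) \<phi>"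
        by (rule SS.Lam_polL_resolvent[OF ee_DD v _ \<phi>m \<phi>b]) simp
      moreover have "\<phi> t * (of_real t - 0) = (\<tau> t * \<psi> t) * indicator UU t * 1" for t
        by (simp add: \<phi>_def \<tau>_def indicator_def)
      ultimately show ?thesis unfolding SS.Lam_polL by simp
    qed
    have IH: "Lam (PL (ee k) v) (\<lambda>t. \<psi>' t * indicator UU t) = ?N (\<lambda>t. \<psi>' t * PP (xn k) t * indicator UU t)"
      if "k < j" "\<psi>' \<in> borel_measurable borel" "\<And>t. norm (\<psi>' t) \<le> C'" for k \<psi>' C' using less.IH[OF that] .
    have n3: "Lam (PL (TT (ee i)) v) \<phi> = ?N (\<lambda>t. \<tau> t * \<psi> t * PP (xn i) t * indicator UU t)"
      unfolding l3 by (rule IH[OF _ _ \<tau>b]) (use Suc in simp, measurable)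
    have n2: "Lam (PL (ee i) v) \<phi> = ?N (\<lambda>t. \<psi> t * PP (xn i) t * indicator UU t)"
      unfolding \<phi>_def by (rule IH[OF _ less.prems]) (use Suc in simp)
    have n1: "Lam (PL (ee (i - 1)) v) \<phi> = ?N (\<lambda>t. \<psi> t * PP (xn (i - 1)) t * indicator UU t)"
      unfolding \<phi>_def by (rule IH[OF _ less.prems]) (use Suc in simp)
    obtain B where B: "\<And>x t. x \<in> II \<Longrightarrow> \<bar>x\<bar> \<le> 1 \<Longrightarrow> norm (PP x t * indicator UU t) \<le> B"
      by (rule PP_QP_bound) blast
    have B0: "0 \<le> B" using order.trans[OF norm_ge_zero B[OF xn_in xn_abs(2)]] .
    have bd: "norm (\<psi>' t * PP (xn n) t * indicator UU t) \<le> D * B" if "norm (\<psi>' t) \<le> D" for \<psi>' D n t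
      unfolding mult.assoc norm_mult[of "\<psi>' t"] using order.trans[OF norm_ge_zero that]
      by (intro mult_mono that B xn_in xn_abs) auto
    have bd\<tau>: "norm (\<tau> t * \<psi> t * PP (xn n) t * indicator UU t) \<le> M * C * B" for n t
      by (rule bd) (rule \<tau>b)
    have L: "good_list (PL (ee 0) v)" by (rule SS.good_polL_const[OF ee_HH vH])
    let ?g = "\<lambda>\<psi>' n t. \<psi>' t * PP (xn n) t * indicator UU t"
    have eq: "?g \<psi> (Suc i) t = (1 / An i) * (?g (\<lambda>t. \<tau> t * \<psi> t) i t + (An i + Bn i) * ?g \<psi> i t) + (- (Bn i / An i)) * ?g \<psi> (i - 1) t" for t
    proof (cases "t \<in> UU")
      case True
      have "PP (xn (Suc i)) t = (An i * PP (xn (Suc i)) t) / An i" using An_nonzero[of i] by simp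
      also have "\<dots> = (1 / An i) * ((of_real t + (An i + Bn i)) * PP (xn i) t) + (- (Bn i / An i)) * PP (xn (i - 1)) t"
        unfolding PP_rec[OF True] by (simp add: diff_divide_distrib)
      finally have P: "PP (xn (Suc i)) t = (1 / An i) * ((of_real t + (An i + Bn i)) * PP (xn i) t) + (- (Bn i / An i)) * PP (xn (i - 1)) t" .
      have al: "y * P = k1 * (r * y * p + A * (y * p)) + k2 * (y * p')" if "P = k1 * ((r + A) * p) + k2 * p'" for y P k1 r A p k2 p' :: complex
        unfolding that by (simp add: algebra_simps)
      have i1: "(indicator UU t :: complex) = 1" "\<tau> t = of_real t" using True by (simp_all add: \<tau>_def)
      show ?thesis unfolding i1 mult_1_right by (rule al[OF P])
    qed simp
    have m: "?g \<psi> n \<in> borel_measurable borel" "?g (\<lambda>t. \<tau> t * \<psi> t) n \<in> borel_measurable borel" for n by measurable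
    have bc: "norm (k * y) \<le> norm k * D" if "norm y \<le> D" for k y :: complex and D
      using that by (simp add: norm_mult mult_left_mono)
    have badd: "norm (x + y) \<le> D + D'" if "norm x \<le> D" "norm y \<le> D'" for x y :: complex and D D'
      using norm_triangle_mono[OF that] .
    have "?N (?g \<psi> (Suc i)) = ?N (\<lambda>t. (1 / An i) * (?g (\<lambda>t. \<tau> t * \<psi> t) i t + (An i + Bn i) * ?g \<psi> i t)) + ?N (\<lambda>t. (- (Bn i / An i)) * ?g \<psi> (i - 1) t)"
      unfolding eq
      by (rule Lam_add[OF L _ bc[OF badd[OF bd\<tau> bc[OF bd[OF less.prems(2)]]]] _ bc[OF bd[OF less.prems(2)]]]) (measurable)
    also have "?N (\<lambda>t. (1 / An i) * (?g (\<lambda>t. \<tau> t * \<psi> t) i t + (An i + Bn i) * ?g \<psi> i t))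
       = (1 / An i) * (?N (?g (\<lambda>t. \<tau> t * \<psi> t) i) + ?N (\<lambda>t. (An i + Bn i) * ?g \<psi> i t))"
      unfolding Lam_cmult[of _ "1 / An i"]
      by (rule arg_cong[OF Lam_add[OF L _ bd\<tau> _ bc[OF bd[OF less.prems(2)]]]]) (measurable)
    finally show ?thesis unfolding Suc using l1 unfolding l2 n1 n2 n3 \<phi>_def[symmetric] Lam_cmult by (simp add: \<phi>_def[abs_def])
  qed
qed

text \<open>The density statement for one pair of points; restricting to the interval leaves aside
  any further spectrum.\<close>

definition spectral_formula :: "real \<Rightarrow> real \<Rightarrow> bool" where
  "spectral_formula x y \<longleftrightarrow> (\<forall>S\<in>sets borel. inn (E (S \<inter> UU) (delta y)) (delta x) = (\<integral>t. indicator S t * indicator UU t * wPP x y t \<partial>NN))"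

lemma inn_E_Lam:
  assumes "f \<in> HH" "g \<in> HH" "S \<in> sets borel"
  shows "inn (E (S \<inter> UU) f) g = Lam (PL f g) (\<lambda>t. indicator S t * indicator UU t)"
  using SS.Lam_polL_indicator[OF assms(1,2), of "S \<inter> UU"] assms(3) by (simp add: indicator_Int)

lemma integral_cnj_wPP:
  "cnj (\<integral>t. indicator S t * indicator UU t * wPP x y t \<partial>NN) = (\<integral>t. indicator S t * indicator UU t * wPP y x t \<partial>NN)"
proof -
  have "cnj (indicator S t * indicator UU t * wPP x y t) = indicator S t * indicator UU t * wPP y x t" for t
    by (simp add: wPP_def PP_real mult_ac indicator_def)
  moreover have "cnj (\<integral>t. indicator S t * indicator UU t * wPP x y t \<partial>NN) = (\<integral>t. cnj (indicator S t * indicator UU t * wPP x y t) \<partial>NN)"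
    by (rule integral_bounded_linear'[OF bounded_linear_cnj bounded_linear_cnj, symmetric]) simp
  ultimately show ?thesis by (simp only:)
qed

lemma spectral_formula_sym:
  assumes "spectral_formula x y" "x \<in> II" "y \<in> II" shows "spectral_formula y x"
  unfolding spectral_formula_def
proof
  fix S :: "real set" assume S: "S \<in> sets borel"
  then have SU: "S \<inter> UU \<in> sets borel" by simp
  have "inn (E (S \<inter> UU) (delta x)) (delta y) = inn (delta x) (E (S \<inter> UU) (delta y))"
    by (intro SS.E_adj SU delta_HH assms)
  also have "\<dots> = cnj (inn (E (S \<inter> UU) (delta y)) (delta x))"
    by (intro inn_sym_HH delta_HH assms SS.E_H SU)
  also have "\<dots> = (\<integral>t. indicator S t * indicator UU t * wPP y x t \<partial>NN)"
    using assms(1) S integral_cnj_wPP[of S x y] by (simp add: spectral_formula_def)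
  finally show "inn (E (S \<inter> UU) (delta x)) (delta y) = (\<integral>t. indicator S t * indicator UU t * wPP y x t \<partial>NN)" .
qed

lemma spectral_formula_pos:
  assumes "x \<in> II" "x \<le> xk k" shows "spectral_formula x (xk k)"
  unfolding spectral_formula_def
proof
  fix S :: "real set" assume S: "S \<in> sets borel"
  show "inn (E (S \<inter> UU) (delta (xk k))) (delta x) = (\<integral>t. indicator S t * indicator UU t * wPP x (xk k) t \<partial>NN)"
    unfolding inn_E_Lam[OF delta_HH[OF xk_in] delta_HH[OF assms(1)] S]
    by (rule Lam_pos[OF assms, where C = 1]) (use S in \<open>auto simp: indicator_def\<close>)
qed

lemma minus_1_in [simp]: "- 1 \<in> II" using xn_in[of 0] by (simp add: xn_0)

text \<open>Two measures are compared, the unknown one of \<open>ee 0\<close> and the candidate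
  \<open>wt (- 1)\<close> times \<open>NN\<close>. Both reproduce the boundary data at 0 of the same
  vector of the domain, so their difference annihilates \<open>F0\<close> and
  \<open>F1\<close>.\<close>

lemma ee_formula:
  assumes S: "S \<in> sets borel"
  shows "Lam (PL (ee 0) (delta (- 1))) (\<lambda>t. indicator S t * indicator UU t) = of_real (wt (- 1)) * (\<integral>t. indicator S t * indicator UU t \<partial>NN)"
proof -
  let ?P = "PL (ee 0) (delta (- 1))" and ?Q = "[(NN, \<lambda>_. complex_of_real (wt (- 1)))]"
  have P: "good_list ?P" by (intro SS.good_polL_const ee_HH delta_HH minus_1_in)
  have c1: "integrable NN (\<lambda>_. k)" for k :: complex by (rule integrable_bounded_NN[where B = "norm k"]) auto
  have Q: "good_list ?Q" using c1 by simp
  have z: "Lam ?P (\<lambda>t. indicator S t * F0 t) = Lam ?Q (\<lambda>t. indicator S t * F0 t)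
     \<and> Lam ?P (\<lambda>t. indicator S t * F1 t) = Lam ?Q (\<lambda>t. indicator S t * F1 t)" if S: "S \<in> sets borel" for S
  proof -
    have SU: "S \<inter> UU \<in> sets borel" using S by simp
    note [measurable] = S
    \<comment> \<open>E(S) preserves the domain, so u satisfies the matching conditions at
      0.\<close>
    define u where "u = E (S \<inter> UU) (delta (- 1))"
    have uD: "u \<in> DD" unfolding u_def by (intro SS.E_D delta_DD minus_1_in SU)
    have uH: "u \<in> HH" by (rule SS.D_H[OF uD])
    have adj: "inn (E (S \<inter> UU) f) (delta (- 1)) = cnj (inn u f)" if "f \<in> HH" for f
    proof -
      have "inn (E (S \<inter> UU) f) (delta (- 1)) = inn f u" unfolding u_def by (intro SS.E_adj SU that delta_HH minus_1_in)
      also have "\<dots> = cnj (inn u f)" by (rule inn_sym_HH[OF that uH])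
      finally show ?thesis .
    qed
    \<comment> \<open>From the left, through \<open>Lam_ee\<close>, the values of u are integrals
      against the unknown measure.\<close>
    have vn: "cnj (u (xn j)) = Lam ?P (\<lambda>t. indicator S t * (PP (xn j) t * indicator UU t))" for j
    proof -
      have "cnj (u (xn j)) = Lam (PL (ee j) (delta (- 1))) (\<lambda>t. indicator S t * indicator UU t)"
        using adj[OF ee_HH[of j]] inn_E_Lam[OF ee_HH delta_HH[OF minus_1_in] S] by (simp add: inn_ee)
      also have "\<dots> = Lam ?P (\<lambda>t. indicator S t * PP (xn j) t * indicator UU t)"
        by (rule Lam_ee[where C = 1]) (auto intro: delta_DD simp: indicator_def)
      finally show ?thesis by (simp add: mult.assoc)
    qed
    \<comment> \<open>From the right the pair consists of - 1 and a positive point, for which the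
      density is known.\<close>
    have vk: "cnj (u (xk k)) = Lam ?Q (\<lambda>t. indicator S t * (PP (xk k) t * indicator UU t))" for k
    proof -
      have le: "- 1 \<le> xk k" using xk_pos[of k] by simp
      have w: "0 < wt (xk k)" by (intro wt_II_pos xk_in)
      have "cnj (u (xk k)) * of_real (wt (xk k)) = inn (E (S \<inter> UU) (delta (xk k))) (delta (- 1))"
        unfolding adj[OF delta_HH[OF xk_in]] inn_delta[OF xk_in] by simp
      also have "\<dots> = (\<integral>t. indicator S t * indicator UU t * wPP (- 1) (xk k) t \<partial>NN)"
        using spectral_formula_pos[OF minus_1_in le] S unfolding spectral_formula_def by blast
      also have "\<dots> = (\<integral>t. of_real (wt (xk k)) * (indicator S t * (PP (xk k) t * indicator UU t) * of_real (wt (- 1))) \<partial>NN)"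
      proof (rule Bochner_Integration.integral_cong[OF refl])
        fix t show "indicator S t * indicator UU t * wPP (- 1) (xk k) t = of_real (wt (xk k)) * (indicator S t * (PP (xk k) t * indicator UU t) * of_real (wt (- 1)))"
          by (cases "t \<in> UU") (simp_all add: wPP_def PP_minus_1)
      qed
      also have "\<dots> = of_real (wt (xk k)) * Lam ?Q (\<lambda>t. indicator S t * (PP (xk k) t * indicator UU t))" by simp
      finally show ?thesis using w by (simp add: mult.commute)
    qed
    obtain l l' where l: "(\<lambda>k::nat. u (z * q ^ k)) \<longlonglongrightarrow> l" "(\<lambda>k::nat. u (- (q ^ k))) \<longlonglongrightarrow> l"
      "(\<lambda>k::nat. qderiv q u (z * q ^ k)) \<longlonglongrightarrow> l'" "(\<lambda>k::nat. qderiv q u (- (q ^ k))) \<longlonglongrightarrow> l'"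
      using uD unfolding Ddom_def by blast
    have qn: "q * xn j = xn (Suc j)" for j by (simp add: xn_Suc)
    have qk: "q * xk j = xk (j + 1)" for j by (simp add: xk_Suc)
    have p: "Lam ?P (\<lambda>t. indicator S t * F0 t) = cnj l" "Lam ?P (\<lambda>t. indicator S t * F1 t) = cnj l'"
      by (rule boundary_values[where s = xn and u = u and l = l and l' = l'];
          (rule P S xn_LIMSEQ xn_in xn_abs vn vn[of "Suc _", folded qn] l[folded xn_def])+)+
    \<comment> \<open>z may exceed 1, whereas the uniform bounds hold for |x| <= 1; the sequence is
      therefore started at a later index.\<close>
    have "eventually (\<lambda>n. xk (int n) < 1) sequentially" by (rule order_tendstoD(2)[OF xk_LIMSEQ]) simp
    then obtain n0 where n0: "\<And>n. n0 \<le> n \<Longrightarrow> xk (int n) < 1" by (auto simp: eventually_sequentially)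
    define s where "s j = xk (int (j + n0))" for j
    have s0: "s \<longlonglongrightarrow> 0" unfolding s_def[abs_def] by (rule LIMSEQ_ignore_initial_segment[OF xk_LIMSEQ])
    have sII: "s j \<in> II" for j by (simp add: s_def)
    have s1: "\<bar>s j\<bar> \<le> 1" for j
    proof -
      have "xk (int (j + n0)) < 1" by (rule n0) simp
      then show ?thesis using xk_pos[of "int (j + n0)"] unfolding s_def by linarith
    qed
    note s = s0 sII s1
    have sl: "(\<lambda>j. u (s j)) \<longlonglongrightarrow> l" "(\<lambda>j. qderiv q u (s j)) \<longlonglongrightarrow> l'"
      using LIMSEQ_ignore_initial_segment[OF l(1), of n0] LIMSEQ_ignore_initial_segment[OF l(3), of n0]
      unfolding s_def[abs_def] by (simp_all only: xk_def power_int_of_nat)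
    have sv: "cnj (u (s j)) = Lam ?Q (\<lambda>t. indicator S t * (PP (s j) t * indicator UU t))" for j unfolding s_def by (rule vk)
    have sq: "cnj (u (q * s j)) = Lam ?Q (\<lambda>t. indicator S t * (PP (q * s j) t * indicator UU t))" for j unfolding s_def qk by (rule vk)
    note b = boundary_values[OF Q S s sv sq sl]
    show ?thesis using p b by simp
  qed
  let ?R = "?P @ [(NN, \<lambda>_. - complex_of_real (wt (- 1)))]"
  have R: "good_list ?R" using P c1 by simp
  have Req: "Lam ?R \<phi> = Lam ?P \<phi> - Lam ?Q \<phi>" for \<phi> by (simp add: Lam_append)
  have "Lam ?R (\<lambda>t. indicator S t * indicator UU t) = 0"
    by (rule Lam_F0_F1_zero[OF R S]) (use z in \<open>simp_all only: Req diff_self\<close>)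
  then show ?thesis unfolding Req by simp
qed

text \<open>Passage from indicators to bounded functions, so that the factor
  \<open>PP (xn j)\<close> produced by \<open>Lam_ee\<close> can be inserted.\<close>

lemma ee_formula_ext:
  assumes sf: "\<And>S. S \<in> sets borel \<Longrightarrow> Lam (PL (ee 0) v) (\<lambda>t. indicator S t * indicator UU t) = (\<integral>t. indicator S t * indicator UU t * w t \<partial>NN)"
    and v: "v \<in> HH" and w: "integrable NN w"
    and \<psi>: "\<psi> \<in> borel_measurable borel" "\<And>t. norm (\<psi> t) \<le> C"
  shows "Lam (PL (ee 0) v) (\<lambda>t. \<psi> t * indicator UU t) = (\<integral>t. \<psi> t * indicator UU t * w t \<partial>NN)"
proof -
  let ?L = "PL (ee 0) v @ [(NN, \<lambda>t. - w t)]"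
  have L: "good_list ?L" unfolding good_list_append using w by (simp add: SS.good_polL_const ee_HH v)
  have Leq: "Lam ?L \<phi> = Lam (PL (ee 0) v) \<phi> - (\<integral>t. \<phi> t * w t \<partial>NN)" for \<phi> by (simp add: Lam_append)
  have "Lam ?L (\<lambda>t. \<psi> t * indicator UU t) = 0"
  proof (rule Lam_mult_zero[OF L _ _ _ \<psi>])
    show "norm (indicator UU t :: complex) \<le> 1" for t by (simp add: indicator_def)
    show "Lam ?L (\<lambda>t. indicator S t * indicator UU t) = 0" if S: "S \<in> sets borel" for S
      using sf[OF S] unfolding Leq by simp
  qed measurable
  then show ?thesis unfolding Leq by simp
qed

lemma inn_scale: "f \<in> HH \<Longrightarrow> g \<in> HH \<Longrightarrow> inn (\<lambda>x. k * f x) g = k * inn f g"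
  using inn_lin_HH[of f f g k 0] by simp

text \<open>A density formula for \<open>ee 0\<close> is moved to - q^j: \<open>Lam_ee\<close>
  contributes the factor \<open>PP (xn j)\<close>, and undoing the normalisation of
  \<open>ee j\<close> contributes the weight.\<close>

lemma spectral_formula_neg_step:
  assumes x: "x \<in> II"
    and sf: "\<And>S. S \<in> sets borel \<Longrightarrow> Lam (PL (ee 0) (delta x)) (\<lambda>t. indicator S t * indicator UU t)
      = (\<integral>t. indicator S t * indicator UU t * (of_real (wt x) * PP x t) \<partial>NN)"
  shows "spectral_formula x (xn j)"
  unfolding spectral_formula_def
proof
  fix S :: "real set" assume S [measurable]: "S \<in> sets borel"
  have SU: "S \<inter> UU \<in> sets borel" by simp
  have w: "0 < wt (xn j)" by (intro wt_II_pos xn_in)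
  obtain Bx where Bx: "\<And>t. norm (PP x t) \<le> Bx" "0 \<le> Bx" by (rule PP_bounded[of x]) blast
  have iw: "integrable NN (\<lambda>t. of_real (wt x) * PP x t)"
    by (rule integrable_bounded_NN[where B = "\<bar>wt x\<bar> * Bx"]) (measurable, simp add: norm_mult mult_left_mono Bx)
  obtain Bj where Bj: "\<And>t. norm (PP (xn j) t) \<le> Bj" "0 \<le> Bj" by (rule PP_bounded[of "xn j"]) blast
  have d: "delta (xn j) = (\<lambda>y. of_real (wt (xn j)) * ee j y + 0 * ee j y)"
    using w by (auto simp: fun_eq_iff delta_def ee_def)
  have "inn (E (S \<inter> UU) (delta (xn j))) (delta x) = of_real (wt (xn j)) * inn (E (S \<inter> UU) (ee j)) (delta x)"
    unfolding d SS.E_lin[OF SU ee_HH ee_HH] using inn_scale[OF SS.E_H[OF SU ee_HH] delta_HH[OF x]] by simp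
  also have "inn (E (S \<inter> UU) (ee j)) (delta x) = Lam (PL (ee j) (delta x)) (\<lambda>t. indicator S t * indicator UU t)"
    by (rule inn_E_Lam[OF ee_HH delta_HH[OF x] S])
  also have "\<dots> = Lam (PL (ee 0) (delta x)) (\<lambda>t. (indicator S t * PP (xn j) t) * indicator UU t)"
    by (rule Lam_ee[OF delta_DD[OF x], where C = 1]) (auto simp: indicator_def)
  also have "\<dots> = (\<integral>t. (indicator S t * PP (xn j) t) * indicator UU t * (of_real (wt x) * PP x t) \<partial>NN)"
    by (rule ee_formula_ext[OF sf delta_HH[OF x] iw, where C = Bj]) (use Bj in \<open>auto simp: indicator_def\<close>)
  also have "of_real (wt (xn j)) * \<dots> = (\<integral>t. indicator S t * indicator UU t * wPP x (xn j) t \<partial>NN)"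
    unfolding integral_mult_right_zero[symmetric] by (simp add: wPP_def mult_ac)
  finally show "inn (E (S \<inter> UU) (delta (xn j))) (delta x) = (\<integral>t. indicator S t * indicator UU t * wPP x (xn j) t \<partial>NN)" .
qed

text \<open>Hermitian symmetry links the cases: a positive point may be put in either slot, and the
  row of - 1 among the negative points becomes a column, from which the step lemma reaches every
  negative pair.\<close>

theorem spectral_formula:
  assumes "x \<in> II" "y \<in> II" shows "spectral_formula x y"
proof -
  have pos: "spectral_formula x (xk k)" if x: "x \<in> II" for x k
  proof (cases "x \<le> xk k")
    case False
    then obtain l where l: "x = xk l" using x xn_neg xk_pos[of k] by (auto elim!: II_cases intro: less_imp_le[OF less_trans])
    with False have "spectral_formula (xk k) x" unfolding l by (intro spectral_formula_pos) auto
    then show ?thesis by (rule spectral_formula_sym) (use x in auto)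
  qed (rule spectral_formula_pos[OF x])
  have m1: "spectral_formula (- 1) (xn j)" for j
  proof (rule spectral_formula_neg_step[OF minus_1_in])
    fix S :: "real set" assume S: "S \<in> sets borel"
    have "(\<integral>t. indicator S t * indicator UU t * (of_real (wt (- 1)) * PP (- 1) t) \<partial>NN)
      = (\<integral>t. of_real (wt (- 1)) * (indicator S t * indicator UU t) \<partial>NN)"
      by (intro Bochner_Integration.integral_cong) (auto simp: indicator_def PP_minus_1)
    then show "Lam (PL (ee 0) (delta (- 1))) (\<lambda>t. indicator S t * indicator UU t)
      = (\<integral>t. indicator S t * indicator UU t * (of_real (wt (- 1)) * PP (- 1) t) \<partial>NN)"
      unfolding ee_formula[OF S] by simp
  qed
  have neg: "spectral_formula (xn i) (xn j)" for i j
  proof (rule spectral_formula_neg_step[OF xn_in])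
    fix S :: "real set" assume S: "S \<in> sets borel"
    have SU: "S \<inter> UU \<in> sets borel" using S by simp
    have w: "0 < wt (- 1)" by (intro wt_II_pos minus_1_in)
    have d: "ee 0 = (\<lambda>y. (1 / of_real (wt (- 1))) * delta (- 1) y + 0 * delta (- 1) y)"
      unfolding ee_eq by (simp add: xn_0)
    have "spectral_formula (xn i) (- 1)" by (rule spectral_formula_sym[OF m1]) simp_all
    then have f: "inn (E (S \<inter> UU) (delta (- 1))) (delta (xn i)) = (\<integral>t. indicator S t * indicator UU t * wPP (xn i) (- 1) t \<partial>NN)"
      using S unfolding spectral_formula_def by blast
    have "Lam (PL (ee 0) (delta (xn i))) (\<lambda>t. indicator S t * indicator UU t) = inn (E (S \<inter> UU) (ee 0)) (delta (xn i))"
      by (rule inn_E_Lam[OF ee_HH delta_HH[OF xn_in] S, symmetric])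
    also have "\<dots> = (1 / of_real (wt (- 1))) * inn (E (S \<inter> UU) (delta (- 1))) (delta (xn i))"
      unfolding d SS.E_lin[OF SU delta_HH[OF minus_1_in] delta_HH[OF minus_1_in]]
        inn_lin_HH[OF SS.E_H[OF SU delta_HH[OF minus_1_in]] SS.E_H[OF SU delta_HH[OF minus_1_in]] delta_HH[OF xn_in]] by simp
    also have "\<dots> = (\<integral>t. (1 / of_real (wt (- 1))) * (indicator S t * indicator UU t * wPP (xn i) (- 1) t) \<partial>NN)"
      unfolding f by (rule integral_mult_right_zero[symmetric])
    also have "\<dots> = (\<integral>t. indicator S t * indicator UU t * (of_real (wt (xn i)) * PP (xn i) t) \<partial>NN)"
      by (intro Bochner_Integration.integral_cong) (use w in \<open>auto simp: indicator_def PP_minus_1 wPP_def\<close>)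
    finally show "Lam (PL (ee 0) (delta (xn i))) (\<lambda>t. indicator S t * indicator UU t)
      = (\<integral>t. indicator S t * indicator UU t * (of_real (wt (xn i)) * PP (xn i) t) \<partial>NN)" .
  qed
  from assms(2) show ?thesis
  proof (cases rule: II_cases)
    case (2 k) then show ?thesis using pos assms(1) by simp
  next
    case (1 j)
    from assms(1) show ?thesis
    proof (cases rule: II_cases)
      case (1 i) then show ?thesis using neg \<open>y = xn j\<close> by simp
    next
      case (2 k) then show ?thesis using spectral_formula_sym[OF pos[OF xn_in]] \<open>y = xn j\<close> by simp
    qed
  qed
qed

end

section \<open>Finitely supported functions\<close>

context big_q_E begin

theorem spectral_measure_Dfin:
  assumes m: "u1 \<le> \<mu>1" "\<mu>1 < \<mu>2" "\<mu>2 \<le> u2"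
    and t: "0 \<le> \<theta>2" "\<theta>2 < \<theta>1" "\<theta>1 \<le> pi"
    and e: "complex_of_real \<mu>1 = mu a (exp (\<i> * of_real \<theta>1))" "complex_of_real \<mu>2 = mu a (exp (\<i> * of_real \<theta>2))"
    and f: "f \<in> Dfin q z" and g: "g \<in> Dfin q z"
  shows "inn (E {\<mu>1<..<\<mu>2} f) g = 1 / of_real (2 * pi * KK) * (LINT \<theta>:{\<theta>2..\<theta>1}|lborel.
    Ftrans q z a b c f (exp (\<i> * of_real \<theta>)) * cnj (Ftrans q z a b c g (exp (\<i> * of_real \<theta>))) / of_real ((cmod (cf (exp (\<i> * of_real \<theta>))))^2))"
proof -
  define S where "S = {\<mu>1<..<\<mu>2}"
  have S [measurable]: "S \<in> sets borel" by (simp add: S_def)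
  have SU: "S \<inter> UU = S" using m by (auto simp: S_def)
  define X where "X = {x. f x \<noteq> 0} \<union> {x. g x \<noteq> 0}"
  have X: "finite X" "X \<subseteq> II" using f g by (auto simp: X_def Dfin_def funs_on_def)
  have out: "x \<notin> X \<Longrightarrow> f x = 0" "x \<notin> X \<Longrightarrow> g x = 0" for x by (auto simp: X_def)
  have fH: "f \<in> HH" using f by (auto simp: Dfin_def intro: finite_support_HH)
  define W where "W x y = (\<integral>t. indicator S t * indicator UU t * wPP x y t \<partial>NN)" for x y
  \<comment> \<open>The point values of E(S) f are recovered by pairing with delta functions, which
    moves E(S) onto a delta function against the finitely supported f.\<close>
  have key: "E S f x * of_real (wt x) = (\<Sum>y\<in>X. f y * W x y)" if x: "x \<in> X" for x
  proof -
    have xI: "x \<in> II" using x X by auto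
    have "E S f x * of_real (wt x) = inn (E S f) (delta x)" by (rule inn_delta[OF xI, symmetric])
    also have "\<dots> = inn f (E S (delta x))" by (rule SS.E_adj[OF S fH delta_HH[OF xI]])
    also have "\<dots> = (\<Sum>y\<in>X. f y * cnj (E S (delta x) y) * of_real (wt y))"
      by (rule inn_finite_support[OF X]) (simp add: out)
    also have "\<dots> = (\<Sum>y\<in>X. f y * W x y)"
    proof (rule sum.cong[OF refl])
      fix y assume "y \<in> X"
      then have yI: "y \<in> II" using X by auto
      have "cnj (E S (delta x) y) * of_real (wt y) = cnj (inn (E S (delta x)) (delta y))"
        unfolding inn_delta[OF yI] by simp
      also have "inn (E S (delta x)) (delta y) = W y x"
        using spectral_formula[OF yI xI] S unfolding spectral_formula_def W_def by (auto simp: SU dest: bspec[of _ _ S])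
      also have "cnj (W y x) = W x y" unfolding W_def by (rule integral_cnj_wPP)
      finally show "f y * cnj (E S (delta x) y) * of_real (wt y) = f y * W x y" by (simp add: mult.assoc)
    qed
    finally show ?thesis .
  qed
  define H where "H t = (\<Sum>x\<in>X. \<Sum>y\<in>X. f y * cnj (g x) * (indicator S t * indicator UU t * wPP x y t))" for t
  have iw: "integrable NN (\<lambda>t. indicator S t * indicator UU t * wPP x y t)" for x y
    by (rule integrable_bounded_mult[OF sets_NN integrable_wPP, where C = 1]) (measurable, simp add: indicator_def)
  have "inn (E S f) g = (\<Sum>x\<in>X. E S f x * cnj (g x) * of_real (wt x))"
    by (rule inn_finite_support[OF X]) (simp add: out)
  also have "\<dots> = (\<Sum>x\<in>X. cnj (g x) * (\<Sum>y\<in>X. f y * W x y))"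
    using key by (intro sum.cong refl) (simp add: mult_ac)
  also have "\<dots> = (\<Sum>x\<in>X. \<Sum>y\<in>X. \<integral>t. f y * cnj (g x) * (indicator S t * indicator UU t * wPP x y t) \<partial>NN)"
    unfolding integral_mult_right_zero W_def[symmetric] sum_distrib_left by (simp add: mult_ac)
  also have "\<dots> = (\<integral>t. H t \<partial>NN)"
    unfolding H_def using iw by (subst Bochner_Integration.integral_sum, simp)+ simp
  also have "\<dots> = (LINT \<theta>:{0..pi}|lborel. of_real (kap \<theta>) * H (mur \<theta>))"
    by (rule integral_NN) (simp add: H_def[abs_def])
  also have "\<dots> = (\<integral>\<theta>. 1 / of_real (2 * pi * KK) * (indicator {\<theta>2..\<theta>1} \<theta> *\<^sub>R
    (Ftrans q z a b c f (exp (\<i> * of_real \<theta>)) * cnj (Ftrans q z a b c g (exp (\<i> * of_real \<theta>))) / of_real ((cmod (cf (exp (\<i> * of_real \<theta>))))^2))) \<partial>lborel)"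
    unfolding set_lebesgue_integral_def
  \<comment> \<open>The spectral interval is open and the \<theta>-interval closed; the integrands
    agree except possibly at the two end points, a null set.\<close>
  proof (rule integral_discrete_difference[where X = "{\<theta>1, \<theta>2}"])
    fix \<theta> assume nX: "\<theta> \<notin> {\<theta>1, \<theta>2}"
    have mm: "mur \<theta>1 = \<mu>1" "mur \<theta>2 = \<mu>2"
      using e unfolding cis_conv_exp[symmetric] mu_cis by simp_all
    show "indicator {0..pi} \<theta> *\<^sub>R (of_real (kap \<theta>) * H (mur \<theta>)) = 1 / of_real (2 * pi * KK) * (indicator {\<theta>2..\<theta>1} \<theta> *\<^sub>R
      (Ftrans q z a b c f (exp (\<i> * of_real \<theta>)) * cnj (Ftrans q z a b c g (exp (\<i> * of_real \<theta>))) / of_real ((cmod (cf (exp (\<i> * of_real \<theta>))))^2)))"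
    proof (cases "\<theta> \<in> {0..pi}")
      case False
      then have "\<theta> \<notin> {\<theta>2..\<theta>1}" using t by auto
      then show ?thesis using False by simp
    next
      case True
      then have th: "0 \<le> \<theta>" "\<theta> \<le> pi" by auto
      have t1: "0 \<le> \<theta>1" "\<theta>1 \<le> pi" and t2: "0 \<le> \<theta>2" "\<theta>2 \<le> pi" using t by auto
      have mS: "mur \<theta> \<in> S \<longleftrightarrow> \<theta>2 < \<theta> \<and> \<theta> < \<theta>1"
        unfolding S_def greaterThanLessThan_iff
        using mur_less_iff[OF t1 th] mur_less_iff[OF th t2] by (auto simp: mm)
      show ?thesis
      proof (cases "\<theta>2 < \<theta> \<and> \<theta> < \<theta>1")
        case False
        then have "mur \<theta> \<notin> S" "\<theta> \<notin> {\<theta>2..\<theta>1}" using mS nX by auto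
        then show ?thesis by (simp add: H_def)
      next
        case th': True
        have mU: "mur \<theta> \<in> S" "mur \<theta> \<in> UU" using mS th' SU by auto
        have ex: "exp (\<i> * of_real \<theta>) = cis \<theta>" by (simp add: cis_conv_exp)
        have ic: "Im (cis \<theta>) \<noteq> 0" using th' t sin_gt_zero[of \<theta>] by simp
        have cg: "c < norm (cis \<theta>)" using c_less_1 by simp
        have PPm: "PP y (mur \<theta>) = fphi (cis \<theta>) y" for y unfolding PP_def tht_mur[OF th] ..
        have Ft: "Ftrans q z a b c h (cis \<theta>) = (\<Sum>y\<in>X. h y * fphi (cis \<theta>) y * of_real (wt y))"
          if "\<And>x. x \<notin> X \<Longrightarrow> h x = 0" for h
          unfolding Ftrans_def phi_eq_fphi[OF cg ic]
          by (subst inn_finite_support[OF X]) (simp_all add: that fphi_real)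
        have "H (mur \<theta>) = (\<Sum>x\<in>X. \<Sum>y\<in>X. (cnj (g x) * fphi (cis \<theta>) x * of_real (wt x)) * (f y * fphi (cis \<theta>) y * of_real (wt y)))"
          unfolding H_def using mU by (simp add: wPP_def PPm mult_ac)
        also have "\<dots> = (\<Sum>x\<in>X. cnj (g x) * fphi (cis \<theta>) x * of_real (wt x)) * (\<Sum>y\<in>X. f y * fphi (cis \<theta>) y * of_real (wt y))"
          by (rule sum_product[symmetric])
        also have "(\<Sum>x\<in>X. cnj (g x) * fphi (cis \<theta>) x * of_real (wt x)) = cnj (Ftrans q z a b c g (cis \<theta>))"
        proof -
          have "cnj (Ftrans q z a b c g (cis \<theta>)) = (\<Sum>y\<in>X. cnj (g y * fphi (cis \<theta>) y * of_real (wt y)))"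
            by (subst Ft) (simp_all only: out(2) cnj_sum not_False_eq_True)
          also have "\<dots> = (\<Sum>x\<in>X. cnj (g x) * fphi (cis \<theta>) x * of_real (wt x))"
            by (intro sum.cong refl) (simp add: fphi_real)
          finally show ?thesis by (rule sym)
        qed
        also have "(\<Sum>y\<in>X. f y * fphi (cis \<theta>) y * of_real (wt y)) = Ftrans q z a b c f (cis \<theta>)"
          by (subst Ft) (simp_all only: out(1) not_False_eq_True)
        finally have "H (mur \<theta>) = cnj (Ftrans q z a b c g (cis \<theta>)) * Ftrans q z a b c f (cis \<theta>)" .
        moreover have "\<theta> \<in> {\<theta>2..\<theta>1}" using th' by auto
        ultimately show ?thesis using True unfolding ex by (simp add: kap_def)
      qed
    qed
  qed auto
  finally show ?thesis unfolding S_def set_lebesgue_integral_def integral_mult_right_zero .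
qed

end

section \<open>Symmetry in b and c\<close>

lemma swap_bc:
  "(a, b, c) \<in> Vgen q z \<Longrightarrow> (a, c, b) \<in> Vgen q z"
  "coeffA a c b = coeffA a b c" "coeffB q c b = coeffB q b c" "pfun q a c b = pfun q a b c"
  by (auto simp: Vgen_def V_def coeffA_def coeffB_def pfun_def fun_eq_iff mult_ac)

lemma swap_bc_space:
  "opL q z a c b = opL q z a b c" "wneg q a c b = wneg q a b c" "wpos q z a c b = wpos q z a b c"
  by (simp_all add: fun_eq_iff opL_def wneg_def wpos_def swap_bc(2)[of a c b] swap_bc(3)[of q c b] swap_bc(4)[of q a c b])

lemma swap_bc_ip:
  "ip q z a c b = ip q z a b c" "Hspace q z a c b = Hspace q z a b c"
  unfolding fun_eq_iff ip_def Hspace_def swap_bc_space(3)[of q z a c b] swap_bc_space(2)[of q a c b] by simp_all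

lemma swap_bc_Ddom: "Ddom q z a c b = Ddom q z a b c"
  unfolding Ddom_def swap_bc_ip(2)[of q z a c b] swap_bc_space(1)[of q z a c b] ..

lemma phi32_swap: "phi32 q \<alpha>1 \<alpha>2 \<alpha>3 \<beta>2 \<beta>1 y = phi32 q \<alpha>1 \<alpha>2 \<alpha>3 \<beta>1 \<beta>2 y"
  by (simp add: phi32_def mult_ac)

lemma swap_bc_Ftrans: "Ftrans q z a c b = Ftrans q z a b c"
proof -
  have p: "phi q z a c b = phi q z a b c"
    unfolding fun_eq_iff phi_def swap_bc_space(1)[of q z a c b] phi32_swap[of q _ _ _ "of_real (a * c)" "of_real (a * b)"] mult.commute[of c b] by simp
  show ?thesis by (intro ext) (simp only: Ftrans_def p swap_bc_ip(1)[of q z a c b])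
qed

lemma swap_bc_constants: "Kconst q z a c b = Kconst q z a b c" "cfun q z a c b = cfun q z a b c"
  by (simp_all add: fun_eq_iff Kconst_def cfun_def mult_ac)

theorem proposition7p2:
  fixes q z a b c \<mu>1 \<mu>2 \<theta>1 \<theta>2 :: real
    and E :: "real set \<Rightarrow> (real \<Rightarrow> complex) \<Rightarrow> (real \<Rightarrow> complex)"
    and f g :: "real \<Rightarrow> complex"
  assumes "0 < q" and "q < 1" and "z > 0"
    and "(a, b, c) \<in> Vgen q z"
    and "is_spectral_measure_of (Hspace q z a b c) (ip q z a b c)
           (opL q z a b c) (Ddom q z a b c) E"
    and "- ((1 + a)^2) \<le> \<mu>1" and "\<mu>1 < \<mu>2" and "\<mu>2 \<le> - ((1 - a)^2)"
    and "0 \<le> \<theta>2" and "\<theta>2 < \<theta>1" and "\<theta>1 \<le> pi"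
    and "complex_of_real \<mu>1 = mu a (exp (\<i> * \<theta>1))"
    and "complex_of_real \<mu>2 = mu a (exp (\<i> * \<theta>2))"
    and "f \<in> Dfin q z" and "g \<in> Dfin q z"
  shows "ip q z a b c (E {\<mu>1<..<\<mu>2} f) g =
    1 / (2 * pi * Kconst q z a b c) *
      (LINT \<theta>:{\<theta>2..\<theta>1}|lborel.
         Ftrans q z a b c f (exp (\<i> * \<theta>)) * cnj (Ftrans q z a b c g (exp (\<i> * \<theta>)))
           / (cmod (cfun q z a b c (exp (\<i> * \<theta>))))^2)"
proof -
  have V: "a > 0" "b > 0" "c > 0" "a * b < 1" "a * c < 1" "b * c < 1"
    using assms(4) by (auto simp: Vgen_def V_def)
  have "c < 1 \<or> b < 1"
  proof (rule ccontr)
    assume "\<not> (c < 1 \<or> b < 1)"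
    then have "1 * 1 \<le> b * c" by (intro mult_mono) auto
    then show False using V by simp
  qed
  then show ?thesis
  proof
    assume "c < 1"
    interpret big_q_E q a b c z E
      by unfold_locales (use assms V \<open>c < 1\<close> in auto)
    show ?thesis using spectral_measure_Dfin[OF assms(6-15)] by simp
  next
    assume "b < 1"
    have E: "is_spectral_measure_of (Hspace q z a c b) (ip q z a c b) (opL q z a c b) (Ddom q z a c b) E"
      unfolding swap_bc_ip[of q z a c b] swap_bc_space(1)[of q z a c b] swap_bc_Ddom[of q z a c b] by (rule assms(5))
    interpret big_q_E q a c b z E
      by unfold_locales (use assms(1-3) swap_bc(1)[OF assms(4)] V E \<open>b < 1\<close> in \<open>auto simp: mult.commute\<close>)
    show ?thesis
      using spectral_measure_Dfin[OF assms(6-15)]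
      unfolding swap_bc_ip(1)[of q z a c b] swap_bc_Ftrans[of q z a c b] swap_bc_constants[of q z a c b] by simp
  qed
qed

end
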